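(* There exists a universal constant $C>0$ such that for every $n\ge1$ and every real matrix $A=(a_{i,j})_{i,j\le n}$, $$\mathbb{E}\|(a_{i,j}\varepsilon_{i,j})_{i,j\leq n}\|\le C\,\mathrm{Log}(\mathrm{Log}(\mathrm{Log}\, n))\Big(\max_{1\leq i\leq n}\|(a_{i,j})_j\|_2+\max_{1\leq j\leq n}\|(a_{i,j})_i\|_2+R_A(\mathrm{Log}\, n)\Big)$$ and $$\mathbb{E}\|(a_{i,j}\varepsilon_{i,j})_{i,j\leq n}\|\le C\,\mathrm{Log}(\mathrm{Log}(\mathrm{Log}\, n))\Big(\max_{1\leq i\leq n}\|(a_{i,j})_j\|_2+\max_{1\leq j\leq n}\|(a_{i,j})_i\|_2+\max_{1\leq k\leq n}\ \min_{I\subset [n],\,|I|\leq k}\ \sup_{\|s\|_2,\|t\|_2\leq 1}\Big\|\sum_{i\notin I,\,j\notin I}a_{i,j}\varepsilon_{i,j}s_it_j\Big\|_{\mathrm{Log}\, k}\Big).$$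
   Context: $[n]=\{1,\dots,n\}$. $(\varepsilon_{i,j})_{i,j\ge1}$ are i.i.d. symmetric $\pm1$ (Rademacher) random variables. For a real matrix $M$, $\|M\|$ denotes the operator (spectral) norm $\sup_{\|s\|_2,\|t\|_2\le1}\sum_{i,j}M_{i,j}s_it_j$. For vectors, $\|\cdot\|_2$ is the Euclidean norm; $(a_{i,j})_j$ is the $i$-th row and $(a_{i,j})_i$ the $j$-th column. $\mathrm{Log}\,x=\log(\max(x,e))$ (natural logarithm). For a random variable $S$ and $p\ge1$, $\|S\|_p=(\mathbb E|S|^p)^{1/p}$, and $R_A(p):=\sup_{\|s\|_2\le1,\|t\|_2\le1}\big\|\sum_{i,j}a_{i,j}\varepsilon_{i,j}s_it_j\big\|_p$. *)

theory Defs
  imports "HOL-Probability.Probability"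
begin

text \<open>
  The dimension varies inside the statement, so a vector of dimension \<open>n\<close> is a function on \<open>nat\<close> of
  which only the values on \<open>{1..n}\<close> matter, and likewise an \<open>n \<times> n\<close> matrix; Euclidean norms are
  \<^const>\<open>L2_set\<close> over \<open>{1..n}\<close>.
\<close>

definition Log :: "real \<Rightarrow> real" where
  "Log x = ln (max x (exp 1))"

definition unit_ball :: "nat \<Rightarrow> (nat \<Rightarrow> real) set" where
  "unit_ball n = {s. L2_set s {1..n} \<le> 1}"

definition op_norm :: "nat \<Rightarrow> (nat \<Rightarrow> nat \<Rightarrow> real) \<Rightarrow> real" where
  "op_norm n B = (SUP (s, t) \<in> unit_ball n \<times> unit_ball n. \<Sum>i\<in>{1..n}. \<Sum>j\<in>{1..n}. B i j * s i * t j)"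

definition rademacher_family :: "'w measure \<Rightarrow> (nat \<Rightarrow> nat \<Rightarrow> 'w \<Rightarrow> real) \<Rightarrow> bool" where
  "rademacher_family M \<epsilon> \<longleftrightarrow>
     prob_space M \<and>
     prob_space.indep_vars M (\<lambda>_. borel) (\<lambda>(i, j). \<epsilon> i j) ({1..} \<times> {1..}) \<and>
     (\<forall>i\<ge>1. \<forall>j\<ge>1. measure M {\<omega> \<in> space M. \<epsilon> i j \<omega> = 1} = 1/2 \<and>
                 measure M {\<omega> \<in> space M. \<epsilon> i j \<omega> = -1} = 1/2)"

definition Lp_norm :: "'w measure \<Rightarrow> real \<Rightarrow> ('w \<Rightarrow> real) \<Rightarrow> real" where
  "Lp_norm M p S = (\<integral>\<omega>. \<bar>S \<omega>\<bar> powr p \<partial>M) powr (1 / p)"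

text \<open>
  With \<open>J = {1..n}\<close> the next quantity is \<open>R\<^sub>A(p)\<close>; with \<open>J = {1..n} - I\<close> it is the quantity in
  which the rows and columns with index in \<open>I\<close> are discarded.
\<close>

definition weak_moment ::
  "'w measure \<Rightarrow> (nat \<Rightarrow> nat \<Rightarrow> 'w \<Rightarrow> real) \<Rightarrow> nat \<Rightarrow> (nat \<Rightarrow> nat \<Rightarrow> real) \<Rightarrow> nat set \<Rightarrow> real \<Rightarrow> real" where
  "weak_moment M \<epsilon> n a J p =
     (SUP (s, t) \<in> unit_ball n \<times> unit_ball n.
        Lp_norm M p (\<lambda>\<omega>. \<Sum>i\<in>J. \<Sum>j\<in>J. a i j * \<epsilon> i j \<omega> * s i * t j))"

definition max_row_norm :: "nat \<Rightarrow> (nat \<Rightarrow> nat \<Rightarrow> real) \<Rightarrow> real" where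
  "max_row_norm n a = (MAX i\<in>{1..n}. L2_set (\<lambda>j. a i j) {1..n})"

definition max_col_norm :: "nat \<Rightarrow> (nat \<Rightarrow> nat \<Rightarrow> real) \<Rightarrow> real" where
  "max_col_norm n a = (MAX j\<in>{1..n}. L2_set (\<lambda>i. a i j) {1..n})"

end

theory Submission
  imports Defs
begin

text \<open>
  The second inequality implies the first (take \<open>I = {}\<close> and use monotonicity of moments). All
  probabilities are averages over the finitely many sign matrices. Normalise the rows and columns to
  norm at most 1.

  The heart of the proof is a tail bound for a block of size at most \<open>N = exp P\<close> whose weak moments
  of order comparable to \<open>P\<close> are at most \<open>R\<close>; write \<open>h = ln P\<close> and \<open>l = ln h\<close>. The entries are split by
  size. If all entries are below \<open>1 / (2 sqrt P)\<close>, a comparison of traces of high powers with those of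
  a full sign matrix of size about \<open>P\<close> (Bandeira--van Handel) gives a bounded norm. The larger
  entries are the edges of a bipartite graph of degree at most \<open>4 P\<close>. A superharmonic majorant
  replaces the two unit vectors by vectors with entries \<open>\<plusminus>2\<^sup>-\<^sup>k\<close> whose level \<open>k\<close> controls the mass of
  the neighbours, so that only levels at distance of order \<open>l\<close> interact strongly. Level sets decompose
  into connected components: on components of size below \<open>P\<close> over the entropy the norm is
  controlled, by a union bound over integer lattice points, through \<open>R\<close>; on larger components
  Hoeffding's inequality beats the number of connected sets, where sparse parts are peeled off first,
  so that what remains is dense and has few realisations. Summing over the interacting
  levels costs the factor \<open>l\<close>, the triple logarithm.

  For the whole matrix the optimal sets \<open>I\<close> for \<open>k = N\<^sub>q\<close> with \<open>N\<^sub>q\<^sub>+\<^sub>1 = N\<^sub>q\<^sup>4\<close> are completed to an increasing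
  chain of layers. Blocks of neighbouring layers are handled by the tail bound; between distant layers
  the Gram matrix has a small off-diagonal part.
\<close>

subsection \<open>Averages over sign matrices\<close>

text \<open>The obstacle is entropy. A union bound over connected sets in a graph of degree about
  \<open>P\<close> costs \<open>h\<close> per vertex, and entries between \<open>P\<close> to the
  power -1/2 and 1 let about \<open>h\<close> levels interact, whereas only a factor
  \<open>l\<close> may be lost. Levels further apart than \<open>b\<close>, where
  \<open>4 ^ b\<close> is about \<open>h\<close>, gain a factor \<open>(1/4) ^ b\<close>, which pays
  for the entropy \<open>h\<close>; this leaves O(l) partners for every level. Between partners a
  connected set is split at density \<open>1 / h\<^sup>2\<close>. Edges outside the dense core carry
  mass at most \<open>1 / h\<^sup>2\<close> per vertex, so even with entropy \<open>h\<close> their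
  deviation is of order \<open>1 / sqrt h\<close> per vertex, which survives the factor
  \<open>2 ^ b\<close> lost in comparing levels. Dense sets number only exp(O(l)) per vertex, and
  this entropy and the O(l) partners stand together under one square root. Entries above
  \<open>h\<close> to the power -3 need no core: their graph has degree at most
  \<open>h ^ 6\<close>, so its entropy is O(l) at once. The fourth powers in the layers make the
  size of a block a fixed power of the size that determines its moment order, so that union bounds
  multiply \<open>R\<close> by constants only.\<close>

definition rsig :: "nat => (nat => real) set" where
 "rsig n = PiE {1..n} (\<lambda>_. {-1, 1})"

text \<open>Both sets are extensional, hence finite, and expectations become finite averages. Rows
  are the outer product, so that averages of products over rows factorise
  (\<open>avg_rows\<close>).\<close>

definition sg :: "nat => (nat => nat => real) set" where
 "sg n = PiE {1..n} (\<lambda>_. rsig n)"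

definition avg :: "nat => ((nat => nat => real) => real) => real" where
 "avg n f = (\<Sum>e\<in>sg n. f e) / real (card (sg n))"

definition ravg :: "nat => ((nat => real) => real) => real" where
 "ravg n g = (\<Sum>r\<in>rsig n. g r) / real (card (rsig n))"

definition pr :: "nat => ((nat => nat => real) => bool) => real" where
 "pr n Q = avg n (\<lambda>e. of_bool (Q e))"

lemma finite_rsig [simp]: "finite (rsig n)" and rsig_ne: "rsig n \<noteq> {}"
 by (auto simp: rsig_def intro!: finite_PiE simp: PiE_eq_empty_iff)

lemma finite_sg [simp]: "finite (sg n)" and sg_ne: "sg n \<noteq> {}"
 using rsig_ne by (auto simp: sg_def PiE_eq_empty_iff intro!: finite_PiE)

lemma card_sg_pos: "card (sg n) > 0"
 using sg_ne by (auto simp: card_gt_0_iff)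

lemma sg_sign: "e \<in> sg n ==> i \<in> {1..n} ==> j \<in> {1..n} ==> e i j = -1 \<or> e i j = 1"
 by (fastforce simp: sg_def rsig_def PiE_iff)

lemma sg_sq: "e \<in> sg n ==> i \<in> {1..n} ==> j \<in> {1..n} ==> (e i j)\<^sup>2 = 1"
 using sg_sign[of e n i j] by auto

lemma sg_abs: "e \<in> sg n ==> i \<in> {1..n} ==> j \<in> {1..n} ==> \<bar>e i j\<bar> = 1"
 using sg_sign[of e n i j] by auto

lemma avg_mono: "(\<And>e. e \<in> sg n ==> f e \<le> g e) ==> avg n f \<le> avg n g"
 by (auto simp: avg_def intro!: divide_right_mono sum_mono)

lemma avg_cong: "(\<And>e. e \<in> sg n ==> f e = g e) ==> avg n f = avg n g"
 by (auto simp: avg_def)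

lemma avg_add: "avg n (\<lambda>e. f e + g e) = avg n f + avg n g"
 by (simp add: avg_def sum.distrib add_divide_distrib)

lemma avg_sum: "avg n (\<lambda>e. \<Sum>x\<in>A. f x e) = (\<Sum>x\<in>A. avg n (f x))"
 by (simp add: avg_def sum_divide_distrib sum.swap[of _ A])

lemma avg_cmult: "avg n (\<lambda>e. c * f e) = c * avg n f"
 by (simp add: avg_def sum_distrib_left)

lemma avg_const [simp]: "avg n (\<lambda>_. c) = c"
 using sg_ne[of n] by (simp add: avg_def)

lemma avg_nonneg: "(\<And>e. e \<in> sg n ==> f e \<ge> 0) ==> avg n f \<ge> 0"
 by (auto simp: avg_def intro!: divide_nonneg_nonneg sum_nonneg)

lemma pr_nonneg: "pr n Q \<ge> 0"
 by (auto simp: pr_def intro!: avg_nonneg)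

lemma pr_mono: "(\<And>e. e \<in> sg n ==> Q e ==> Q' e) ==> pr n Q \<le> pr n Q'"
 by (auto simp: pr_def intro!: avg_mono)

lemma pr_or: "pr n (\<lambda>e. Q e \<or> Q' e) \<le> pr n Q + pr n Q'"
 unfolding pr_def avg_add[symmetric] by (intro avg_mono) auto

lemma pr_ex: "finite A ==> pr n (\<lambda>e. \<exists>x\<in>A. Q x e) \<le> (\<Sum>x\<in>A. pr n (Q x))"
proof (induction A rule: finite_induct)
 case empty then show ?case by (simp add: pr_def)
next
 case (insert x A)
 have "pr n (\<lambda>e. \<exists>x\<in>insert x A. Q x e) = pr n (\<lambda>e. Q x e \<or> (\<exists>x\<in>A. Q x e))" by simp
 also note pr_or
 finally show ?case using insert by simp
qed

lemma pr_ex_le: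
 assumes "finite A" "\<And>x. x \<in> A ==> pr n (Q x) \<le> B x"
 shows "pr n (\<lambda>e. \<exists>x\<in>A. Q x e) \<le> (\<Sum>x\<in>A. B x)"
 using pr_ex[OF assms(1), of n Q] sum_mono[of A "\<lambda>x. pr n (Q x)" B] assms(2) by fastforce

lemma avg_rows: "avg n (\<lambda>e. \<Prod>i\<in>{1..n}. g i (e i)) = (\<Prod>i\<in>{1..n}. ravg n (g i))"
 unfolding avg_def ravg_def sg_def
 by (subst prod_sum_PiE[symmetric]) (auto simp: card_PiE prod_dividef)

lemma ravg_prod: "ravg n (\<lambda>r. \<Prod>j\<in>{1..n}. g j (r j)) = (\<Prod>j\<in>{1..n}. (g j (-1) + g j 1) / 2)"
proof -
 have "(\<Sum>r\<in>rsig n. \<Prod>j\<in>{1..n}. g j (r j)) = (\<Prod>j\<in>{1..n}. \<Sum>y\<in>{-1,1::real}. g j y)"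
  unfolding rsig_def by (subst prod_sum_PiE[symmetric]) auto
 then show ?thesis
  by (simp add: ravg_def rsig_def card_PiE prod_dividef)
qed

lemma avg_prod:
 "avg n (\<lambda>e. \<Prod>i\<in>{1..n}. \<Prod>j\<in>{1..n}. g i j (e i j)) = (\<Prod>i\<in>{1..n}. \<Prod>j\<in>{1..n}. (g i j (-1) + g i j 1) / 2)"
 by (subst avg_rows[of n "\<lambda>i r. \<Prod>j\<in>{1..n}. g i j (r j)"]) (intro prod.cong refl ravg_prod)

lemma ravg_mono: "(\<And>e. e \<in> rsig n ==> f e \<le> g e) ==> ravg n f \<le> ravg n g"
 by (auto simp: ravg_def intro!: divide_right_mono sum_mono)

lemma ravg_add: "ravg n (\<lambda>e. f e + g e) = ravg n f + ravg n g"
 by (simp add: ravg_def sum.distrib add_divide_distrib)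

lemma ravg_sum: "ravg n (\<lambda>e. \<Sum>x\<in>A. f x e) = (\<Sum>x\<in>A. ravg n (f x))"
 by (simp add: ravg_def sum_divide_distrib sum.swap[of _ A])

lemma ravg_cmult: "ravg n (\<lambda>e. c * f e) = c * ravg n f"
 by (simp add: ravg_def sum_distrib_left)

lemma ravg_const [simp]: "ravg n (\<lambda>_. c) = c"
 using rsig_ne[of n] by (simp add: ravg_def)

lemma ravg_nonneg: "(\<And>e. e \<in> rsig n ==> f e \<ge> 0) ==> ravg n f \<ge> 0"
 by (auto simp: ravg_def intro!: divide_nonneg_nonneg sum_nonneg)

lemma fact_double_ge: "(2::real) ^ m * fact m \<le> fact (2 * m)"
proof (induction m)
 case (Suc m)
 have "(2::real) ^ Suc m * fact (Suc m) = 2 * (real m + 1) * (2 ^ m * fact m)" by (simp add: algebra_simps)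
 also have "... \<le> 2 * (real m + 1) * fact (2 * m)" using Suc by (intro mult_left_mono) auto
 also have "... \<le> ((2 * real m + 2) * (2 * real m + 1)) * fact (2 * m)"
  by (intro mult_right_mono) (auto simp: algebra_simps)
 also have "... = fact (2 * Suc m)" by (simp add: algebra_simps)
 finally show ?case .
qed simp

text \<open>The power series are compared term by term with \<open>fact_double_ge\<close>, after
  reindexing the series of \<open>cosh\<close> by its even powers.\<close>

lemma cosh_le_exp: "cosh (x::real) \<le> exp (x\<^sup>2 / 2)"
proof -
 have 1: "(\<lambda>n. if even n then x ^ n /\<^sub>R fact n else 0) sums cosh x" by (rule cosh_converges)
 have "(\<lambda>n. (\<lambda>n. if even n then x ^ n /\<^sub>R fact n else 0) (2 * n)) sums cosh x \<longleftrightarrow>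
   (\<lambda>n. if even n then x ^ n /\<^sub>R fact n else 0) sums cosh x"
  by (rule sums_mono_reindex) (auto simp: strict_mono_def elim!: evenE)
 with 1 have 2: "(\<lambda>n. x ^ (2 * n) /\<^sub>R fact (2 * n)) sums cosh x" by simp
 have 3: "(\<lambda>n. (x\<^sup>2 / 2) ^ n /\<^sub>R fact n) sums exp (x\<^sup>2 / 2)" by (rule exp_converges)
 show ?thesis
 proof (rule sums_le[OF _ 2 3])
  fix n
  have "x ^ (2 * n) / fact (2 * n) \<le> x ^ (2 * n) / (2 ^ n * fact n)"
   using fact_double_ge[of n] by (intro divide_left_mono) auto
  then show "x ^ (2 * n) /\<^sub>R fact (2 * n) \<le> (x\<^sup>2 / 2) ^ n /\<^sub>R fact n"
   by (simp add: power_divide field_simps flip: power_mult)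
 qed
qed

lemma mgf_row: "ravg n (\<lambda>r. exp (\<Sum>j\<in>{1..n}. z j * r j)) \<le> exp ((\<Sum>j\<in>{1..n}. (z j)\<^sup>2) / 2)"
proof -
 have "ravg n (\<lambda>r. exp (\<Sum>j\<in>{1..n}. z j * r j)) = ravg n (\<lambda>r. \<Prod>j\<in>{1..n}. exp (z j * r j))"
  by (simp add: exp_sum)
 also have "... = (\<Prod>j\<in>{1..n}. cosh (z j))"
  by (subst ravg_prod[of n "\<lambda>j y. exp (z j * y)"]) (simp add: cosh_def add.commute)
 also have "... \<le> (\<Prod>j\<in>{1..n}. exp ((z j)\<^sup>2 / 2))"
  by (intro prod_mono) (auto simp: cosh_le_exp)
 also have "... = exp ((\<Sum>j\<in>{1..n}. (z j)\<^sup>2) / 2)" by (simp add: exp_sum sum_divide_distrib)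
 finally show ?thesis .
qed

lemma mgf: "avg n (\<lambda>e. exp (\<Sum>i\<in>{1..n}. \<Sum>j\<in>{1..n}. z i j * e i j)) \<le> exp ((\<Sum>i\<in>{1..n}. \<Sum>j\<in>{1..n}. (z i j)\<^sup>2) / 2)"
proof -
 have "avg n (\<lambda>e. exp (\<Sum>i\<in>{1..n}. \<Sum>j\<in>{1..n}. z i j * e i j)) =
  (\<Prod>i\<in>{1..n}. ravg n (\<lambda>r. exp (\<Sum>j\<in>{1..n}. z i j * r j)))"
  by (simp only: exp_sum finite_atLeastAtMost avg_rows[of n "\<lambda>i r. \<Prod>j\<in>{1..n}. exp (z i j * r j)"])
 also have "... \<le> (\<Prod>i\<in>{1..n}. exp ((\<Sum>j\<in>{1..n}. (z i j)\<^sup>2) / 2))"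
  by (intro prod_mono conjI mgf_row ravg_nonneg) auto
 also have "... = exp ((\<Sum>i\<in>{1..n}. \<Sum>j\<in>{1..n}. (z i j)\<^sup>2) / 2)" by (simp add: exp_sum sum_divide_distrib)
 finally show ?thesis .
qed

lemma sum2_restrict:
 assumes "I \<subseteq> {1..n}" "J \<subseteq> {1..(n::nat)}"
 shows "(\<Sum>i\<in>I. \<Sum>j\<in>J. f i j) = (\<Sum>i\<in>{1..n}. \<Sum>j\<in>{1..n}. if i \<in> I \<and> j \<in> J then f i j else (0::real))"
proof -
 have "(\<Sum>i\<in>{1..n}. \<Sum>j\<in>{1..n}. if i \<in> I \<and> j \<in> J then f i j else 0) =
   (\<Sum>i\<in>{1..n}. if i \<in> I then (\<Sum>j\<in>{1..n}. if j \<in> J then f i j else 0) else 0)"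
  by (intro sum.cong) auto
 also have "... = (\<Sum>i\<in>{1..n} \<inter> I. \<Sum>j\<in>{1..n} \<inter> J. f i j)"
  by (simp add: sum.inter_restrict del: One_nat_def)
 finally show ?thesis using assms by (simp add: Int_absorb1)
qed

lemma mgf_sub:
 assumes "I \<subseteq> {1..n}" "J \<subseteq> {1..n}"
 shows "avg n (\<lambda>e. exp (\<Sum>i\<in>I. \<Sum>j\<in>J. z i j * e i j)) \<le> exp ((\<Sum>i\<in>I. \<Sum>j\<in>J. (z i j)\<^sup>2) / 2)"
proof -
 define z' where "z' = (\<lambda>i j. if i \<in> I \<and> j \<in> J then z i j else 0)"
 have 1: "(\<Sum>i\<in>I. \<Sum>j\<in>J. z i j * e i j) = (\<Sum>i\<in>{1..n}. \<Sum>j\<in>{1..n}. z' i j * e i j)" for e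
  unfolding sum2_restrict[OF assms] by (intro sum.cong) (auto simp: z'_def)
 have 2: "(\<Sum>i\<in>I. \<Sum>j\<in>J. (z i j)\<^sup>2) = (\<Sum>i\<in>{1..n}. \<Sum>j\<in>{1..n}. (z' i j)\<^sup>2)"
  unfolding sum2_restrict[OF assms] by (intro sum.cong) (auto simp: z'_def)
 show ?thesis unfolding 1 2 by (rule mgf)
qed

lemma hoeffding_one:
 assumes IJ: "I \<subseteq> {1..n}" "J \<subseteq> {1..n}" and B: "(\<Sum>i\<in>I. \<Sum>j\<in>J. (z i j)\<^sup>2) \<le> B" "B > 0" and t: "t \<ge> 0"
 shows "pr n (\<lambda>e. (\<Sum>i\<in>I. \<Sum>j\<in>J. z i j * e i j) \<ge> t) \<le> exp (- (t\<^sup>2) / (2 * B))"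
proof -
 \<comment> \<open>The minimiser of \<open>l\<^sup>2 * B / 2 - l * t\<close> in Chernoff's
   bound.\<close>
 define l where "l = t / B"
 have l: "l \<ge> 0" using t B by (simp add: l_def)
 have "pr n (\<lambda>e. (\<Sum>i\<in>I. \<Sum>j\<in>J. z i j * e i j) \<ge> t) \<le>
   avg n (\<lambda>e. exp (- (l * t)) * exp (\<Sum>i\<in>I. \<Sum>j\<in>J. (l * z i j) * e i j))"
  unfolding pr_def
 proof (intro avg_mono)
  fix e
  have "(\<Sum>i\<in>I. \<Sum>j\<in>J. (l * z i j) * e i j) = l * (\<Sum>i\<in>I. \<Sum>j\<in>J. z i j * e i j)"
   by (simp add: sum_distrib_left mult_ac)
  then show "of_bool ((\<Sum>i\<in>I. \<Sum>j\<in>J. z i j * e i j) \<ge> t) \<le> exp (- (l * t)) * exp (\<Sum>i\<in>I. \<Sum>j\<in>J. (l * z i j) * e i j)"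
   using l by (auto simp: mult_exp_exp intro!: mult_left_mono)
 qed
 also have "... \<le> exp (- (l * t)) * exp ((\<Sum>i\<in>I. \<Sum>j\<in>J. (l * z i j)\<^sup>2) / 2)"
  unfolding avg_cmult by (intro mult_left_mono mgf_sub IJ) auto
 also have "(\<Sum>i\<in>I. \<Sum>j\<in>J. (l * z i j)\<^sup>2) = l\<^sup>2 * (\<Sum>i\<in>I. \<Sum>j\<in>J. (z i j)\<^sup>2)"
  by (simp add: power_mult_distrib sum_distrib_left)
 also have "exp (- (l * t)) * exp (l\<^sup>2 * (\<Sum>i\<in>I. \<Sum>j\<in>J. (z i j)\<^sup>2) / 2) \<le> exp (- (l * t)) * exp (l\<^sup>2 * B / 2)"
  using B by (intro mult_left_mono) (auto intro!: mult_left_mono)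
 also have "... = exp (- (t\<^sup>2) / (2 * B))"
  using B by (simp add: mult_exp_exp l_def field_simps power2_eq_square)
 finally show ?thesis .
qed

text \<open>Parametrised by the exponent \<open>H\<close>, ready for union bounds. For
  \<open>B = 0\<close> the sum vanishes identically and the strict inequality makes the event
  empty.\<close>

lemma hoeffding:
 assumes IJ: "I \<subseteq> {1..n}" "J \<subseteq> {1..n}" and B: "(\<Sum>i\<in>I. \<Sum>j\<in>J. (z i j)\<^sup>2) \<le> B" and H: "H \<ge> 0"
 shows "pr n (\<lambda>e. \<bar>\<Sum>i\<in>I. \<Sum>j\<in>J. z i j * e i j\<bar> > sqrt (2 * B * H)) \<le> 2 * exp (- H)"
proof (cases "B > 0")
 case True
 let ?t = "sqrt (2 * B * H)" and ?S = "\<lambda>z e. \<Sum>i\<in>I. \<Sum>j\<in>J. z i j * e i j"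
 have neg: "?S (\<lambda>i j. - z i j) e = - ?S z e" for e by (simp add: sum_negf)
 have t0: "?t \<ge> 0" using H True by simp
 have e: "- (?t\<^sup>2) / (2 * B) = - H" using True H by simp
 have "pr n (\<lambda>e. \<bar>?S z e\<bar> > ?t) \<le> pr n (\<lambda>e. ?S z e \<ge> ?t \<or> ?S (\<lambda>i j. - z i j) e \<ge> ?t)"
  by (intro pr_mono) (simp only: neg, linarith)
 also have "... \<le> pr n (\<lambda>e. ?S z e \<ge> ?t) + pr n (\<lambda>e. ?S (\<lambda>i j. - z i j) e \<ge> ?t)" by (rule pr_or)
 also have "... \<le> exp (- (?t\<^sup>2) / (2 * B)) + exp (- (?t\<^sup>2) / (2 * B))"
  using B True t0 by (intro add_mono hoeffding_one IJ) auto
 finally show ?thesis unfolding e by simp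
next
 case False
 have fin: "finite I" "finite J" using IJ finite_subset by auto
 have "(\<Sum>i\<in>I. \<Sum>j\<in>J. (z i j)\<^sup>2) \<ge> 0" by (intro sum_nonneg) auto
 then have "(\<Sum>i\<in>I. \<Sum>j\<in>J. (z i j)\<^sup>2) = 0" "B = 0" using False B by auto
 then have "\<forall>i\<in>I. \<forall>j\<in>J. z i j = 0"
  using fin by (subst (asm) sum_nonneg_eq_0_iff) (auto intro!: sum_nonneg simp: sum_nonneg_eq_0_iff)
 then have "(\<Sum>i\<in>I. \<Sum>j\<in>J. z i j * e i j) = 0" for e by simp
 then show ?thesis using \<open>B = 0\<close> by (simp add: pr_def)
qed

text \<open>For even \<open>L\<close>, a single term of the exponential series bounds the power by
  \<open>fact L / l ^ L\<close> times a sum of two exponentials. The free \<open>l\<close> becomes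
  the square root of the dimension in \<open>sign_moment\<close>.\<close>

lemma even_moment:
 assumes IJ: "I \<subseteq> {1..n}" "J \<subseteq> {1..n}" and B: "(\<Sum>i\<in>I. \<Sum>j\<in>J. (z i j)\<^sup>2) \<le> B" and L: "even L" and l: "l > 0"
 shows "avg n (\<lambda>e. (\<Sum>i\<in>I. \<Sum>j\<in>J. z i j * e i j) ^ L) \<le> 2 * fact L * exp (l\<^sup>2 * B / 2) / l ^ L"
proof -
 let ?S = "\<lambda>z e. \<Sum>i\<in>I. \<Sum>j\<in>J. z i j * e i j"
 have main: "avg n (\<lambda>e. exp (?S (\<lambda>i j. m * z i j) e)) \<le> exp (l\<^sup>2 * B / 2)" if "m = l \<or> m = -l" for m
 proof -
  have "(\<Sum>i\<in>I. \<Sum>j\<in>J. (m * z i j)\<^sup>2) = l\<^sup>2 * (\<Sum>i\<in>I. \<Sum>j\<in>J. (z i j)\<^sup>2)"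
   using that by (auto simp: power_mult_distrib sum_distrib_left)
  then have "(\<Sum>i\<in>I. \<Sum>j\<in>J. (m * z i j)\<^sup>2) / 2 \<le> l\<^sup>2 * B / 2" using B by (auto intro!: mult_left_mono)
  then show ?thesis using mgf_sub[OF IJ, of "\<lambda>i j. m * z i j"] by (meson exp_le_cancel_iff order_trans)
 qed
 have pw: "x ^ L \<le> fact L / l ^ L * (exp (l * x) + exp (- l * x))" for x :: real
 proof -
  have ev: "(l * x) ^ L \<ge> 0" using L by (simp add: zero_le_even_power)
  have *: "y ^ L / fact L \<le> exp y" if "y \<ge> 0" for y :: real
  proof -
   have "(\<Sum>k\<in>{L}. y ^ k /\<^sub>R fact k) \<le> (\<Sum>k. y ^ k /\<^sub>R fact k)"
    using that by (intro sum_le_suminf summable_exp_generic) auto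
   then show ?thesis by (simp add: exp_def divide_inverse mult.commute)
  qed
  have "(l * x) ^ L = \<bar>l * x\<bar> ^ L" using L by (simp add: power_even_abs)
  also have "... \<le> fact L * exp \<bar>l * x\<bar>" using *[of "\<bar>l * x\<bar>"] by (simp add: field_simps)
  also have "... \<le> fact L * (exp (l * x) + exp (- l * x))"
   by (intro mult_left_mono) (auto simp: abs_if)
  finally show ?thesis using l by (simp add: power_mult_distrib field_simps)
 qed
 have "avg n (\<lambda>e. ?S z e ^ L) \<le> avg n (\<lambda>e. fact L / l ^ L * (exp (?S (\<lambda>i j. l * z i j) e) + exp (?S (\<lambda>i j. - l * z i j) e)))"
 proof (intro avg_mono)
  fix e
  have a: "?S (\<lambda>i j. m * z i j) e = m * ?S z e" for m by (simp add: sum_distrib_left mult_ac)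
  show "?S z e ^ L \<le> fact L / l ^ L * (exp (?S (\<lambda>i j. l * z i j) e) + exp (?S (\<lambda>i j. - l * z i j) e))"
   unfolding a by (rule pw)
 qed
 also have "... = fact L / l ^ L * (avg n (\<lambda>e. exp (?S (\<lambda>i j. l * z i j) e)) + avg n (\<lambda>e. exp (?S (\<lambda>i j. - l * z i j) e)))"
  by (simp only: avg_cmult avg_add)
 also have "... \<le> fact L / l ^ L * (exp (l\<^sup>2 * B / 2) + exp (l\<^sup>2 * B / 2))"
  using l by (intro mult_left_mono add_mono main) auto
 finally show ?thesis by (simp add: mult_ac)
qed

lemma row_tail:
 assumes J: "J \<subseteq> {1..n}" and v: "v = (\<Sum>j\<in>J. (z j)\<^sup>2)" "v > 0" and t: "t \<ge> 0"
 shows "ravg n (\<lambda>r. of_bool ((\<Sum>j\<in>J. z j * r j)\<^sup>2 \<ge> t * v)) \<le> 2 * exp (- t / 2)"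
proof -
 define z' where "z' = (\<lambda>j. if j \<in> J then z j else 0)"
 have 1: "(\<Sum>j\<in>J. z j * r j) = (\<Sum>j\<in>{1..n}. z' j * r j)" for r
  using J by (intro sum.mono_neutral_cong_left) (auto simp: z'_def)
 have 2: "v = (\<Sum>j\<in>{1..n}. (z' j)\<^sup>2)"
  unfolding v(1) using J by (intro sum.mono_neutral_cong_left) (auto simp: z'_def)
 let ?S = "\<lambda>r. \<Sum>j\<in>{1..n}. z' j * r j"
 define l where "l = sqrt (t / v)"
 have l: "l \<ge> 0" "l\<^sup>2 = t / v" using t v by (auto simp: l_def)
 have lt: "l * sqrt (t * v) = t" using t v by (simp add: l_def flip: real_sqrt_mult)
 have "ravg n (\<lambda>r. of_bool ((?S r)\<^sup>2 \<ge> t * v)) \<le> ravg n (\<lambda>r. exp (- t) * (exp (\<Sum>j\<in>{1..n}. (l * z' j) * r j) + exp (\<Sum>j\<in>{1..n}. (-l * z' j) * r j)))"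
 proof (intro ravg_mono)
  fix r
  have a: "(\<Sum>j\<in>{1..n}. (m * z' j) * r j) = m * ?S r" for m by (simp add: sum_distrib_left mult_ac)
  show "of_bool ((?S r)\<^sup>2 \<ge> t * v) \<le> exp (- t) * (exp (\<Sum>j\<in>{1..n}. (l * z' j) * r j) + exp (\<Sum>j\<in>{1..n}. (-l * z' j) * r j))"
  proof (cases "(?S r)\<^sup>2 \<ge> t * v")
   case True
   then have "sqrt (t * v) \<le> \<bar>?S r\<bar>" by (metis real_sqrt_abs real_sqrt_le_mono)
   then have "t \<le> l * \<bar>?S r\<bar>" using lt l by (metis mult_left_mono)
   then have "t \<le> l * ?S r \<or> t \<le> - l * ?S r" by (auto simp: abs_if split: if_splits)
   then have "exp t \<le> exp (l * ?S r) + exp (- l * ?S r)"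
    by (smt (verit) exp_gt_zero exp_le_cancel_iff)
   then show ?thesis using True unfolding a by (simp add: exp_minus field_simps)
  qed auto
 qed
 also have "... = exp (- t) * (ravg n (\<lambda>r. exp (\<Sum>j\<in>{1..n}. (l * z' j) * r j)) + ravg n (\<lambda>r. exp (\<Sum>j\<in>{1..n}. (-l * z' j) * r j)))"
  by (simp only: ravg_cmult ravg_add)
 also have "... \<le> exp (- t) * (exp ((\<Sum>j\<in>{1..n}. (l * z' j)\<^sup>2) / 2) + exp ((\<Sum>j\<in>{1..n}. (-l * z' j)\<^sup>2) / 2))"
  by (intro mult_left_mono add_mono mgf_row) auto
 also have "(\<Sum>j\<in>{1..n}. (l * z' j)\<^sup>2) = t"
  using l v(2) by (simp add: power_mult_distrib 2[symmetric] flip: sum_distrib_left sum_divide_distrib del: One_nat_def)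
 also have "(\<Sum>j\<in>{1..n}. (-l * z' j)\<^sup>2) = t"
  using l v(2) by (simp add: power_mult_distrib 2[symmetric] flip: sum_distrib_left sum_divide_distrib del: One_nat_def)
 also have "exp (- t) * (exp (t / 2) + exp (t / 2)) = 2 * exp (- t / 2)"
  by (simp add: algebra_simps mult_exp_exp)
 finally show ?thesis unfolding 1 .
qed

lemma exp_minus_38: "exp (- 3 / 8 :: real) \<le> 8 / 11"
proof -
 have "1 + 3 / 8 \<le> exp (3 / 8 :: real)" by (rule exp_ge_add_one_self)
 then show ?thesis by (simp add: exp_minus field_simps)
qed

text \<open>The tail of \<open>row_tail\<close> is summed over the integer parts of the normalised
  square: a geometric series with ratio exp(-3/8) <= 8/11 and total at most 2 * (8/7) * (11/3) <
  9.\<close>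

lemma row_chi:
 assumes J: "J \<subseteq> {1..n}" and v: "v = (\<Sum>j\<in>J. (z j)\<^sup>2)" "v > 0"
 shows "ravg n (\<lambda>r. exp ((\<Sum>j\<in>J. z j * r j)\<^sup>2 / (8 * v))) \<le> 9"
proof -
 let ?Y = "\<lambda>r. (\<Sum>j\<in>J. z j * r j)\<^sup>2 / v"
 define B where "B = Max (insert 0 ((\<lambda>r. nat \<lfloor>?Y r\<rfloor>) ` rsig n))"
 have Y0: "?Y r \<ge> 0" for r using v by simp
 have pt: "exp ((\<Sum>j\<in>J. z j * r j)\<^sup>2 / (8 * v)) \<le> (\<Sum>k\<in>{..B}. exp ((real k + 1) / 8) * of_bool (real k * v \<le> (\<Sum>j\<in>J. z j * r j)\<^sup>2))"
  if r: "r \<in> rsig n" for r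
 proof -
  define k where "k = nat \<lfloor>?Y r\<rfloor>"
  have "k \<le> B" unfolding B_def k_def using r by (intro Max_ge) auto
  have k1: "real k \<le> ?Y r" "?Y r \<le> real k + 1" using Y0[of r] unfolding k_def by linarith+
  then have k2: "real k * v \<le> (\<Sum>j\<in>J. z j * r j)\<^sup>2" using v by (simp add: field_simps)
  have "exp ((\<Sum>j\<in>J. z j * r j)\<^sup>2 / (8 * v)) \<le> exp ((real k + 1) / 8)" using k1 by simp
  also have "... = (\<Sum>k\<in>{k}. exp ((real k + 1) / 8) * of_bool (real k * v \<le> (\<Sum>j\<in>J. z j * r j)\<^sup>2))"
   using k2 by simp
  also have "... \<le> (\<Sum>k\<in>{..B}. exp ((real k + 1) / 8) * of_bool (real k * v \<le> (\<Sum>j\<in>J. z j * r j)\<^sup>2))"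
   using \<open>k \<le> B\<close> by (intro sum_mono2) auto
  finally show ?thesis .
 qed
 have e18: "exp (1 / 8 :: real) \<le> 8 / 7"
 proof -
  have "1 + (- 1 / 8) \<le> exp (- 1 / 8 :: real)" by (rule exp_ge_add_one_self)
  then show ?thesis by (simp add: exp_minus field_simps)
 qed
 have "ravg n (\<lambda>r. exp ((\<Sum>j\<in>J. z j * r j)\<^sup>2 / (8 * v))) \<le>
   (\<Sum>k\<in>{..B}. exp ((real k + 1) / 8) * ravg n (\<lambda>r. of_bool (real k * v \<le> (\<Sum>j\<in>J. z j * r j)\<^sup>2)))"
  using ravg_mono[OF pt] by (simp only: ravg_sum ravg_cmult)
 also have "... \<le> (\<Sum>k\<in>{..B}. exp ((real k + 1) / 8) * (2 * exp (- real k / 2)))"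
  by (intro sum_mono mult_left_mono row_tail[OF J v]) auto
 also have "... = (\<Sum>k\<in>{..B}. 2 * exp (1 / 8) * exp (- 3 / 8) ^ k)"
  by (intro sum.cong refl) (simp add: mult_exp_exp flip: exp_of_nat_mult, simp add: field_simps)
 also have "... = 2 * exp (1 / 8) * (\<Sum>k\<in>{..B}. exp (- 3 / 8) ^ k)" by (simp add: sum_distrib_left)
 also have "... \<le> 2 * (8 / 7) * (\<Sum>k\<in>{..B}. (8 / 11) ^ k)"
  using e18 exp_minus_38 by (intro mult_mono sum_mono power_mono) (auto intro!: sum_nonneg)
 also have "(\<Sum>k\<in>{..B}. (8 / 11 :: real) ^ k) \<le> (\<Sum>k. (8 / 11) ^ k)"
  by (intro sum_le_suminf) auto
 also have "(\<Sum>k. (8 / 11 :: real) ^ k) = 11 / 3" by (subst suminf_geometric) auto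
 finally show ?thesis by simp
qed

lemma exp_conv: "0 \<le> c ==> c \<le> 1 ==> exp (c * x) \<le> 1 + c * (exp x - 1)" for x :: real
proof -
 assume c: "0 \<le> c" "c \<le> 1"
 have "convex_on UNIV (exp :: real => real)" by (rule exp_convex)
 from convex_onD[OF this c, of 0 x] show ?thesis by (simp add: algebra_simps)
qed

text \<open>The square seldom exceeds \<open>L * v\<close>, which is the origin of
  \<open>exp (- L / 8)\<close>. Convexity (\<open>exp_conv\<close>) keeps the distance from 1
  proportional to \<open>t * v\<close>, so that the bounds for many rows multiply to the exponential
  of a sum of the \<open>v\<close>.\<close>

lemma row_chi_excess:
 assumes J: "J \<subseteq> {1..n}" and v: "v = (\<Sum>j\<in>J. (z j)\<^sup>2)" and L: "L \<ge> 0" and t: "0 \<le> t" "16 * t * v \<le> 1"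
 shows "ravg n (\<lambda>r. exp (t * max 0 ((\<Sum>j\<in>J. z j * r j)\<^sup>2 - L * v))) \<le> exp (144 * t * v * exp (- L / 8))"
proof (cases "v > 0")
 case True
 define c where "c = 16 * t * v"
 have c: "0 \<le> c" "c \<le> 1" using t True by (auto simp: c_def)
 let ?S = "\<lambda>r. (\<Sum>j\<in>J. z j * r j)\<^sup>2"
 have "exp (t * max 0 (?S r - L * v)) \<le> 1 + c * exp (- L / 8) * exp (?S r / (8 * v))" for r
 proof -
  define x where "x = max 0 (?S r - L * v) / (16 * v)"
  have tx: "t * max 0 (?S r - L * v) = c * x" using True by (simp add: x_def c_def)
  have "exp x - 1 \<le> exp (- L / 8) * exp (?S r / (8 * v))"
  proof (cases "?S r > L * v")
   case T: True
   then have "x = (?S r - L * v) / (16 * v)" by (simp add: x_def)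
   also have "... = - L / 16 + ?S r / (16 * v)" using True by (simp add: field_simps)
   also have "... \<le> - L / 8 + ?S r / (8 * v)" using T True by (simp add: field_simps)
   finally have "exp x \<le> exp (- L / 8 + ?S r / (8 * v))" by simp
   then show ?thesis unfolding mult_exp_exp by linarith
  qed (simp add: x_def)
  then have "1 + c * (exp x - 1) \<le> 1 + c * (exp (- L / 8) * exp (?S r / (8 * v)))" using c by (intro add_left_mono mult_left_mono) auto
  then show ?thesis unfolding tx using exp_conv[OF c, of x] by (simp add: mult.assoc)
 qed
 then have "ravg n (\<lambda>r. exp (t * max 0 (?S r - L * v))) \<le> ravg n (\<lambda>r. 1 + c * exp (- L / 8) * exp (?S r / (8 * v)))"
  by (intro ravg_mono)
 also have "... = 1 + c * exp (- L / 8) * ravg n (\<lambda>r. exp (?S r / (8 * v)))"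
  by (simp only: ravg_add ravg_cmult ravg_const)
 also have "... \<le> 1 + c * exp (- L / 8) * 9"
  using row_chi[OF J v True] c by (intro add_left_mono mult_left_mono) auto
 also have "... \<le> exp (c * exp (- L / 8) * 9)" by (rule exp_ge_add_one_self)
 finally show ?thesis by (simp add: c_def mult_ac)
next
 case False
 have fin: "finite J" using J finite_subset by auto
 have "v \<ge> 0" unfolding v by (intro sum_nonneg) auto
 then have v0: "v = 0" using False by simp
 then have "\<forall>j\<in>J. z j = 0" using v fin by (auto simp: sum_nonneg_eq_0_iff)
 then show ?thesis using v0 by simp
qed

text \<open>Chernoff's bound for independent rows; \<open>t = 1 / (16 * w)\<close> is the largest
  parameter that \<open>row_chi_excess\<close> admits for all rows at once, whence the price
  \<open>16 * w * H\<close> of the probability \<open>exp (- H)\<close>.\<close>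

lemma chi_tail:
 assumes Om: "Om \<subseteq> {1..n}" and J: "J \<subseteq> {1..n}" and v: "\<And>i. i \<in> Om ==> v i = (\<Sum>j\<in>J. (z i j)\<^sup>2)"
  and w: "w > 0" "\<And>i. i \<in> Om ==> v i \<le> w" and L: "L \<ge> 0"
 shows "pr n (\<lambda>e. (\<Sum>i\<in>Om. max 0 ((\<Sum>j\<in>J. z i j * e i j)\<^sup>2 - L * v i)) > 144 * exp (- L / 8) * (\<Sum>i\<in>Om. v i) + 16 * w * H) \<le> exp (- H)"
proof -
 define t where "t = 1 / (16 * w)"
 have t: "t > 0" "16 * t * w = 1" using w by (auto simp: t_def)
 have fin: "finite Om" using Om finite_subset by auto
 let ?u = "144 * exp (- L / 8) * (\<Sum>i\<in>Om. v i) + 16 * w * H"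
 let ?Y = "\<lambda>i r. max 0 ((\<Sum>j\<in>J. z i j * r j)\<^sup>2 - L * v i)"
 have "pr n (\<lambda>e. (\<Sum>i\<in>Om. ?Y i (e i)) > ?u) \<le> avg n (\<lambda>e. exp (- (t * ?u)) * exp (\<Sum>i\<in>Om. t * ?Y i (e i)))"
  unfolding pr_def using t by (intro avg_mono) (auto simp: mult_exp_exp sum_distrib_left[symmetric] simp del: max.bounded_iff intro!: mult_left_mono)
 also have "... = exp (- (t * ?u)) * avg n (\<lambda>e. exp (\<Sum>i\<in>Om. t * ?Y i (e i)))" by (rule avg_cmult)
 also have "avg n (\<lambda>e. exp (\<Sum>i\<in>Om. t * ?Y i (e i))) = avg n (\<lambda>e. \<Prod>i\<in>{1..n}. if i \<in> Om then exp (t * ?Y i (e i)) else 1)"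
 proof (intro avg_cong)
  fix e
  have "exp (\<Sum>i\<in>Om. t * ?Y i (e i)) = (\<Prod>i\<in>{1..n} \<inter> Om. exp (t * ?Y i (e i)))"
   using Om fin by (simp add: exp_sum Int_absorb1)
  then show "exp (\<Sum>i\<in>Om. t * ?Y i (e i)) = (\<Prod>i\<in>{1..n}. if i \<in> Om then exp (t * ?Y i (e i)) else 1)"
   by (simp add: prod.inter_restrict del: One_nat_def)
 qed
 also have "... = (\<Prod>i\<in>{1..n}. ravg n (\<lambda>r. if i \<in> Om then exp (t * ?Y i r) else 1))"
  by (rule avg_rows[of n "\<lambda>i r. if i \<in> Om then exp (t * ?Y i r) else 1"])
 also have "... \<le> (\<Prod>i\<in>{1..n}. if i \<in> Om then exp (144 * t * v i * exp (- L / 8)) else 1)"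
 proof (intro prod_mono conjI)
  fix i
  show "ravg n (\<lambda>r. if i \<in> Om then exp (t * ?Y i r) else 1) \<le> (if i \<in> Om then exp (144 * t * v i * exp (- L / 8)) else 1)"
  proof (cases "i \<in> Om")
   case True
   then have "16 * t * v i \<le> 16 * t * w" using w t by (intro mult_left_mono) auto
   then show ?thesis using True row_chi_excess[OF J v[OF True] L, of t] t by auto
  qed auto
 qed (auto intro!: ravg_nonneg)
 also have "... = exp (\<Sum>i\<in>Om. 144 * t * v i * exp (- L / 8))"
  using Om by (simp add: exp_sum fin Int_absorb1 flip: prod.inter_restrict del: One_nat_def)
 also have "exp (- (t * ?u)) * exp (\<Sum>i\<in>Om. 144 * t * v i * exp (- L / 8)) = exp (- H)"
 proof -
  have "(\<Sum>i\<in>Om. 144 * t * v i * exp (- L / 8)) = t * (144 * exp (- L / 8) * (\<Sum>i\<in>Om. v i))"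
   unfolding sum_distrib_left by (intro sum.cong refl) (simp add: mult_ac)
  moreover have "t * ?u = t * (144 * exp (- L / 8) * (\<Sum>i\<in>Om. v i)) + (16 * t * w) * H" by (simp add: algebra_simps)
  ultimately show ?thesis using t by (simp add: mult_exp_exp)
 qed
 finally show ?thesis by simp
qed

lemma avg_bij:
 assumes "bij_betw g (sg n) (sg n)"
 shows "avg n (\<lambda>e. f (g e)) = avg n f"
 unfolding avg_def using sum.reindex_bij_betw[OF assms, of f] by simp

text \<open>A symmetry of the uniform measure on \<open>sg n\<close>, like \<open>tp\<close> below:
  flips remove entries from a form and make mixed moments vanish, transposition carries statements
  on rows to columns. The restrictions keep the image extensional.\<close>

definition flip :: "nat => (nat => nat => bool) => (nat => nat => real) => nat => nat => real" where
 "flip n c e = (\<lambda>i\<in>{1..n}. \<lambda>j\<in>{1..n}. if c i j then - e i j else e i j)"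

definition tp :: "nat => (nat => nat => real) => nat => nat => real" where
 "tp n e = (\<lambda>i\<in>{1..n}. \<lambda>j\<in>{1..n}. e j i)"

lemma sg_eqI:
 assumes "e \<in> sg n" "e' \<in> sg n" "\<And>i j. i \<in> {1..n} ==> j \<in> {1..n} ==> e i j = e' i j"
 shows "e = e'"
proof (rule ext)
 fix i
 show "e i = e' i"
 proof (cases "i \<in> {1..n}")
  case True
  then have *: "e i \<in> rsig n" "e' i \<in> rsig n" using assms by (auto simp: sg_def simp del: One_nat_def)
  show ?thesis
  proof (rule ext)
   fix j show "e i j = e' i j"
    using * assms(3)[OF True, of j] PiE_arb[of "e i" _ _ j] PiE_arb[of "e' i" _ _ j]
    unfolding rsig_def by (cases "j \<in> {1..n}") metis+
  qed
 next
  case False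
  then show ?thesis using assms PiE_arb[of e _ _ i] PiE_arb[of e' _ _ i] unfolding sg_def by metis
 qed
qed

lemma flip_in: "e \<in> sg n ==> flip n c e \<in> sg n"
 using sg_sign[of e n] by (fastforce simp: sg_def rsig_def flip_def)

lemma tp_in: "e \<in> sg n ==> tp n e \<in> sg n"
 using sg_sign[of e n] by (fastforce simp: sg_def rsig_def tp_def)

lemma avg_flip: "avg n (\<lambda>e. f (flip n c e)) = avg n f"
proof (rule avg_bij)
 show "bij_betw (flip n c) (sg n) (sg n)"
  by (rule bij_betwI[where g = "flip n c"]) (use flip_in in \<open>auto intro!: sg_eqI[OF flip_in[OF flip_in]] simp del: One_nat_def, auto simp: flip_def\<close>)
qed

lemma avg_tp: "avg n (\<lambda>e. f (tp n e)) = avg n f"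
proof (rule avg_bij)
 show "bij_betw (tp n) (sg n) (sg n)"
  by (rule bij_betwI[where g = "tp n"]) (use tp_in in \<open>auto intro!: sg_eqI[OF tp_in[OF tp_in]] simp del: One_nat_def, auto simp: tp_def\<close>)
qed

lemma pr_tp: "pr n (\<lambda>e. Q (tp n e)) = pr n Q"
 unfolding pr_def by (rule avg_tp)

lemma tp_apply: "i \<in> {1..n} ==> j \<in> {1..n} ==> tp n e i j = e j i"
 by (simp add: tp_def)

lemma powr_midpoint:
 fixes x y p :: real
 assumes "x \<ge> 0" "y \<ge> 0" "p \<ge> 1"
 shows "((x + y) / 2) powr p \<le> (x powr p + y powr p) / 2"
proof -
 have half: "(z / 2) powr p \<le> z powr p / 2" if "z \<ge> 0" for z :: real
 proof -
  have "(2::real) powr 1 \<le> 2 powr p" using assms by (intro powr_mono) auto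
  then have "z powr p * 2 \<le> z powr p * 2 powr p" by (intro mult_left_mono) auto
  then show ?thesis using that by (simp add: powr_divide field_simps)
 qed
 consider "x = 0" | "y = 0" | "x > 0" "y > 0" using assms by linarith
 then show ?thesis
 proof cases
  case 3
  from convex_onD[OF powr_convex[OF assms(3)], of "1/2" x y] 3 show ?thesis by (simp add: field_simps)
 qed (use half assms in auto)
qed

text \<open>The masked form is the mean of the form and of its copy with the signs outside the mask
  flipped. The copy has the same distribution, so convexity of the power gives the claim. Hence
  splitting the matrix by the size of its entries does not increase weak moments.\<close>

lemma masked_moment:
 assumes IJ: "I \<subseteq> {1..n}" "J \<subseteq> {1..n}" and p: "p \<ge> 1"
 shows "avg n (\<lambda>e. \<bar>\<Sum>i\<in>I. \<Sum>j\<in>J. (if c i j then z i j else 0) * e i j\<bar> powr p) \<le>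
     avg n (\<lambda>e. \<bar>\<Sum>i\<in>I. \<Sum>j\<in>J. z i j * e i j\<bar> powr p)"
proof -
 let ?S = "\<lambda>e. \<Sum>i\<in>I. \<Sum>j\<in>J. z i j * e i j" and ?F = "flip n (\<lambda>i j. \<not> c i j)"
 have "\<bar>\<Sum>i\<in>I. \<Sum>j\<in>J. (if c i j then z i j else 0) * e i j\<bar> powr p \<le> (1 / 2) * (\<bar>?S e\<bar> powr p + \<bar>?S (?F e)\<bar> powr p)" for e
 proof -
  have "(\<Sum>i\<in>I. \<Sum>j\<in>J. (if c i j then z i j else 0) * e i j) = (\<Sum>i\<in>I. \<Sum>j\<in>J. (z i j * e i j + z i j * ?F e i j) / 2)"
   using IJ by (intro sum.cong refl) (auto simp: flip_def subset_iff)
  also have "... = (?S e + ?S (?F e)) / 2" by (simp add: sum.distrib sum_divide_distrib add_divide_distrib)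
  finally have "\<bar>\<Sum>i\<in>I. \<Sum>j\<in>J. (if c i j then z i j else 0) * e i j\<bar> \<le> (\<bar>?S e\<bar> + \<bar>?S (?F e)\<bar>) / 2" by (rule ssubst) (use abs_triangle_ineq[of "?S e" "?S (?F e)"] in \<open>simp\<close>)
  then have "\<bar>\<Sum>i\<in>I. \<Sum>j\<in>J. (if c i j then z i j else 0) * e i j\<bar> powr p \<le> ((\<bar>?S e\<bar> + \<bar>?S (?F e)\<bar>) / 2) powr p"
   using p by (intro powr_mono2) auto
  also have "... \<le> (1 / 2) * (\<bar>?S e\<bar> powr p + \<bar>?S (?F e)\<bar> powr p)"
   using powr_midpoint[of "\<bar>?S e\<bar>" "\<bar>?S (?F e)\<bar>" p] p by simp
  finally show ?thesis .
 qed
 then have "avg n (\<lambda>e. \<bar>\<Sum>i\<in>I. \<Sum>j\<in>J. (if c i j then z i j else 0) * e i j\<bar> powr p) \<le>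
   avg n (\<lambda>e. (1 / 2) * (\<bar>?S e\<bar> powr p + \<bar>?S (?F e)\<bar> powr p))" by (intro avg_mono)
 also have "... = avg n (\<lambda>e. \<bar>?S e\<bar> powr p)"
  unfolding avg_cmult avg_add avg_flip[of n "\<lambda>e. \<bar>?S e\<bar> powr p"] by simp
 finally show ?thesis .
qed

subsection \<open>Nets and operator norms of column families\<close>

text \<open>Lattice points in the ball of squared radius \<open>m\<close>; divided by
  \<open>sqrt c\<close>, with \<open>m\<close> about \<open>4 * c\<close>, they serve as a net for
  the unit ball.\<close>

definition ilat :: "nat set => nat => (nat => int) set" where
 "ilat K m = {z \<in> PiE K (\<lambda>_. {- int m..int m}). (\<Sum>j\<in>K. (z j)\<^sup>2) \<le> int m}"

lemma finite_ilat [simp]: "finite K ==> finite (ilat K m)"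
 unfolding ilat_def by (rule finite_subset[of _ "PiE K (\<lambda>_. {- int m..int m})"]) (auto intro: finite_PiE)

lemma int_abs_le_sq: "\<bar>z\<bar> \<le> z\<^sup>2" for z :: int
proof (cases "z = 0")
 case False
 then have "\<bar>z\<bar> \<le> \<bar>z\<bar> ^ 2" by (intro self_le_power) auto
 then show ?thesis by simp
qed auto

lemma sum_half_power_int: "(\<Sum>z\<in>{- int m..int m}. (1 / 2 :: real) ^ nat \<bar>z\<bar>) \<le> 3 - 2 * (1 / 2) ^ m"
proof (induction m)
 case (Suc m)
 have "{- int (Suc m)..int (Suc m)} = insert (- int (Suc m)) (insert (int (Suc m)) {- int m..int m})" by auto
 then have "(\<Sum>z\<in>{- int (Suc m)..int (Suc m)}. (1 / 2 :: real) ^ nat \<bar>z\<bar>) =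
   2 * (1 / 2) ^ Suc m + (\<Sum>z\<in>{- int m..int m}. (1 / 2) ^ nat \<bar>z\<bar>)"
  by (simp add: nat_add_distrib)
 then show ?case using Suc by simp
qed auto

text \<open>Each point has weight at least 1 under \<open>exp (real m)\<close> times the Gaussian
  weight, which factorises over the coordinates; a one-dimensional Gaussian sum is at most
  3.\<close>

lemma card_ilat:
 assumes "finite K"
 shows "real (card (ilat K m)) \<le> exp (real m) * 3 ^ card K"
proof -
 have one: "(\<Sum>z\<in>{- int m..int m}. exp (- (real_of_int z)\<^sup>2)) \<le> 3"
 proof -
  have "exp (- (real_of_int z)\<^sup>2) \<le> (1 / 2) ^ nat \<bar>z\<bar>" for z
  proof -
   have "(2::real) \<le> exp 1" using exp_ge_add_one_self[of 1] by simp
   then have "(2::real) ^ nat \<bar>z\<bar> \<le> exp 1 ^ nat \<bar>z\<bar>" by (intro power_mono) auto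
   also have "... = exp (real (nat \<bar>z\<bar>))" by (simp flip: exp_of_nat_mult)
   also have "real (nat \<bar>z\<bar>) \<le> (real_of_int z)\<^sup>2"
   proof -
    have "real (nat \<bar>z\<bar>) = real_of_int \<bar>z\<bar>" by simp
    also have "... \<le> real_of_int (z\<^sup>2)" using int_abs_le_sq[of z] by (simp only: of_int_le_iff)
    finally show ?thesis by simp
   qed
   finally show ?thesis by (simp add: exp_minus power_divide field_simps)
  qed
  then have "(\<Sum>z\<in>{- int m..int m}. exp (- (real_of_int z)\<^sup>2)) \<le> (\<Sum>z\<in>{- int m..int m}. (1 / 2) ^ nat \<bar>z\<bar>)"
   by (intro sum_mono)
  also note sum_half_power_int
  finally show ?thesis by (smt (verit) zero_le_power divide_nonneg_nonneg)
 qed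
 have "real (card (ilat K m)) = (\<Sum>z\<in>ilat K m. 1)" by simp
 also have "... \<le> (\<Sum>z\<in>ilat K m. exp (real m) * (\<Prod>j\<in>K. exp (- (real_of_int (z j))\<^sup>2)))"
 proof (intro sum_mono)
  fix z assume "z \<in> ilat K m"
  then have "(\<Sum>j\<in>K. (z j)\<^sup>2) \<le> int m" by (simp add: ilat_def)
  then have "real_of_int (\<Sum>j\<in>K. (z j)\<^sup>2) \<le> real m" by linarith
  then show "1 \<le> exp (real m) * (\<Prod>j\<in>K. exp (- (real_of_int (z j))\<^sup>2))"
   using assms by (simp add: mult_exp_exp sum_negf flip: exp_sum)
 qed
 also have "... \<le> (\<Sum>z\<in>PiE K (\<lambda>_. {- int m..int m}). exp (real m) * (\<Prod>j\<in>K. exp (- (real_of_int (z j))\<^sup>2)))"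
  using assms by (intro sum_mono2) (auto simp: ilat_def intro!: finite_PiE mult_nonneg_nonneg prod_nonneg)
 also have "... = exp (real m) * (\<Prod>j\<in>K. \<Sum>z\<in>{- int m..int m}. exp (- (real_of_int z)\<^sup>2))"
  using assms by (subst prod_sum_PiE) (auto simp: sum_distrib_left)
 also have "... \<le> exp (real m) * (\<Prod>j\<in>K. 3)"
  using one by (intro mult_left_mono prod_mono) (auto intro!: sum_nonneg)
 finally show ?thesis by simp
qed

text \<open>There is no approximation error: rounding each coordinate of \<open>sqrt c * t\<close>
  in the direction of the sign of \<open>w j\<close> can only increase the linear form. Rounding
  gives squares at most \<open>2 * c * (t j)\<^sup>2 + 2\<close>, and \<open>card K \<le> c\<close>
  keeps their sum below \<open>4 * c\<close>.\<close>

lemma ilat_max: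
 assumes K: "finite K" "real (card K) \<le> c" and c: "c > 0" and t: "(\<Sum>j\<in>K. (t j)\<^sup>2) \<le> 1"
 shows "\<exists>z\<in>ilat K (nat \<lfloor>4 * c\<rfloor>). (\<Sum>j\<in>K. w j * t j) \<le> (\<Sum>j\<in>K. w j * (real_of_int (z j) / sqrt c))"
proof -
 define z where "z = (\<lambda>j\<in>K. if w j \<ge> 0 then \<lceil>sqrt c * t j\<rceil> else \<lfloor>sqrt c * t j\<rfloor>)"
 have z1: "(real_of_int (z j))\<^sup>2 \<le> 2 * c * (t j)\<^sup>2 + 2" if "j \<in> K" for j
 proof -
  have "\<bar>real_of_int (z j) - sqrt c * t j\<bar> \<le> 1" using that unfolding z_def by (simp, linarith)
  then have "(real_of_int (z j) - sqrt c * t j)\<^sup>2 \<le> 1" using abs_square_le_1 by blast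
  moreover have "(real_of_int (z j))\<^sup>2 \<le> 2 * (sqrt c * t j)\<^sup>2 + 2 * (real_of_int (z j) - sqrt c * t j)\<^sup>2"
   using sum_squares_bound[of "sqrt c * t j" "real_of_int (z j) - sqrt c * t j"]
   by (simp add: power2_eq_square algebra_simps)
  moreover have "(sqrt c * t j)\<^sup>2 = c * (t j)\<^sup>2" using c by (simp add: power_mult_distrib)
  ultimately show ?thesis by linarith
 qed
 have "(\<Sum>j\<in>K. (real_of_int (z j))\<^sup>2) \<le> (\<Sum>j\<in>K. 2 * c * (t j)\<^sup>2 + 2)" by (intro sum_mono z1)
 also have "... = 2 * c * (\<Sum>j\<in>K. (t j)\<^sup>2) + 2 * real (card K)" by (simp add: sum.distrib sum_distrib_left)
 also have "... \<le> 2 * c * 1 + 2 * c" using K c t by (intro add_mono mult_left_mono) auto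
 finally have "real_of_int (\<Sum>j\<in>K. (z j)\<^sup>2) \<le> 4 * c" by simp
 then have S: "(\<Sum>j\<in>K. (z j)\<^sup>2) \<le> int (nat \<lfloor>4 * c\<rfloor>)" using c by linarith
 have bd: "\<bar>z j\<bar> \<le> int (nat \<lfloor>4 * c\<rfloor>)" if "j \<in> K" for j
 proof -
  have "\<bar>z j\<bar> \<le> (z j)\<^sup>2" by (rule int_abs_le_sq)
  also have "... \<le> (\<Sum>j\<in>K. (z j)\<^sup>2)" using K that by (intro member_le_sum) auto
  finally show ?thesis using S by linarith
 qed
 have "z \<in> PiE K (\<lambda>_. {- int (nat \<lfloor>4 * c\<rfloor>)..int (nat \<lfloor>4 * c\<rfloor>)})"
 proof (rule PiE_I)
  fix j assume "j \<in> K"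
  from bd[OF this] show "z j \<in> {- int (nat \<lfloor>4 * c\<rfloor>)..int (nat \<lfloor>4 * c\<rfloor>)}" unfolding atLeastAtMost_iff abs_le_iff by linarith
 qed (simp add: z_def)
 then have "z \<in> ilat K (nat \<lfloor>4 * c\<rfloor>)"
  using S by (simp only: ilat_def mem_Collect_eq)
 moreover have "w j * t j \<le> w j * (real_of_int (z j) / sqrt c)" if "j \<in> K" for j
 proof (cases "w j \<ge> 0")
  case True
  have "sqrt c * t j \<le> real_of_int (z j)" using True that by (simp add: z_def)
  then show ?thesis using True c by (intro mult_left_mono) (auto simp: field_simps)
 next
  case False
  have "sqrt c * t j \<ge> real_of_int (z j)" using False that by (simp add: z_def)
  then show ?thesis using False c by (intro mult_left_mono_neg) (auto simp: field_simps)
 qed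
 ultimately show ?thesis by (intro bexI[of _ z] sum_mono) auto
qed

lemma ilat_norm:
 assumes "z \<in> ilat K (nat \<lfloor>4 * c\<rfloor>)" "c > 0"
 shows "(\<Sum>j\<in>K. (real_of_int (z j) / sqrt c)\<^sup>2) \<le> 4"
proof -
 have "real_of_int (\<Sum>j\<in>K. (z j)\<^sup>2) \<le> 4 * c"
 proof -
  have "(\<Sum>j\<in>K. (z j)\<^sup>2) \<le> int (nat \<lfloor>4 * c\<rfloor>)" using assms by (simp only: ilat_def mem_Collect_eq)
  then show ?thesis using assms(2) by linarith
 qed
 then show ?thesis using assms(2) by (simp add: power_divide field_simps flip: sum_divide_distrib)
qed

definition sqn :: "nat set => (nat => real) => real" where
 "sqn K s = (\<Sum>i\<in>K. (s i)\<^sup>2)"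

definition bform :: "(nat => nat => real) => nat set => nat set => (nat => nat => real) => (nat => real) => (nat => real) => real" where
 "bform a I J e s t = (\<Sum>i\<in>I. \<Sum>j\<in>J. a i j * e i j * s i * t j)"

text \<open>The operator norm of the signed block is at most \<open>Z\<close>. As a predicate in
  homogeneous form it needs no supremum and applies to vectors of any length.\<close>

definition opb :: "real => (nat => nat => real) => nat set => nat set => (nat => nat => real) => bool" where
 "opb Z a I J e \<longleftrightarrow> (\<forall>s t. bform a I J e s t \<le> Z * sqrt (sqn I s) * sqrt (sqn J t))"

lemma sqn_nonneg [simp]: "sqn K s \<ge> 0" by (simp add: sqn_def sum_nonneg)

lemma opbI:
 assumes fin: "finite I" "finite J" and u: "\<And>s t. sqn I s \<le> 1 ==> sqn J t \<le> 1 ==> bform a I J e s t \<le> Z"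
 shows "opb Z a I J e"
 unfolding opb_def
proof (intro allI)
 fix s t
 show "bform a I J e s t \<le> Z * sqrt (sqn I s) * sqrt (sqn J t)"
 proof (cases "sqn I s = 0 \<or> sqn J t = 0")
  case True
  then have "(\<forall>i\<in>I. s i = 0) \<or> (\<forall>j\<in>J. t j = 0)" using fin by (auto simp: sqn_def sum_nonneg_eq_0_iff)
  then have "bform a I J e s t = 0" by (auto simp: bform_def)
  then show ?thesis using True by auto
 next
  case False
  define c d where "c = sqrt (sqn I s)" "d = sqrt (sqn J t)"
  have cd: "c > 0" "d > 0" using False sqn_nonneg[of I s] sqn_nonneg[of J t] unfolding c_d_def by (auto simp del: sqn_nonneg)
  have 1: "sqn I (\<lambda>i. s i / c) = sqn I s / c\<^sup>2" "sqn J (\<lambda>i. t i / d) = sqn J t / d\<^sup>2"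
   by (simp_all add: sqn_def power_divide sum_divide_distrib)
  have "sqn I (\<lambda>i. s i / c) \<le> 1" "sqn J (\<lambda>i. t i / d) \<le> 1" unfolding 1 using False by (simp_all add: c_d_def)
  then have "bform a I J e (\<lambda>i. s i / c) (\<lambda>i. t i / d) \<le> Z" by (rule u)
  also have "bform a I J e (\<lambda>i. s i / c) (\<lambda>i. t i / d) = bform a I J e s t / (c * d)"
   by (simp add: bform_def sum_divide_distrib)
  finally show ?thesis using cd unfolding c_d_def[symmetric] by (simp add: field_simps)
 qed
qed

locale mat =
 fixes n :: nat and A :: "nat set" and a :: "nat => nat => real"
 assumes A: "A \<subseteq> {1..n}"
  and row: "\<And>i. i \<in> A ==> (\<Sum>j\<in>A. (a i j)\<^sup>2) \<le> 1"
  and col: "\<And>j. j \<in> A ==> (\<Sum>i\<in>A. (a i j)\<^sup>2) \<le> 1"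
begin

lemma finA [simp]: "finite A" using A finite_subset by auto

lemma mat_tp: "mat n A (\<lambda>i j. a j i)"
 using A row col by unfold_locales auto

end

text \<open>The bound \<open>R\<close> on the weak moment of order \<open>p\<close>, over the finite
  sample space and in homogeneous form.\<close>

definition mom :: "nat => nat set => (nat => nat => real) => real => real => bool" where
 "mom n A a p R \<longleftrightarrow> (\<forall>s t. avg n (\<lambda>e. \<bar>bform a A A e s t\<bar> powr p) \<le> (R * sqrt (sqn A s) * sqrt (sqn A t)) powr p)"

lemma sqn_mono: "finite A ==> K \<subseteq> A ==> sqn K s \<le> sqn A s"
 unfolding sqn_def by (intro sum_mono2) auto

lemma bform_sub:
 assumes "finite A" "I \<subseteq> A" "J \<subseteq> A"
 shows "bform a I J e s t = bform a A A e (\<lambda>i. if i \<in> I then s i else 0) (\<lambda>j. if j \<in> J then t j else 0)"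
proof -
 have "bform a A A e (\<lambda>i. if i \<in> I then s i else 0) (\<lambda>j. if j \<in> J then t j else 0) =
  (\<Sum>i\<in>A. if i \<in> I then (\<Sum>j\<in>A. if j \<in> J then a i j * e i j * s i * t j else 0) else 0)"
  unfolding bform_def by (intro sum.cong refl) (auto intro!: sum.cong)
 also have "... = bform a I J e s t"
  using assms by (simp add: bform_def Int_absorb1 flip: sum.inter_restrict)
 finally show ?thesis by simp
qed

lemma sqn_ext: "finite A ==> I \<subseteq> A ==> sqn A (\<lambda>i. if i \<in> I then s i else 0) = sqn I s"
 unfolding sqn_def by (simp add: if_distrib[of "\<lambda>x. x\<^sup>2"] Int_absorb1 flip: sum.inter_restrict cong: if_cong)

text \<open>Markov's inequality; the factor 4 is the product of the norms of two lattice vectors,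
  each of squared norm at most 4.\<close>

lemma mom_tail:
 assumes m: "mom n A a p R" and fin: "finite A" and sub: "I \<subseteq> A" "J \<subseteq> A" and R: "R > 0" and tau: "tau > 0" and p: "p > 0"
  and st: "sqn I s \<le> 4" "sqn J t \<le> 4"
 shows "pr n (\<lambda>e. \<bar>bform a I J e s t\<bar> > tau) \<le> (4 * R / tau) powr p"
proof -
 let ?s = "\<lambda>i. if i \<in> I then s i else 0" and ?t = "\<lambda>j. if j \<in> J then t j else 0"
 have "pr n (\<lambda>e. \<bar>bform a I J e s t\<bar> > tau) \<le> avg n (\<lambda>e. (1 / tau powr p) * \<bar>bform a A A e ?s ?t\<bar> powr p)"
  unfolding pr_def
 proof (intro avg_mono)
  fix e
  show "of_bool (\<bar>bform a I J e s t\<bar> > tau) \<le> (1 / tau powr p) * \<bar>bform a A A e ?s ?t\<bar> powr p"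
   using tau p powr_mono2[of p tau "\<bar>bform a A A e ?s ?t\<bar>"] unfolding bform_sub[OF fin sub] by auto
 qed
 also have "... \<le> (1 / tau powr p) * (R * sqrt (sqn A ?s) * sqrt (sqn A ?t)) powr p"
  unfolding avg_cmult using m by (intro mult_left_mono) (auto simp: mom_def)
 also have "... \<le> (1 / tau powr p) * (R * 2 * 2) powr p"
 proof (intro mult_left_mono powr_mono2 mult_mono)
  show "sqrt (sqn A ?s) \<le> 2" "sqrt (sqn A ?t) \<le> 2"
   unfolding sqn_ext[OF fin sub(1)] sqn_ext[OF fin sub(2)] using st real_sqrt_le_mono[of _ 4] by fastforce+
 qed (use R p in auto)
 also have "... = (4 * R / tau) powr p" using R tau by (simp add: powr_divide mult.commute)
 finally show ?thesis .
qed

text \<open>Fix a column set \<open>K\<close> and a lattice vector \<open>z\<close> on it. The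
  variances \<open>v K z i\<close> of the rows sum to at most 4, so at most \<open>4 * P\<close>
  rows exceed \<open>1 / P\<close>; on these a second lattice vector is affordable and the weak
  moments apply. The other rows have variance at most \<open>1 / P\<close>, and the sum of their
  squares concentrates by \<open>chi_tail\<close>; the constant is 144 * 4 + 16 * (c + 10) = 736 +
  16 * c.\<close>

lemma (in mat) opb_family:
 assumes m: "mom n A a p R" and R: "R > 0" and P: "P \<ge> 1" "17 * p \<ge> P" and c: "c \<ge> 0"
  and KK: "finite KK" "\<And>K. K \<in> KK ==> K \<subseteq> A \<and> real (card K) \<le> P" "real (card KK) \<le> exp (c * P)"
 shows "pr n (\<lambda>e. \<exists>K\<in>KK. \<not> opb (sqrt (736 + 16 * c) + 4 * R * exp (17 * (c + 34))) a A K e) \<le> 2 * exp (- 4 * P)"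
proof -
 define tv where "tv = (\<lambda>(z::nat=>int) j. real_of_int (z j) / sqrt P)"
 define sv where "sv = (\<lambda>(z::nat=>int) j. real_of_int (z j) / sqrt (4 * P))"
 define Q where "Q = nat \<lfloor>4 * P\<rfloor>"
 define Q' where "Q' = nat \<lfloor>4 * (4 * P)\<rfloor>"
 define v where "v = (\<lambda>K z i. \<Sum>j\<in>K. (a i j * tv z j)\<^sup>2)"
 define big where "big = (\<lambda>K z. {i\<in>A. v K z i > 1 / P})"
 define T1 where "T1 = Sigma KK (\<lambda>K. ilat K Q)"
 define T2 where "T2 = Sigma T1 (\<lambda>(K,z). ilat (big K z) Q')"
 \<comment> \<open>With \<open>17 * p \<ge> P\<close>, Markov's bound at \<open>tau\<close> is
   \<open>exp (- ((c + 34) * P))\<close>, against at most \<open>exp ((c + 30) * P)\<close> triples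
   in \<open>T2\<close>.\<close>
 define tau where "tau = 4 * R * exp (17 * (c + 34))"
 define W where "W = 736 + 16 * c"
 have finK: "finite K" if "K \<in> KK" for K using KK(2)[OF that] finite_subset[of K A] finA by auto
 have finT1: "finite T1" unfolding T1_def using KK finK by auto
 have finbig [simp]: "finite (big K z)" "big K z \<subseteq> A" for K z by (auto simp: big_def)
 have finT2: "finite T2" unfolding T2_def using finT1 by auto
 have e3: "(3::real) \<le> exp 2"
 proof -
  have "(2::real) ^ 2 \<le> (exp 1)\<^sup>2" using exp_ge_add_one_self[of 1] by (intro power_mono) auto
  then show ?thesis by (simp flip: exp_of_nat_mult)
 qed
 have three: "(3::real) ^ k \<le> exp (2 * r)" if "real k \<le> r" for k r
 proof -
  have "(3::real) ^ k \<le> exp 2 ^ k" using e3 by (intro power_mono) auto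
  also have "... = exp (2 * real k)" by (simp flip: exp_of_nat_mult add: mult.commute)
  also have "... \<le> exp (2 * r)" using that by simp
  finally show ?thesis .
 qed
 have cl: "real (card (ilat K Q)) \<le> exp (6 * P)" if "K \<in> KK" for K
 proof -
  have "real (card (ilat K Q)) \<le> exp (real Q) * 3 ^ card K" by (rule card_ilat[OF finK[OF that]])
  also have "... \<le> exp (4 * P) * exp (2 * P)"
   using KK(2)[OF that] P by (intro mult_mono three) (auto simp: Q_def)
  finally show ?thesis by (simp add: mult_exp_exp)
 qed
 have cT1: "real (card T1) \<le> exp ((c + 6) * P)"
 proof -
  have "real (card T1) = (\<Sum>K\<in>KK. real (card (ilat K Q)))"
   unfolding T1_def using KK finK by (subst card_SigmaI) auto
  also have "... \<le> (\<Sum>K\<in>KK. exp (6 * P))" by (intro sum_mono cl)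
  also have "... = real (card KK) * exp (6 * P)" by simp
  also have "... \<le> exp (c * P) * exp (6 * P)" using KK by (intro mult_right_mono) auto
  finally show ?thesis by (simp add: mult_exp_exp algebra_simps)
 qed
 have tvn: "sqn K (tv z) \<le> 4" if "z \<in> ilat K Q" for K z
  using ilat_norm[of z K P] that P unfolding sqn_def tv_def Q_def by auto
 have svn: "sqn K (sv z) \<le> 4" if "z \<in> ilat K Q'" for K z
  using ilat_norm[of z K "4 * P"] that P unfolding sqn_def sv_def Q'_def by auto
 have sumv: "(\<Sum>i\<in>A. v K z i) \<le> 4" if "(K, z) \<in> T1" for K z
 proof -
  have K: "K \<subseteq> A" "z \<in> ilat K Q" using that KK by (auto simp: T1_def)
  have "(\<Sum>i\<in>A. v K z i) = (\<Sum>j\<in>K. (\<Sum>i\<in>A. (a i j)\<^sup>2) * (tv z j)\<^sup>2)"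
   unfolding v_def by (subst sum.swap) (simp add: power_mult_distrib sum_distrib_right)
  also have "... \<le> (\<Sum>j\<in>K. 1 * (tv z j)\<^sup>2)" using K col by (intro sum_mono mult_right_mono) auto
  also have "... \<le> 4" using tvn[OF K(2)] by (simp add: sqn_def)
  finally show ?thesis .
 qed
 have v0: "v K z i \<ge> 0" for K z i by (auto simp: v_def intro: sum_nonneg)
 have cbig: "real (card (big K z)) \<le> 4 * P" if "(K, z) \<in> T1" for K z
 proof -
  have "real (card (big K z)) * (1 / P) = (\<Sum>i\<in>big K z. 1 / P)" by simp
  also have "... \<le> (\<Sum>i\<in>big K z. v K z i)" by (intro sum_mono) (auto simp: big_def)
  also have "... \<le> (\<Sum>i\<in>A. v K z i)" by (intro sum_mono2) (auto simp: v0)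
  also note sumv[OF that]
  finally show ?thesis using P by (simp add: field_simps)
 qed
 have cT2: "real (card T2) \<le> exp ((c + 30) * P)"
 proof -
  have "real (card T2) = (\<Sum>x\<in>T1. real (card (case x of (K,z) => ilat (big K z) Q')))"
   unfolding T2_def using finT1 by (subst card_SigmaI) auto
  also have "... \<le> (\<Sum>x\<in>T1. exp (24 * P))"
  proof (intro sum_mono, clarify)
   fix K z assume "(K, z) \<in> T1"
   note cb = cbig[OF this]
   have "real (card (ilat (big K z) Q')) \<le> exp (real Q') * 3 ^ card (big K z)" by (rule card_ilat) auto
   also have "... \<le> exp (16 * P) * exp (2 * (4 * P))"
    using cb P by (intro mult_mono three) (auto simp: Q'_def)
   finally show "real (card (ilat (big K z) Q')) \<le> exp (24 * P)" by (simp add: mult_exp_exp)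
  qed
  also have "... = real (card T1) * exp (24 * P)" by simp
  also have "... \<le> exp ((c + 6) * P) * exp (24 * P)" using cT1 by (intro mult_right_mono) auto
  finally show ?thesis by (simp add: mult_exp_exp algebra_simps)
 qed
 define B1 where "B1 = (\<lambda>(K,z) e. (\<Sum>i\<in>A - big K z. (\<Sum>j\<in>K. a i j * tv z j * e i j)\<^sup>2) > W)"
 define B2 where "B2 = (\<lambda>((K,z),y) e. \<bar>bform a (big K z) K e (sv y) (tv z)\<bar> > tau)"
 have pB1: "pr n (B1 x) \<le> exp (- ((c + 10) * P))" if x: "x \<in> T1" for x
 proof -
  obtain K z where xe: "x = (K, z)" by (cases x)
  note Kz = x[unfolded xe]
  have KA: "K \<subseteq> A" using Kz KK by (auto simp: T1_def)
  have "pr n (B1 x) \<le> pr n (\<lambda>e. (\<Sum>i\<in>A - big K z. max 0 ((\<Sum>j\<in>K. (a i j * tv z j) * e i j)\<^sup>2 - 0 * v K z i)) >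
    144 * exp (- 0 / 8) * (\<Sum>i\<in>A - big K z. v K z i) + 16 * (1 / P) * ((c + 10) * P))"
  proof (intro pr_mono)
   fix e assume b: "B1 x e"
   have "(\<Sum>i\<in>A - big K z. v K z i) \<le> (\<Sum>i\<in>A. v K z i)" by (intro sum_mono2) (auto simp: v0)
   then have "144 * exp (- 0 / 8) * (\<Sum>i\<in>A - big K z. v K z i) + 16 * (1 / P) * ((c + 10) * P) \<le> W"
    using sumv[OF Kz] P unfolding W_def by simp
   then show "(\<Sum>i\<in>A - big K z. max 0 ((\<Sum>j\<in>K. (a i j * tv z j) * e i j)\<^sup>2 - 0 * v K z i)) >
    144 * exp (- 0 / 8) * (\<Sum>i\<in>A - big K z. v K z i) + 16 * (1 / P) * ((c + 10) * P)"
    using b unfolding B1_def xe by (simp add: max_def)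
  qed
  also have "... \<le> exp (- ((c + 10) * P))"
   using A KA P by (intro chi_tail) (auto simp: v_def[symmetric] big_def, auto simp: v_def)
  finally show ?thesis by simp
 qed
 have pB2: "pr n (B2 x) \<le> exp (- ((c + 34) * P))" if x: "x \<in> T2" for x
 proof -
  obtain K z y where xe: "x = ((K, z), y)" by (metis surj_pair)
  have Kz: "(K, z) \<in> T1" "y \<in> ilat (big K z) Q'" using x by (auto simp: xe T2_def)
  have KA: "K \<subseteq> A" "z \<in> ilat K Q" using Kz KK by (auto simp: T1_def)
  have ex: "4 * R / (4 * R * exp x) = exp (- x)" for x using R by (simp add: exp_minus field_simps)
  have tp: "tau > 0" "4 * R / tau = exp (- (17 * (c + 34)))" using R ex by (simp_all only: tau_def) simp_all
  have "pr n (B2 x) \<le> (4 * R / tau) powr p"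
   unfolding B2_def xe prod.case using P KA by (intro mom_tail[OF m finA _ _ R tp(1)] svn tvn Kz) auto
  also have "... = exp (- ((c + 34) * (17 * p)))" unfolding tp by (simp add: powr_def algebra_simps)
  also have "... \<le> exp (- ((c + 34) * P))" using c P by (simp add: mult_left_mono)
  finally show ?thesis by simp
 qed
 have good: "opb (sqrt W + tau) a A K e" if e: "e \<in> sg n" and K: "K \<in> KK"
  and n1: "\<forall>x\<in>T1. \<not> B1 x e" and n2: "\<forall>x\<in>T2. \<not> B2 x e" for K e
 proof (rule opbI[OF finA finK[OF K]])
  fix s t assume s: "sqn A s \<le> 1" and t: "sqn K t \<le> 1"
  have KA: "K \<subseteq> A" "real (card K) \<le> P" using KK K by auto
  let ?w = "\<lambda>j. \<Sum>i\<in>A. a i j * e i j * s i"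
  obtain z where z: "z \<in> ilat K Q" and zw: "(\<Sum>j\<in>K. ?w j * t j) \<le> (\<Sum>j\<in>K. ?w j * tv z j)"
   using ilat_max[OF finK[OF K] KA(2), of t ?w] t P unfolding sqn_def Q_def tv_def by auto
  have Kz: "(K, z) \<in> T1" using K z by (auto simp: T1_def)
  let ?Y = "\<lambda>i. \<Sum>j\<in>K. a i j * tv z j * e i j"
  have sb: "(\<Sum>i\<in>big K z. (s i)\<^sup>2) \<le> 1" using s sqn_mono[of A "big K z" s] unfolding sqn_def by auto
  obtain y where y: "y \<in> ilat (big K z) Q'" and yw: "(\<Sum>i\<in>big K z. ?Y i * s i) \<le> (\<Sum>i\<in>big K z. ?Y i * sv y i)"
   using ilat_max[OF _ cbig[OF Kz] _ sb, of ?Y] P unfolding Q'_def sv_def by auto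
  have "bform a A K e s t = (\<Sum>j\<in>K. ?w j * t j)"
   unfolding bform_def by (subst sum.swap) (simp add: sum_distrib_right)
  also note zw
  also have "(\<Sum>j\<in>K. ?w j * tv z j) = (\<Sum>i\<in>A. ?Y i * s i)"
   unfolding sum_distrib_right by (subst sum.swap) (simp add: mult_ac)
  also have "... = (\<Sum>i\<in>A - big K z. ?Y i * s i) + (\<Sum>i\<in>big K z. ?Y i * s i)"
   by (intro sum.subset_diff) auto
  also have "(\<Sum>i\<in>A - big K z. ?Y i * s i) \<le> sqrt W"
  proof -
   have "(\<Sum>i\<in>A - big K z. ?Y i * s i)\<^sup>2 \<le> (\<Sum>i\<in>A - big K z. (?Y i)\<^sup>2) * (\<Sum>i\<in>A - big K z. (s i)\<^sup>2)"
    by (rule Cauchy_Schwarz_ineq_sum)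
   also have "... \<le> W * 1"
   proof (intro mult_mono)
    show "(\<Sum>i\<in>A - big K z. (?Y i)\<^sup>2) \<le> W" using n1 Kz unfolding B1_def by force
    show "(\<Sum>i\<in>A - big K z. (s i)\<^sup>2) \<le> 1" using s sqn_mono[of A "A - big K z" s] unfolding sqn_def by auto
   qed (use c in \<open>auto simp: W_def intro: sum_nonneg\<close>)
   finally show ?thesis by (simp add: real_le_rsqrt)
  qed
  also have "(\<Sum>i\<in>big K z. ?Y i * s i) \<le> tau"
  proof -
   have "((K, z), y) \<in> T2" using Kz y by (auto simp: T2_def)
   then have "\<bar>bform a (big K z) K e (sv y) (tv z)\<bar> \<le> tau" using n2 unfolding B2_def by force
   moreover have "bform a (big K z) K e (sv y) (tv z) = (\<Sum>i\<in>big K z. ?Y i * sv y i)"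
    unfolding bform_def sum_distrib_right by (simp add: mult_ac)
   ultimately show ?thesis using yw by linarith
  qed
  finally show "bform a A K e s t \<le> sqrt W + tau" by simp
 qed
 have "pr n (\<lambda>e. \<exists>K\<in>KK. \<not> opb (sqrt W + tau) a A K e) \<le> pr n (\<lambda>e. (\<exists>x\<in>T1. B1 x e) \<or> (\<exists>x\<in>T2. B2 x e))"
  using good by (intro pr_mono) blast
 also have "... \<le> pr n (\<lambda>e. \<exists>x\<in>T1. B1 x e) + pr n (\<lambda>e. \<exists>x\<in>T2. B2 x e)" by (rule pr_or)
 also have "... \<le> (\<Sum>x\<in>T1. exp (- ((c + 10) * P))) + (\<Sum>x\<in>T2. exp (- ((c + 34) * P)))"
  by (intro add_mono pr_ex_le finT1 finT2 pB1 pB2)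
 also have "... = real (card T1) * exp (- ((c + 10) * P)) + real (card T2) * exp (- ((c + 34) * P))" by simp
 also have "... \<le> exp ((c + 6) * P) * exp (- ((c + 10) * P)) + exp ((c + 30) * P) * exp (- ((c + 34) * P))"
  by (intro add_mono mult_right_mono cT1 cT2) auto
 also have "... = 2 * exp (- 4 * P)" by (simp add: mult_exp_exp algebra_simps)
 finally show ?thesis unfolding W_def tau_def .
qed

subsection \<open>Connected vertex sets\<close>

text \<open>Connectedness by cuts: an edge leaves every proper nonempty part. This is the form used
  to grow walks and to pass to dominating sets.\<close>

definition conn :: "('v => 'v => bool) => 'v set => bool" where
 "conn r K \<longleftrightarrow> K \<noteq> {} \<and> (\<forall>P. P \<subset> K \<longrightarrow> P \<noteq> {} \<longrightarrow> (\<exists>x\<in>P. \<exists>y\<in>K - P. r x y))"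

definition lazy :: "('v => 'v => bool) => 'v list => bool" where
 "lazy r = successively (\<lambda>x y. x = y \<or> r x y)"

lemma lazy_detour:
 assumes "lazy r (ys @ p # zs)" "r p q" "r q p"
 shows "lazy r (ys @ p # q # p # zs)"
 using assms unfolding lazy_def by (cases zs) (auto simp: successively_append_iff)

text \<open>The covered part grows by one vertex at a time: an edge from \<open>p\<close> to a new
  \<open>q\<close> inserts the detour p, q, p, which adds two entries to the walk.\<close>

lemma conn_cover:
 assumes K: "finite K" "conn r K" "v \<in> K" and sym: "\<And>x y. r x y ==> r y x" and m: "1 \<le> m" "m \<le> card K"
 shows "\<exists>P xs. P \<subseteq> K \<and> card P = m \<and> xs \<noteq> [] \<and> set xs = P \<and> length xs = 2 * m - 1 \<and> lazy r xs"
 using m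
proof (induction m rule: nat_induct_at_least)
 case base
 show ?case using K(3) by (intro exI[of _ "{v}"] exI[of _ "[v]"]) (auto simp: lazy_def)
next
 case (Suc m)
 then obtain P xs where P: "P \<subseteq> K" "card P = m" "xs \<noteq> []" "set xs = P" "length xs = 2 * m - 1" "lazy r xs" by force
 then have "P \<subset> K" "P \<noteq> {}" using Suc by auto
 then obtain p q where pq: "p \<in> P" "q \<in> K - P" "r p q" using K(2) unfolding conn_def by meson
 obtain ys zs where xs: "xs = ys @ p # zs" using pq(1) P(4) by (metis split_list)
 have fin: "finite P" using P(1) K(1) finite_subset by auto
 show ?case
  using lazy_detour[of r ys p zs q] pq sym[OF pq(3)] P xs fin \<open>1 \<le> m\<close>
  by (intro exI[of _ "insert q P"] exI[of _ "ys @ p # q # p # zs"]) auto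
qed

definition walks :: "('v => 'v => bool) => 'v set => nat => 'v list set" where
 "walks r V L = {xs. set xs \<subseteq> V \<and> length xs = Suc L \<and> lazy r xs}"

lemma finite_walks: "finite V ==> finite (walks r V L)"
 unfolding walks_def by (rule finite_subset[OF _ finite_lists_length_eq[of V "Suc L"]]) auto

lemma card_walks:
 assumes V: "finite V" and deg: "\<And>x. x \<in> V ==> card {y\<in>V. r x y} \<le> d" and sym: "\<And>x y. r x y ==> r y x"
 shows "card (walks r V L) \<le> card V * (d + 1) ^ L"
proof (induction L)
 case 0
 have "walks r V 0 = (\<lambda>x. [x]) ` V" by (auto simp: walks_def lazy_def length_Suc_conv)
 then show ?case by (simp add: card_image inj_on_def)
next
 case (Suc L)
 let ?S = "Sigma (walks r V L) (\<lambda>xs. insert (hd xs) {y\<in>V. r (hd xs) y})"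
 have fin: "finite (walks r V L)" using V by (rule finite_walks)
 have sub: "walks r V (Suc L) \<subseteq> (\<lambda>(xs, y). y # xs) ` ?S"
 proof
  fix zs assume z: "zs \<in> walks r V (Suc L)"
  then obtain y xs where e: "zs = y # xs" "xs \<noteq> []" by (auto simp: walks_def length_Suc_conv)
  then have "(xs, y) \<in> ?S" using z sym by (cases xs) (auto simp: walks_def lazy_def)
  then show "zs \<in> (\<lambda>(xs, y). y # xs) ` ?S" using e by force
 qed
 have "card (walks r V (Suc L)) \<le> card ?S"
  using card_mono[OF _ sub] card_image_le[of ?S "\<lambda>(xs, y). y # xs"] fin V by fastforce
 also have "... = (\<Sum>xs\<in>walks r V L. card (insert (hd xs) {y\<in>V. r (hd xs) y}))"
  using fin V by (subst card_SigmaI) auto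
 also have "... \<le> (\<Sum>xs\<in>walks r V L. d + 1)"
 proof (intro sum_mono)
  fix xs assume "xs \<in> walks r V L"
  then have "hd xs \<in> V" by (cases xs) (auto simp: walks_def)
  then show "card (insert (hd xs) {y\<in>V. r (hd xs) y}) \<le> d + 1"
   using deg[of "hd xs"] V by (simp add: card_insert_if)
 qed
 also have "... \<le> card V * (d + 1) ^ L * (d + 1)" using mult_right_mono[OF Suc, of "d + 1"] by simp
 finally show ?case by (simp add: mult_ac)
qed

text \<open>A connected set of \<open>M\<close> vertices is the vertex set of a walk with
  \<open>2 * M - 2\<close> steps, each of which has at most \<open>d + 1\<close> choices.\<close>

lemma card_conn:
 assumes V: "finite V" and deg: "\<And>x. x \<in> V ==> card {y\<in>V. r x y} \<le> d" and sym: "\<And>x y. r x y ==> r y x"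
 shows "card {K. K \<subseteq> V \<and> conn r K \<and> card K = M} \<le> card V * (d + 1) ^ (2 * M)"
proof -
 have "{K. K \<subseteq> V \<and> conn r K \<and> card K = M} \<subseteq> set ` walks r V (2 * M - 2)"
 proof
  fix K assume "K \<in> {K. K \<subseteq> V \<and> conn r K \<and> card K = M}"
  then have K: "K \<subseteq> V" "conn r K" "card K = M" by auto
  have fin: "finite K" using K(1) V finite_subset by auto
  obtain v where v: "v \<in> K" using K(2) unfolding conn_def by auto
  then have M: "1 \<le> M" using K(3) fin by (metis One_nat_def Suc_leI card_gt_0_iff empty_iff)
  obtain P xs where P: "P \<subseteq> K" "card P = M" "xs \<noteq> []" "set xs = P" "length xs = 2 * M - 1" "lazy r xs"
   using conn_cover[OF fin K(2) v sym M] K(3) by blast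
  have "P = K" using P K fin by (metis card_subset_eq)
  then have "xs \<in> walks r V (2 * M - 2)" using P K M by (auto simp: walks_def)
  then show "K \<in> set ` walks r V (2 * M - 2)" using P \<open>P = K\<close> by blast
 qed
 then have "card {K. K \<subseteq> V \<and> conn r K \<and> card K = M} \<le> card (walks r V (2 * M - 2))"
  using finite_walks[OF V] by (meson card_image_le card_mono finite_imageI le_trans)
 also have "... \<le> card V * (d + 1) ^ (2 * M - 2)" using V deg sym by (rule card_walks)
 also have "... \<le> card V * (d + 1) ^ (2 * M)" by (intro mult_left_mono power_increasing) auto
 finally show ?thesis .
qed

text \<open>The closure is reflexive, so \<open>x\<close> belongs to its component even if it lies
  outside \<open>W\<close>; hence the hypothesis of \<open>comp_sub\<close>.\<close>

definition ccomp :: "('v => 'v => bool) => 'v set => 'v => 'v set" where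
 "ccomp r W x = {y. (\<lambda>a b. a \<in> W \<and> b \<in> W \<and> r a b)\<^sup>*\<^sup>* x y}"

lemma comp_refl [simp]: "x \<in> ccomp r W x" by (simp add: ccomp_def)

lemma comp_sub: "x \<in> W ==> ccomp r W x \<subseteq> W"
proof
 fix y assume x: "x \<in> W" and "y \<in> ccomp r W x"
 then have "(\<lambda>a b. a \<in> W \<and> b \<in> W \<and> r a b)\<^sup>*\<^sup>* x y" by (simp add: ccomp_def)
 then show "y \<in> W" using x by (induction rule: rtranclp_induct) auto
qed

lemma comp_mono: "W \<subseteq> W' ==> ccomp r W x \<subseteq> ccomp r W' x"
 unfolding ccomp_def by (auto elim!: rtranclp_mono[THEN predicate2D, rotated])

lemma comp_eq:
 assumes sym: "\<And>x y. r x y ==> r y x" and y: "y \<in> ccomp r W x"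
 shows "ccomp r W y = ccomp r W x"
proof -
 let ?R = "\<lambda>a b. a \<in> W \<and> b \<in> W \<and> r a b"
 have "symp ?R" using sym by (auto intro!: sympI)
 then have s: "symp ?R\<^sup>*\<^sup>*" by (rule symp_rtranclp)
 have xy: "?R\<^sup>*\<^sup>* x y" using y by (simp add: ccomp_def)
 then have yx: "?R\<^sup>*\<^sup>* y x" using s by (rule sympD[rotated])
 show ?thesis unfolding ccomp_def using xy yx by (auto intro: rtranclp_trans)
qed

lemma comp_edge:
 assumes sym: "\<And>x y. r x y ==> r y x" and "x \<in> W" "y \<in> W" "r x y"
 shows "ccomp r W x = ccomp r W y"
proof -
 have "y \<in> ccomp r W x" using assms by (auto simp: ccomp_def)
 then show ?thesis using comp_eq[of r y W x] sym by auto
qed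

lemma conn_comp:
 assumes sym: "\<And>x y. r x y ==> r y x"
 shows "conn r (ccomp r W x)"
 unfolding conn_def
proof (intro conjI allI impI)
 show "ccomp r W x \<noteq> {}" using comp_refl by fast
 fix P assume P: "P \<subset> ccomp r W x" "P \<noteq> {}"
 let ?R = "\<lambda>a b. a \<in> W \<and> b \<in> W \<and> r a b"
 show "\<exists>x'\<in>P. \<exists>y\<in>ccomp r W x - P. r x' y"
 proof (rule ccontr)
  assume no: "\<not> ?thesis"
  obtain p where p: "p \<in> P" using P by auto
  have pe: "ccomp r W p = ccomp r W x" using comp_eq[of r p W x] sym p P by auto
  have "y \<in> P" if "?R\<^sup>*\<^sup>* p y" for y
   using that
  proof (induction rule: rtranclp_induct)
   case (step y z)
   then have "z \<in> ccomp r W p" by (auto simp: ccomp_def intro: rtranclp.rtrancl_into_rtrancl)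
   then show ?case using no step pe by auto
  qed (rule p)
  then have "ccomp r W p \<subseteq> P" by (auto simp: ccomp_def)
  then show False using P pe by auto
 qed
qed

definition near3 :: "('v => 'v => bool) => 'v => 'v => bool" where
 "near3 r x y \<longleftrightarrow> r x y \<or> (\<exists>u. r x u \<and> r u y) \<or> (\<exists>u w. r x u \<and> r u w \<and> r w y)"

lemma near3_sym: "(\<And>x y. r x y ==> r y x) ==> near3 r x y ==> near3 r y x"
 unfolding near3_def by blast

lemma near3_degree:
 assumes V: "finite V" "\<And>x y. r x y ==> x \<in> V \<and> y \<in> V" and deg: "\<And>x. x \<in> V ==> card {y\<in>V. r x y} \<le> d" and x: "x \<in> V"
 shows "card {y\<in>V. near3 r x y} \<le> d + d * d + d * d * d"
proof -
 let ?N = "\<lambda>x. {y\<in>V. r x y}"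
 have fN: "finite (?N x)" for x using V by auto
 have c2: "card (\<Union>u\<in>?N x. ?N u) \<le> d * d" if "x \<in> V" for x
 proof -
  have "card (\<Union>u\<in>?N x. ?N u) \<le> (\<Sum>u\<in>?N x. card (?N u))" by (rule card_UN_le[OF fN])
  also have "... \<le> (\<Sum>u\<in>?N x. d)" by (intro sum_mono deg) auto
  also have "... \<le> d * d" using deg[OF that] by simp
  finally show ?thesis .
 qed
 have c3: "card (\<Union>u\<in>?N x. \<Union>w\<in>?N u. ?N w) \<le> d * d * d"
 proof -
  have "card (\<Union>u\<in>?N x. \<Union>w\<in>?N u. ?N w) \<le> (\<Sum>u\<in>?N x. card (\<Union>w\<in>?N u. ?N w))" by (rule card_UN_le[OF fN])
  also have "... \<le> (\<Sum>u\<in>?N x. d * d)" by (intro sum_mono c2) auto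
  also have "... \<le> d * (d * d)" using deg[OF x] by simp
  finally show ?thesis by simp
 qed
 have "{y\<in>V. near3 r x y} \<subseteq> ?N x \<union> (\<Union>u\<in>?N x. ?N u) \<union> (\<Union>u\<in>?N x. \<Union>w\<in>?N u. ?N w)"
  using V(2) unfolding near3_def by blast
 then have "card {y\<in>V. near3 r x y} \<le> card (?N x \<union> (\<Union>u\<in>?N x. ?N u) \<union> (\<Union>u\<in>?N x. \<Union>w\<in>?N u. ?N w))"
  by (intro card_mono) (auto simp: V)
 also have "... \<le> card (?N x) + card (\<Union>u\<in>?N x. ?N u) + card (\<Union>u\<in>?N x. \<Union>w\<in>?N u. ?N w)"
  by (meson add_le_mono1 card_Un_le le_trans)
 finally show ?thesis using deg[OF x] c2[OF x] c3 by linarith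
qed

text \<open>The closed neighbourhoods of the two parts of \<open>Z\<close> cover \<open>K\<close>.
  If they meet, a common vertex joins the parts by a path of length at most two; otherwise an edge
  of \<open>K\<close> between them yields length at most three. This is why range three is the right
  notion.\<close>

lemma conn_dominating:
 assumes sym: "\<And>x y. r x y ==> r y x" and K: "conn r K" and Z: "Z \<subseteq> K" "\<And>x. x \<in> K ==> x \<in> Z \<or> (\<exists>z\<in>Z. r x z)"
 shows "conn (near3 r) Z"
 unfolding conn_def
proof (intro conjI allI impI)
 show "Z \<noteq> {}" using K Z unfolding conn_def by blast
 fix P assume P: "P \<subset> Z" "P \<noteq> {}"
 define D where "D = (\<lambda>P. {x\<in>K. x \<in> P \<or> (\<exists>z\<in>P. r x z)})"
 have cover: "D P \<union> D (Z - P) = K" using Z unfolding D_def by blast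
 have ne: "D P \<noteq> {}" "D (Z - P) \<noteq> {}" using P Z unfolding D_def by blast+
 show "\<exists>x\<in>P. \<exists>y\<in>Z - P. near3 r x y"
 proof (cases "D P \<inter> D (Z - P) = {}")
  case True
  then have "D P \<subset> K" using cover ne by blast
  then obtain x y where xy: "x \<in> D P" "y \<in> K - D P" "r x y" using K ne(1) unfolding conn_def by meson
  then have "y \<in> D (Z - P)" using cover by auto
  then show ?thesis using xy sym unfolding D_def near3_def by blast
 next
  case False
  then obtain x where "x \<in> D P" "x \<in> D (Z - P)" by blast
  then show ?thesis using sym unfolding D_def near3_def by blast
 qed
qed

lemma conn_near3: "(\<And>x y. r x y ==> r y x) ==> conn r K ==> conn (near3 r) K"
 using conn_dominating[of r K K] by blast

subsection \<open>Dense cores\<close>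

definition imass :: "('v => 'v => real) => 'v set => 'v => real" where
 "imass w K x = (\<Sum>y\<in>K. w x y)"

text \<open>The largest subset in which every vertex has inner mass at least \<open>\<rho>\<close>:
  a union of such sets is again one (\<open>core_mass\<close>). It is what remains after all sparse
  vertices have been peeled off.\<close>

definition core :: "('v => 'v => real) => real => 'v set => 'v set" where
 "core w \<rho> K = \<Union>{C. C \<subseteq> K \<and> (\<forall>x\<in>C. imass w C x \<ge> \<rho>)}"

lemma imass_mono: "(\<And>x y. w x y \<ge> 0) ==> finite K ==> C \<subseteq> K ==> imass w C x \<le> imass w K x"
 unfolding imass_def by (intro sum_mono2) auto

lemma core_sub: "core w \<rho> K \<subseteq> K" by (auto simp: core_def)

lemma core_mass:
 assumes w: "\<And>x y. w x y \<ge> 0" and K: "finite K" and x: "x \<in> core w \<rho> K"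
 shows "imass w (core w \<rho> K) x \<ge> \<rho>"
proof -
 obtain C where C: "C \<subseteq> K" "\<forall>x\<in>C. imass w C x \<ge> \<rho>" "x \<in> C" using x by (auto simp: core_def)
 then have "C \<subseteq> core w \<rho> K" by (auto simp: core_def)
 then have "imass w C x \<le> imass w (core w \<rho> K) x"
  using K core_sub[of w \<rho> K] w finite_subset by (intro imass_mono) auto
 then show ?thesis using C by force
qed

text \<open>While some vertex has mass below \<open>\<rho>\<close>, remove it; the core does not
  change. Each removal accounts for mass below \<open>2 * \<rho>\<close>, since the double sum sees
  every edge in both orders.\<close>

lemma light_mass:
 assumes w: "\<And>x y. w x y \<ge> 0" "\<And>x y. w x y = w y x" and K: "finite K" and rho: "\<rho> \<ge> 0"
 shows "(\<Sum>x\<in>K. \<Sum>y\<in>K. if x \<in> core w \<rho> K \<and> y \<in> core w \<rho> K then 0 else w x y) \<le> 2 * \<rho> * real (card K)"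
 using K
proof (induction "card K" arbitrary: K rule: less_induct)
 case less
 show ?case
 proof (cases "\<forall>x\<in>K. imass w K x \<ge> \<rho>")
  case True
  then have "core w \<rho> K = K" by (auto simp: core_def)
  then show ?thesis using rho by simp
 next
  case False
  then obtain x0 where x0: "x0 \<in> K" "imass w K x0 < \<rho>" by force
  define K' where "K' = K - {x0}"
  have K': "K = insert x0 K'" "x0 \<notin> K'" "finite K'" using x0 less by (auto simp: K'_def)
  have x0c: "x0 \<notin> core w \<rho> K"
  proof
   assume "x0 \<in> core w \<rho> K"
   from core_mass[OF w(1) less.prems this] have "\<rho> \<le> imass w K x0"
    using imass_mono[where w = w and x = x0, OF w(1) less.prems core_sub[of w \<rho> K]] by simp
   then show False using x0 by simp
  qed
  have ce: "core w \<rho> K = core w \<rho> K'"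
  proof
   show "core w \<rho> K' \<subseteq> core w \<rho> K" using K'_def by (auto simp: core_def)
   show "core w \<rho> K \<subseteq> core w \<rho> K'"
   proof
    fix x assume x: "x \<in> core w \<rho> K"
    then obtain C where C: "C \<subseteq> K" "\<forall>x\<in>C. imass w C x \<ge> \<rho>" "x \<in> C" by (auto simp: core_def)
    then have "C \<subseteq> core w \<rho> K" by (auto simp: core_def)
    then have "C \<subseteq> K'" using C x0c K'_def by auto
    then show "x \<in> core w \<rho> K'" using C by (auto simp: core_def)
   qed
  qed
  let ?f = "\<lambda>x y. if x \<in> core w \<rho> K \<and> y \<in> core w \<rho> K then 0 else w x y"
  have f0: "?f x y \<le> w x y" for x y using w by auto
  have IH: "(\<Sum>x\<in>K'. \<Sum>y\<in>K'. ?f x y) \<le> 2 * \<rho> * real (card K')"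
   unfolding ce by (rule less.hyps) (use K' in auto)
  have "(\<Sum>x\<in>K. \<Sum>y\<in>K. ?f x y) = (\<Sum>y\<in>K. ?f x0 y) + (\<Sum>x\<in>K'. ?f x x0) + (\<Sum>x\<in>K'. \<Sum>y\<in>K'. ?f x y)"
   using K' by (simp add: sum.distrib del: if_split)
  also have "(\<Sum>y\<in>K. ?f x0 y) \<le> imass w K x0" unfolding imass_def by (intro sum_mono f0)
  also have "(\<Sum>x\<in>K'. ?f x x0) \<le> (\<Sum>x\<in>K. w x0 x)"
   using K' w f0 by (intro order_trans[OF sum_mono[of K' "\<lambda>x. ?f x x0" "\<lambda>x. w x0 x"] sum_mono2]) auto
  also have "... = imass w K x0" by (simp add: imass_def)
  finally have "(\<Sum>x\<in>K. \<Sum>y\<in>K. ?f x y) \<le> 2 * \<rho> + 2 * \<rho> * real (card K')" using x0 IH by linarith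
  also have "... = 2 * \<rho> * real (card K)" using K' by (simp add: algebra_simps)
  finally show ?thesis .
 qed
qed

subsection \<open>Counting dense connected sets\<close>

lemma sum_Pow_power: "finite S ==> (\<Sum>A\<in>Pow S. x ^ card A) = (1 + x :: real) ^ card S"
proof (induction S rule: finite_induct)
 case (insert s S)
 have "(\<Sum>A\<in>Pow (insert s S). x ^ card A) = (\<Sum>A\<in>Pow S. x ^ card A) + (\<Sum>A\<in>insert s ` Pow S. x ^ card A)"
  unfolding Pow_insert using insert by (intro sum.union_disjoint) auto
 also have "(\<Sum>A\<in>insert s ` Pow S. x ^ card A) = (\<Sum>A\<in>Pow S. x ^ card (insert s A))"
  using insert by (intro sum.reindex_cong[of "insert s"]) (auto simp: inj_on_def)
 also have "... = (\<Sum>A\<in>Pow S. x * x ^ card A)"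
  using insert by (intro sum.cong) (auto simp: card_insert_if finite_subset)
 finally show ?case using insert by (simp add: algebra_simps flip: sum_distrib_left)
qed auto

text \<open>Each set counted has weight \<open>x ^ card A\<close> at least \<open>x ^ M\<close>, and
  over all subsets the weights sum to \<open>(1 + x) ^ card S\<close>.\<close>

lemma card_small_subsets:
 assumes S: "finite S" and x: "0 < x" "x \<le> 1"
 shows "real (card {A. A \<subseteq> S \<and> card A \<le> M}) \<le> (1 / x) ^ M * exp (x * real (card S))"
proof -
 let ?F = "{A. A \<subseteq> S \<and> card A \<le> M}"
 have "x ^ M * real (card ?F) = (\<Sum>A\<in>?F. x ^ M)" by simp
 also have "... \<le> (\<Sum>A\<in>?F. x ^ card A)" using x by (intro sum_mono power_decreasing) auto
 also have "... \<le> (\<Sum>A\<in>Pow S. x ^ card A)" using S x by (intro sum_mono2) auto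
 also have "... = (1 + x) ^ card S" by (rule sum_Pow_power[OF S])
 also have "... \<le> exp x ^ card S" using x by (intro power_mono) auto
 also have "... = exp (x * real (card S))" by (simp flip: exp_of_nat_mult add: mult.commute)
 finally show ?thesis using x by (simp add: field_simps power_divide)
qed

text \<open>The expectation over uniform independent colourings of \<open>K\<close> with
  \<open>Q\<close> colours; one colour class is a random subset of density
  \<open>1 / Q\<close>.\<close>

definition cavg :: "'v set => nat => (('v => nat) => real) => real" where
 "cavg K Q f = (\<Sum>c\<in>PiE K (\<lambda>_. {0..<Q}). f c) / real Q ^ card K"

lemma cavg_prod:
 assumes "finite K" "Q > 0"
 shows "cavg K Q (\<lambda>c. \<Prod>u\<in>K. g u (c u)) = (\<Prod>u\<in>K. (\<Sum>v\<in>{0..<Q}. g u v) / real Q)"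
 unfolding cavg_def using assms
 by (subst prod_sum_PiE[symmetric, of K "\<lambda>_. {0..<Q}" g]) (auto simp: prod_dividef prod_sum_PiE)

lemma cavg_sum: "cavg K Q (\<lambda>c. \<Sum>x\<in>A. f x c) = (\<Sum>x\<in>A. cavg K Q (f x))"
 by (simp add: cavg_def sum_divide_distrib sum.swap[of _ A])

lemma cavg_cmult: "cavg K Q (\<lambda>c. b * f c) = b * cavg K Q f"
 by (simp add: cavg_def sum_distrib_left)

lemma cavg_mono: "(\<And>c. c \<in> PiE K (\<lambda>_. {0..<Q}) ==> f c \<le> g c) ==> cavg K Q f \<le> cavg K Q g"
 unfolding cavg_def by (intro divide_right_mono sum_mono) auto

lemma cavg_add: "cavg K Q (\<lambda>c. f c + g c) = cavg K Q f + cavg K Q g"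
 by (simp add: cavg_def sum.distrib add_divide_distrib)

lemma cavg_exists:
 assumes K: "finite K" "Q > 0" and f: "cavg K Q f \<le> b"
 shows "\<exists>c\<in>PiE K (\<lambda>_. {0..<Q}). f c \<le> b"
proof (rule ccontr)
 assume no: "\<not> ?thesis"
 have ne: "PiE K (\<lambda>_. {0..<Q}) \<noteq> {}" using K by (auto simp: PiE_eq_empty_iff)
 have "(\<Sum>c\<in>PiE K (\<lambda>_. {0..<Q}). b) < (\<Sum>c\<in>PiE K (\<lambda>_. {0..<Q}). f c)"
  using no K ne by (intro sum_strict_mono) (auto intro: finite_PiE)
 then have "b < cavg K Q f" using K by (simp add: cavg_def card_PiE field_simps)
 then show False using f by simp
qed

lemma cavg_one:
 assumes K: "finite K" "Q > 0" "y \<in> K"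
 shows "cavg K Q (\<lambda>c. h (c y)) = (\<Sum>v\<in>{0..<Q}. h v) / real Q"
proof -
 have "cavg K Q (\<lambda>c. h (c y)) = cavg K Q (\<lambda>c. \<Prod>u\<in>K. (if u = y then h (c u) else 1))"
  using K by (simp add: prod.delta)
 also have "... = (\<Prod>u\<in>K. (\<Sum>v\<in>{0..<Q}. if u = y then h v else 1) / real Q)"
  by (rule cavg_prod[OF K(1,2)])
 also have "... = (\<Prod>u\<in>K. if u = y then (\<Sum>v\<in>{0..<Q}. h v) / real Q else 1)"
  using K by (intro prod.cong) auto
 finally show ?thesis using K by (simp add: prod.delta)
qed

lemma cavg_two:
 assumes K: "finite K" "Q > 0" "y \<in> K" "z \<in> K" "y \<noteq> z" and h: "(\<Sum>v\<in>{0..<Q}. h v) = 0"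
 shows "cavg K Q (\<lambda>c. h (c y) * h (c z)) = 0"
proof -
 have "cavg K Q (\<lambda>c. h (c y) * h (c z)) = cavg K Q (\<lambda>c. \<Prod>u\<in>K. (if u = y then h (c u) else 1) * (if u = z then h (c u) else 1))"
  using K by (simp add: prod.delta prod.distrib)
 also have "... = (\<Prod>u\<in>K. (\<Sum>v\<in>{0..<Q}. (if u = y then h v else 1) * (if u = z then h v else 1)) / real Q)"
  by (rule cavg_prod[OF K(1,2)])
 also have "... = 0" using K h by (intro prod_zero) (auto intro!: bexI[of _ y])
 finally show ?thesis .
qed

text \<open>The second moment method for a random colour class \<open>T\<close>. The variance of the
  mass seen by \<open>x\<close> is at most \<open>al * q\<close> times its full mass, so Chebyshev's
  inequality and \<open>small\<close> bound by \<open>q\<close> the probability of seeing less than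
  half of the expected mass. \<open>F\<close> collects the failures; the expected sizes of
  \<open>T\<close> and \<open>F\<close> add up to at most \<open>2 * q * card K\<close>, so one
  colouring suits both.\<close>

lemma sampling:
 assumes K: "finite K" and Q: "Q > (0::nat)" and w: "\<And>x y. w x y \<ge> 0" "\<And>x y. w x y \<le> al" and al: "al \<ge> 0"
  and rho: "\<rho> > 0" "\<And>x. x \<in> K ==> imass w K x \<ge> \<rho>" and small: "4 * al * real Q ^ 2 \<le> \<rho>"
 shows "\<exists>T F. T \<subseteq> K \<and> F \<subseteq> K \<and> real (card T) \<le> 2 * real (card K) / real Q \<and> real (card F) \<le> 2 * real (card K) / real Q \<and>
   (\<forall>x\<in>K - F. imass w T x \<ge> \<rho> / (2 * real Q))"
proof -
 define q where "q = 1 / real Q"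
 have q: "q > 0" "q * real Q = 1" "q \<le> 1" using Q by (auto simp: q_def)
 define X where "X = (\<lambda>v::nat. (if v = 0 then 1 else 0 :: real))"
 define h where "h = (\<lambda>v. X v - q)"
 have sX: "(\<Sum>v\<in>{0..<Q}. X v) = 1" using Q by (simp add: X_def)
 have h0: "(\<Sum>v\<in>{0..<Q}. h v) = 0" using sX q Q by (simp add: h_def sum_subtractf mult.commute)
 have h2: "(\<Sum>v\<in>{0..<Q}. (h v)\<^sup>2) \<le> 1"
 proof -
  have "(h v)\<^sup>2 = X v - 2 * q * X v + q\<^sup>2" for v by (simp add: h_def X_def power2_eq_square algebra_simps)
  then have "(\<Sum>v\<in>{0..<Q}. (h v)\<^sup>2) = 1 - 2 * q + real Q * q\<^sup>2"
   using sX by (simp add: sum.distrib sum_subtractf flip: sum_distrib_left)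
  also have "real Q * q\<^sup>2 = q" using q by (simp add: power2_eq_square mult.commute mult.left_commute)
  finally show ?thesis using q by simp
 qed
 define T where "T = (\<lambda>c::'a => nat. {y\<in>K. c y = 0})"
 define F where "F = (\<lambda>c. {x\<in>K. imass w (T c) x < imass w K x * q / 2})"
 have eT: "cavg K Q (\<lambda>c. real (card (T c))) = q * real (card K)"
 proof -
  have "cavg K Q (\<lambda>c. real (card (T c))) = cavg K Q (\<lambda>c. \<Sum>y\<in>K. X (c y))"
   using K by (simp add: T_def X_def sum.If_cases Int_def)
  also have "... = (\<Sum>y\<in>K. 1 / real Q)" unfolding cavg_sum using sX K Q by (intro sum.cong refl) (simp add: cavg_one)
  finally show ?thesis by (simp add: q_def)
 qed
 have var: "cavg K Q (\<lambda>c. (\<Sum>y\<in>K. w x y * h (c y))\<^sup>2) \<le> al * q * imass w K x" for x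
 proof -
  have "cavg K Q (\<lambda>c. (\<Sum>y\<in>K. w x y * h (c y))\<^sup>2) = cavg K Q (\<lambda>c. \<Sum>y\<in>K. \<Sum>z\<in>K. (w x y * w x z) * (h (c y) * h (c z)))"
   by (simp add: power2_eq_square sum_product mult_ac)
  also have "... = (\<Sum>y\<in>K. \<Sum>z\<in>K. (w x y * w x z) * cavg K Q (\<lambda>c. h (c y) * h (c z)))"
   by (simp add: cavg_sum cavg_cmult)
  also have "... = (\<Sum>y\<in>K. \<Sum>z\<in>K. if z = y then (w x y)\<^sup>2 * cavg K Q (\<lambda>c. (h (c y))\<^sup>2) else 0)"
   using cavg_two[OF K Q _ _ _ h0] by (intro sum.cong refl) (auto simp: power2_eq_square)
  also have "... = (\<Sum>y\<in>K. (w x y)\<^sup>2 * cavg K Q (\<lambda>c. (h (c y))\<^sup>2))"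
   using K by (simp add: sum.delta)
  also have "... \<le> (\<Sum>y\<in>K. al * w x y * q)"
  proof (intro sum_mono mult_mono)
   fix y assume y: "y \<in> K"
   show "(w x y)\<^sup>2 \<le> al * w x y" using w by (simp add: power2_eq_square mult_right_mono)
   have "cavg K Q (\<lambda>c. (h (c y))\<^sup>2) = (\<Sum>v\<in>{0..<Q}. (h v)\<^sup>2) / real Q" by (rule cavg_one[OF K Q y])
   then show "cavg K Q (\<lambda>c. (h (c y))\<^sup>2) \<le> q" using h2 Q by (simp add: q_def divide_right_mono)
   show "0 \<le> cavg K Q (\<lambda>c. (h (c y))\<^sup>2)" by (auto simp: cavg_def intro!: divide_nonneg_nonneg sum_nonneg)
  qed (use w al in auto)
  also have "... = al * q * imass w K x" by (simp add: imass_def sum_distrib_left mult_ac)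
  finally show ?thesis .
 qed
 have eF: "cavg K Q (\<lambda>c. real (card (F c))) \<le> q * real (card K)"
 proof -
  have "cavg K Q (\<lambda>c. real (card (F c))) = cavg K Q (\<lambda>c. \<Sum>x\<in>K. of_bool (imass w (T c) x < imass w K x * q / 2))"
   using K by (simp add: F_def of_bool_def sum.If_cases Int_def)
  also have "... = (\<Sum>x\<in>K. cavg K Q (\<lambda>c. of_bool (imass w (T c) x < imass w K x * q / 2)))" by (rule cavg_sum)
  also have "... \<le> (\<Sum>x\<in>K. q)"
  proof (rule sum_mono)
   fix x assume x: "x \<in> K"
   define m where "m = imass w K x"
   have m: "m \<ge> \<rho>" "m > 0" using rho x unfolding m_def by force+
   have "cavg K Q (\<lambda>c. of_bool (imass w (T c) x < m * q / 2)) \<le> cavg K Q (\<lambda>c. (4 / (m * q)\<^sup>2) * (\<Sum>y\<in>K. w x y * h (c y))\<^sup>2)"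
   proof (rule cavg_mono)
    fix c
    have "imass w (T c) x = (\<Sum>y\<in>K. w x y * X (c y))"
     using K by (simp add: imass_def T_def X_def sum.inter_filter if_distrib cong: if_cong)
    then have e: "(\<Sum>y\<in>K. w x y * h (c y)) = imass w (T c) x - m * q"
     by (simp add: h_def m_def imass_def algebra_simps sum_subtractf sum_distrib_left)
    show "of_bool (imass w (T c) x < m * q / 2) \<le> (4 / (m * q)\<^sup>2) * (\<Sum>y\<in>K. w x y * h (c y))\<^sup>2"
    proof (cases "imass w (T c) x < m * q / 2")
     case True
     have mq: "m * q > 0" using m q by simp
     have "m * q / 2 \<le> \<bar>imass w (T c) x - m * q\<bar>" using True mq by linarith
     then have "(m * q / 2)\<^sup>2 \<le> (imass w (T c) x - m * q)\<^sup>2" using mq by (simp add: abs_le_square_iff[symmetric])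
     then have "(m * q)\<^sup>2 \<le> 4 * (imass w (T c) x - m * q)\<^sup>2" by (simp add: power_divide)
     moreover have "(m * q)\<^sup>2 > 0" using mq by (rule zero_less_power)
     ultimately have "1 \<le> 4 * (imass w (T c) x - m * q)\<^sup>2 / (m * q)\<^sup>2" by (simp only: pos_le_divide_eq mult_1)
     then show ?thesis unfolding e by simp
    qed auto
   qed
   also have "... \<le> (4 / (m * q)\<^sup>2) * (al * q * m)"
    unfolding cavg_cmult m_def by (intro mult_left_mono var) auto
   also have "... = 4 * al / (m * q)" using m q by (simp add: power2_eq_square field_simps)
   also have "... \<le> q"
   proof -
    have "4 * al = q * (4 * al * real Q ^ 2) * q" using q by (simp add: power2_eq_square mult_ac) (metis mult.assoc mult.commute mult.left_neutral)
    also have "... \<le> q * m * q" using small m q by (intro mult_right_mono mult_left_mono) auto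
    finally show ?thesis using m q by (simp add: pos_divide_le_eq mult_ac)
   qed
   finally show "cavg K Q (\<lambda>c. of_bool (imass w (T c) x < imass w K x * q / 2)) \<le> q" unfolding m_def .
  qed
  finally show ?thesis by (simp add: mult.commute)
 qed
 have "cavg K Q (\<lambda>c. real (card (T c)) + real (card (F c))) \<le> 2 * q * real (card K)"
  unfolding cavg_add using eT eF by simp
 from cavg_exists[OF K Q this] obtain c where c: "real (card (T c)) + real (card (F c)) \<le> 2 * q * real (card K)" by blast
 have "imass w (T c) x \<ge> \<rho> / (2 * real Q)" if "x \<in> K - F c" for x
 proof -
  have "imass w K x * q / 2 \<le> imass w (T c) x" using that by (auto simp: F_def)
  moreover have "\<rho> * q / 2 \<le> imass w K x * q / 2" using rho(2)[of x] that q by (intro divide_right_mono mult_right_mono) auto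
  ultimately show ?thesis by (simp add: q_def)
 qed
 then show ?thesis using c by (intro exI[of _ "T c"] exI[of _ "F c"]) (auto simp: T_def F_def q_def)
qed

definition dense :: "('v => 'v => real) => real => 'v set => bool" where
 "dense w \<rho> K \<longleftrightarrow> conn (\<lambda>x y. w x y \<noteq> 0) K \<and> (\<forall>x\<in>K. imass w K x \<ge> \<rho>)"

text \<open>A random subset of \<open>K\<close> together with the vertices at which it fails to represent the mass
 dominates \<open>K\<close>, so it is connected at range three and cheap to choose; it confines \<open>K\<close> to a set that is
 larger than \<open>K\<close> by the factor \<open>4 / \<rho>\<close> only.\<close>

lemma card_dense:
 fixes w :: "'v => 'v => real"
 assumes V: "finite V" and w: "\<And>x y. w x y \<ge> 0" "\<And>x y. w x y = w y x" "\<And>x y. w x y \<le> al" and al: "al \<ge> 0"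
  and mass: "\<And>x. x \<in> V ==> imass w V x \<le> 1" and Q: "Q > (0::nat)" and rho: "0 < \<rho>" "\<rho> \<le> 1" and small: "4 * al * real Q ^ 2 \<le> \<rho>"
  and deg: "\<And>x. x \<in> V ==> card {y\<in>V. near3 (\<lambda>x y. w x y \<noteq> 0) x y} \<le> d"
 shows "real (card {K. K \<subseteq> V \<and> dense w \<rho> K \<and> card K = M}) \<le>
   real (card V) * real (4 * M + 1) * (2 * (real d + 1)\<^sup>2) powr (4 * real M / real Q) * (4 / \<rho>) ^ M * exp (real M)"
proof -
 let ?r = "\<lambda>x y. w x y \<noteq> 0"
 have rs: "?r y x" if "?r x y" for x y using that w(2) by metis
 have sym3: "near3 ?r y x" if "near3 ?r x y" for x y
  by (rule near3_sym[of ?r, OF _ that]) (rule rs)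
 define m0 where "m0 = nat \<lfloor>4 * real M / real Q\<rfloor>"
 define ZZ where "ZZ = (\<Union>m\<in>{0..m0}. {Z. Z \<subseteq> V \<and> conn (near3 ?r) Z \<and> card Z = m})"
 \<comment> \<open>The vertices that \<open>T\<close> sees with sufficient mass. The masses seen sum
   to at most \<open>card T\<close>, so there are at most \<open>4 * M / \<rho>\<close> such
   vertices; this is the confining set.\<close>
 define Sup where "Sup = (\<lambda>T. {x\<in>V. imass w T x \<ge> \<rho> / (2 * real Q)})"
 define TT where "TT = {(Z, T). Z \<in> ZZ \<and> T \<subseteq> Z \<and> real (card T) \<le> 2 * real M / real Q}"
 define BB where "BB = (\<lambda>T. {B. B \<subseteq> Sup T \<and> card B \<le> M})"
 define D where "D = {K. K \<subseteq> V \<and> dense w \<rho> K \<and> card K = M}"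
 have finZZ: "finite ZZ" "\<And>Z. Z \<in> ZZ ==> Z \<subseteq> V" using V by (auto simp: ZZ_def)
 have finZ: "finite Z" if "Z \<in> ZZ" for Z using finite_subset[OF finZZ(2)[OF that] V] .
 have TTsub: "TT \<subseteq> Sigma ZZ Pow" by (auto simp: TT_def)
 have finTT: "finite TT"
  by (rule finite_subset[OF TTsub]) (use finZZ(1) finZ in \<open>auto intro!: finite_SigmaI\<close>)
 have finSup: "finite (Sup T)" for T using V by (auto simp: Sup_def)
 have finBB: "finite (BB T)" for T using finSup[of T] by (auto simp: BB_def)
 have sub: "D \<subseteq> (\<lambda>((Z,T),B). Z \<union> B) ` (Sigma TT (\<lambda>(Z,T). BB T))"
 proof
  fix K assume "K \<in> D"
  then have K: "K \<subseteq> V" "dense w \<rho> K" "card K = M" by (auto simp: D_def)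
  have fK: "finite K" using K V finite_subset by auto
  have Kd: "conn ?r K" "\<And>x. x \<in> K ==> imass w K x \<ge> \<rho>" using K by (auto simp: dense_def)
  obtain T F where TF: "T \<subseteq> K" "F \<subseteq> K" "real (card T) \<le> 2 * real M / real Q" "real (card F) \<le> 2 * real M / real Q"
   "\<And>x. x \<in> K - F ==> imass w T x \<ge> \<rho> / (2 * real Q)"
   using sampling[OF fK Q w(1,3) al rho(1) Kd(2) small] K(3) by auto
  define Z where "Z = T \<union> F"
  have Zc: "conn (near3 ?r) Z"
  proof (rule conn_dominating[OF rs Kd(1)])
   fix x assume x: "x \<in> K"
   show "x \<in> Z \<or> (\<exists>z\<in>Z. ?r x z)"
   proof (cases "x \<in> F")
    case False
    then have "imass w T x > 0" using TF(5)[of x] x rho Q by (smt (verit) DiffI divide_pos_pos of_nat_0_less_iff)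
    then show ?thesis unfolding imass_def Z_def by (metis UnI1 less_irrefl sum.neutral)
   qed (simp add: Z_def)
  qed (use TF in \<open>auto simp: Z_def\<close>)
  have "real (card Z) \<le> real (card T) + real (card F)" unfolding Z_def using card_Un_le[of T F] by linarith
  also have "... \<le> 2 * real M / real Q + 2 * real M / real Q" using TF by (intro add_mono)
  also have "... = 4 * real M / real Q" by simp
  finally have cZ: "card Z \<le> m0" by (simp add: m0_def le_nat_floor)
  have "Z \<in> ZZ" using Zc cZ TF K(1) by (auto simp: ZZ_def Z_def)
  then have "(Z, T) \<in> TT" using TF by (auto simp: TT_def Z_def)
  moreover have "K \<inter> Sup T \<in> BB T" using fK K(3) by (auto simp: BB_def intro: card_mono)
  ultimately have p: "((Z, T), K \<inter> Sup T) \<in> Sigma TT (\<lambda>(Z,T). BB T)" by auto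
  have e: "K = Z \<union> (K \<inter> Sup T)" using TF K(1) by (auto simp: Z_def Sup_def)
  show "K \<in> (\<lambda>((Z,T),B). Z \<union> B) ` (Sigma TT (\<lambda>(Z,T). BB T))"
   by (rule image_eqI[OF _ p]) (unfold prod.case, rule e)
 qed
 have cB: "real (card (BB T)) \<le> (4 / \<rho>) ^ M * exp (real M)" if "(Z, T) \<in> TT" for Z T
 proof -
  have T: "T \<subseteq> V" "real (card T) \<le> 2 * real M / real Q" using that finZZ(2) by (auto simp: TT_def)
  have "real (card (Sup T)) * (\<rho> / (2 * real Q)) = (\<Sum>x\<in>Sup T. \<rho> / (2 * real Q))" by simp
  also have "... \<le> (\<Sum>x\<in>Sup T. imass w T x)" by (intro sum_mono) (auto simp: Sup_def)
  also have "... \<le> (\<Sum>x\<in>V. imass w T x)" using V w by (intro sum_mono2) (auto simp: Sup_def imass_def intro: sum_nonneg)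
  also have "... = (\<Sum>y\<in>T. imass w V y)" unfolding imass_def by (subst sum.swap) (use w(2) in auto)
  also have "... \<le> (\<Sum>y\<in>T. 1)" using T mass by (intro sum_mono) auto
  also have "... \<le> 2 * real M / real Q" using T by simp
  finally have "real (card (Sup T)) * (\<rho> / 4) \<le> real M" using Q rho by (simp add: field_simps)
  then have e: "exp (\<rho> / 4 * real (card (Sup T))) \<le> exp (real M)" by (simp add: mult.commute)
  \<comment> \<open>The parameter \<open>\<rho> / 4\<close> is the reciprocal of the ratio between
    the sizes of \<open>Sup T\<close> and \<open>M\<close>, so that the exponential factor is at
    most \<open>exp (real M)\<close>.\<close>
  have "real (card (BB T)) \<le> (1 / (\<rho> / 4)) ^ M * exp (\<rho> / 4 * real (card (Sup T)))"
   unfolding BB_def using rho by (intro card_small_subsets finSup) auto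
  also have "... \<le> (1 / (\<rho> / 4)) ^ M * exp (real M)" using e rho by (intro mult_left_mono) auto
  finally show ?thesis by simp
 qed
 have cZ: "real (card ZZ) * 2 ^ m0 \<le> real (card V) * real (4 * M + 1) * (2 * (real d + 1)\<^sup>2) powr (4 * real M / real Q)"
 proof -
  have "m0 \<le> 4 * M"
  proof -
   have "4 * real M / real Q \<le> 4 * real M" using Q by (simp add: divide_le_eq mult_le_cancel_left1)
   then show ?thesis unfolding m0_def by linarith
  qed
  have "card ZZ \<le> (\<Sum>m\<in>{0..m0}. card {Z. Z \<subseteq> V \<and> conn (near3 ?r) Z \<and> card Z = m})"
   unfolding ZZ_def by (intro card_UN_le) auto
  also have "... \<le> (\<Sum>m\<in>{0..m0}. card V * (d + 1) ^ (2 * m))"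
   by (rule sum_mono) (rule card_conn[OF V deg sym3])
  also have "... \<le> (\<Sum>m\<in>{0..m0}. card V * (d + 1) ^ (2 * m0))"
   by (intro sum_mono mult_left_mono power_increasing) auto
  also have "... \<le> (4 * M + 1) * (card V * (d + 1) ^ (2 * m0))" using \<open>m0 \<le> 4 * M\<close> by simp
  finally have "real (card ZZ) \<le> real ((4 * M + 1) * (card V * (d + 1) ^ (2 * m0)))" by (simp only: of_nat_le_iff)
  then have "real (card ZZ) * 2 ^ m0 \<le> real ((4 * M + 1) * (card V * (d + 1) ^ (2 * m0))) * 2 ^ m0" by (intro mult_right_mono) auto
  also have "... = real (card V) * real (4 * M + 1) * (2 * (real d + 1)\<^sup>2) ^ m0"
  proof -
   have e: "real ((d + 1) ^ (2 * m0)) = ((real d + 1)\<^sup>2) ^ m0" by (simp add: power_mult add.commute)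
   show ?thesis unfolding of_nat_mult[of "4 * M + 1"] of_nat_mult[of "card V"] e power_mult_distrib[of 2] by (simp only: mult_ac)
  qed
  also have "(2 * (real d + 1)\<^sup>2) ^ m0 = (2 * (real d + 1)\<^sup>2) powr real m0"
   by (rule powr_realpow[symmetric]) (simp add: add_pos_nonneg zero_less_power)
  also have "... \<le> (2 * (real d + 1)\<^sup>2) powr (4 * real M / real Q)"
  proof (rule powr_mono)
   show "1 \<le> 2 * (real d + 1)\<^sup>2" by (simp add: power2_eq_square algebra_simps)
  qed (simp add: m0_def)
  finally show ?thesis by (simp add: mult_left_mono)
 qed
 have "card TT \<le> card (Sigma ZZ Pow)"
  by (rule card_mono[OF _ TTsub]) (use finZZ(1) finZ in \<open>auto intro!: finite_SigmaI\<close>)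
 also have "... = (\<Sum>Z\<in>ZZ. card (Pow Z))" using finZZ(1) finZ by (subst card_SigmaI) auto
 also have "... \<le> (\<Sum>Z\<in>ZZ. 2 ^ m0)"
 proof (intro sum_mono)
  fix Z assume "Z \<in> ZZ"
  then have "card Z \<le> m0" "finite Z" by (auto simp: ZZ_def intro: finite_subset[OF _ V])
  then show "card (Pow Z) \<le> 2 ^ m0" by (simp only: card_Pow) (rule power_increasing, auto)
 qed
 finally have "card TT \<le> card ZZ * 2 ^ m0" by simp
 then have "real (card TT) \<le> real (card ZZ * 2 ^ m0)" by (simp only: of_nat_le_iff)
 then have cT: "real (card TT) \<le> real (card ZZ) * 2 ^ m0" by simp
 have "card D \<le> card (Sigma TT (\<lambda>(Z,T). BB T))"
  by (rule surj_card_le[OF _ sub]) (use finTT finBB in \<open>auto intro!: finite_SigmaI\<close>)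
 also have "... = (\<Sum>(Z,T)\<in>TT. card (BB T))" using finTT finBB by (subst card_SigmaI) (auto simp: case_prod_beta)
 finally have "real (card D) \<le> (\<Sum>(Z,T)\<in>TT. real (card (BB T)))" by (simp add: case_prod_beta flip: of_nat_sum)
 also have "... \<le> (\<Sum>x\<in>TT. (4 / \<rho>) ^ M * exp (real M))" by (intro sum_mono) (use cB in auto)
 also have "... = real (card TT) * ((4 / \<rho>) ^ M * exp (real M))" by simp
 also have "... \<le> real (card V) * real (4 * M + 1) * (2 * (real d + 1)\<^sup>2) powr (4 * real M / real Q) * ((4 / \<rho>) ^ M * exp (real M))"
  using cT cZ rho by (intro mult_right_mono) auto
 finally show ?thesis unfolding D_def by (simp add: mult.assoc)
qed

subsection \<open>Superharmonic majorants\<close>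

text \<open>The witness is the resolvent of the weight operator at 1/2, the sum of its r-th iterates
  on \<open>p\<close> with factors \<open>(1/2) ^ r\<close>. Applying the operator shifts the series
  and costs a factor 2; the operator does not increase the total, so the geometric factors at most
  double it.\<close>

lemma superharmonic:
 assumes V: "finite V" and w: "\<And>x y. w x y \<ge> 0" "\<And>x y. w x y = w y x" and mass: "\<And>x. x \<in> V ==> imass w V x \<le> 1"
  and p: "\<And>x. x \<in> V ==> p x \<ge> 0"
 shows "\<exists>P. (\<forall>x\<in>V. p x \<le> P x) \<and> (\<forall>x\<in>V. (\<Sum>y\<in>V. w x y * P y) \<le> 2 * P x) \<and> (\<Sum>x\<in>V. P x) \<le> 2 * (\<Sum>x\<in>V. p x)"
proof -
 define T where "T = (\<lambda>f x. \<Sum>y\<in>V. w x y * f y :: real)"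
 define g where "g = (\<lambda>r. (T ^^ r) p)"
 define S where "S = (\<Sum>x\<in>V. p x)"
 have gS: "g (Suc r) = T (g r)" for r by (simp add: g_def)
 have g0: "\<forall>x\<in>V. g r x \<ge> 0" for r
  by (induction r) (use w p in \<open>auto simp: gS T_def, auto simp: g_def intro!: sum_nonneg\<close>)
 have gs: "(\<Sum>x\<in>V. g r x) \<le> S" for r
 proof (induction r)
  case (Suc r)
  have "(\<Sum>x\<in>V. g (Suc r) x) = (\<Sum>y\<in>V. imass w V y * g r y)"
   unfolding gS T_def imass_def sum_distrib_right by (subst sum.swap) (use w(2) in auto)
  also have "... \<le> (\<Sum>y\<in>V. 1 * g r y)" using mass g0 by (intro sum_mono mult_right_mono) auto
  finally show ?case using Suc by simp
 qed (simp add: g_def S_def)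
 have gle: "g r x \<le> S" if "x \<in> V" for r x
  using member_le_sum[of x V "g r"] that g0 V gs[of r] by force
 have sm: "summable (\<lambda>r. (1/2) ^ r * g r x)" if "x \<in> V" for x
  by (rule summable_comparison_test'[of "\<lambda>r. (1/2) ^ r * S" 0])
   (use that g0 gle in \<open>auto intro!: summable_mult2 mult_left_mono\<close>)
 define P where "P = (\<lambda>x. \<Sum>r. (1/2) ^ r * g r x)"
 have shift: "P x = g 0 x + (\<Sum>r. (1/2) ^ Suc r * g (Suc r) x)" if "x \<in> V" for x
  unfolding P_def using suminf_split_head[OF sm[OF that]] by simp
 have sm': "summable (\<lambda>r. (1/2) ^ Suc r * g (Suc r) x)" if "x \<in> V" for x
  using sm[OF that] by (subst summable_Suc_iff)
 show ?thesis
 proof (intro exI[of _ P] conjI ballI)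
  fix x assume x: "x \<in> V"
  have "(\<Sum>r. (1/2) ^ Suc r * g (Suc r) x) \<ge> 0"
   using g0 x by (intro suminf_nonneg sm') auto
  then show "p x \<le> P x" unfolding shift[OF x] by (simp add: g_def)
  have "(\<Sum>y\<in>V. w x y * P y) = (\<Sum>y\<in>V. \<Sum>r. w x y * ((1/2) ^ r * g r y))"
   unfolding P_def by (intro sum.cong refl suminf_mult[symmetric] sm)
  also have "... = (\<Sum>r. \<Sum>y\<in>V. w x y * ((1/2) ^ r * g r y))"
   by (intro suminf_sum[symmetric] summable_mult sm)
  also have "... = (\<Sum>r. 2 * ((1/2) ^ Suc r * g (Suc r) x))"
  proof (intro arg_cong[of _ _ suminf] ext)
   fix r
   have "2 * ((1/2) ^ Suc r * g (Suc r) x) = (1/2) ^ r * (\<Sum>y\<in>V. w x y * g r y)" by (simp add: gS T_def)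
   then show "(\<Sum>y\<in>V. w x y * ((1/2) ^ r * g r y)) = 2 * ((1/2) ^ Suc r * g (Suc r) x)"
    by (simp only: sum_distrib_left mult_ac)
  qed
  also have "... = 2 * (\<Sum>r. (1/2) ^ Suc r * g (Suc r) x)" by (intro suminf_mult sm' x)
  also have "... \<le> 2 * P x" unfolding shift[OF x] using g0[of 0] x by auto
  finally show "(\<Sum>y\<in>V. w x y * P y) \<le> 2 * P x" .
 next
  have "(\<Sum>x\<in>V. P x) = (\<Sum>r. \<Sum>x\<in>V. (1/2) ^ r * g r x)"
   unfolding P_def by (intro suminf_sum[symmetric] sm)
  also have "... \<le> (\<Sum>r. (1/2) ^ r * S)"
  proof (intro suminf_le summable_sum sm)
   show "(\<Sum>x\<in>V. (1/2) ^ r * g r x) \<le> (1/2) ^ r * S" for r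
    unfolding sum_distrib_left[symmetric] by (intro mult_left_mono gs) auto
  qed (auto intro!: summable_mult2)
  also have "... = 2 * S" by (subst suminf_mult2[symmetric]) (auto simp: suminf_geometric)
  finally show "(\<Sum>x\<in>V. P x) \<le> 2 * (\<Sum>x\<in>V. p x)" by (simp add: S_def)
 qed
qed

lemma ex_level:
 assumes "0 < P" "P \<le> (1::real)"
 shows "\<exists>k::nat. P \<le> (1/4) ^ k \<and> (1/4) ^ k < 4 * P"
proof -
 define k where "k = (LEAST k. (1/4::real) ^ Suc k < P)"
 obtain k0 where k0: "(1/4::real) ^ k0 < P" using real_arch_pow_inv[of P "1/4"] assms by auto
 have "(1/4::real) ^ Suc k0 \<le> (1/4) ^ k0" by (intro power_decreasing) auto
 then have ex: "(1/4::real) ^ Suc k0 < P" using k0 by linarith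
 have k: "(1/4::real) ^ Suc k < P" unfolding k_def by (rule LeastI[of "\<lambda>k. (1/4::real) ^ Suc k < P", OF ex])
 have "P \<le> (1/4) ^ k"
 proof (cases k)
  case (Suc l)
  then have "\<not> (1/4::real) ^ Suc l < P" unfolding k_def using not_less_Least[of l "\<lambda>k. (1/4::real) ^ Suc k < P"] by simp
  then show ?thesis using Suc by simp
 qed (use assms in auto)
 then show ?thesis using k by auto
qed

subsection \<open>Block decompositions of bilinear forms\<close>

lemma sum_labelled:
 fixes x :: "'a => 'b => real"
 assumes fin: "finite I" "finite J" and lab: "\<And>i j. i \<in> I ==> j \<in> J ==> x i j \<noteq> 0 ==> f i = g j"
 shows "(\<Sum>i\<in>I. \<Sum>j\<in>J. x i j) = (\<Sum>c\<in>f ` I. \<Sum>i\<in>{i\<in>I. f i = c}. \<Sum>j\<in>{j\<in>J. g j = c}. x i j)"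
proof -
 have "(\<Sum>c\<in>f ` I. \<Sum>i\<in>{i\<in>I. f i = c}. \<Sum>j\<in>{j\<in>J. g j = c}. x i j) =
   (\<Sum>c\<in>f ` I. \<Sum>i\<in>{i\<in>I. f i = c}. \<Sum>j\<in>J. x i j)"
  using fin lab by (intro sum.cong sum.mono_neutral_left refl) auto
 also have "... = (\<Sum>i\<in>I. \<Sum>j\<in>J. x i j)" by (rule sum.image_gen[symmetric, OF fin(1)])
 finally show ?thesis by simp
qed

lemma sum_by_label:
 fixes q :: "'b => real"
 assumes "finite J" "finite L"
 shows "(\<Sum>c\<in>L. \<Sum>j\<in>{j\<in>J. g j = c}. q j) = (\<Sum>j\<in>{j\<in>J. g j \<in> L}. q j)"
proof -
 have "(\<Sum>j\<in>{j\<in>J. g j \<in> L}. q j) = (\<Sum>c\<in>L. \<Sum>j\<in>{j\<in>{j\<in>J. g j \<in> L}. g j = c}. q j)"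
  using assms by (intro sum.group[symmetric]) auto
 also have "... = (\<Sum>c\<in>L. \<Sum>j\<in>{j\<in>J. g j = c}. q j)" by (intro sum.cong) auto
 finally show ?thesis by simp
qed

text \<open>The geometric mean of two block masses is at most half of their sum, and masses of
  disjoint blocks add up, so there is no loss in the number of blocks. The columns keep their
  restriction to labels in \<open>L\<close>, on which \<open>T_level\<close> relies.\<close>

lemma block_bound:
 fixes x :: "'a => 'b => real"
 assumes fin: "finite I" "finite J" and L: "L \<subseteq> f ` I" and Z: "Z \<ge> 0"
  and pq: "\<And>i. i \<in> I ==> p i \<ge> 0" "\<And>j. j \<in> J ==> q j \<ge> 0"
  and blk: "\<And>c. c \<in> L ==> \<bar>\<Sum>i\<in>{i\<in>I. f i = c}. \<Sum>j\<in>{j\<in>J. g j = c}. x i j\<bar> \<le>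
    Z * sqrt (\<Sum>i\<in>{i\<in>I. f i = c}. p i) * sqrt (\<Sum>j\<in>{j\<in>J. g j = c}. q j)"
 shows "\<bar>\<Sum>c\<in>L. \<Sum>i\<in>{i\<in>I. f i = c}. \<Sum>j\<in>{j\<in>J. g j = c}. x i j\<bar> \<le> Z / 2 * ((\<Sum>i\<in>I. p i) + (\<Sum>j\<in>{j\<in>J. g j \<in> L}. q j))"
proof -
 have finL: "finite L" using L fin finite_subset by blast
 let ?p = "\<lambda>c. \<Sum>i\<in>{i\<in>I. f i = c}. p i" and ?q = "\<lambda>c. \<Sum>j\<in>{j\<in>J. g j = c}. q j"
 have "\<bar>\<Sum>c\<in>L. \<Sum>i\<in>{i\<in>I. f i = c}. \<Sum>j\<in>{j\<in>J. g j = c}. x i j\<bar> \<le> (\<Sum>c\<in>L. Z * sqrt (?p c) * sqrt (?q c))"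
  by (intro order_trans[OF sum_abs] sum_mono blk)
 also have "... \<le> (\<Sum>c\<in>L. Z / 2 * (?p c + ?q c))"
 proof (intro sum_mono)
  fix c
  have nn: "?p c \<ge> 0" "?q c \<ge> 0" using pq by (auto intro: sum_nonneg)
  then have "sqrt (?p c) * sqrt (?q c) \<le> (?p c + ?q c) / 2" using arith_geo_mean_sqrt[OF nn] by (simp add: real_sqrt_mult)
  then show "Z * sqrt (?p c) * sqrt (?q c) \<le> Z / 2 * (?p c + ?q c)" using mult_left_mono[OF _ Z] by fastforce
 qed
 also have "... = Z / 2 * ((\<Sum>c\<in>L. ?p c) + (\<Sum>c\<in>L. ?q c))" by (simp only: sum.distrib sum_distrib_left distrib_left)
 also have "... \<le> Z / 2 * ((\<Sum>i\<in>I. p i) + (\<Sum>j\<in>{j\<in>J. g j \<in> L}. q j))"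
 proof (intro mult_left_mono add_mono)
  show "(\<Sum>c\<in>L. ?p c) \<le> (\<Sum>i\<in>I. p i)"
   unfolding sum_by_label[OF fin(1) finL] using fin pq by (intro sum_mono2) auto
  show "(\<Sum>c\<in>L. ?q c) \<le> (\<Sum>j\<in>{j\<in>J. g j \<in> L}. q j)" unfolding sum_by_label[OF fin(2) finL] ..
 qed (use Z in auto)
 finally show ?thesis .
qed

lemma bform_neg: "bform a I J e s (\<lambda>j. - t j) = - bform a I J e s t"
 by (simp add: bform_def sum_negf)

lemma opb_abs:
 assumes o: "opb Z a I J e" and fin: "finite I" "finite J" and sub: "I0 \<subseteq> I" "J0 \<subseteq> J"
 shows "\<bar>bform a I0 J0 e s t\<bar> \<le> Z * sqrt (sqn I0 s) * sqrt (sqn J0 t)"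
proof -
 let ?s = "\<lambda>i. if i \<in> I0 then s i else 0" and ?t = "\<lambda>j. if j \<in> J0 then t j else 0"
 have "bform a I J e ?s ?t = (\<Sum>i\<in>I. if i \<in> I0 then (\<Sum>j\<in>J. if j \<in> J0 then a i j * e i j * s i * t j else 0) else 0)"
  unfolding bform_def by (intro sum.cong refl) (auto intro!: sum.cong)
 also have "... = bform a I0 J0 e s t"
  using fin sub by (simp add: bform_def Int_absorb1 flip: sum.inter_restrict)
 finally have b: "bform a I J e ?s ?t = bform a I0 J0 e s t" .
 have n: "sqn J (\<lambda>j. - ?t j) = sqn J ?t" by (simp add: sqn_def)
 have "bform a I J e ?s ?t \<le> Z * sqrt (sqn I ?s) * sqrt (sqn J ?t)" using o by (auto simp: opb_def)
 moreover have "bform a I J e ?s (\<lambda>j. - ?t j) \<le> Z * sqrt (sqn I ?s) * sqrt (sqn J (\<lambda>j. - ?t j))" using o by (auto simp: opb_def simp del: bform_neg)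
 ultimately show ?thesis
  unfolding n bform_neg b sqn_ext[OF fin(1) sub(1)] sqn_ext[OF fin(2) sub(2)] by linarith
qed

section \<open>The weighted bipartite graph of a matrix, and vectors with dyadic levels\<close>

definition VV :: "nat set => (nat + nat) set" where "VV A = Inl ` A \<union> Inr ` A"
definition rws :: "(nat + nat) set => nat set" where "rws K = {i. Inl i \<in> K}"
definition cls :: "(nat + nat) set => nat set" where "cls K = {j. Inr j \<in> K}"

definition wt :: "nat set => (nat => nat => real) => nat + nat => nat + nat => real" where
 "wt A a x y = (case (x, y) of
   (Inl i, Inr j) => if i \<in> A \<and> j \<in> A then (a i j)\<^sup>2 else 0
  | (Inr j, Inl i) => if i \<in> A \<and> j \<in> A then (a i j)\<^sup>2 else 0
  | _ => 0)"

abbreviation adj :: "nat set => (nat => nat => real) => nat + nat => nat + nat => bool" where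
 "adj A a \<equiv> (\<lambda>x y. wt A a x y \<noteq> 0)"

lemma wt_nonneg: "wt A a x y \<ge> 0" by (auto simp: wt_def split: sum.splits)
lemma wt_sym: "wt A a x y = wt A a y x" by (auto simp: wt_def split: sum.splits)
lemma wt_V: "wt A a x y \<noteq> 0 ==> x \<in> VV A \<and> y \<in> VV A" by (auto simp: wt_def VV_def split: sum.splits if_splits)
lemma adj_sym: "adj A a x y ==> adj A a y x" by (simp add: wt_sym)
lemma near3_adj_sym: "near3 (adj A a) x y ==> near3 (adj A a) y x" by (rule near3_sym[OF adj_sym])

lemma sum_VV: "finite K ==> (\<Sum>x\<in>K. f x) = (\<Sum>i\<in>rws K. f (Inl i)) + (\<Sum>j\<in>cls K. f (Inr j))"
proof -
 assume fin: "finite K"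
 have K: "K = Inl ` rws K \<union> Inr ` cls K"
  by (auto simp: rws_def cls_def image_iff) (metis sum.exhaust)
 have f: "finite (rws K)" "finite (cls K)"
  using fin by (auto simp: rws_def cls_def intro: finite_vimageI[of K, unfolded vimage_def])
 have "(\<Sum>x\<in>K. f x) = (\<Sum>x\<in>Inl ` rws K \<union> Inr ` cls K. f x)" using K by simp
 also have "... = (\<Sum>x\<in>Inl ` rws K. f x) + (\<Sum>x\<in>Inr ` cls K. f x)" using f by (intro sum.union_disjoint) auto
 also have "... = (\<Sum>i\<in>rws K. f (Inl i)) + (\<Sum>j\<in>cls K. f (Inr j))" by (simp add: sum.reindex inj_on_def)
 finally show ?thesis .
qed

lemma rws_VV [simp]: "rws (VV A) = A" and cls_VV [simp]: "cls (VV A) = A" by (auto simp: rws_def cls_def VV_def)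
lemma finite_VV [simp]: "finite A ==> finite (VV A)" by (simp add: VV_def)
lemma rws_mono: "K \<subseteq> K' ==> rws K \<subseteq> rws K'" and cls_mono: "K \<subseteq> K' ==> cls K \<subseteq> cls K'" by (auto simp: rws_def cls_def)
lemma rws_sub: "K \<subseteq> VV A ==> rws K \<subseteq> A" and cls_sub: "K \<subseteq> VV A ==> cls K \<subseteq> A"
 using rws_mono[of K "VV A"] cls_mono[of K "VV A"] by auto
lemma card_VV: "finite K ==> card K = card (rws K) + card (cls K)"
 using sum_VV[of K "\<lambda>_. 1 :: nat"] by simp
lemma finite_rws: "finite K ==> finite (rws K)" and finite_cls: "finite K ==> finite (cls K)"
 by (auto simp: rws_def cls_def intro: finite_vimageI[of K, unfolded vimage_def])

text \<open>The vectors under consideration have the entries \<open>th x / 2 ^ lev x\<close> with signs \<open>th\<close>; rows and columns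
 are the two summands of the vertex type.\<close>

locale cfg = mat n A a for n A a +
 fixes lev :: "nat + nat => nat" and th :: "nat + nat => real" and e :: "nat => nat => real" and kmax :: nat
 assumes lev_le: "\<And>x. x \<in> VV A ==> lev x \<le> kmax"
  and th: "\<And>x. x \<in> VV A ==> (th x)\<^sup>2 = 1"
  and tot: "(\<Sum>x\<in>VV A. (1/4) ^ lev x) \<le> (4::real)"
  and super: "\<And>x. x \<in> VV A ==> (\<Sum>y\<in>VV A. wt A a x y * (1/4) ^ lev y) \<le> 8 * (1/4) ^ lev x"
begin

definition u :: "nat + nat => real" where "u x = (1/2) ^ lev x"
definition sr :: "nat => real" where "sr i = th (Inl i) * u (Inl i)"
definition tc :: "nat => real" where "tc j = th (Inr j) * u (Inr j)"

lemma u_sq: "(u x)\<^sup>2 = (1/4) ^ lev x" by (simp add: u_def power2_eq_square flip: power_mult_distrib)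

lemma sr_sq: "i \<in> A ==> (sr i)\<^sup>2 = (1/4) ^ lev (Inl i)" using th[of "Inl i"] u_sq by (simp add: sr_def power_mult_distrib VV_def)
lemma tc_sq: "j \<in> A ==> (tc j)\<^sup>2 = (1/4) ^ lev (Inr j)" using th[of "Inr j"] u_sq by (simp add: tc_def power_mult_distrib VV_def)

lemma finV [simp]: "finite (VV A)" by simp

lemma tot2: "(\<Sum>i\<in>A. (1/4) ^ lev (Inl i)) + (\<Sum>j\<in>A. (1/4) ^ lev (Inr j)) \<le> (4::real)"
 using tot sum_VV[of "VV A" "\<lambda>x. (1/4::real) ^ lev x"] by simp

definition xx :: "nat => nat => real" where "xx i j = a i j * e i j * sr i * tc j"

section \<open>Components of sublevel sets, and edges inside small components\<close>

definition W :: "nat => nat => (nat + nat) set" where "W b k = {y\<in>VV A. lev y + b \<le> k}"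
definition cb :: "nat => nat => nat + nat => (nat + nat) set" where "cb b k x = ccomp (near3 (adj A a)) (W b k) x"

lemma cb_sub: "x \<in> W b k ==> cb b k x \<subseteq> W b k" unfolding cb_def by (rule comp_sub)
lemma cb_eq: "y \<in> cb b k x ==> cb b k y = cb b k x" unfolding cb_def by (rule comp_eq[OF near3_adj_sym])
lemma cb_mono: "W b k \<subseteq> W b' k' ==> cb b k x \<subseteq> cb b' k' x" unfolding cb_def by (rule comp_mono)
lemma cb_refl [simp]: "x \<in> cb b k x" by (simp add: cb_def)
lemma cb_edge: "near3 (adj A a) x y ==> x \<in> W b k ==> y \<in> W b k ==> cb b k x = cb b k y"
 unfolding cb_def by (rule comp_edge[OF near3_adj_sym])
lemma cb_conn: "conn (near3 (adj A a)) (cb b k x)" unfolding cb_def by (rule conn_comp[OF near3_adj_sym])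
lemma W_V: "W b k \<subseteq> VV A" by (auto simp: W_def)
lemma finW [simp]: "finite (W b k)" by (rule finite_subset[OF W_V finV])
lemma cb_fin: "x \<in> W b k ==> finite (cb b k x)" by (rule finite_subset[OF cb_sub finW])

lemma adj_ij: "i \<in> A ==> j \<in> A ==> a i j \<noteq> 0 ==> adj A a (Inl i) (Inr j)" by (simp add: wt_def)

text \<open>All rows of \<open>A\<close> are kept and only the columns come from \<open>K\<close>:
  in \<open>T_level\<close> the rows sit at level \<open>k\<close> and need not belong to the
  component of their columns.\<close>

definition colgood :: "real => nat => bool" where
 "colgood Z m \<longleftrightarrow> (\<forall>K. K \<subseteq> VV A \<longrightarrow> conn (near3 (adj A a)) K \<longrightarrow> card K < m \<longrightarrow> opb Z a A (cls K) e)"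

definition sm :: "nat => nat => nat => bool" where
 "sm m i j \<longleftrightarrow> card (cb 0 (max (lev (Inl i)) (lev (Inr j))) (Inl i)) < m"

definition Ks :: "nat => nat + nat => nat set" where
 "Ks m x = {k. lev x \<le> k \<and> k \<le> kmax \<and> card (cb 0 k x) < m}"

text \<open>The largest small component containing the vertex, over all levels; the two ends of an edge
 inside a small component get the same label.\<close>

definition lab :: "nat => nat + nat => (nat + nat) set" where
 "lab m x = (if Ks m x = {} then {} else cb 0 (Max (Ks m x)) x)"

lemma Ks_Max: "Ks m x \<noteq> {} ==> Max (Ks m x) \<in> Ks m x" and Ks_ge: "k \<in> Ks m x ==> k \<le> Max (Ks m x)"
proof -
 have "finite (Ks m x)" unfolding Ks_def by (rule finite_subset[of _ "{..kmax}"]) auto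
 then show "Ks m x \<noteq> {} ==> Max (Ks m x) \<in> Ks m x" "k \<in> Ks m x ==> k \<le> Max (Ks m x)" by auto
qed

lemma lab_edge:
 assumes ij: "i \<in> A" "j \<in> A" "a i j \<noteq> 0" and s: "sm m i j"
 shows "lab m (Inl i) = lab m (Inr j) \<and> lab m (Inl i) \<noteq> {} \<and> card (lab m (Inl i)) < m"
proof -
 define k0 where "k0 = max (lev (Inl i)) (lev (Inr j))"
 have V: "Inl i \<in> VV A" "Inr j \<in> VV A" using ij by (auto simp: VV_def)
 have k0: "k0 \<le> kmax" using lev_le V by (simp add: k0_def)
 have same: "cb 0 k (Inl i) = cb 0 k (Inr j)" if "k0 \<le> k" for k
  using that V ij by (intro cb_edge) (auto simp: near3_def adj_ij W_def k0_def)
 have in1: "k0 \<in> Ks m (Inl i)" "k0 \<in> Ks m (Inr j)" using s k0 same[of k0] by (auto simp: Ks_def sm_def k0_def)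
 have ge: "k0 \<le> Max (Ks m (Inl i))" "k0 \<le> Max (Ks m (Inr j))" using in1 Ks_ge by auto
 have M: "Max (Ks m (Inl i)) \<in> Ks m (Inl i)" "Max (Ks m (Inr j)) \<in> Ks m (Inr j)" using in1 Ks_Max by auto
 have "Max (Ks m (Inl i)) \<in> Ks m (Inr j)" "Max (Ks m (Inr j)) \<in> Ks m (Inl i)"
  using M same[OF ge(1)] same[OF ge(2)] ge by (auto simp: Ks_def k0_def)
 then have e: "Max (Ks m (Inl i)) = Max (Ks m (Inr j))" using Ks_ge by (meson antisym)
 have l: "lab m (Inl i) = cb 0 (Max (Ks m (Inl i))) (Inl i)" "lab m (Inr j) = cb 0 (Max (Ks m (Inr j))) (Inr j)"
  using in1 by (auto simp: lab_def)
 have "card (cb 0 (Max (Ks m (Inl i))) (Inl i)) < m" using M(1) by (simp add: Ks_def)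
 moreover have "cb 0 (Max (Ks m (Inl i))) (Inl i) \<noteq> {}" using cb_refl by blast
 ultimately show ?thesis unfolding l using e same[OF ge(1)] by simp
qed

lemma lab_same:
 assumes ij: "i \<in> A" "j \<in> A" and l: "lab m (Inl i) = lab m (Inr j)" "lab m (Inl i) \<noteq> {}"
 shows "sm m i j" "Inr j \<in> lab m (Inl i)" "conn (near3 (adj A a)) (lab m (Inl i))" "lab m (Inl i) \<subseteq> VV A" "card (lab m (Inl i)) < m"
proof -
 have V: "Inl i \<in> VV A" "Inr j \<in> VV A" using ij by (auto simp: VV_def)
 have ne: "Ks m x \<noteq> {}" if "lab m x \<noteq> {}" for x using that unfolding lab_def by auto
 have M: "Max (Ks m (Inl i)) \<in> Ks m (Inl i)" using ne[OF l(2)] by (rule Ks_Max)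
 have li: "lab m (Inl i) = cb 0 (Max (Ks m (Inl i))) (Inl i)" using ne[OF l(2)] by (auto simp: lab_def)
 have lj: "lab m (Inr j) = cb 0 (Max (Ks m (Inr j))) (Inr j)" using ne[of "Inr j"] l by (auto simp: lab_def)
 define k where "k = Max (Ks m (Inl i))"
 have k: "lev (Inl i) \<le> k" "card (cb 0 k (Inl i)) < m" using M by (auto simp: Ks_def k_def)
 show j: "Inr j \<in> lab m (Inl i)" using l(1) lj by simp
 have iW: "Inl i \<in> W 0 k" using V k by (auto simp: W_def)
 have "Inr j \<in> W 0 k" using j cb_sub[OF iW] unfolding li k_def[symmetric] by auto
 then have "max (lev (Inl i)) (lev (Inr j)) \<le> k" using k by (auto simp: W_def)
 then have "cb 0 (max (lev (Inl i)) (lev (Inr j))) (Inl i) \<subseteq> cb 0 k (Inl i)" by (intro cb_mono) (auto simp: W_def)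
 then show "sm m i j" unfolding sm_def using k card_mono[OF cb_fin[OF iW]] le_less_trans by blast
 show "conn (near3 (adj A a)) (lab m (Inl i))" unfolding li by (rule cb_conn)
 show "lab m (Inl i) \<subseteq> VV A" unfolding li k_def[symmetric] using cb_sub[OF iW] W_V by blast
 show "card (lab m (Inl i)) < m" unfolding li k_def[symmetric] by (rule k)
qed

text \<open>By \<open>lab_edge\<close> and \<open>lab_same\<close> the small edges are the nonzero
  entries inside the blocks of \<open>lab\<close>. Each block has its columns in one small
  component, so \<open>colgood\<close> applies, and the masses of all blocks sum to at most
  4.\<close>

lemma small_part:
 assumes g: "colgood Z m" and Z: "Z \<ge> 0"
 shows "\<bar>\<Sum>i\<in>A. \<Sum>j\<in>A. if sm m i j then xx i j else 0\<bar> \<le> 2 * Z"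
proof -
 let ?f = "\<lambda>i. lab m (Inl i)" and ?g = "\<lambda>j. lab m (Inr j)"
 let ?x = "\<lambda>i j. if sm m i j then xx i j else 0"
 let ?p = "\<lambda>i. (1/4::real) ^ lev (Inl i)" and ?q = "\<lambda>j. (1/4::real) ^ lev (Inr j)"
 have blk: "\<bar>\<Sum>i\<in>{i\<in>A. ?f i = c}. \<Sum>j\<in>{j\<in>A. ?g j = c}. ?x i j\<bar> \<le>
    Z * sqrt (\<Sum>i\<in>{i\<in>A. ?f i = c}. ?p i) * sqrt (\<Sum>j\<in>{j\<in>A. ?g j = c}. ?q j)" if c: "c \<in> ?f ` A" for c
 proof -
 let ?I = "{i\<in>A. ?f i = c}" and ?J = "{j\<in>A. ?g j = c}"
 have pq: "sqn ?I sr = (\<Sum>i\<in>?I. ?p i)" "sqn ?J tc = (\<Sum>j\<in>?J. ?q j)"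
  unfolding sqn_def by (auto intro!: sum.cong simp: sr_sq tc_sq)
 show "\<bar>\<Sum>i\<in>?I. \<Sum>j\<in>?J. ?x i j\<bar> \<le> Z * sqrt (\<Sum>i\<in>?I. ?p i) * sqrt (\<Sum>j\<in>?J. ?q j)"
 proof (cases "c = {} \<or> ?J = {}")
  case True
  then have "?x i j = 0" if "i \<in> ?I" "j \<in> ?J" for i j
   using that lab_edge[of i j m] by (auto simp: xx_def)
  then have "(\<Sum>i\<in>?I. \<Sum>j\<in>?J. ?x i j) = 0" by (intro sum.neutral ballI) auto
  then show ?thesis using Z by (auto intro!: mult_nonneg_nonneg sum_nonneg)
 next
  case False
  then obtain i0 j0 where ij0: "i0 \<in> A" "j0 \<in> A" "?f i0 = c" "?g j0 = c" using c by auto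
  note ls = lab_same[OF ij0(1,2), of m]
  have o: "opb Z a A (cls c) e" using g ls ij0 False unfolding colgood_def by auto
  have "(\<Sum>i\<in>?I. \<Sum>j\<in>?J. ?x i j) = bform a ?I ?J e sr tc"
   unfolding bform_def xx_def[symmetric] using lab_same(1)[of _ _ m] False by (intro sum.cong refl) auto
  moreover have "?J \<subseteq> cls c" using lab_same(2)[OF ij0(1), of _ m] False ij0 by (auto simp: cls_def)
  moreover have "finite (cls c)" using ls ij0 False by (intro finite_subset[OF cls_sub[of c A]]) auto
  ultimately show ?thesis using opb_abs[OF o finA, of ?I ?J sr tc] unfolding pq by auto
 qed
 qed
 have e: "(\<Sum>i\<in>A. \<Sum>j\<in>A. ?x i j) = (\<Sum>c\<in>?f ` A. \<Sum>i\<in>{i\<in>A. ?f i = c}. \<Sum>j\<in>{j\<in>A. ?g j = c}. ?x i j)"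
 proof (rule sum_labelled[OF finA finA])
  fix i j assume "i \<in> A" "j \<in> A" "?x i j \<noteq> 0"
  then show "?f i = ?g j" using lab_edge[of i j m] by (auto simp: xx_def split: if_splits)
 qed
 have "\<bar>\<Sum>i\<in>A. \<Sum>j\<in>A. ?x i j\<bar> \<le> Z / 2 * ((\<Sum>i\<in>A. ?p i) + (\<Sum>j\<in>{j\<in>A. ?g j \<in> ?f ` A}. ?q j))" unfolding e
  by (rule block_bound[where f = ?f and g = ?g and p = ?p and q = ?q and x = ?x and L = "?f ` A", OF finA finA order_refl Z _ _ blk]) simp_all
 also have "... \<le> Z / 2 * 4"
 proof (intro mult_left_mono)
  have "(\<Sum>j\<in>{j\<in>A. ?g j \<in> ?f ` A}. ?q j) \<le> (\<Sum>j\<in>A. ?q j)" by (intro sum_mono2) auto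
  then show "(\<Sum>i\<in>A. ?p i) + (\<Sum>j\<in>{j\<in>A. ?g j \<in> ?f ` A}. ?q j) \<le> 4" using tot2 by linarith
 qed (use Z in auto)
 finally show ?thesis by simp
qed

end

section \<open>Edges between levels at distance at least \<open>b\<close>\<close>

context cfg
begin

definition rowlow :: "nat => nat => nat => nat => bool" where
 "rowlow b m i j \<longleftrightarrow> lev (Inr j) + b \<le> lev (Inl i) \<and> \<not> sm m i j"

lemma rowlow_iff: "rowlow b m i j \<longleftrightarrow> lev (Inr j) + b \<le> lev (Inl i) \<and> m \<le> card (cb 0 (lev (Inl i)) (Inl i))"
proof (cases "lev (Inr j) + b \<le> lev (Inl i)")
 case True
 then have "max (lev (Inl i)) (lev (Inr j)) = lev (Inl i)" by simp
 then show ?thesis using True by (auto simp: rowlow_def sm_def)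
qed (simp add: rowlow_def)

definition Ik :: "nat => nat => nat set" where "Ik m k = {i\<in>A. lev (Inl i) = k \<and> m \<le> card (cb 0 k (Inl i))}"
definition Jk :: "nat => nat => nat set" where "Jk b k = {j\<in>A. lev (Inr j) + b \<le> k}"
definition gl :: "nat => nat => nat => (nat + nat) set" where "gl b k j = cb b k (Inr j)"
text \<open>All columns of \<open>Jk b k\<close> that meet one row are at distance two from each
  other, so they share a component of \<open>W b k\<close>, which then labels the row. A row without
  such columns gets the empty set, which labels no column (\<open>gl_ne\<close>).\<close>

definition fl :: "nat => nat => nat => (nat + nat) set" where
 "fl b k i = (if \<exists>j\<in>Jk b k. a i j \<noteq> 0 then gl b k (SOME j. j \<in> Jk b k \<and> a i j \<noteq> 0) else {})"

lemma finIJ [simp]: "finite (Ik m k)" "finite (Jk b k)" by (auto simp: Ik_def Jk_def)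
lemma IJ_sub: "Ik m k \<subseteq> A" "Jk b k \<subseteq> A" by (auto simp: Ik_def Jk_def)

lemma rowlow_sum:
 "(\<Sum>i\<in>A. \<Sum>j\<in>A. if rowlow b m i j then xx i j else 0) = (\<Sum>k\<in>{..kmax}. \<Sum>i\<in>Ik m k. \<Sum>j\<in>Jk b k. xx i j)"
proof -
 have "(\<Sum>i\<in>A. \<Sum>j\<in>A. if rowlow b m i j then xx i j else 0) =
   (\<Sum>k\<in>{..kmax}. \<Sum>i\<in>{i\<in>A. lev (Inl i) = k}. \<Sum>j\<in>A. if rowlow b m i j then xx i j else 0)"
  using lev_le by (intro sum.group[symmetric]) (auto simp: VV_def)
 also have "... = (\<Sum>k\<in>{..kmax}. \<Sum>i\<in>Ik m k. \<Sum>j\<in>Jk b k. xx i j)"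
 proof (rule sum.cong[OF refl])
  fix k
  have 1: "(\<Sum>j\<in>A. if rowlow b m i j then xx i j else 0) = (if i \<in> Ik m k then \<Sum>j\<in>Jk b k. xx i j else 0)"
   if i: "i \<in> A" "lev (Inl i) = k" for i
  proof (cases "i \<in> Ik m k")
   case True
   have "(\<Sum>j\<in>A. if rowlow b m i j then xx i j else 0) = (\<Sum>j\<in>{j\<in>A. rowlow b m i j}. xx i j)"
    by (simp add: sum.inter_filter)
   also have "{j\<in>A. rowlow b m i j} = Jk b k" using True i by (auto simp: rowlow_iff Jk_def Ik_def)
   finally show ?thesis using True by simp
  next
   case False
   then have "\<not> rowlow b m i j" if "j \<in> A" for j using i that by (auto simp: rowlow_iff Ik_def)
   then show ?thesis using False by (simp add: sum.neutral)
  qed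
  have "(\<Sum>i\<in>{i\<in>A. lev (Inl i) = k}. \<Sum>j\<in>A. if rowlow b m i j then xx i j else 0) =
    (\<Sum>i\<in>{i\<in>A. lev (Inl i) = k}. if i \<in> Ik m k then \<Sum>j\<in>Jk b k. xx i j else 0)"
   using 1 by (intro sum.cong refl) auto
  also have "... = (\<Sum>i\<in>Ik m k. \<Sum>j\<in>Jk b k. xx i j)"
   by (subst sum.inter_filter[symmetric]) (auto simp: Ik_def intro!: sum.cong)
  finally show "(\<Sum>i\<in>{i\<in>A. lev (Inl i) = k}. \<Sum>j\<in>A. if rowlow b m i j then xx i j else 0) = (\<Sum>i\<in>Ik m k. \<Sum>j\<in>Jk b k. xx i j)" .
 qed
 finally show ?thesis .
qed

lemma Jk_W: "j \<in> Jk b k ==> Inr j \<in> W b k" by (auto simp: Jk_def W_def VV_def)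

lemma fl_gl:
 assumes i: "i \<in> A" and j: "j \<in> Jk b k" "a i j \<noteq> 0"
 shows "fl b k i = gl b k j"
proof -
 define j0 where "j0 = (SOME j. j \<in> Jk b k \<and> a i j \<noteq> 0)"
 have j0: "j0 \<in> Jk b k \<and> a i j0 \<noteq> 0" unfolding j0_def by (rule someI[of _ j]) (use j in auto)
 have r: "adj A a (Inl i) (Inr j)" "adj A a (Inl i) (Inr j0)" using i j j0 IJ_sub(2)[of b k] by (auto simp: wt_def)
 have "near3 (adj A a) (Inr j0) (Inr j)" unfolding near3_def using r(1) adj_sym[OF r(2)] by blast
 then have "cb b k (Inr j0) = cb b k (Inr j)" using j j0 Jk_W by (intro cb_edge) auto
 then show ?thesis using j by (auto simp: fl_def gl_def j0_def)
qed

lemma fl_cases: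
 assumes "i \<in> Ik m k" "fl b k i \<noteq> {}"
 obtains j where "j \<in> Jk b k" "a i j \<noteq> 0" "fl b k i = gl b k j"
proof -
 have "\<exists>j\<in>Jk b k. a i j \<noteq> 0" using assms by (auto simp: fl_def split: if_splits)
 then show ?thesis using that fl_gl[of i _ b k] assms IJ_sub by blast
qed

lemma gl_ne: "gl b k j \<noteq> {}" unfolding gl_def using cb_refl by blast

lemma gl_facts: "j \<in> Jk b k ==> gl b k j \<subseteq> W b k" "conn (near3 (adj A a)) (gl b k j)" "j \<in> cls (gl b k j)"
 unfolding gl_def using cb_sub[OF Jk_W] cb_conn by (auto simp: cls_def)

lemma gl_cls: "j0 \<in> Jk b k ==> {j\<in>Jk b k. gl b k j = gl b k j0} = cls (gl b k j0)"
proof (intro set_eqI iffI)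
 fix j assume j0: "j0 \<in> Jk b k" and j: "j \<in> cls (gl b k j0)"
 then have 1: "Inr j \<in> cb b k (Inr j0)" by (auto simp: cls_def gl_def)
 then have 2: "Inr j \<in> W b k" using cb_sub[OF Jk_W[OF j0]] by blast
 have "gl b k j = gl b k j0" unfolding gl_def by (rule cb_eq[OF 1])
 then show "j \<in> {j\<in>Jk b k. gl b k j = gl b k j0}" using 2 by (auto simp: Jk_def W_def VV_def)
next
 fix j assume "j \<in> {j\<in>Jk b k. gl b k j = gl b k j0}"
 then have "gl b k j = gl b k j0" by simp
 then show "j \<in> cls (gl b k j0)" using gl_facts(3)[of j b k] by simp
qed

abbreviation "pp i \<equiv> (1/4::real) ^ lev (Inl i)"
abbreviation "qq j \<equiv> (1/4::real) ^ lev (Inr j)"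

definition Lab :: "nat => nat => nat => (nat + nat) set set" where "Lab b m k = fl b k ` Ik m k"

definition blk :: "nat => nat => nat => (nat + nat) set => real" where
 "blk b m k c = (\<Sum>i\<in>{i\<in>Ik m k. fl b k i = c}. \<Sum>j\<in>{j\<in>Jk b k. gl b k j = c}. xx i j)"

lemma level_split: "(\<Sum>i\<in>Ik m k. \<Sum>j\<in>Jk b k. xx i j) =
  (\<Sum>c\<in>{c\<in>Lab b m k. card c < m}. blk b m k c) + (\<Sum>c\<in>{c\<in>Lab b m k. \<not> card c < m}. blk b m k c)"
proof -
 have "(\<Sum>i\<in>Ik m k. \<Sum>j\<in>Jk b k. xx i j) = (\<Sum>c\<in>Lab b m k. blk b m k c)"
  unfolding blk_def Lab_def
 proof (rule sum_labelled)
  fix i j assume "i \<in> Ik m k" "j \<in> Jk b k" "xx i j \<noteq> 0"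
  then show "fl b k i = gl b k j" using IJ_sub by (intro fl_gl) (auto simp: xx_def)
 qed auto
 also have "... = (\<Sum>c\<in>{c\<in>Lab b m k. card c < m} \<union> {c\<in>Lab b m k. \<not> card c < m}. blk b m k c)"
  by (rule sum.cong) auto
 also have "... = (\<Sum>c\<in>{c\<in>Lab b m k. card c < m}. blk b m k c) + (\<Sum>c\<in>{c\<in>Lab b m k. \<not> card c < m}. blk b m k c)"
  by (rule sum.union_disjoint) (auto simp: Lab_def)
 finally show ?thesis .
qed

definition Tk :: "nat => nat => nat => nat set" where
 "Tk b m j = {k. k \<le> kmax \<and> lev (Inr j) + b \<le> k \<and> card (cb b k (Inr j)) < m \<and> m \<le> card (cb 0 k (Inr j))}"

text \<open>For \<open>k \<ge> k1 + b\<close> the set \<open>W 0 k1\<close> is contained in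
  \<open>W b k\<close>. Hence a component that is large without the shift at level \<open>k1\<close>
  is large with the shift from level \<open>k1 + b\<close> on, and the column spends at most
  \<open>b\<close> levels in between.\<close>

lemma card_Tk: "j \<in> A ==> card (Tk b m j) \<le> b"
proof (cases "Tk b m j = {}")
 case False
 assume j: "j \<in> A"
 have fin: "finite (Tk b m j)" unfolding Tk_def by (rule finite_subset[of _ "{..kmax}"]) auto
 define k1 where "k1 = Min (Tk b m j)"
 have k1: "k1 \<in> Tk b m j" "\<And>k. k \<in> Tk b m j ==> k1 \<le> k" using fin False by (auto simp: k1_def)
 have "k < k1 + b" if k: "k \<in> Tk b m j" for k
 proof (rule ccontr)
  assume "\<not> k < k1 + b"
  then have "cb 0 k1 (Inr j) \<subseteq> cb b k (Inr j)" by (intro cb_mono) (auto simp: W_def)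
  moreover have "Inr j \<in> W b k" using k j by (auto simp: Tk_def W_def VV_def)
  ultimately have "card (cb 0 k1 (Inr j)) \<le> card (cb b k (Inr j))" by (intro card_mono cb_fin)
  then show False using k k1(1) by (auto simp: Tk_def)
 qed
 then have "Tk b m j \<subseteq> {k1..<k1 + b}" using k1 by auto
 then show ?thesis using card_mono[of "{k1..<k1 + b}"] by force
qed auto

text \<open>Small labels are covered by \<open>colgood\<close>. The rows in \<open>Ik m k\<close>
  lie in large components of \<open>W 0 k\<close>, so a column with a small label that meets such a
  block is itself in a large component without the shift: its level \<open>k\<close> is one of those
  counted by \<open>Tk\<close>.\<close>

lemma T_level:
 assumes g: "colgood Z m" and Z: "Z \<ge> 0"
 shows "\<bar>\<Sum>c\<in>{c\<in>Lab b m k. card c < m}. blk b m k c\<bar> \<le> Z / 2 * ((\<Sum>i\<in>Ik m k. pp i) + (\<Sum>j\<in>{j\<in>A. k \<in> Tk b m j \<or> kmax < k}. qq j))"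
proof -
 let ?L = "{c\<in>Lab b m k. card c < m}"
 have b1: "\<bar>\<Sum>i\<in>{i\<in>Ik m k. fl b k i = c}. \<Sum>j\<in>{j\<in>Jk b k. gl b k j = c}. xx i j\<bar> \<le>
   Z * sqrt (\<Sum>i\<in>{i\<in>Ik m k. fl b k i = c}. pp i) * sqrt (\<Sum>j\<in>{j\<in>Jk b k. gl b k j = c}. qq j)" if c: "c \<in> ?L" for c
 proof (cases "c = {}")
  case True
  then have "{j\<in>Jk b k. gl b k j = c} = {}" using gl_ne by auto
  then show ?thesis using Z by (simp only: sum.empty) simp
 next
  case False
  let ?I = "{i\<in>Ik m k. fl b k i = c}" and ?J = "{j\<in>Jk b k. gl b k j = c}"
  obtain j0 where j0: "j0 \<in> Jk b k" "c = gl b k j0"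
  proof -
   obtain i where "i \<in> Ik m k" "c = fl b k i" using c by (auto simp: Lab_def)
   then show ?thesis using fl_cases[of i m k b] False that by metis
  qed
  have cV: "c \<subseteq> VV A" using gl_facts(1)[OF j0(1)] W_V j0 by blast
  have o: "opb Z a A (cls c) e" using g cV gl_facts(2) j0 c unfolding colgood_def by auto
  have fc: "finite (cls c)" by (rule finite_subset[OF cls_sub[OF cV] finA])
  have pq: "sqn ?I sr = (\<Sum>i\<in>?I. pp i)" "sqn ?J tc = (\<Sum>j\<in>?J. qq j)"
   unfolding sqn_def using IJ_sub by (auto intro!: sum.cong simp: sr_sq tc_sq subset_iff)
  have "(\<Sum>i\<in>?I. \<Sum>j\<in>?J. xx i j) = bform a ?I ?J e sr tc" by (simp add: bform_def xx_def)
  moreover have "?J \<subseteq> cls c" using gl_cls[OF j0(1)] j0 by simp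
  moreover have "?I \<subseteq> A" using IJ_sub by auto
  ultimately show ?thesis using opb_abs[OF o finA fc, of ?I ?J sr tc] unfolding pq by simp
 qed
 have "\<bar>\<Sum>c\<in>?L. blk b m k c\<bar> \<le> Z / 2 * ((\<Sum>i\<in>Ik m k. pp i) + (\<Sum>j\<in>{j\<in>Jk b k. gl b k j \<in> ?L}. qq j))"
  unfolding blk_def
  by (rule block_bound[where f = "fl b k" and g = "gl b k" and p = pp and q = qq and x = xx and L = ?L, OF finIJ _ Z _ _ b1]) (auto simp: Lab_def)
 moreover have "(\<Sum>j\<in>{j\<in>Jk b k. gl b k j \<in> ?L}. qq j) \<le> (\<Sum>j\<in>{j\<in>A. k \<in> Tk b m j \<or> kmax < k}. qq j)"
 proof (intro sum_mono2)
  show "{j\<in>Jk b k. gl b k j \<in> ?L} \<subseteq> {j\<in>A. k \<in> Tk b m j \<or> kmax < k}"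
  proof
   fix j assume "j \<in> {j\<in>Jk b k. gl b k j \<in> ?L}"
   then obtain i where i: "j \<in> Jk b k" "card (gl b k j) < m" "i \<in> Ik m k" "gl b k j = fl b k i" by (auto simp: Lab_def)
   obtain j' where j': "j' \<in> Jk b k" "a i j' \<noteq> 0" "fl b k i = gl b k j'" using fl_cases[OF i(3)] gl_ne i(4) by metis
   have V: "Inl i \<in> W 0 k" "Inr j' \<in> W 0 k" using i j' by (auto simp: W_def VV_def Ik_def Jk_def)
   have "adj A a (Inl i) (Inr j')" using i j' by (auto simp: wt_def Ik_def Jk_def)
   then have "cb 0 k (Inl i) = cb 0 k (Inr j')" using V by (intro cb_edge) (auto simp: near3_def)
   moreover have "Inr j' \<in> cb 0 k (Inr j)"
   proof -
    have "Inr j' \<in> cb b k (Inr j)" using i(4) j'(3) cb_refl[of "Inr j'" b k] by (simp add: gl_def)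
    moreover have "cb b k (Inr j) \<subseteq> cb 0 k (Inr j)" by (rule cb_mono) (auto simp: W_def)
    ultimately show ?thesis by blast
   qed
   ultimately have "cb 0 k (Inr j) = cb 0 k (Inl i)" using cb_eq by metis
   then have "m \<le> card (cb 0 k (Inr j))" using i(3) by (auto simp: Ik_def)
   then show "j \<in> {j\<in>A. k \<in> Tk b m j \<or> kmax < k}" using i IJ_sub by (auto simp: Tk_def Jk_def gl_def)
  qed
 qed auto
 ultimately show ?thesis using Z
  by (elim order_trans) (intro mult_left_mono add_left_mono, auto)
qed

text \<open>Over all levels every row mass is used once, every column mass at most \<open>b\<close>
  times by \<open>card_Tk\<close>.\<close>

lemma T_total:
 assumes g: "colgood Z m" and Z: "Z \<ge> 0"
 shows "\<bar>\<Sum>k\<in>{..kmax}. \<Sum>c\<in>{c\<in>Lab b m k. card c < m}. blk b m k c\<bar> \<le> 2 * Z * (1 + real b)"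
proof -
 have "\<bar>\<Sum>k\<in>{..kmax}. \<Sum>c\<in>{c\<in>Lab b m k. card c < m}. blk b m k c\<bar> \<le>
   (\<Sum>k\<in>{..kmax}. Z / 2 * ((\<Sum>i\<in>Ik m k. pp i) + (\<Sum>j\<in>{j\<in>A. k \<in> Tk b m j}. qq j)))"
 proof (rule order_trans[OF sum_abs], rule sum_mono)
  fix k assume "k \<in> {..kmax}"
  then have "{j\<in>A. k \<in> Tk b m j \<or> kmax < k} = {j\<in>A. k \<in> Tk b m j}" by auto
  then show "\<bar>\<Sum>c\<in>{c\<in>Lab b m k. card c < m}. blk b m k c\<bar> \<le> Z / 2 * ((\<Sum>i\<in>Ik m k. pp i) + (\<Sum>j\<in>{j\<in>A. k \<in> Tk b m j}. qq j))"
   using T_level[OF g Z, of b k] by simp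
 qed
 also have "... = Z / 2 * ((\<Sum>k\<in>{..kmax}. \<Sum>i\<in>Ik m k. pp i) + (\<Sum>k\<in>{..kmax}. \<Sum>j\<in>{j\<in>A. k \<in> Tk b m j}. qq j))"
  by (simp only: sum.distrib sum_distrib_left distrib_left)
 also have "... \<le> Z / 2 * ((\<Sum>i\<in>A. pp i) + real b * (\<Sum>j\<in>A. qq j))"
 proof (intro mult_left_mono add_mono)
  show "(\<Sum>k\<in>{..kmax}. \<Sum>i\<in>Ik m k. pp i) \<le> (\<Sum>i\<in>A. pp i)"
  proof -
   have "(\<Sum>k\<in>{..kmax}. \<Sum>i\<in>Ik m k. pp i) \<le> (\<Sum>k\<in>{..kmax}. \<Sum>i\<in>{i\<in>A. lev (Inl i) = k}. pp i)"
    by (intro sum_mono sum_mono2) (auto simp: Ik_def)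
   also have "... = (\<Sum>i\<in>A. pp i)" using lev_le by (intro sum.group) (auto simp: VV_def)
   finally show ?thesis .
  qed
  have "(\<Sum>k\<in>{..kmax}. \<Sum>j\<in>{j\<in>A. k \<in> Tk b m j}. qq j) = (\<Sum>j\<in>A. \<Sum>k\<in>{k\<in>{..kmax}. k \<in> Tk b m j}. qq j)"
   by (rule sum.swap_restrict) auto
  also have "... \<le> (\<Sum>j\<in>A. real b * qq j)"
  proof (intro sum_mono)
   fix j assume j: "j \<in> A"
   have "{k\<in>{..kmax}. k \<in> Tk b m j} = Tk b m j" by (auto simp: Tk_def)
   then have "(\<Sum>k\<in>{k\<in>{..kmax}. k \<in> Tk b m j}. qq j) = real (card (Tk b m j)) * qq j" by simp
   also have "... \<le> real b * qq j" using card_Tk[OF j, of b m] by (intro mult_right_mono) auto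
   finally show "(\<Sum>k\<in>{k\<in>{..kmax}. k \<in> Tk b m j}. qq j) \<le> real b * qq j" .
  qed
  finally show "(\<Sum>k\<in>{..kmax}. \<Sum>j\<in>{j\<in>A. k \<in> Tk b m j}. qq j) \<le> real b * (\<Sum>j\<in>A. qq j)" by (simp add: sum_distrib_left)
 qed (use Z in auto)
 also have "... \<le> Z / 2 * (4 + real b * 4)"
 proof (intro mult_left_mono add_mono)
  have "(\<Sum>i\<in>A. pp i) \<ge> 0" "(\<Sum>j\<in>A. qq j) \<ge> 0" by (auto intro: sum_nonneg)
  then show "(\<Sum>i\<in>A. pp i) \<le> 4" "(\<Sum>j\<in>A. qq j) \<le> 4" using tot2 by linarith+
 qed (use Z in auto)
 finally show ?thesis by (simp add: algebra_simps)
qed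

text \<open>After scaling by \<open>2 ^ k\<close> the column entries are 0 or signed powers
  \<open>2 ^ d\<close> with \<open>d\<close> the distance of the levels, so only finitely many
  \<open>z\<close> occur in a union bound. The right-hand side is that of \<open>chi_tail\<close>,
  where \<open>G\<close> stands for the entropy per vertex.\<close>

definition fargood :: "nat => nat => nat => real => real => bool" where
 "fargood b dm m L G \<longleftrightarrow> (\<forall>K. K \<subseteq> VV A \<longrightarrow> conn (near3 (adj A a)) K \<longrightarrow> m \<le> card K \<longrightarrow>
   (\<forall>z. (\<forall>j\<in>cls K. z j = 0 \<or> (\<exists>d. b \<le> d \<and> d \<le> dm \<and> \<bar>z j\<bar> = 2 ^ d)) \<longrightarrow>
    (\<Sum>i\<in>{i\<in>A. (\<Sum>j\<in>cls K. (a i j * z j)\<^sup>2) \<le> 8}. max 0 ((\<Sum>j\<in>cls K. a i j * z j * e i j)\<^sup>2 - L * (\<Sum>j\<in>cls K. (a i j * z j)\<^sup>2)))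
    \<le> 144 * exp (- L / 8) * (\<Sum>j\<in>cls K. (z j)\<^sup>2) + G * real (card K)))"

text \<open>By \<open>super\<close> the scaled row variances \<open>v i\<close> are at most 8, so
  the rows of the block are among those of \<open>fargood\<close>. A row sum then has modulus at
  most \<open>sqrt (8 * L) + 1\<close> plus the excess of its square over \<open>L * v i\<close>,
  and the excesses are summed by \<open>fargood\<close>.\<close>

lemma F_block:
 assumes fg: "fargood b dm m L G" and L: "L \<ge> 0" and m: "m > 0"
  and big: "\<And>i j. i \<in> A ==> j \<in> A ==> a i j \<noteq> 0 ==> (a i j)\<^sup>2 * 4 ^ dm > 2"
  and c: "c \<in> Lab b m k" "\<not> card c < m"
 shows "\<bar>blk b m k c\<bar> \<le> (sqrt (8 * L) + 1) * (\<Sum>i\<in>{i\<in>Ik m k. fl b k i = c}. pp i) +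
   144 * exp (- L / 8) * (\<Sum>j\<in>{j\<in>Jk b k. gl b k j = c}. if k \<le> lev (Inr j) + dm then qq j else 0) + G * (1/4) ^ k * real (card c)"
proof -
 let ?I = "{i\<in>Ik m k. fl b k i = c}" and ?J = "{j\<in>Jk b k. gl b k j = c}"
 have "c \<noteq> {}" using c m by auto
 then obtain j0 where j0: "j0 \<in> Jk b k" "c = gl b k j0"
 proof -
  obtain i where "i \<in> Ik m k" "c = fl b k i" using c by (auto simp: Lab_def)
  then show ?thesis using fl_cases[of i m k b] \<open>c \<noteq> {}\<close> that by metis
 qed
 have J: "?J = cls c" using gl_cls[OF j0(1)] j0 by simp
 have JA: "cls c \<subseteq> A" using J IJ_sub by blast
 have finJ: "finite (cls c)" by (rule finite_subset[OF JA finA])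
 have IA: "?I \<subseteq> A" using IJ_sub by auto
 have cV: "c \<subseteq> VV A" using gl_facts(1)[OF j0(1)] W_V j0 by blast
 \<comment> \<open>Columns more than \<open>dm\<close> levels below \<open>k\<close> may be set to
   0: an edge from them to a row of level \<open>k\<close> would violate \<open>super\<close>,
   because \<open>big\<close> gives its square times \<open>4 ^ dm\<close> more than 2.\<close>
 define z where "z = (\<lambda>j. if k \<le> lev (Inr j) + dm then th (Inr j) * 2 ^ (k - lev (Inr j)) else 0)"
 have levJ: "lev (Inr j) + b \<le> k" if "j \<in> cls c" for j using that J by (auto simp: Jk_def)
 have thabs: "\<bar>th x\<bar> = 1" if "x \<in> VV A" for x using th[OF that] by (simp add: power2_eq_1_iff, auto)
 have zz: "z j = 0 \<or> (\<exists>d. b \<le> d \<and> d \<le> dm \<and> \<bar>z j\<bar> = 2 ^ d)" if j: "j \<in> cls c" for j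
  using levJ[OF j] thabs[of "Inr j"] JA j
  by (auto simp: z_def abs_mult VV_def intro!: exI[of _ "k - lev (Inr j)"])
 define v where "v = (\<lambda>i. \<Sum>j\<in>cls c. (a i j * z j)\<^sup>2)"
 define Y where "Y = (\<lambda>i. \<Sum>j\<in>cls c. a i j * z j * e i j)"
 have z2: "(1/4) ^ k * (z j)\<^sup>2 = (if k \<le> lev (Inr j) + dm then qq j else 0)" if j: "j \<in> cls c" for j
 proof -
  have "(th (Inr j))\<^sup>2 = 1" using th[of "Inr j"] j JA by (auto simp: VV_def)
  moreover have "(1/4::real) ^ k * (2 ^ (k - lev (Inr j)))\<^sup>2 = qq j"
  proof -
   have "(2::real) ^ (k - lev (Inr j)) ^ 2 = 2 ^ (k - lev (Inr j)) ^ 2" ..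
   have "((2::real) ^ (k - lev (Inr j)))\<^sup>2 = 4 ^ (k - lev (Inr j))" by (simp add: power2_eq_square flip: power_mult_distrib)
   moreover have "(1/4::real) ^ k = (1/4) ^ (k - lev (Inr j)) * qq j" using levJ[OF j] by (simp flip: power_add)
   ultimately show ?thesis by (simp add: power_one_over)
  qed
  ultimately show ?thesis by (simp add: z_def power_mult_distrib)
 qed
 have zu: "tc j = (1/2) ^ k * z j \<or> a i j = 0" if i: "i \<in> ?I" and j: "j \<in> cls c" for i j
 proof (cases "k \<le> lev (Inr j) + dm")
  case True
  have "(1/2::real) ^ k = (1/2) ^ (k - lev (Inr j)) * (1/2) ^ lev (Inr j)" using levJ[OF j] by (simp flip: power_add)
  then show ?thesis using True by (simp add: tc_def z_def u_def power_one_over)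
 next
  case False
  have "a i j = 0"
  proof (rule ccontr)
   assume ne: "a i j \<noteq> 0"
   have ij: "i \<in> A" "j \<in> A" using i j IA JA by auto
   then have V: "Inl i \<in> VV A" "Inr j \<in> VV A" by (auto simp: VV_def)
   have "wt A a (Inl i) (Inr j) * (1/4) ^ lev (Inr j) \<le> (\<Sum>y\<in>VV A. wt A a (Inl i) y * (1/4) ^ lev y)"
    using V finV by (intro member_le_sum[of "Inr j" "VV A" "\<lambda>y. wt A a (Inl i) y * (1/4) ^ lev y"]) (auto simp: wt_nonneg)
   also have "... \<le> 8 * (1/4) ^ lev (Inl i)" by (rule super[OF V(1)])
   finally have 1: "(a i j)\<^sup>2 * qq j \<le> 8 * (1/4) ^ k" using ij i by (simp add: wt_def Ik_def)
   have "(1/4::real) ^ k \<le> (1/4) ^ (lev (Inr j) + dm + 1)" using False by (intro power_decreasing) auto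
   also have "... = qq j * (1/4) ^ dm / 4" by (simp add: power_add)
   finally have "(a i j)\<^sup>2 * qq j \<le> 2 * (qq j * (1/4) ^ dm)" using 1 by linarith
   then have "qq j * (a i j)\<^sup>2 \<le> qq j * (2 * (1/4) ^ dm)" by (simp only: mult_ac)
   then have "(a i j)\<^sup>2 \<le> 2 * (1/4) ^ dm" by (subst (asm) mult_le_cancel_left_pos) auto
   then have "(a i j)\<^sup>2 * 4 ^ dm \<le> 2" by (simp add: power_one_over field_simps)
   then show False using big[OF ij ne] by simp
  qed
  then show ?thesis by simp
 qed
 have v8: "v i \<le> 8" if i: "i \<in> ?I" for i
 proof -
  have iA: "i \<in> A" "Inl i \<in> VV A" "lev (Inl i) = k" using i IA by (auto simp: VV_def Ik_def)
  have "(1/4) ^ k * v i = (\<Sum>j\<in>cls c. (a i j)\<^sup>2 * ((1/4) ^ k * (z j)\<^sup>2))"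
   by (simp add: v_def power_mult_distrib sum_distrib_left mult_ac)
  also have "... \<le> (\<Sum>j\<in>cls c. (a i j)\<^sup>2 * qq j)" using z2 by (intro sum_mono mult_left_mono) auto
  also have "... \<le> (\<Sum>j\<in>A. (a i j)\<^sup>2 * qq j)" using JA by (intro sum_mono2) auto
  also have "... = (\<Sum>y\<in>VV A. wt A a (Inl i) y * (1/4) ^ lev y)"
   using iA by (simp add: sum_VV) (simp add: wt_def)
  also have "... \<le> 8 * (1/4) ^ k" using super[OF iA(2)] iA by simp
  finally show ?thesis by simp
 qed
 have bl: "blk b m k c = (\<Sum>i\<in>?I. sr i * ((1/2) ^ k * Y i))"
 proof -
  have "xx i j = sr i * ((1/2) ^ k * (a i j * z j * e i j))" if "i \<in> ?I" "j \<in> cls c" for i j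
   using zu[OF that] by (auto simp: xx_def)
  then show ?thesis unfolding blk_def J Y_def sum_distrib_left by (intro sum.cong refl) blast
 qed
 have "\<bar>blk b m k c\<bar> \<le> (\<Sum>i\<in>?I. \<bar>sr i * ((1/2) ^ k * Y i)\<bar>)" unfolding bl by (rule sum_abs)
 also have "... \<le> (\<Sum>i\<in>?I. (1/4) ^ k * (sqrt (8 * L) + 1 + max 0 ((Y i)\<^sup>2 - L * v i)))"
 proof (intro sum_mono)
  fix i assume i: "i \<in> ?I"
  then have iA: "i \<in> A" "Inl i \<in> VV A" "lev (Inl i) = k" using IA by (auto simp: VV_def Ik_def)
  have "\<bar>sr i\<bar> = (1/2) ^ k" using thabs[OF iA(2)] iA by (simp add: sr_def abs_mult u_def)
  then have "\<bar>sr i * ((1/2) ^ k * Y i)\<bar> = (1/4) ^ k * \<bar>Y i\<bar>" by (simp add: abs_mult power_mult_distrib[symmetric] flip: mult.assoc)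
  moreover have "\<bar>Y i\<bar> \<le> sqrt (8 * L) + 1 + max 0 ((Y i)\<^sup>2 - L * v i)"
  proof -
   define g where "g = max 0 ((Y i)\<^sup>2 - L * v i)"
   have g0: "g \<ge> 0" by (simp add: g_def)
   have "(Y i)\<^sup>2 \<le> L * v i + g" by (auto simp: g_def)
   also have "... \<le> 8 * L + g" using v8[OF i] L by (simp add: mult.commute mult_left_mono)
   also have "... \<le> (sqrt (8 * L) + 1 + g)\<^sup>2"
    using L g0 by (simp add: power2_eq_square algebra_simps)
   finally show ?thesis using L g0 abs_le_square_iff[of "Y i" "sqrt (8 * L) + 1 + g"] unfolding g_def[symmetric] by auto
  qed
  ultimately show "\<bar>sr i * ((1/2) ^ k * Y i)\<bar> \<le> (1/4) ^ k * (sqrt (8 * L) + 1 + max 0 ((Y i)\<^sup>2 - L * v i))"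
   by (simp add: mult_left_mono)
 qed
 also have "... = (sqrt (8 * L) + 1) * (\<Sum>i\<in>?I. (1/4) ^ k) + (1/4) ^ k * (\<Sum>i\<in>?I. max 0 ((Y i)\<^sup>2 - L * v i))"
  unfolding distrib_left[of _ "sqrt (8 * L) + 1"] sum.distrib sum_distrib_left by (simp only: mult.commute)
 finally have main: "\<bar>blk b m k c\<bar> \<le> (sqrt (8 * L) + 1) * (\<Sum>i\<in>?I. (1/4) ^ k) + (1/4) ^ k * (\<Sum>i\<in>?I. max 0 ((Y i)\<^sup>2 - L * v i))" .
 have p: "(\<Sum>i\<in>?I. (1/4) ^ k) = (\<Sum>i\<in>?I. pp i)" by (intro sum.cong) (auto simp: Ik_def)
 have "(\<Sum>i\<in>?I. max 0 ((Y i)\<^sup>2 - L * v i)) \<le> (\<Sum>i\<in>{i\<in>A. v i \<le> 8}. max 0 ((Y i)\<^sup>2 - L * v i))"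
  using IA v8 by (intro sum_mono2) auto
 also have "... \<le> 144 * exp (- L / 8) * (\<Sum>j\<in>cls c. (z j)\<^sup>2) + G * real (card c)"
 proof -
  have cc: "conn (near3 (adj A a)) c" unfolding j0(2) by (rule gl_facts(2))
  have mc: "m \<le> card c" using c(2) by simp
  show ?thesis using fg[unfolded fargood_def, rule_format, OF cV cc mc zz] unfolding v_def Y_def .
 qed
 finally have B: "(1/4) ^ k * (\<Sum>i\<in>?I. max 0 ((Y i)\<^sup>2 - L * v i)) \<le> (1/4) ^ k * (144 * exp (- L / 8) * (\<Sum>j\<in>cls c. (z j)\<^sup>2) + G * real (card c))"
  by (rule mult_left_mono) simp
 have e1: "(1/4) ^ k * (144 * exp (- L / 8) * (\<Sum>j\<in>cls c. (z j)\<^sup>2) + G * real (card c)) =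
   144 * exp (- L / 8) * (\<Sum>j\<in>cls c. (1/4) ^ k * (z j)\<^sup>2) + G * (1/4) ^ k * real (card c)"
  unfolding sum_distrib_left[of "(1/4) ^ k", symmetric] by (simp add: distrib_left mult_ac)
 have e2: "(\<Sum>j\<in>cls c. (1/4) ^ k * (z j)\<^sup>2) = (\<Sum>j\<in>?J. if k \<le> lev (Inr j) + dm then qq j else 0)"
  unfolding J using z2 by (intro sum.cong) auto
 show ?thesis using main B unfolding p e1 e2 by linarith
qed

lemma F_level:
 assumes fg: "fargood b dm m L G" and L: "L \<ge> 0" and m: "m > 0" and G: "G \<ge> 0"
  and big: "\<And>i j. i \<in> A ==> j \<in> A ==> a i j \<noteq> 0 ==> (a i j)\<^sup>2 * 4 ^ dm > 2"
 shows "\<bar>\<Sum>c\<in>{c\<in>Lab b m k. \<not> card c < m}. blk b m k c\<bar> \<le> (sqrt (8 * L) + 1) * (\<Sum>i\<in>Ik m k. pp i) +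
   144 * exp (- L / 8) * (\<Sum>j\<in>Jk b k. if k \<le> lev (Inr j) + dm then qq j else 0) + G * ((1/4) ^ k * real (card (W b k)))"
proof -
 let ?L = "{c\<in>Lab b m k. \<not> card c < m}"
 have finL: "finite ?L" by (auto simp: Lab_def)
 let ?q = "\<lambda>j. if k \<le> lev (Inr j) + dm then qq j else 0"
 have cW: "c = {y\<in>W b k. cb b k y = c}" if c: "c \<in> ?L" for c
 proof -
  obtain i where i: "i \<in> Ik m k" "c = fl b k i" using c by (auto simp: Lab_def)
  have "c \<noteq> {}" using c m by auto
  then obtain j0 where j0: "j0 \<in> Jk b k" "c = gl b k j0" using fl_cases[of i m k b] i by metis
  show ?thesis
  proof (intro set_eqI iffI)
   fix y assume y: "y \<in> c"
   then have "cb b k y = cb b k (Inr j0)" using j0(2) by (intro cb_eq) (simp add: gl_def)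
   moreover have "y \<in> W b k" using y gl_facts(1)[OF j0(1)] j0(2) by blast
   ultimately show "y \<in> {y\<in>W b k. cb b k y = c}" using j0(2) by (simp add: gl_def)
  next
   fix y assume "y \<in> {y\<in>W b k. cb b k y = c}"
   then show "y \<in> c" using cb_refl by blast
  qed
 qed
 have "\<bar>\<Sum>c\<in>?L. blk b m k c\<bar> \<le> (\<Sum>c\<in>?L. (sqrt (8 * L) + 1) * (\<Sum>i\<in>{i\<in>Ik m k. fl b k i = c}. pp i) +
   144 * exp (- L / 8) * (\<Sum>j\<in>{j\<in>Jk b k. gl b k j = c}. ?q j) + G * (1/4) ^ k * real (card c))"
 proof (rule order_trans[OF sum_abs], rule sum_mono)
  fix c assume "c \<in> ?L"
  then have c: "c \<in> Lab b m k" "\<not> card c < m" by auto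
  show "\<bar>blk b m k c\<bar> \<le> (sqrt (8 * L) + 1) * (\<Sum>i\<in>{i\<in>Ik m k. fl b k i = c}. pp i) +
    144 * exp (- L / 8) * (\<Sum>j\<in>{j\<in>Jk b k. gl b k j = c}. ?q j) + G * (1/4) ^ k * real (card c)"
   by (rule F_block[OF fg L m _ c], rule big)
 qed
 also have "... = (sqrt (8 * L) + 1) * (\<Sum>c\<in>?L. \<Sum>i\<in>{i\<in>Ik m k. fl b k i = c}. pp i) +
   144 * exp (- L / 8) * (\<Sum>c\<in>?L. \<Sum>j\<in>{j\<in>Jk b k. gl b k j = c}. ?q j) + G * (1/4) ^ k * (\<Sum>c\<in>?L. real (card c))"
  by (simp only: sum.distrib sum_distrib_left)
 also have "... \<le> (sqrt (8 * L) + 1) * (\<Sum>i\<in>Ik m k. pp i) +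
   144 * exp (- L / 8) * (\<Sum>j\<in>Jk b k. ?q j) + G * (1/4) ^ k * real (card (W b k))"
 proof (intro add_mono mult_left_mono)
  show "(\<Sum>c\<in>?L. \<Sum>i\<in>{i\<in>Ik m k. fl b k i = c}. pp i) \<le> (\<Sum>i\<in>Ik m k. pp i)"
   unfolding sum_by_label[OF finIJ(1) finL] by (intro sum_mono2) auto
  show "(\<Sum>c\<in>?L. \<Sum>j\<in>{j\<in>Jk b k. gl b k j = c}. ?q j) \<le> (\<Sum>j\<in>Jk b k. ?q j)"
   unfolding sum_by_label[OF finIJ(2) finL] by (intro sum_mono2) auto
  have "(\<Sum>c\<in>?L. real (card c)) = (\<Sum>c\<in>?L. \<Sum>y\<in>{y\<in>W b k. cb b k y = c}. 1)"
   using cW by (intro sum.cong refl) simp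
  also have "... \<le> (\<Sum>y\<in>W b k. 1)" unfolding sum_by_label[OF finW finL] by (intro sum_mono2) auto
  finally show "(\<Sum>c\<in>?L. real (card c)) \<le> real (card (W b k))" by simp
 qed (use L G in auto)
 finally show ?thesis by (simp only: mult.assoc)
qed

lemma geo4: "(\<Sum>k\<in>{k\<in>{..kmax}. l \<le> k}. (1/4::real) ^ k) \<le> 4 / 3 * (1/4) ^ l"
proof -
 have "(\<Sum>k\<in>{k\<in>{..kmax}. l \<le> k}. (1/4::real) ^ k) \<le> (\<Sum>k\<in>(\<lambda>r. l + r) ` {..kmax}. (1/4) ^ k)"
 proof (intro sum_mono2 subsetI)
  fix k assume "k \<in> {k\<in>{..kmax}. l \<le> k}"
  then show "k \<in> (\<lambda>r. l + r) ` {..kmax}" by (intro image_eqI[of _ _ "k - l"]) auto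
 qed auto
 also have "... = (1/4) ^ l * (\<Sum>r\<in>{..kmax}. (1/4) ^ r)" by (simp add: sum.reindex power_add sum_distrib_left)
 also have "(\<Sum>r\<in>{..kmax}. (1/4::real) ^ r) \<le> (\<Sum>r. (1/4) ^ r)" by (intro sum_le_suminf) auto
 also have "(\<Sum>r. (1/4::real) ^ r) = 4 / 3" by (subst suminf_geometric) auto
 finally show ?thesis by simp
qed

text \<open>A column counts at no more than \<open>dm + 1\<close> levels. In the entropy term a
  vertex \<open>y\<close> counts only from level \<open>lev y + b\<close> on, with weights
  \<open>(1/4) ^ k\<close>; the geometric series yields the factor \<open>(1/4) ^ b\<close> that
  offsets \<open>G\<close>. The constant 6 exceeds (4/3) * 4.\<close>

lemma F_total:
 assumes fg: "fargood b dm m L G" and L: "L \<ge> 0" and m: "m > 0" and G: "G \<ge> 0"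
  and big: "\<And>i j. i \<in> A ==> j \<in> A ==> a i j \<noteq> 0 ==> (a i j)\<^sup>2 * 4 ^ dm > 2"
 shows "\<bar>\<Sum>k\<in>{..kmax}. \<Sum>c\<in>{c\<in>Lab b m k. \<not> card c < m}. blk b m k c\<bar> \<le>
   4 * (sqrt (8 * L) + 1) + 576 * exp (- L / 8) * (real dm + 1) + 6 * G * (1/4) ^ b"
proof -
 have s4: "(\<Sum>i\<in>A. pp i) \<le> 4" "(\<Sum>j\<in>A. qq j) \<le> 4"
 proof -
  have "(\<Sum>i\<in>A. pp i) \<ge> 0" "(\<Sum>j\<in>A. qq j) \<ge> 0" by (auto intro: sum_nonneg)
  then show "(\<Sum>i\<in>A. pp i) \<le> 4" "(\<Sum>j\<in>A. qq j) \<le> 4" using tot2 by linarith+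
 qed
 have "\<bar>\<Sum>k\<in>{..kmax}. \<Sum>c\<in>{c\<in>Lab b m k. \<not> card c < m}. blk b m k c\<bar> \<le> (\<Sum>k\<in>{..kmax}. (sqrt (8 * L) + 1) * (\<Sum>i\<in>Ik m k. pp i) +
   144 * exp (- L / 8) * (\<Sum>j\<in>Jk b k. if k \<le> lev (Inr j) + dm then qq j else 0) + G * ((1/4) ^ k * real (card (W b k))))"
  by (rule order_trans[OF sum_abs], rule sum_mono, rule F_level[OF fg L m G], rule big)
 also have "... = (sqrt (8 * L) + 1) * (\<Sum>k\<in>{..kmax}. \<Sum>i\<in>Ik m k. pp i) +
   144 * exp (- L / 8) * (\<Sum>k\<in>{..kmax}. \<Sum>j\<in>Jk b k. if k \<le> lev (Inr j) + dm then qq j else 0) + G * (\<Sum>k\<in>{..kmax}. (1/4) ^ k * real (card (W b k)))"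
  by (simp only: sum.distrib sum_distrib_left)
 also have "... \<le> (sqrt (8 * L) + 1) * 4 + 144 * exp (- L / 8) * ((real dm + 1) * 4) + G * (6 * (1/4) ^ b)"
 proof (intro add_mono mult_left_mono)
  have "(\<Sum>k\<in>{..kmax}. \<Sum>i\<in>Ik m k. pp i) \<le> (\<Sum>k\<in>{..kmax}. \<Sum>i\<in>{i\<in>A. lev (Inl i) = k}. pp i)"
   by (intro sum_mono sum_mono2) (auto simp: Ik_def)
  also have "... = (\<Sum>i\<in>A. pp i)" using lev_le by (intro sum.group) (auto simp: VV_def)
  finally show "(\<Sum>k\<in>{..kmax}. \<Sum>i\<in>Ik m k. pp i) \<le> 4" using s4 by linarith
  have "(\<Sum>k\<in>{..kmax}. \<Sum>j\<in>Jk b k. if k \<le> lev (Inr j) + dm then qq j else 0) \<le>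
    (\<Sum>k\<in>{..kmax}. \<Sum>j\<in>{j\<in>A. lev (Inr j) \<le> k \<and> k \<le> lev (Inr j) + dm}. qq j)"
  proof (rule sum_mono)
   fix k
   have "(\<Sum>j\<in>Jk b k. if k \<le> lev (Inr j) + dm then qq j else 0) = (\<Sum>j\<in>{j\<in>Jk b k. k \<le> lev (Inr j) + dm}. qq j)"
    by (simp add: sum.inter_filter)
   also have "... \<le> (\<Sum>j\<in>{j\<in>A. lev (Inr j) \<le> k \<and> k \<le> lev (Inr j) + dm}. qq j)" by (intro sum_mono2) (auto simp: Jk_def)
   finally show "(\<Sum>j\<in>Jk b k. if k \<le> lev (Inr j) + dm then qq j else 0) \<le> (\<Sum>j\<in>{j\<in>A. lev (Inr j) \<le> k \<and> k \<le> lev (Inr j) + dm}. qq j)" .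
  qed
  also have "... = (\<Sum>j\<in>A. \<Sum>k\<in>{k\<in>{..kmax}. lev (Inr j) \<le> k \<and> k \<le> lev (Inr j) + dm}. qq j)"
   by (rule sum.swap_restrict) auto
  also have "... \<le> (\<Sum>j\<in>A. (real dm + 1) * qq j)"
  proof (rule sum_mono)
   fix j
   have "card {k\<in>{..kmax}. lev (Inr j) \<le> k \<and> k \<le> lev (Inr j) + dm} \<le> card {lev (Inr j)..lev (Inr j) + dm}"
    by (intro card_mono) auto
   then have "real (card {k\<in>{..kmax}. lev (Inr j) \<le> k \<and> k \<le> lev (Inr j) + dm}) \<le> real dm + 1" by simp
   then show "(\<Sum>k\<in>{k\<in>{..kmax}. lev (Inr j) \<le> k \<and> k \<le> lev (Inr j) + dm}. qq j) \<le> (real dm + 1) * qq j"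
    by (simp only: sum_constant) (rule mult_right_mono, auto)
  qed
  also have "... \<le> (real dm + 1) * 4" unfolding sum_distrib_left[symmetric] using s4 by (intro mult_left_mono) auto
  finally show "(\<Sum>k\<in>{..kmax}. \<Sum>j\<in>Jk b k. if k \<le> lev (Inr j) + dm then qq j else 0) \<le> (real dm + 1) * 4" .
  have "(\<Sum>k\<in>{..kmax}. (1/4::real) ^ k * real (card (W b k))) = (\<Sum>k\<in>{..kmax}. \<Sum>y\<in>{y\<in>VV A. lev y + b \<le> k}. (1/4) ^ k)"
   by (simp add: W_def mult.commute)
  also have "... = (\<Sum>y\<in>VV A. \<Sum>k\<in>{k\<in>{..kmax}. lev y + b \<le> k}. (1/4) ^ k)"
   by (rule sum.swap_restrict) auto
  also have "... \<le> (\<Sum>y\<in>VV A. 4 / 3 * (1/4) ^ (lev y + b))" by (intro sum_mono geo4)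
  also have "... = 4 / 3 * (1/4) ^ b * (\<Sum>y\<in>VV A. (1/4) ^ lev y)" by (simp add: power_add sum_distrib_left mult_ac)
  also have "... \<le> 4 / 3 * (1/4) ^ b * 4" by (intro mult_left_mono tot) auto
  also have "... \<le> 6 * (1/4) ^ b" by simp
  finally show "(\<Sum>k\<in>{..kmax}. (1/4::real) ^ k * real (card (W b k))) \<le> 6 * (1/4) ^ b" .
 qed (use L G in auto)
 finally show ?thesis by (simp add: algebra_simps)
qed

lemma rowlow_bound:
 assumes g: "colgood Z m" and Z: "Z \<ge> 0" and fg: "fargood b dm m L G" and L: "L \<ge> 0" and m: "m > 0" and G: "G \<ge> 0"
  and big: "\<And>i j. i \<in> A ==> j \<in> A ==> a i j \<noteq> 0 ==> (a i j)\<^sup>2 * 4 ^ dm > 2"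
 shows "\<bar>\<Sum>i\<in>A. \<Sum>j\<in>A. if rowlow b m i j then xx i j else 0\<bar> \<le>
   2 * Z * (1 + real b) + (4 * (sqrt (8 * L) + 1) + 576 * exp (- L / 8) * (real dm + 1) + 6 * G * (1/4) ^ b)"
proof -
 have F: "\<bar>\<Sum>k\<in>{..kmax}. \<Sum>c\<in>{c\<in>Lab b m k. \<not> card c < m}. blk b m k c\<bar> \<le>
   4 * (sqrt (8 * L) + 1) + 576 * exp (- L / 8) * (real dm + 1) + 6 * G * (1/4) ^ b"
  by (rule F_total[OF fg L m G], rule big)
 show ?thesis
  unfolding rowlow_sum level_split sum.distrib
  by (rule order_trans[OF abs_triangle_ineq add_mono[OF T_total[OF g Z, of b] F]])
qed

end

lemma sum_sqrt_mult_le: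
 assumes "\<And>c. c \<in> L ==> x c \<ge> 0" "\<And>c. c \<in> L ==> y c \<ge> (0::real)"
 shows "(\<Sum>c\<in>L. sqrt (x c * y c)) \<le> sqrt ((\<Sum>c\<in>L. x c) * (\<Sum>c\<in>L. y c))"
proof -
 have "(\<Sum>c\<in>L. sqrt (x c) * sqrt (y c))\<^sup>2 \<le> (\<Sum>c\<in>L. (sqrt (x c))\<^sup>2) * (\<Sum>c\<in>L. (sqrt (y c))\<^sup>2)"
  by (rule Cauchy_Schwarz_ineq_sum)
 also have "... = (\<Sum>c\<in>L. x c) * (\<Sum>c\<in>L. y c)" using assms by (intro arg_cong2[of _ _ _ _ "(*)"] sum.cong) auto
 finally have "(\<Sum>c\<in>L. sqrt (x c) * sqrt (y c)) \<le> sqrt ((\<Sum>c\<in>L. x c) * (\<Sum>c\<in>L. y c))"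
  by (rule real_le_rsqrt)
 then show ?thesis by (simp only: real_sqrt_mult)
qed

section \<open>Edges between levels at distance below \<open>b\<close>\<close>

context cfg
begin

definition frob :: "(nat + nat) set => real" where "frob K = (\<Sum>i\<in>rws K. \<Sum>j\<in>cls K. (a i j)\<^sup>2)"
definition tform :: "nat set => nat set => real" where
 "tform I J = bform a I J e (\<lambda>i. th (Inl i)) (\<lambda>j. th (Inr j))"

text \<open>The three terms come from sets on which an operator norm bound is available, from Hoeffding's
 inequality with entropy \<open>eta\<close>, and from the light edges outside the dense core.\<close>

definition nbd :: "real => real => real => (nat + nat) set => bool" where
 "nbd Z eta beta K \<longleftrightarrow> \<bar>tform (rws K) (cls K)\<bar> \<le>
   Z * sqrt (real (card (rws K)) * real (card (cls K))) + sqrt (eta * real (card K) * frob K) + beta * real (card K)"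

lemma frob_nonneg: "frob K \<ge> 0" by (auto simp: frob_def intro!: sum_nonneg)

lemma frob_mono: "finite K ==> C \<subseteq> K ==> frob C \<le> frob K"
proof -
 assume fin: "finite K" and sub: "C \<subseteq> K"
 have f: "finite (rws K)" "finite (cls K)" using fin finite_rws finite_cls by auto
 have "frob C \<le> (\<Sum>i\<in>rws C. \<Sum>j\<in>cls K. (a i j)\<^sup>2)"
  unfolding frob_def using f cls_mono[OF sub] by (intro sum_mono sum_mono2) auto
 also have "... \<le> frob K" unfolding frob_def using f rws_mono[OF sub] by (intro sum_mono2 sum_nonneg) auto
 finally show ?thesis .
qed

text \<open>The form splits into blocks over the components, since an edge has both ends in the same
  one. The three terms of \<open>nbd\<close> add up by the Cauchy-Schwarz inequality, because
  cardinalities and Frobenius masses of the components sum to at most those of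
  \<open>X\<close>.\<close>

lemma nb_ext:
 assumes X: "X \<subseteq> VV A" and nb: "\<And>x. x \<in> X ==> nbd Z eta beta (ccomp (adj A a) X x)"
  and nn: "Z \<ge> 0" "eta \<ge> 0" "beta \<ge> 0"
 shows "nbd Z eta beta X"
proof -
 have finW: "finite X" by (rule finite_subset[OF X finV])
 let ?I = "rws X" and ?J = "cls X"
 have fI: "finite ?I" "finite ?J" using finW finite_rws finite_cls by auto
 have IA: "?I \<subseteq> A" "?J \<subseteq> A" using X rws_sub cls_sub by auto
 let ?c = "ccomp (adj A a) X"
 let ?f = "\<lambda>i. ?c (Inl i)" and ?g = "\<lambda>j. ?c (Inr j)"
 let ?L = "?f ` ?I"
 let ?x = "\<lambda>i j. a i j * e i j * th (Inl i) * th (Inr j)"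
 have ceq: "?c y = ?c x" if "y \<in> ?c x" for x y by (rule comp_eq[OF adj_sym that])
 have csub: "?c x \<subseteq> X" if "x \<in> X" for x by (rule comp_sub[OF that])
 have cc: "{x\<in>X. ?c x = c} = c" if c: "c \<in> ?L" for c
 proof -
  obtain x0 where x0: "x0 \<in> X" "c = ?c x0" using c by (auto simp: rws_def)
  show ?thesis
  proof (intro set_eqI iffI)
   fix y assume "y \<in> {x\<in>X. ?c x = c}" then show "y \<in> c" using comp_refl[of y "adj A a" X] by auto
  next
   fix y assume "y \<in> c" then show "y \<in> {x\<in>X. ?c x = c}" using x0 csub[OF x0(1)] ceq[of y x0] by auto
  qed
 qed
 have r: "{i\<in>?I. ?f i = c} = rws c" "{j\<in>?J. ?g j = c} = cls c" if c: "c \<in> ?L" for c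
  using cc[OF c] by (auto simp: rws_def cls_def)
 have cW: "c \<subseteq> X" if "c \<in> ?L" for c using cc[OF that] by blast
 have nbc: "nbd Z eta beta c" if "c \<in> ?L" for c using that nb by (auto simp: rws_def)
 have "tform ?I ?J = (\<Sum>c\<in>?L. \<Sum>i\<in>{i\<in>?I. ?f i = c}. \<Sum>j\<in>{j\<in>?J. ?g j = c}. ?x i j)"
  unfolding tform_def bform_def
 proof (rule sum_labelled[OF fI])
  fix i j assume ij: "i \<in> ?I" "j \<in> ?J" "?x i j \<noteq> 0"
  then have "adj A a (Inl i) (Inr j)" using IA by (auto simp: wt_def)
  then show "?f i = ?g j" using ij by (intro comp_edge[OF adj_sym]) (auto simp: rws_def cls_def)
 qed
 also have "... = (\<Sum>c\<in>?L. tform (rws c) (cls c))"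
  using r by (intro sum.cong refl) (simp add: tform_def bform_def)
 finally have t: "tform ?I ?J = (\<Sum>c\<in>?L. tform (rws c) (cls c))" .
 have cr: "(\<Sum>c\<in>?L. real (card (rws c))) \<le> real (card ?I)"
 proof -
  have "(\<Sum>c\<in>?L. real (card (rws c))) = (\<Sum>c\<in>?L. \<Sum>i\<in>{i\<in>?I. ?f i = c}. 1)" using r by (intro sum.cong refl) simp
  also have "... \<le> (\<Sum>i\<in>?I. 1)" using fI by (subst sum_by_label) (auto intro!: card_mono)
  finally show ?thesis by simp
 qed
 have ccl: "(\<Sum>c\<in>?L. real (card (cls c))) \<le> real (card ?J)"
 proof -
  have "(\<Sum>c\<in>?L. real (card (cls c))) = (\<Sum>c\<in>?L. \<Sum>i\<in>{i\<in>?J. ?g i = c}. 1)" using r by (intro sum.cong refl) simp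
  also have "... \<le> (\<Sum>i\<in>?J. 1)" using fI by (subst sum_by_label) (auto intro!: card_mono)
  finally show ?thesis by simp
 qed
 have cd: "real (card c) = real (card (rws c)) + real (card (cls c))" if "c \<in> ?L" for c
  using card_VV[OF finite_subset[OF cW[OF that] finW]] by simp
 have ck: "(\<Sum>c\<in>?L. real (card c)) \<le> real (card X)"
  using cr ccl card_VV[OF finW] cd by (simp add: sum.distrib)
 have fr: "(\<Sum>c\<in>?L. frob c) \<le> frob X"
 proof -
  have "(\<Sum>c\<in>?L. frob c) \<le> (\<Sum>c\<in>?L. \<Sum>i\<in>{i\<in>?I. ?f i = c}. \<Sum>j\<in>?J. (a i j)\<^sup>2)"
  proof (rule sum_mono)
   fix c assume c: "c \<in> ?L"
   show "frob c \<le> (\<Sum>i\<in>{i\<in>?I. ?f i = c}. \<Sum>j\<in>?J. (a i j)\<^sup>2)"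
    unfolding frob_def r(1)[OF c] using fI cls_mono[OF cW[OF c]] by (intro sum_mono sum_mono2) auto
  qed
  also have "... \<le> frob X" unfolding frob_def using fI by (subst sum_by_label) (auto intro!: sum_mono2 sum_nonneg)
  finally show ?thesis .
 qed
 have "\<bar>tform ?I ?J\<bar> \<le> (\<Sum>c\<in>?L. Z * sqrt (real (card (rws c)) * real (card (cls c))) + sqrt (eta * real (card c) * frob c) + beta * real (card c))"
  unfolding t using nbc by (intro order_trans[OF sum_abs] sum_mono) (auto simp: nbd_def)
 also have "... = Z * (\<Sum>c\<in>?L. sqrt (real (card (rws c)) * real (card (cls c)))) + (\<Sum>c\<in>?L. sqrt ((eta * real (card c)) * frob c)) + beta * (\<Sum>c\<in>?L. real (card c))"
  by (simp only: sum.distrib sum_distrib_left)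
 also have "... \<le> Z * sqrt (real (card ?I) * real (card ?J)) + sqrt ((eta * real (card X)) * frob X) + beta * real (card X)"
 proof (intro add_mono mult_left_mono ck nn)
  show "(\<Sum>c\<in>?L. sqrt (real (card (rws c)) * real (card (cls c)))) \<le> sqrt (real (card ?I) * real (card ?J))"
   using cr ccl by (intro order_trans[OF sum_sqrt_mult_le] real_sqrt_le_mono mult_mono) (auto intro!: sum_nonneg)
  show "(\<Sum>c\<in>?L. sqrt ((eta * real (card c)) * frob c)) \<le> sqrt ((eta * real (card X)) * frob X)"
   using ck fr nn by (intro order_trans[OF sum_sqrt_mult_le] real_sqrt_le_mono mult_mono)
    (auto intro!: sum_nonneg mult_left_mono frob_nonneg simp flip: sum_distrib_left)
 qed
 finally show ?thesis unfolding nbd_def by simp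
qed

definition near :: "nat => nat => nat => bool" where "near b k l \<longleftrightarrow> k < l + b \<and> l < k + b"
definition Ikl :: "nat => nat => nat => nat set" where "Ikl m k l = {i\<in>A. lev (Inl i) = k \<and> m \<le> card (cb 0 (max k l) (Inl i))}"
definition Jkl :: "nat => nat => nat => nat set" where "Jkl m k l = {j\<in>A. lev (Inr j) = l \<and> m \<le> card (cb 0 (max k l) (Inr j))}"

lemma sm_edge:
 assumes "i \<in> A" "j \<in> A" "a i j \<noteq> 0"
 shows "cb 0 (max (lev (Inl i)) (lev (Inr j))) (Inl i) = cb 0 (max (lev (Inl i)) (lev (Inr j))) (Inr j)"
proof (rule cb_edge)
 show "near3 (adj A a) (Inl i) (Inr j)" using adj_ij[OF assms] by (auto simp: near3_def)
qed (use assms in \<open>auto simp: W_def VV_def\<close>)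

lemma near_sum:
 "(\<Sum>i\<in>A. \<Sum>j\<in>A. if near b (lev (Inl i)) (lev (Inr j)) \<and> \<not> sm m i j then xx i j else 0) =
  (\<Sum>k\<in>{..kmax}. \<Sum>l\<in>{l\<in>{..kmax}. near b k l}. \<Sum>i\<in>Ikl m k l. \<Sum>j\<in>Jkl m k l. xx i j)"
proof -
 let ?y = "\<lambda>i j. if near b (lev (Inl i)) (lev (Inr j)) \<and> \<not> sm m i j then xx i j else 0"
 have "(\<Sum>i\<in>A. \<Sum>j\<in>A. ?y i j) = (\<Sum>k\<in>{..kmax}. \<Sum>i\<in>{i\<in>A. lev (Inl i) = k}. \<Sum>j\<in>A. ?y i j)"
  using lev_le by (intro sum.group[symmetric]) (auto simp: VV_def)
 also have "... = (\<Sum>k\<in>{..kmax}. \<Sum>i\<in>{i\<in>A. lev (Inl i) = k}. \<Sum>l\<in>{..kmax}. \<Sum>j\<in>{j\<in>A. lev (Inr j) = l}. ?y i j)"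
  using lev_le by (intro sum.cong refl sum.group[symmetric]) (auto simp: VV_def)
 also have "... = (\<Sum>k\<in>{..kmax}. \<Sum>l\<in>{..kmax}. \<Sum>i\<in>{i\<in>A. lev (Inl i) = k}. \<Sum>j\<in>{j\<in>A. lev (Inr j) = l}. ?y i j)"
  by (intro sum.cong refl sum.swap)
 also have "... = (\<Sum>k\<in>{..kmax}. \<Sum>l\<in>{..kmax}. if near b k l then \<Sum>i\<in>Ikl m k l. \<Sum>j\<in>Jkl m k l. xx i j else 0)"
 proof (rule sum.cong[OF refl], rule sum.cong[OF refl])
  fix k l
  let ?z = "\<lambda>i j. if i \<in> Ikl m k l \<and> j \<in> Jkl m k l then xx i j else 0"
  have "?y i j = (if near b k l then ?z i j else 0)" if ij: "i \<in> A" "lev (Inl i) = k" "j \<in> A" "lev (Inr j) = l" for i j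
  proof (cases "a i j = 0")
   case False
   have "sm m i j \<longleftrightarrow> \<not> (i \<in> Ikl m k l \<and> j \<in> Jkl m k l)"
    using sm_edge[OF ij(1,3) False] ij by (auto simp: sm_def Ikl_def Jkl_def)
   then show ?thesis using ij by auto
  qed (simp add: xx_def)
  then have "(\<Sum>i\<in>{i\<in>A. lev (Inl i) = k}. \<Sum>j\<in>{j\<in>A. lev (Inr j) = l}. ?y i j) =
   (\<Sum>i\<in>{i\<in>A. lev (Inl i) = k}. \<Sum>j\<in>{j\<in>A. lev (Inr j) = l}. if near b k l then ?z i j else 0)"
   by (intro sum.cong refl) auto
  also have "... = (if near b k l then \<Sum>i\<in>{i\<in>A. lev (Inl i) = k}. \<Sum>j\<in>{j\<in>A. lev (Inr j) = l}. ?z i j else 0)" by simp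
  also have "(\<Sum>i\<in>{i\<in>A. lev (Inl i) = k}. \<Sum>j\<in>{j\<in>A. lev (Inr j) = l}. ?z i j) = (\<Sum>i\<in>Ikl m k l. \<Sum>j\<in>{j\<in>A. lev (Inr j) = l}. ?z i j)"
   by (intro sum.mono_neutral_right) (auto simp: Ikl_def)
  also have "... = (\<Sum>i\<in>Ikl m k l. \<Sum>j\<in>Jkl m k l. ?z i j)"
   by (intro sum.cong refl sum.mono_neutral_right) (auto simp: Jkl_def)
  also have "... = (\<Sum>i\<in>Ikl m k l. \<Sum>j\<in>Jkl m k l. xx i j)" by (intro sum.cong refl) auto
  finally show "(\<Sum>i\<in>{i\<in>A. lev (Inl i) = k}. \<Sum>j\<in>{j\<in>A. lev (Inr j) = l}. ?y i j) =
    (if near b k l then \<Sum>i\<in>Ikl m k l. \<Sum>j\<in>Jkl m k l. xx i j else 0)" .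
 qed
 also have "... = (\<Sum>k\<in>{..kmax}. \<Sum>l\<in>{l\<in>{..kmax}. near b k l}. \<Sum>i\<in>Ikl m k l. \<Sum>j\<in>Jkl m k l. xx i j)"
  by (rule sum.cong[OF refl], rule sum.inter_filter[symmetric]) simp
 finally show ?thesis .
qed

definition Uk :: "nat => nat set" where "Uk k = {i\<in>A. lev (Inl i) = k}"
definition Ul :: "nat => nat set" where "Ul l = {j\<in>A. lev (Inr j) = l}"

text \<open>\<open>nbd\<close> is scaled by \<open>h\<close>, the product of the two entry sizes.
  The parameter \<open>psi\<close> weighs vertex mass against Frobenius mass and is fixed when the
  pairs are summed. In the term with \<open>beta\<close>, replacing the product of the two sizes by
  the square of either one costs \<open>2 ^ b\<close>.\<close>

lemma near_pair:
 assumes nb: "\<And>X. X \<subseteq> VV A ==> nbd Z eta beta X" and nn: "Z \<ge> 0" "eta \<ge> 0" "beta \<ge> 0" and psi: "psi > 0" and nr: "near b k l"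
 shows "\<bar>\<Sum>i\<in>Ikl m k l. \<Sum>j\<in>Jkl m k l. xx i j\<bar> \<le>
  (Z / 2 + beta * 2 ^ b + sqrt eta / (2 * psi)) * ((\<Sum>i\<in>Uk k. pp i) + (\<Sum>j\<in>Ul l. qq j)) +
  sqrt eta * psi / 2 * ((\<Sum>j\<in>Ul l. qq j * (\<Sum>i\<in>Uk k. (a i j)\<^sup>2)) + (\<Sum>i\<in>Uk k. pp i * (\<Sum>j\<in>Ul l. (a i j)\<^sup>2)))"
proof -
 let ?I = "Ikl m k l" and ?J = "Jkl m k l"
 let ?X = "Inl ` ?I \<union> Inr ` ?J"
 have X: "?X \<subseteq> VV A" by (auto simp: VV_def Ikl_def Jkl_def)
 have rc: "rws ?X = ?I" "cls ?X = ?J" by (auto simp: rws_def cls_def)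
 have sub: "?I \<subseteq> Uk k" "?J \<subseteq> Ul l" by (auto simp: Ikl_def Jkl_def Uk_def Ul_def)
 have fin: "finite (Uk k)" "finite (Ul l)" "finite ?I" "finite ?J" by (auto simp: Ikl_def Jkl_def Uk_def Ul_def)
 have cW: "card ?X = card ?I + card ?J" using card_VV[of ?X] fin rc by simp
 define x where "x = (1/4::real) ^ k * real (card ?I)"
 define y where "y = (1/4::real) ^ l * real (card ?J)"
 define h where "h = (1/2::real) ^ k * (1/2) ^ l"
 define F where "F = frob ?X"
 have F0: "F \<ge> 0" by (simp add: F_def frob_nonneg)
 have xy0: "x \<ge> 0" "y \<ge> 0" by (auto simp: x_def y_def)
 have h0: "h > 0" by (simp add: h_def)
 have hh: "h * h = (1/4) ^ k * (1/4) ^ l" by (simp add: h_def power_mult_distrib[symmetric] mult_ac)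
 have b1: "(\<Sum>i\<in>?I. \<Sum>j\<in>?J. xx i j) = h * tform ?I ?J"
  unfolding tform_def bform_def sum_distrib_left
  by (intro sum.cong refl) (auto simp: xx_def sr_def tc_def u_def h_def Ikl_def Jkl_def)
 have "\<bar>tform ?I ?J\<bar> \<le> Z * sqrt (real (card ?I) * real (card ?J)) + sqrt (eta * real (card ?X) * F) + beta * real (card ?X)"
  using nb[OF X] unfolding nbd_def rc F_def .
 then have "h * \<bar>tform ?I ?J\<bar> \<le> h * (Z * sqrt (real (card ?I) * real (card ?J)) + sqrt (eta * real (card ?X) * F) + beta * real (card ?X))"
  using h0 by (intro mult_left_mono) auto
 then have main: "\<bar>\<Sum>i\<in>?I. \<Sum>j\<in>?J. xx i j\<bar> \<le> Z * (h * sqrt (real (card ?I) * real (card ?J))) + h * sqrt (eta * real (card ?X) * F) + beta * (h * real (card ?X))"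
  unfolding b1 using h0 by (simp add: abs_mult algebra_simps)
 have t1: "h * sqrt (real (card ?I) * real (card ?J)) \<le> (x + y) / 2"
 proof -
  have "h * sqrt (real (card ?I) * real (card ?J)) = sqrt ((h * h) * (real (card ?I) * real (card ?J)))" using h0 by (simp add: real_sqrt_mult)
  also have "... = sqrt (x * y)" unfolding hh by (simp add: x_def y_def mult_ac)
  also have "... \<le> (x + y) / 2" using xy0 by (rule arith_geo_mean_sqrt)
  finally show ?thesis .
 qed
 have t3: "h * real (card ?X) \<le> 2 ^ b * (x + y)"
 proof -
  have p: "(1/2::real) ^ l \<le> 2 ^ b * (1/2) ^ k" if "k < l + b" for k l
  proof -
   have "(1/2::real) ^ (l + b) \<le> (1/2) ^ k" using that by (intro power_decreasing) auto
   then show ?thesis by (simp add: power_add power_one_over field_simps)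
  qed
  have q: "(1/4::real) ^ k = (1/2) ^ k * (1/2) ^ k" for k by (simp flip: power_mult_distrib)
  have "h \<le> 2 ^ b * (1/4) ^ k" unfolding h_def q using p[of k l] nr by (simp add: near_def mult_left_mono mult.left_commute)
  moreover have "h \<le> 2 ^ b * (1/4) ^ l" unfolding h_def q using p[of l k] nr by (simp add: near_def mult_right_mono mult.assoc[symmetric])
  ultimately have "h * real (card ?I) + h * real (card ?J) \<le> 2 ^ b * (1/4) ^ k * real (card ?I) + 2 ^ b * (1/4) ^ l * real (card ?J)"
   by (intro add_mono mult_right_mono) auto
  then show ?thesis unfolding cW x_def y_def by (simp add: algebra_simps)
 qed
 have t2: "h * sqrt (eta * real (card ?X) * F) \<le> sqrt eta * ((x + y) / (2 * psi) + psi / 2 * ((1/4) ^ l * F + (1/4) ^ k * F))"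
 proof -
  have am: "sqrt (s * t) \<le> s / (2 * psi) + psi / 2 * t" if "s \<ge> 0" "t \<ge> 0" for s t
  proof -
   have "sqrt ((s / psi) * (psi * t)) \<le> (s / psi + psi * t) / 2" using that psi by (intro arith_geo_mean_sqrt) auto
   then show ?thesis using psi by (simp add: field_simps)
  qed
  have "h * sqrt (eta * real (card ?X) * F) = sqrt ((h * h) * (eta * real (card ?X) * F))" using h0 by (simp add: real_sqrt_mult)
  also have "(h * h) * (eta * real (card ?X) * F) = eta * (x * ((1/4) ^ l * F) + y * ((1/4) ^ k * F))"
   unfolding hh cW by (simp add: x_def y_def algebra_simps)
  also have "sqrt ... = sqrt eta * sqrt (x * ((1/4) ^ l * F) + y * ((1/4) ^ k * F))" by (rule real_sqrt_mult)
  also have "... \<le> sqrt eta * (sqrt (x * ((1/4) ^ l * F)) + sqrt (y * ((1/4) ^ k * F)))"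
   using nn xy0 F0 by (intro mult_left_mono sqrt_add_le_add_sqrt) auto
  also have "... \<le> sqrt eta * ((x / (2 * psi) + psi / 2 * ((1/4) ^ l * F)) + (y / (2 * psi) + psi / 2 * ((1/4) ^ k * F)))"
   using nn xy0 F0 by (intro mult_left_mono add_mono am) auto
  finally show ?thesis by (simp add: add_divide_distrib algebra_simps)
 qed
 have x: "x \<le> (\<Sum>i\<in>Uk k. pp i)"
 proof -
  have "x \<le> (1/4) ^ k * real (card (Uk k))" unfolding x_def using sub fin by (intro mult_left_mono) (auto intro!: card_mono)
  also have "... = (\<Sum>i\<in>Uk k. pp i)" by (simp add: Uk_def)
  finally show ?thesis .
 qed
 have y: "y \<le> (\<Sum>j\<in>Ul l. qq j)"
 proof -
  have "y \<le> (1/4) ^ l * real (card (Ul l))" unfolding y_def using sub fin by (intro mult_left_mono) (auto intro!: card_mono)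
  also have "... = (\<Sum>j\<in>Ul l. qq j)" by (simp add: Ul_def)
  finally show ?thesis .
 qed
 have FF: "F \<le> (\<Sum>i\<in>Uk k. \<Sum>j\<in>Ul l. (a i j)\<^sup>2)"
 proof -
  have "F \<le> (\<Sum>i\<in>?I. \<Sum>j\<in>Ul l. (a i j)\<^sup>2)" unfolding F_def frob_def rc using fin sub by (intro sum_mono sum_mono2) auto
  also have "... \<le> (\<Sum>i\<in>Uk k. \<Sum>j\<in>Ul l. (a i j)\<^sup>2)" using fin sub by (intro sum_mono2 sum_nonneg) auto
  finally show ?thesis .
 qed
 have f1: "(1/4) ^ l * F \<le> (\<Sum>j\<in>Ul l. qq j * (\<Sum>i\<in>Uk k. (a i j)\<^sup>2))"
 proof -
  have "(1/4) ^ l * F \<le> (1/4) ^ l * (\<Sum>i\<in>Uk k. \<Sum>j\<in>Ul l. (a i j)\<^sup>2)" by (intro mult_left_mono FF) auto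
  also have "... = (\<Sum>j\<in>Ul l. (1/4) ^ l * (\<Sum>i\<in>Uk k. (a i j)\<^sup>2))" by (subst sum.swap) (simp add: sum_distrib_left)
  also have "... = (\<Sum>j\<in>Ul l. qq j * (\<Sum>i\<in>Uk k. (a i j)\<^sup>2))" by (intro sum.cong) (auto simp: Ul_def)
  finally show ?thesis .
 qed
 have f2: "(1/4) ^ k * F \<le> (\<Sum>i\<in>Uk k. pp i * (\<Sum>j\<in>Ul l. (a i j)\<^sup>2))"
 proof -
  have "(1/4) ^ k * F \<le> (1/4) ^ k * (\<Sum>i\<in>Uk k. \<Sum>j\<in>Ul l. (a i j)\<^sup>2)" by (intro mult_left_mono FF) auto
  also have "... = (\<Sum>i\<in>Uk k. pp i * (\<Sum>j\<in>Ul l. (a i j)\<^sup>2))" unfolding sum_distrib_left[of "(1/4) ^ k"] by (intro sum.cong) (auto simp: Uk_def sum_distrib_left)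
  finally show ?thesis .
 qed
 define p where "p = (\<Sum>i\<in>Uk k. pp i)"
 define q where "q = (\<Sum>j\<in>Ul l. qq j)"
 have "\<bar>\<Sum>i\<in>?I. \<Sum>j\<in>?J. xx i j\<bar> \<le> Z * ((x + y) / 2) + sqrt eta * ((x + y) / (2 * psi) + psi / 2 * ((1/4) ^ l * F + (1/4) ^ k * F)) + beta * (2 ^ b * (x + y))"
  by (rule order_trans[OF main]) (intro add_mono mult_left_mono t1 t2 t3 nn)
 also have "... \<le> Z * ((p + q) / 2) + sqrt eta * ((p + q) / (2 * psi) + psi / 2 * ((\<Sum>j\<in>Ul l. qq j * (\<Sum>i\<in>Uk k. (a i j)\<^sup>2)) + (\<Sum>i\<in>Uk k. pp i * (\<Sum>j\<in>Ul l. (a i j)\<^sup>2)))) + beta * (2 ^ b * (p + q))"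
  using x y f1 f2 nn psi unfolding p_def[symmetric] q_def[symmetric]
  by (intro add_mono mult_left_mono divide_right_mono) auto
 finally show ?thesis unfolding p_def[symmetric] q_def[symmetric] using psi by (simp add: field_simps)
qed

lemma near_card: "card {l\<in>{..kmax}. near b k l} \<le> 2 * b" "card {l\<in>{..kmax}. near b l k} \<le> 2 * b"
proof -
 have "{l\<in>{..kmax}. near b k l} \<subseteq> {k + 1 - b..<k + b}" by (auto simp: near_def)
 then have "card {l\<in>{..kmax}. near b k l} \<le> card {k + 1 - b..<k + b}" by (intro card_mono) auto
 also have "... \<le> 2 * b" by simp
 finally show "card {l\<in>{..kmax}. near b k l} \<le> 2 * b" .
 moreover have "near b l k = near b k l" for l by (auto simp: near_def)
 ultimately show "card {l\<in>{..kmax}. near b l k} \<le> 2 * b" by simp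
qed

lemma sum_Uk: "(\<Sum>k\<in>{..kmax}. \<Sum>i\<in>Uk k. f i) = (\<Sum>i\<in>A. f i)" and sum_Ul: "(\<Sum>k\<in>{..kmax}. \<Sum>i\<in>Ul k. f i) = (\<Sum>i\<in>A. f i)"
 unfolding Uk_def Ul_def using lev_le by (auto intro!: sum.group simp: VV_def)

text \<open>A level has at most \<open>2 * b\<close> partners, which multiplies the vertex masses by
  \<open>2 * b\<close>; the Frobenius terms sum over all pairs without loss, since rows and columns
  have norm at most 1. The choice \<open>psi = sqrt (2 * real b)\<close> balances both and gives
  \<open>sqrt (b * eta)\<close> up to constants, instead of \<open>b * sqrt eta\<close>.\<close>

lemma near_bound:
 assumes nb: "\<And>X. X \<subseteq> VV A ==> nbd Z eta beta X" and nn: "Z \<ge> 0" "eta \<ge> 0" "beta \<ge> 0" and b: "b > 0"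
 shows "\<bar>\<Sum>i\<in>A. \<Sum>j\<in>A. if near b (lev (Inl i)) (lev (Inr j)) \<and> \<not> sm m i j then xx i j else 0\<bar> \<le>
   4 * real b * Z + 8 * real b * 2 ^ b * beta + 4 * sqrt (2 * real b * eta)"
proof -
 define psi where "psi = sqrt (2 * real b)"
 have psi: "psi > 0" "psi * psi = 2 * real b" using b by (auto simp: psi_def)
 define p where "p = (\<lambda>k. \<Sum>i\<in>Uk k. pp i)"
 define q where "q = (\<lambda>l. \<Sum>j\<in>Ul l. qq j)"
 define f1 where "f1 = (\<lambda>k l. \<Sum>j\<in>Ul l. qq j * (\<Sum>i\<in>Uk k. (a i j)\<^sup>2))"
 define f2 where "f2 = (\<lambda>k l. \<Sum>i\<in>Uk k. pp i * (\<Sum>j\<in>Ul l. (a i j)\<^sup>2))"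
 define c1 where "c1 = Z / 2 + beta * 2 ^ b + sqrt eta / (2 * psi)"
 define c2 where "c2 = sqrt eta * psi / 2"
 have c: "c1 \<ge> 0" "c2 \<ge> 0" using nn psi by (auto simp: c1_def c2_def)
 have fU: "finite (Uk k)" "finite (Ul k)" for k by (auto simp: Uk_def Ul_def)
 have pq0: "p k \<ge> 0" "q k \<ge> 0" "f1 k l \<ge> 0" "f2 k l \<ge> 0" for k l
  by (auto simp: p_def q_def f1_def f2_def intro!: sum_nonneg mult_nonneg_nonneg)
 let ?N = "\<lambda>k. {l\<in>{..kmax}. near b k l}"
 have sp: "(\<Sum>k\<in>{..kmax}. p k) = (\<Sum>i\<in>A. pp i)" "(\<Sum>l\<in>{..kmax}. q l) = (\<Sum>j\<in>A. qq j)"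
  unfolding p_def q_def by (rule sum_Uk, rule sum_Ul)
 have 1: "(\<Sum>k\<in>{..kmax}. \<Sum>l\<in>?N k. p k) \<le> 2 * real b * (\<Sum>i\<in>A. pp i)"
 proof -
  have "(\<Sum>k\<in>{..kmax}. \<Sum>l\<in>?N k. p k) \<le> (\<Sum>k\<in>{..kmax}. 2 * real b * p k)"
  proof (rule sum_mono)
   fix k
   have "(\<Sum>l\<in>?N k. p k) = real (card (?N k)) * p k" by simp
   also have "... \<le> real (2 * b) * p k" using near_card(1)[of b k] pq0 by (intro mult_right_mono) (simp_all only: of_nat_le_iff)
   finally show "(\<Sum>l\<in>?N k. p k) \<le> 2 * real b * p k" by simp
  qed
  then show ?thesis unfolding sp(1)[symmetric] by (simp add: sum_distrib_left)
 qed
 have 2: "(\<Sum>k\<in>{..kmax}. \<Sum>l\<in>?N k. q l) \<le> 2 * real b * (\<Sum>j\<in>A. qq j)"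
 proof -
  have "(\<Sum>k\<in>{..kmax}. \<Sum>l\<in>?N k. q l) = (\<Sum>l\<in>{..kmax}. \<Sum>k\<in>{k\<in>{..kmax}. near b k l}. q l)"
   by (rule sum.swap_restrict) auto
  also have "... \<le> (\<Sum>k\<in>{..kmax}. 2 * real b * q k)"
  proof (rule sum_mono)
   fix l
   have "(\<Sum>k\<in>{k\<in>{..kmax}. near b k l}. q l) = real (card {k\<in>{..kmax}. near b k l}) * q l" by simp
   also have "... \<le> real (2 * b) * q l" using near_card(2)[of b l] pq0 by (intro mult_right_mono) (simp_all only: of_nat_le_iff)
   finally show "(\<Sum>k\<in>{k\<in>{..kmax}. near b k l}. q l) \<le> 2 * real b * q l" by simp
  qed
  finally show ?thesis unfolding sp(2)[symmetric] by (simp add: sum_distrib_left)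
 qed
 have 3: "(\<Sum>k\<in>{..kmax}. \<Sum>l\<in>?N k. f1 k l) \<le> (\<Sum>j\<in>A. qq j)"
 proof -
  have "(\<Sum>k\<in>{..kmax}. \<Sum>l\<in>?N k. f1 k l) \<le> (\<Sum>k\<in>{..kmax}. \<Sum>l\<in>{..kmax}. f1 k l)"
   using pq0 by (intro sum_mono sum_mono2) auto
  also have "... = (\<Sum>l\<in>{..kmax}. \<Sum>j\<in>Ul l. \<Sum>k\<in>{..kmax}. qq j * (\<Sum>i\<in>Uk k. (a i j)\<^sup>2))"
   unfolding f1_def by (subst sum.swap) (intro sum.cong refl sum.swap)
  also have "... = (\<Sum>j\<in>A. qq j * (\<Sum>i\<in>A. (a i j)\<^sup>2))"
   unfolding sum_distrib_left[symmetric] sum_Uk by (rule sum_Ul)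
  also have "... \<le> (\<Sum>j\<in>A. qq j * 1)" using col by (intro sum_mono mult_left_mono) auto
  finally show ?thesis by simp
 qed
 have 4: "(\<Sum>k\<in>{..kmax}. \<Sum>l\<in>?N k. f2 k l) \<le> (\<Sum>i\<in>A. pp i)"
 proof -
  have "(\<Sum>k\<in>{..kmax}. \<Sum>l\<in>?N k. f2 k l) \<le> (\<Sum>k\<in>{..kmax}. \<Sum>l\<in>{..kmax}. f2 k l)"
   using pq0 by (intro sum_mono sum_mono2) auto
  also have "... = (\<Sum>k\<in>{..kmax}. \<Sum>i\<in>Uk k. \<Sum>l\<in>{..kmax}. pp i * (\<Sum>j\<in>Ul l. (a i j)\<^sup>2))"
   unfolding f2_def by (intro sum.cong refl sum.swap)
  also have "... = (\<Sum>i\<in>A. pp i * (\<Sum>j\<in>A. (a i j)\<^sup>2))"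
   unfolding sum_distrib_left[symmetric] sum_Ul by (rule sum_Uk)
  also have "... \<le> (\<Sum>i\<in>A. pp i * 1)" using row by (intro sum_mono mult_left_mono) auto
  finally show ?thesis by simp
 qed
 have "\<bar>\<Sum>k\<in>{..kmax}. \<Sum>l\<in>?N k. \<Sum>i\<in>Ikl m k l. \<Sum>j\<in>Jkl m k l. xx i j\<bar> \<le> (\<Sum>k\<in>{..kmax}. \<Sum>l\<in>?N k. c1 * (p k + q l) + c2 * (f1 k l + f2 k l))"
 proof (rule order_trans[OF sum_abs], rule sum_mono, rule order_trans[OF sum_abs], rule sum_mono)
  fix k l assume "l \<in> ?N k"
  then show "\<bar>\<Sum>i\<in>Ikl m k l. \<Sum>j\<in>Jkl m k l. xx i j\<bar> \<le> c1 * (p k + q l) + c2 * (f1 k l + f2 k l)"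
   using near_pair[OF nb nn psi(1), of b k l m] unfolding c1_def c2_def p_def q_def f1_def f2_def by simp
 qed
 also have "... = c1 * ((\<Sum>k\<in>{..kmax}. \<Sum>l\<in>?N k. p k) + (\<Sum>k\<in>{..kmax}. \<Sum>l\<in>?N k. q l)) + c2 * ((\<Sum>k\<in>{..kmax}. \<Sum>l\<in>?N k. f1 k l) + (\<Sum>k\<in>{..kmax}. \<Sum>l\<in>?N k. f2 k l))"
  by (simp only: sum.distrib sum_distrib_left distrib_left)
 also have "... \<le> c1 * (2 * real b * 4) + c2 * 4"
 proof (intro add_mono mult_left_mono c)
  have "(\<Sum>k\<in>{..kmax}. \<Sum>l\<in>?N k. p k) + (\<Sum>k\<in>{..kmax}. \<Sum>l\<in>?N k. q l) \<le> 2 * real b * ((\<Sum>i\<in>A. pp i) + (\<Sum>j\<in>A. qq j))"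
   using 1 2 by (simp add: distrib_left)
  also have "... \<le> 2 * real b * 4" by (intro mult_left_mono tot2) auto
  finally show "(\<Sum>k\<in>{..kmax}. \<Sum>l\<in>?N k. p k) + (\<Sum>k\<in>{..kmax}. \<Sum>l\<in>?N k. q l) \<le> 2 * real b * 4" .
  show "(\<Sum>k\<in>{..kmax}. \<Sum>l\<in>?N k. f1 k l) + (\<Sum>k\<in>{..kmax}. \<Sum>l\<in>?N k. f2 k l) \<le> 4" using 3 4 tot2 by linarith
 qed
 also have "... = 4 * real b * Z + 8 * real b * 2 ^ b * beta + (sqrt eta * (4 * real b / psi) + sqrt eta * psi * 2)"
  by (simp add: c1_def c2_def algebra_simps)
 also have "4 * real b / psi = 2 * psi" using psi by (simp add: field_simps)
 also have "sqrt eta * (2 * psi) + sqrt eta * psi * 2 = 4 * sqrt (2 * real b * eta)" by (simp add: psi_def real_sqrt_mult)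
 finally show ?thesis unfolding near_sum .
qed

text \<open>One summand of \<open>super\<close> at either end of the edge already bounds the
  difference of the levels.\<close>

lemma window:
 assumes ij: "i \<in> A" "j \<in> A" "a i j \<noteq> 0" and big: "(a i j)\<^sup>2 * 4 ^ b > 8"
 shows "lev (Inl i) < lev (Inr j) + b" "lev (Inr j) < lev (Inl i) + b"
proof -
 have V: "Inl i \<in> VV A" "Inr j \<in> VV A" using ij by (auto simp: VV_def)
 have *: "k < l + b" if "(a i j)\<^sup>2 * (1/4) ^ l \<le> 8 * (1/4) ^ k" for k l
 proof (rule ccontr)
  assume "\<not> k < l + b"
  then have "(1/4::real) ^ k \<le> (1/4) ^ (l + b)" by (intro power_decreasing) auto
  then have "(a i j)\<^sup>2 * (1/4) ^ l \<le> 8 * ((1/4) ^ l * (1/4) ^ b)" using that unfolding power_add by linarith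
  then have "(1/4) ^ l * (a i j)\<^sup>2 \<le> (1/4) ^ l * (8 * (1/4) ^ b)" by (simp only: mult_ac)
  then have "(a i j)\<^sup>2 \<le> 8 * (1/4) ^ b" by (subst (asm) mult_le_cancel_left_pos) auto
  then show False using big by (simp add: power_one_over field_simps)
 qed
 have "wt A a (Inl i) (Inr j) * (1/4) ^ lev (Inr j) \<le> (\<Sum>y\<in>VV A. wt A a (Inl i) y * (1/4) ^ lev y)"
  using V finV by (intro member_le_sum[of "Inr j" "VV A" "\<lambda>y. wt A a (Inl i) y * (1/4) ^ lev y"]) (auto simp: wt_nonneg)
 then have "(a i j)\<^sup>2 * (1/4) ^ lev (Inr j) \<le> 8 * (1/4) ^ lev (Inl i)" using super[OF V(1)] ij by (simp add: wt_def)
 then show "lev (Inl i) < lev (Inr j) + b" by (rule *)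
 have "wt A a (Inr j) (Inl i) * (1/4) ^ lev (Inl i) \<le> (\<Sum>y\<in>VV A. wt A a (Inr j) y * (1/4) ^ lev y)"
  using V finV by (intro member_le_sum[of "Inl i" "VV A" "\<lambda>y. wt A a (Inr j) y * (1/4) ^ lev y"]) (auto simp: wt_nonneg)
 then have "(a i j)\<^sup>2 * (1/4) ^ lev (Inl i) \<le> 8 * (1/4) ^ lev (Inr j)" using super[OF V(2)] ij by (simp add: wt_def)
 then show "lev (Inr j) < lev (Inl i) + b" by (rule *)
qed

text \<open>When all nonzero entries are large, \<open>window\<close> makes every edge near; with
  \<open>m = 0\<close> no edge counts as small.\<close>

lemma total_near:
 assumes nb: "\<And>X. X \<subseteq> VV A ==> nbd Z eta 0 X" and nn: "Z \<ge> 0" "eta \<ge> 0" and b: "b > 0"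
  and big: "\<And>i j. i \<in> A ==> j \<in> A ==> a i j \<noteq> 0 ==> (a i j)\<^sup>2 * 4 ^ b > 8"
 shows "\<bar>\<Sum>i\<in>A. \<Sum>j\<in>A. xx i j\<bar> \<le> 4 * real b * Z + 4 * sqrt (2 * real b * eta)"
proof -
 have "(\<Sum>i\<in>A. \<Sum>j\<in>A. xx i j) = (\<Sum>i\<in>A. \<Sum>j\<in>A. if near b (lev (Inl i)) (lev (Inr j)) \<and> \<not> sm 0 i j then xx i j else 0)"
 proof (intro sum.cong refl)
  fix i j assume ij: "i \<in> A" "j \<in> A"
  show "xx i j = (if near b (lev (Inl i)) (lev (Inr j)) \<and> \<not> sm 0 i j then xx i j else 0)"
   using window[OF ij] big[OF ij] by (auto simp: near_def sm_def xx_def)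
 qed
 then show ?thesis using near_bound[OF nb nn(1,2) order_refl b, of 0] by simp
qed

lemma sqn_th:
 assumes "K \<subseteq> VV A"
 shows "sqn (rws K) (\<lambda>i. th (Inl i)) = real (card (rws K))" "sqn (cls K) (\<lambda>j. th (Inr j)) = real (card (cls K))"
proof -
 have "sqn (rws K) (\<lambda>i. th (Inl i)) = (\<Sum>i\<in>rws K. 1)" unfolding sqn_def using assms by (intro sum.cong refl th) (auto simp: rws_def)
 then show "sqn (rws K) (\<lambda>i. th (Inl i)) = real (card (rws K))" by simp
 have "sqn (cls K) (\<lambda>j. th (Inr j)) = (\<Sum>j\<in>cls K. 1)" unfolding sqn_def using assms by (intro sum.cong refl th) (auto simp: cls_def)
 then show "sqn (cls K) (\<lambda>j. th (Inr j)) = real (card (cls K))" by simp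
qed

lemma opb_nbd:
 assumes K: "K \<subseteq> VV A" and o: "opb Z a A (cls K) e" and eta: "eta \<ge> 0" and beta: "beta \<ge> 0"
 shows "nbd Z eta beta K"
proof -
 have finK: "finite K" by (rule finite_subset[OF K finV])
 have fr: "finite (cls K)" using finK finite_cls by auto
 from opb_abs[OF o finA fr rws_sub[OF K] order_refl]
 have "\<bar>tform (rws K) (cls K)\<bar> \<le> Z * sqrt (sqn (rws K) (\<lambda>i. th (Inl i))) * sqrt (sqn (cls K) (\<lambda>j. th (Inr j)))"
  unfolding tform_def .
 then have "\<bar>tform (rws K) (cls K)\<bar> \<le> Z * sqrt (real (card (rws K)) * real (card (cls K)))"
  unfolding sqn_th[OF K] by (simp only: real_sqrt_mult mult.assoc)
 moreover have "sqrt (eta * real (card K) * frob K) \<ge> 0" "beta * real (card K) \<ge> 0" using eta beta frob_nonneg[of K] by auto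
 ultimately show ?thesis unfolding nbd_def by linarith
qed

text \<open>Below \<open>m\<close> vertices \<open>colgood\<close> suffices. Above, the light edges
  are bounded by \<open>light\<close>, and the core is the union of its components; a vertex keeps
  its whole core mass inside its own component, so these are dense and \<open>nb_ext\<close>
  collects them.\<close>

lemma core_nbd:
 assumes K: "K \<subseteq> VV A" "conn (adj A a) K" and g: "colgood Z m" and Z: "Z \<ge> 0" and eta: "eta \<ge> 0" and beta: "beta \<ge> 0" and rho: "rho > 0"
  and light: "m \<le> card K ==> \<bar>\<Sum>i\<in>rws K. \<Sum>j\<in>cls K. if Inl i \<in> core (wt A a) rho K \<and> Inr j \<in> core (wt A a) rho K then 0 else
    a i j * e i j * th (Inl i) * th (Inr j)\<bar> \<le> beta * real (card K)"
  and dns: "\<And>C. C \<subseteq> VV A ==> dense (wt A a) rho C ==> nbd Z eta 0 C"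
 shows "nbd Z eta beta K"
proof -
 have finK: "finite K" by (rule finite_subset[OF K(1) finV])
 have fr: "finite (rws K)" "finite (cls K)" using finK finite_rws finite_cls by auto
 show ?thesis
 proof (cases "card K < m")
  case True
  have "conn (near3 (adj A a)) K" by (rule conn_near3[OF adj_sym K(2)])
  then have "opb Z a A (cls K) e" using g K(1) True unfolding colgood_def by blast
  then show ?thesis by (rule opb_nbd[OF K(1) _ eta beta])
 next
  case False
  define C where "C = core (wt A a) rho K"
  have CK: "C \<subseteq> K" unfolding C_def by (rule core_sub)
  have CV: "C \<subseteq> VV A" using CK K(1) by blast
  have nC: "nbd Z eta 0 C"
  proof (rule nb_ext[OF CV _ Z eta order_refl])
   fix x assume x: "x \<in> C"
   let ?c = "ccomp (adj A a) C x"
   have cC: "?c \<subseteq> C" by (rule comp_sub[OF x])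
   have "imass (wt A a) ?c y \<ge> rho" if y: "y \<in> ?c" for y
   proof -
    have "rho \<le> imass (wt A a) C y" using core_mass[of "wt A a" K y rho] finK y cC wt_nonneg unfolding C_def by blast
    also have "... = imass (wt A a) ?c y" unfolding imass_def
    proof (rule sum.mono_neutral_right)
     show "finite C" using finK CK finite_subset by blast
     show "\<forall>z\<in>C - ?c. wt A a y z = 0"
     proof (intro ballI, rule ccontr)
      fix z assume z: "z \<in> C - ?c" "wt A a y z \<noteq> 0"
      have "y \<in> C" using y cC by blast
      then have "ccomp (adj A a) C y = ccomp (adj A a) C z" using z by (intro comp_edge[OF adj_sym]) auto
      moreover have "ccomp (adj A a) C y = ?c" by (rule comp_eq[OF adj_sym y])
      ultimately show False using z comp_refl[of z "adj A a" C] by auto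
     qed
    qed (rule cC)
    finally show ?thesis .
   qed
   moreover have "conn (adj A a) ?c" by (rule conn_comp[OF adj_sym])
   ultimately have "dense (wt A a) rho ?c" by (simp add: dense_def)
   then show "nbd Z eta 0 ?c" using dns[of ?c] cC CV by blast
  qed
  have cl: "rws C \<subseteq> rws K" "cls C \<subseteq> cls K" using CK rws_mono cls_mono by auto
  let ?x = "\<lambda>i j. a i j * e i j * th (Inl i) * th (Inr j)"
  have "tform (rws K) (cls K) = (\<Sum>i\<in>rws K. \<Sum>j\<in>cls K. (if Inl i \<in> C \<and> Inr j \<in> C then 0 else ?x i j) + (if i \<in> rws C \<and> j \<in> cls C then ?x i j else 0))"
   unfolding tform_def bform_def by (intro sum.cong refl) (auto simp: rws_def cls_def)
  also have "... = (\<Sum>i\<in>rws K. \<Sum>j\<in>cls K. if Inl i \<in> C \<and> Inr j \<in> C then 0 else ?x i j) + (\<Sum>i\<in>rws K. \<Sum>j\<in>cls K. if i \<in> rws C \<and> j \<in> cls C then ?x i j else 0)"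
   by (simp only: sum.distrib)
  also have "(\<Sum>i\<in>rws K. \<Sum>j\<in>cls K. if i \<in> rws C \<and> j \<in> cls C then ?x i j else 0) = tform (rws C) (cls C)"
  proof -
   have "(\<Sum>i\<in>rws K. \<Sum>j\<in>cls K. if i \<in> rws C \<and> j \<in> cls C then ?x i j else 0) = (\<Sum>i\<in>rws C. \<Sum>j\<in>cls K. if i \<in> rws C \<and> j \<in> cls C then ?x i j else 0)"
    using fr cl by (intro sum.mono_neutral_right) auto
   also have "... = (\<Sum>i\<in>rws C. \<Sum>j\<in>cls C. if i \<in> rws C \<and> j \<in> cls C then ?x i j else 0)"
    using fr cl by (intro sum.cong refl sum.mono_neutral_right) auto
   finally show ?thesis by (simp add: tform_def bform_def)
  qed
  finally have t: "tform (rws K) (cls K) = (\<Sum>i\<in>rws K. \<Sum>j\<in>cls K. if Inl i \<in> C \<and> Inr j \<in> C then 0 else ?x i j) + tform (rws C) (cls C)" .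
  have "\<bar>tform (rws K) (cls K)\<bar> \<le> beta * real (card K) + (Z * sqrt (real (card (rws C)) * real (card (cls C))) + sqrt (eta * real (card C) * frob C))"
   unfolding t using light[folded C_def] False nC unfolding nbd_def by (intro order_trans[OF abs_triangle_ineq add_mono]) auto
  moreover have "Z * sqrt (real (card (rws C)) * real (card (cls C))) \<le> Z * sqrt (real (card (rws K)) * real (card (cls K)))"
   using cl fr Z by (intro mult_left_mono real_sqrt_le_mono mult_mono) (auto intro: card_mono)
  moreover have "sqrt (eta * real (card C) * frob C) \<le> sqrt (eta * real (card K) * frob K)"
   using CK finK eta frob_mono[OF finK CK] frob_nonneg by (intro real_sqrt_le_mono mult_mono) (auto intro: card_mono)
  ultimately show ?thesis unfolding nbd_def by linarith
 qed
qed

end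

section \<open>Exchange of rows and columns\<close>

definition sw :: "nat + nat => nat + nat" where "sw x = (case x of Inl i => Inr i | Inr j => Inl j)"

lemma sw_sw [simp]: "sw (sw x) = x" and sw_Inl [simp]: "sw (Inl i) = Inr i" and sw_Inr [simp]: "sw (Inr i) = Inl i"
 by (auto simp: sw_def split: sum.splits)
lemma sw_VV [simp]: "sw x \<in> VV A \<longleftrightarrow> x \<in> VV A" by (cases x) (auto simp: VV_def)
lemma inj_sw: "inj_on sw B" by (rule inj_on_inverseI[of _ sw]) simp
lemma sw_image: "sw ` VV A = VV A" by (auto simp: image_iff intro!: bexI[of _ "sw _"])
lemma wt_sw: "wt A (\<lambda>i j. a j i) (sw x) (sw y) = wt A a x y"
 by (cases x; cases y) (auto simp: wt_def)
lemma ex_sw: "(\<exists>u. P (sw u)) \<longleftrightarrow> (\<exists>u. P u)" by (metis sw_sw)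
lemma near3_sw: "near3 (adj A (\<lambda>i j. a j i)) (sw x) (sw y) \<longleftrightarrow> near3 (adj A a) x y"
proof -
 have "(\<exists>u. adj A (\<lambda>i j. a j i) (sw x) u \<and> adj A (\<lambda>i j. a j i) u (sw y)) \<longleftrightarrow> (\<exists>u. adj A a x u \<and> adj A a u y)"
  by (subst ex_sw[symmetric]) (simp add: wt_sw)
 moreover have "(\<exists>u w. adj A (\<lambda>i j. a j i) (sw x) u \<and> adj A (\<lambda>i j. a j i) u w \<and> adj A (\<lambda>i j. a j i) w (sw y)) \<longleftrightarrow>
   (\<exists>u w. adj A a x u \<and> adj A a u w \<and> adj A a w y)"
  by (subst ex_sw[symmetric], subst (2) ex_sw[symmetric]) (simp add: wt_sw)
 ultimately show ?thesis unfolding near3_def wt_sw by blast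
qed

lemma comp_image:
 assumes "\<And>x y. r x y ==> r' (f x) (f y)"
 shows "f ` ccomp r X x \<subseteq> ccomp r' (f ` X) (f x)"
proof
 fix z assume "z \<in> f ` ccomp r X x"
 then obtain y where y: "z = f y" "(\<lambda>a b. a \<in> X \<and> b \<in> X \<and> r a b)\<^sup>*\<^sup>* x y" by (auto simp: ccomp_def)
 from y(2) have "(\<lambda>a b. a \<in> f ` X \<and> b \<in> f ` X \<and> r' a b)\<^sup>*\<^sup>* (f x) (f y)"
 proof (induction rule: rtranclp_induct)
  case (step y z)
  then have "f y \<in> f ` X \<and> f z \<in> f ` X \<and> r' (f y) (f z)" using assms by auto
  then show ?case using step(3) by (rule rtranclp.rtrancl_into_rtrancl[rotated])
 qed auto
 then show "z \<in> ccomp r' (f ` X) (f x)" using y by (simp add: ccomp_def)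
qed

lemma comp_sw: "ccomp (near3 (adj A (\<lambda>i j. a j i))) (sw ` X) (sw x) = sw ` ccomp (near3 (adj A a)) X x"
proof
 show "sw ` ccomp (near3 (adj A a)) X x \<subseteq> ccomp (near3 (adj A (\<lambda>i j. a j i))) (sw ` X) (sw x)"
  by (rule comp_image) (simp add: near3_sw)
 have "sw ` ccomp (near3 (adj A (\<lambda>i j. a j i))) (sw ` X) (sw x) \<subseteq> ccomp (near3 (adj A a)) (sw ` (sw ` X)) (sw (sw x))"
  by (rule comp_image) (metis near3_sw sw_sw)
 then have sub: "sw ` ccomp (near3 (adj A (\<lambda>i j. a j i))) (sw ` X) (sw x) \<subseteq> ccomp (near3 (adj A a)) X x"
  by (simp add: image_image)
 show "ccomp (near3 (adj A (\<lambda>i j. a j i))) (sw ` X) (sw x) \<subseteq> sw ` ccomp (near3 (adj A a)) X x"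
 proof
  fix z assume "z \<in> ccomp (near3 (adj A (\<lambda>i j. a j i))) (sw ` X) (sw x)"
  then have "sw z \<in> ccomp (near3 (adj A a)) X x" using sub by blast
  then show "z \<in> sw ` ccomp (near3 (adj A a)) X x" by (rule rev_image_eqI) simp
 qed
qed

context cfg
begin

lemma cfg_tp: "cfg n A (\<lambda>i j. a j i) (lev \<circ> sw) (th \<circ> sw) kmax"
proof -
 interpret T: mat n A "\<lambda>i j. a j i" by (rule mat_tp)
 have re: "(\<Sum>x\<in>VV A. f (sw x)) = (\<Sum>x\<in>VV A. f x)" for f :: "nat + nat => real"
  using sum.reindex[OF inj_sw, of f "VV A"] by (simp add: sw_image)
 show ?thesis
 proof unfold_locales
  show "(\<Sum>x\<in>VV A. (1/4) ^ (lev \<circ> sw) x) \<le> (4::real)" using tot re[of "\<lambda>x. (1/4) ^ lev x"] by simp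
  fix x assume x: "x \<in> VV A"
  have "(\<Sum>y\<in>VV A. wt A (\<lambda>i j. a j i) x y * (1/4) ^ (lev \<circ> sw) y) = (\<Sum>y\<in>VV A. wt A a (sw x) (sw y) * (1/4) ^ lev (sw y))"
   by (metis (no_types, lifting) comp_apply sw_sw wt_sw)
  also have "... = (\<Sum>y\<in>VV A. wt A a (sw x) y * (1/4) ^ lev y)" by (rule re[of "\<lambda>y. wt A a (sw x) y * (1/4) ^ lev y"])
  also have "... \<le> 8 * (1/4) ^ (lev \<circ> sw) x" using super[of "sw x"] x by simp
  finally show "(\<Sum>y\<in>VV A. wt A (\<lambda>i j. a j i) x y * (1/4) ^ (lev \<circ> sw) y) \<le> 8 * (1/4) ^ (lev \<circ> sw) x" .
 qed (use lev_le th in auto)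
qed

lemma collow_bound:
 assumes g: "cfg.colgood A (\<lambda>i j. a j i) (tp n e) Z m" and Z: "Z \<ge> 0" and fg: "cfg.fargood A (\<lambda>i j. a j i) (tp n e) b dm m L G" and L: "L \<ge> 0" and m: "m > 0" and G: "G \<ge> 0"
  and big: "\<And>i j. i \<in> A ==> j \<in> A ==> a i j \<noteq> 0 ==> (a i j)\<^sup>2 * 4 ^ dm > 2"
 shows "\<bar>\<Sum>i\<in>A. \<Sum>j\<in>A. if lev (Inl i) + b \<le> lev (Inr j) \<and> \<not> sm m i j then xx i j else 0\<bar> \<le>
   2 * Z * (1 + real b) + (4 * (sqrt (8 * L) + 1) + 576 * exp (- L / 8) * (real dm + 1) + 6 * G * (1/4) ^ b)"
proof -
 interpret T: cfg n A "\<lambda>i j. a j i" "lev \<circ> sw" "th \<circ> sw" "tp n e" kmax by (rule cfg_tp)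
 have TX: "T.W b k = sw ` W b k" for b k
 proof
  show "T.W b k \<subseteq> sw ` W b k"
  proof
   fix x assume "x \<in> T.W b k"
   then have "sw x \<in> W b k" by (auto simp: T.W_def W_def)
   then show "x \<in> sw ` W b k" by (metis image_eqI sw_sw)
  qed
 qed (auto simp: T.W_def W_def)
 have Tcb: "T.cb b k (sw x) = sw ` cb b k x" for b k x unfolding T.cb_def cb_def TX by (rule comp_sw)
 have Tc: "card (T.cb b k (Inl j)) = card (cb b k (Inr j))" for b k j
  using Tcb[of b k "Inr j"] by (simp add: card_image inj_sw)
 have eq: "(if lev (Inl i) + b \<le> lev (Inr j) \<and> \<not> sm m i j then xx i j else 0) = (if T.rowlow b m j i then T.xx j i else 0)"
  if ij: "i \<in> A" "j \<in> A" for i j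
 proof (cases "a i j = 0")
  case False
  have x: "T.xx j i = xx i j" using ij A by (simp add: T.xx_def xx_def tp_apply subset_iff T.sr_def T.tc_def sr_def tc_def T.u_def u_def)
  have "T.sm m j i = sm m i j" using sm_edge[OF ij False] by (simp add: T.sm_def sm_def Tc max.commute)
  then show ?thesis unfolding T.rowlow_def x by simp
 qed (simp add: xx_def T.xx_def)
 have "(\<Sum>i\<in>A. \<Sum>j\<in>A. if lev (Inl i) + b \<le> lev (Inr j) \<and> \<not> sm m i j then xx i j else 0) = (\<Sum>i\<in>A. \<Sum>j\<in>A. if T.rowlow b m j i then T.xx j i else 0)"
  using eq by (intro sum.cong refl) auto
 also have "... = (\<Sum>j\<in>A. \<Sum>i\<in>A. if T.rowlow b m j i then T.xx j i else 0)" by (rule sum.swap)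
 finally have e: "(\<Sum>i\<in>A. \<Sum>j\<in>A. if lev (Inl i) + b \<le> lev (Inr j) \<and> \<not> sm m i j then xx i j else 0) = (\<Sum>j\<in>A. \<Sum>i\<in>A. if T.rowlow b m j i then T.xx j i else 0)" .
 show ?thesis unfolding e by (rule T.rowlow_bound[OF g Z fg L m G], rule big)
qed

text \<open>Every edge is small, or near, or has its column at least \<open>b\<close> levels below
  its row, or its row at least \<open>b\<close> levels below its column; the last case is the third
  one for the transposed configuration.\<close>

lemma total_far:
 assumes g: "colgood Z m" "cfg.colgood A (\<lambda>i j. a j i) (tp n e) Z m" and Z: "Z \<ge> 0"
  and fg: "fargood b dm m L G" "cfg.fargood A (\<lambda>i j. a j i) (tp n e) b dm m L G" and L: "L \<ge> 0" and m: "m > 0" and G: "G \<ge> 0"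
  and nb: "\<And>X. X \<subseteq> VV A ==> nbd Z eta beta X" and nn: "eta \<ge> 0" "beta \<ge> 0" and b: "b > 0"
  and big: "\<And>i j. i \<in> A ==> j \<in> A ==> a i j \<noteq> 0 ==> (a i j)\<^sup>2 * 4 ^ dm > 2"
 shows "\<bar>\<Sum>i\<in>A. \<Sum>j\<in>A. xx i j\<bar> \<le> 2 * Z + (4 * real b * Z + 8 * real b * 2 ^ b * beta + 4 * sqrt (2 * real b * eta)) +
   2 * (2 * Z * (1 + real b) + (4 * (sqrt (8 * L) + 1) + 576 * exp (- L / 8) * (real dm + 1) + 6 * G * (1/4) ^ b))"
proof -
 let ?S = "\<Sum>i\<in>A. \<Sum>j\<in>A. if sm m i j then xx i j else 0"
 let ?N = "\<Sum>i\<in>A. \<Sum>j\<in>A. if near b (lev (Inl i)) (lev (Inr j)) \<and> \<not> sm m i j then xx i j else 0"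
 let ?R = "\<Sum>i\<in>A. \<Sum>j\<in>A. if rowlow b m i j then xx i j else 0"
 let ?C = "\<Sum>i\<in>A. \<Sum>j\<in>A. if lev (Inl i) + b \<le> lev (Inr j) \<and> \<not> sm m i j then xx i j else 0"
 have "(\<Sum>i\<in>A. \<Sum>j\<in>A. xx i j) = (\<Sum>i\<in>A. \<Sum>j\<in>A. (if sm m i j then xx i j else 0) +
  (if near b (lev (Inl i)) (lev (Inr j)) \<and> \<not> sm m i j then xx i j else 0) + (if rowlow b m i j then xx i j else 0) +
  (if lev (Inl i) + b \<le> lev (Inr j) \<and> \<not> sm m i j then xx i j else 0))"
  using b by (intro sum.cong refl) (auto simp: near_def rowlow_def)
 also have "... = ?S + ?N + ?R + ?C" by (simp only: sum.distrib)
 finally have e: "(\<Sum>i\<in>A. \<Sum>j\<in>A. xx i j) = ?S + ?N + ?R + ?C" .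
 have "\<bar>?S\<bar> \<le> 2 * Z" by (rule small_part[OF g(1) Z])
 moreover have "\<bar>?N\<bar> \<le> 4 * real b * Z + 8 * real b * 2 ^ b * beta + 4 * sqrt (2 * real b * eta)"
  by (rule near_bound[OF nb Z nn b])
 moreover have "\<bar>?R\<bar> \<le> 2 * Z * (1 + real b) + (4 * (sqrt (8 * L) + 1) + 576 * exp (- L / 8) * (real dm + 1) + 6 * G * (1/4) ^ b)"
  by (rule rowlow_bound[OF g(1) Z fg(1) L m G], rule big)
 moreover have "\<bar>?C\<bar> \<le> 2 * Z * (1 + real b) + (4 * (sqrt (8 * L) + 1) + 576 * exp (- L / 8) * (real dm + 1) + 6 * G * (1/4) ^ b)"
  by (rule collow_bound[OF g(2) Z fg(2) L m G], rule big)
 ultimately show ?thesis unfolding e by (smt (verit))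
qed

end

section \<open>From level configurations to operator norms\<close>

lemma VV_imass:
 assumes "mat n A a" "x \<in> VV A"
 shows "imass (wt A a) (VV A) x \<le> 1"
proof -
 interpret mat n A a by fact
 show ?thesis
 proof (cases x)
  case (Inl i)
  then have i: "i \<in> A" using assms by (auto simp: VV_def)
  have "imass (wt A a) (VV A) x = (\<Sum>j\<in>A. (a i j)\<^sup>2)" using Inl i by (simp add: imass_def sum_VV) (simp add: wt_def)
  then show ?thesis using row[OF i] by simp
 next
  case (Inr i)
  then have i: "i \<in> A" using assms by (auto simp: VV_def)
  have "imass (wt A a) (VV A) x = (\<Sum>j\<in>A. (a j i)\<^sup>2)" using Inr i by (simp add: imass_def sum_VV) (simp add: wt_def)
  then show ?thesis using col[OF i] by simp
 qed
qed

text \<open>The bilinear form is affine in every coordinate, so on the box given by the superharmonic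
 majorant it is maximal at a vector of signs.\<close>

lemma opb_from_cfg:
 assumes m: "mat n A a"
  and B: "\<And>lev th kmax. cfg n A a lev th kmax ==>
   \<bar>\<Sum>i\<in>A. \<Sum>j\<in>A. a i j * e i j * (th (Inl i) * (1/2) ^ lev (Inl i)) * (th (Inr j) * (1/2) ^ lev (Inr j))\<bar> \<le> B"
 shows "opb (8 * B) a A A e"
proof -
 interpret mat n A a by fact
 show ?thesis
 proof (rule opbI[OF finA finA])
  fix s t assume st: "sqn A s \<le> 1" "sqn A t \<le> 1"
  show "bform a A A e s t \<le> 8 * B"
  proof (cases "A = {}")
   case True
   have "B \<ge> 0" using B[of "\<lambda>_. 0" "\<lambda>_. 1" 0] True m by (force simp: cfg_def cfg_axioms_def VV_def)
   then show ?thesis using True by (simp add: bform_def)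
  next
   case False
   define c where "c = 1 / real (card A)"
   have c: "c > 0" "real (card A) * c = 1" using False finA by (auto simp: c_def card_gt_0_iff)
   \<comment> \<open>The summand \<open>c\<close> makes the weight positive, so that every vertex
     has a level. The total is at most (1 + 1 + 2) / 8 = 1/2, so the majorant is at most 1 and
     levels are natural numbers.\<close>
   define p where "p = (\<lambda>x. case x of Inl i => ((s i)\<^sup>2 + c) / 8 | Inr j => ((t j)\<^sup>2 + c) / 8)"
   have p0: "p x > 0" for x using c by (auto simp: p_def add_nonneg_pos split: sum.splits)
   have sp: "(\<Sum>x\<in>VV A. p x) \<le> 1 / 2"
   proof -
    have "(\<Sum>x\<in>VV A. p x) = (sqn A s + sqn A t + 2 * (real (card A) * c)) / 8"
     by (simp add: sum_VV p_def sqn_def sum.distrib add_divide_distrib sum_divide_distrib)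
    then show ?thesis using st c by simp
   qed
   obtain P where P: "\<And>x. x \<in> VV A ==> p x \<le> P x" "\<And>x. x \<in> VV A ==> (\<Sum>y\<in>VV A. wt A a x y * P y) \<le> 2 * P x"
    "(\<Sum>x\<in>VV A. P x) \<le> 2 * (\<Sum>x\<in>VV A. p x)"
   proof -
    have "\<exists>P. (\<forall>x\<in>VV A. p x \<le> P x) \<and> (\<forall>x\<in>VV A. (\<Sum>y\<in>VV A. wt A a x y * P y) \<le> 2 * P x) \<and> (\<Sum>x\<in>VV A. P x) \<le> 2 * (\<Sum>x\<in>VV A. p x)"
     by (rule superharmonic[OF finite_VV[OF finA] wt_nonneg wt_sym VV_imass[OF m] less_imp_le[OF p0]])
    then show ?thesis using that by blast
   qed
   have P0: "P x > 0" if "x \<in> VV A" for x using P(1)[OF that] p0[of x] by simp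
   have P1: "P x \<le> 1" if x: "x \<in> VV A" for x
   proof -
    have "P x \<le> (\<Sum>x\<in>VV A. P x)" using x P0 by (intro member_le_sum) (auto intro: less_imp_le)
    then show ?thesis using P(3) sp by linarith
   qed
   have "\<forall>x\<in>VV A. \<exists>k::nat. P x \<le> (1/4) ^ k \<and> (1/4) ^ k < 4 * P x" using ex_level P0 P1 by blast
   then obtain lev where lev: "\<And>x. x \<in> VV A ==> P x \<le> (1/4) ^ lev x \<and> (1/4) ^ lev x < 4 * P x" by metis
   define kmax where "kmax = Max (lev ` VV A)"
   define h where "h = (\<lambda>x. (1/2::real) ^ lev x)"
   have h2: "(h x)\<^sup>2 = (1/4) ^ lev x" for x by (simp add: h_def power2_eq_square flip: power_mult_distrib)
   have sb: "\<bar>s i\<bar> \<le> sqrt 8 * h (Inl i)" if i: "i \<in> A" for i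
   proof -
    have V: "Inl i \<in> VV A" using i by (simp add: VV_def)
    have "(s i)\<^sup>2 \<le> 8 * p (Inl i)" using c by (simp add: p_def)
    also have "... \<le> 8 * (h (Inl i))\<^sup>2" using P(1)[OF V] lev[OF V] unfolding h2 by linarith
    also have "... = (sqrt 8 * h (Inl i))\<^sup>2" by (simp add: power_mult_distrib)
    finally show ?thesis by (simp add: abs_le_square_iff[symmetric] h_def)
   qed
   have tb: "\<bar>t j\<bar> \<le> sqrt 8 * h (Inr j)" if i: "j \<in> A" for j
   proof -
    have V: "Inr j \<in> VV A" using i by (simp add: VV_def)
    have "(t j)\<^sup>2 \<le> 8 * p (Inr j)" using c by (simp add: p_def)
    also have "... \<le> 8 * (h (Inr j))\<^sup>2" using P(1)[OF V] lev[OF V] unfolding h2 by linarith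
    also have "... = (sqrt 8 * h (Inr j))\<^sup>2" by (simp add: power_mult_distrib)
    finally show ?thesis by (simp add: abs_le_square_iff[symmetric] h_def)
   qed
   define sg where "sg = (\<lambda>x::real. if x \<ge> 0 then 1 else -1 :: real)"
   have sg: "sg x * x = \<bar>x\<bar>" "(sg x)\<^sup>2 = 1" for x by (auto simp: sg_def)
   \<comment> \<open>The columns are moved to a corner of the box first, then the rows against the
     new columns; each move costs \<open>sqrt 8\<close>.\<close>
   define w where "w = (\<lambda>j. \<Sum>i\<in>A. a i j * e i j * s i)"
   define g where "g = (\<lambda>j. sg (w j) * h (Inr j))"
   define w' where "w' = (\<lambda>i. \<Sum>j\<in>A. a i j * e i j * g j)"
   define th where "th = (\<lambda>x. case x of Inl i => sg (w' i) | Inr j => sg (w j))"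
   have "bform a A A e s t = (\<Sum>j\<in>A. w j * t j)"
    unfolding bform_def w_def sum_distrib_right by (subst sum.swap) simp
   also have "... \<le> (\<Sum>j\<in>A. sqrt 8 * (w j * (sg (w j) * h (Inr j))))"
   proof (rule sum_mono)
    fix j assume j: "j \<in> A"
    have "w j * t j \<le> \<bar>w j\<bar> * \<bar>t j\<bar>" by (metis abs_ge_self abs_mult)
    also have "... \<le> \<bar>w j\<bar> * (sqrt 8 * h (Inr j))" using tb[OF j] by (intro mult_left_mono) auto
    finally show "w j * t j \<le> sqrt 8 * (w j * (sg (w j) * h (Inr j)))" unfolding sg(1)[symmetric] by (simp add: mult_ac)
   qed
   also have "... = sqrt 8 * (\<Sum>i\<in>A. w' i * s i)"
   proof -
    have "(\<Sum>j\<in>A. w j * (sg (w j) * h (Inr j))) = (\<Sum>i\<in>A. w' i * s i)"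
    proof -
     have "(\<Sum>j\<in>A. w j * (sg (w j) * h (Inr j))) = (\<Sum>j\<in>A. w j * g j)" by (simp add: g_def)
     also have "... = (\<Sum>j\<in>A. \<Sum>i\<in>A. a i j * e i j * s i * g j)"
      by (intro sum.cong refl) (simp only: w_def sum_distrib_right)
     also have "... = (\<Sum>i\<in>A. \<Sum>j\<in>A. a i j * e i j * s i * g j)" by (rule sum.swap)
     also have "... = (\<Sum>i\<in>A. w' i * s i)"
      by (intro sum.cong refl) (simp add: w'_def sum_distrib_right, simp only: mult_ac)
     finally show ?thesis .
    qed
    then show ?thesis by (simp flip: sum_distrib_left)
   qed
   also have "... \<le> sqrt 8 * (\<Sum>i\<in>A. sqrt 8 * (w' i * (sg (w' i) * h (Inl i))))"
   proof (intro mult_left_mono sum_mono)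
    fix i assume i: "i \<in> A"
    have "w' i * s i \<le> \<bar>w' i\<bar> * \<bar>s i\<bar>" by (metis abs_ge_self abs_mult)
    also have "... \<le> \<bar>w' i\<bar> * (sqrt 8 * h (Inl i))" using sb[OF i] by (intro mult_left_mono) auto
    finally show "w' i * s i \<le> sqrt 8 * (w' i * (sg (w' i) * h (Inl i)))" unfolding sg(1)[symmetric] by (simp add: mult_ac)
   qed auto
   also have "... = 8 * (\<Sum>i\<in>A. w' i * (sg (w' i) * h (Inl i)))"
    unfolding sum_distrib_left[symmetric] mult.assoc[symmetric, of "sqrt 8" "sqrt 8"] by simp
   also have "(\<Sum>i\<in>A. w' i * (sg (w' i) * h (Inl i))) = (\<Sum>i\<in>A. \<Sum>j\<in>A. a i j * e i j * (th (Inl i) * (1/2) ^ lev (Inl i)) * (th (Inr j) * (1/2) ^ lev (Inr j)))"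
   proof (rule sum.cong[OF refl])
    fix i
    have "w' i * (sg (w' i) * h (Inl i)) = (\<Sum>j\<in>A. a i j * e i j * g j * (sg (w' i) * h (Inl i)))"
     by (subst (1) w'_def) (simp only: sum_distrib_right)
    also have "... = (\<Sum>j\<in>A. a i j * e i j * (th (Inl i) * (1/2) ^ lev (Inl i)) * (th (Inr j) * (1/2) ^ lev (Inr j)))"
     by (intro sum.cong refl) (simp add: th_def g_def h_def)
    finally show "w' i * (sg (w' i) * h (Inl i)) = (\<Sum>j\<in>A. a i j * e i j * (th (Inl i) * (1/2) ^ lev (Inl i)) * (th (Inr j) * (1/2) ^ lev (Inr j)))" .
   qed
   finally have fin: "bform a A A e s t \<le> 8 * (\<Sum>i\<in>A. \<Sum>j\<in>A. a i j * e i j * (th (Inl i) * (1/2) ^ lev (Inl i)) * (th (Inr j) * (1/2) ^ lev (Inr j)))" .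
   have "cfg n A a lev th kmax"
   proof unfold_locales
    fix x assume x: "x \<in> VV A"
    show "lev x \<le> kmax" using x finA by (auto simp: kmax_def)
    show "(th x)\<^sup>2 = 1" by (auto simp: th_def sg split: sum.splits)
    have "(\<Sum>y\<in>VV A. wt A a x y * (1/4) ^ lev y) \<le> (\<Sum>y\<in>VV A. wt A a x y * (4 * P y))"
     using lev wt_nonneg by (intro sum_mono mult_left_mono) (auto intro: less_imp_le)
    also have "... = 4 * (\<Sum>y\<in>VV A. wt A a x y * P y)" by (simp add: sum_distrib_left mult_ac)
    also have "... \<le> 8 * P x" using P(2)[OF x] by simp
    also have "... \<le> 8 * (1/4) ^ lev x" using lev[OF x] by simp
    finally show "(\<Sum>y\<in>VV A. wt A a x y * (1/4) ^ lev y) \<le> 8 * (1/4) ^ lev x" .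
   next
    have "(\<Sum>x\<in>VV A. (1/4) ^ lev x) \<le> (\<Sum>x\<in>VV A. 4 * P x)" using lev by (intro sum_mono) (auto intro: less_imp_le)
    also have "... = 4 * (\<Sum>x\<in>VV A. P x)" by (simp add: sum_distrib_left)
    also have "... \<le> 4" using P(3) sp by simp
    finally show "(\<Sum>x\<in>VV A. (1/4) ^ lev x) \<le> (4::real)" .
   qed
   from B[OF this] show ?thesis using fin by linarith
  qed
 qed
qed

section \<open>Union bounds over families of vertex sets\<close>

lemma sum_exp_tail:
 assumes "r \<ge> (1::real)"
 shows "(\<Sum>M\<in>{m..m'}. exp (- r * real M)) \<le> 2 * exp (- r * real m)"
proof -
 have e: "exp (- r) \<le> 1 / 2"
 proof -
  have "2 \<le> exp (1::real)" using exp_ge_add_one_self[of 1] by simp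
  also have "... \<le> exp r" using assms by simp
  finally show ?thesis by (simp add: exp_minus field_simps)
 qed
 have "(\<Sum>M\<in>{m..m'}. exp (- r * real M)) \<le> (\<Sum>M\<in>(+) m ` {..m'}. exp (- r * real M))"
 proof (intro sum_mono2 subsetI)
  fix k assume "k \<in> {m..m'}"
  then show "k \<in> (+) m ` {..m'}" by (intro image_eqI[of _ _ "k - m"]) auto
 qed auto
 also have "... = exp (- r * real m) * (\<Sum>M\<in>{..m'}. exp (- r) ^ M)"
  by (simp add: sum.reindex sum_distrib_left distrib_left exp_add[symmetric] algebra_simps flip: exp_of_nat_mult)
 also have "(\<Sum>M\<in>{..m'}. exp (- r) ^ M) \<le> (\<Sum>M\<in>{..m'}. (1/2) ^ M)" using e by (intro sum_mono power_mono) auto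
 also have "... \<le> (\<Sum>M. (1/2::real) ^ M)" by (intro sum_le_suminf) auto
 also have "... = 2" by (subst suminf_geometric) auto
 finally show ?thesis by simp
qed

text \<open>Grouping by cardinality, the entropy \<open>c\<close> per vertex cancels and a geometric
  series with ratio at most 1/2 remains.\<close>

lemma sum_family:
 assumes fin: "finite KK" and m: "\<And>K. K \<in> KK ==> m \<le> card K" and r: "r \<ge> 1"
  and cnt: "\<And>M. m \<le> M ==> real (card {K\<in>KK. card K = M}) \<le> exp (c * real M)"
 shows "(\<Sum>K\<in>KK. exp (- (c + r) * real (card K))) \<le> 2 * exp (- r * real m)"
proof -
 define m' where "m' = Max (insert m (card ` KK))"
 have "(\<Sum>K\<in>KK. exp (- (c + r) * real (card K))) = (\<Sum>M\<in>{m..m'}. \<Sum>K\<in>{K\<in>KK. card K = M}. exp (- (c + r) * real (card K)))"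
  using fin m by (intro sum.group[symmetric]) (auto simp: m'_def)
 also have "... = (\<Sum>M\<in>{m..m'}. real (card {K\<in>KK. card K = M}) * exp (- (c + r) * real M))"
  by (intro sum.cong refl) simp
 also have "... \<le> (\<Sum>M\<in>{m..m'}. exp (c * real M) * exp (- (c + r) * real M))"
  by (intro sum_mono mult_right_mono cnt) auto
 also have "... = (\<Sum>M\<in>{m..m'}. exp (- r * real M))" by (simp add: mult_exp_exp algebra_simps)
 also have "... \<le> 2 * exp (- r * real m)" by (rule sum_exp_tail[OF r])
 finally show ?thesis .
qed

text \<open>Hoeffding's inequality for every set and every sign vector on it: the summand 1 in
  \<open>c + 1 + r\<close> pays for the \<open>2 ^ card K\<close> sign vectors.\<close>

lemma (in mat) dev_family:
 assumes fam: "\<And>K. K \<in> KK ==> K \<subseteq> VV A \<and> m \<le> card K" and r: "r \<ge> 1" and c: "c \<ge> 0"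
  and cnt: "\<And>M. m \<le> M ==> real (card {K\<in>KK. card K = M}) \<le> exp (c * real M)"
  and Bd: "\<And>K. K \<in> KK ==> (\<Sum>i\<in>rws K. \<Sum>j\<in>cls K. (y K i j)\<^sup>2) \<le> Bd K"
 shows "pr n (\<lambda>e. \<exists>K\<in>KK. \<exists>th. (\<forall>x\<in>K. (th x)\<^sup>2 = 1) \<and>
   \<bar>\<Sum>i\<in>rws K. \<Sum>j\<in>cls K. y K i j * e i j * th (Inl i) * th (Inr j)\<bar> > sqrt (2 * Bd K * ((c + 1 + r) * real (card K)))) \<le> 4 * exp (- r * real m)"
proof -
 have finKK: "finite KK" by (rule finite_subset[of _ "Pow (VV A)"]) (use fam in auto)
 have finK: "finite K" if "K \<in> KK" for K using fam[OF that] finite_subset[OF _ finite_VV[OF finA]] by auto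
 define S where "S = Sigma KK (\<lambda>K. PiE K (\<lambda>_. {-1, 1::real}))"
 have finS: "finite S" unfolding S_def using finKK finK by (intro finite_SigmaI finite_PiE) auto
 define Q where "Q = (\<lambda>(K,th) e. \<bar>\<Sum>i\<in>rws K. \<Sum>j\<in>cls K. (y K i j * th (Inl i) * th (Inr j)) * e i j\<bar> > sqrt (2 * Bd K * ((c + 1 + r) * real (card K))))"
 have "pr n (\<lambda>e. \<exists>K\<in>KK. \<exists>th. (\<forall>x\<in>K. (th x)\<^sup>2 = 1) \<and>
   \<bar>\<Sum>i\<in>rws K. \<Sum>j\<in>cls K. y K i j * e i j * th (Inl i) * th (Inr j)\<bar> > sqrt (2 * Bd K * ((c + 1 + r) * real (card K)))) \<le> pr n (\<lambda>e. \<exists>x\<in>S. Q x e)"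
 proof (rule pr_mono, elim bexE exE conjE)
  fix e K th assume K: "K \<in> KK" and th: "\<forall>x\<in>K. (th x)\<^sup>2 = 1"
   and g: "\<bar>\<Sum>i\<in>rws K. \<Sum>j\<in>cls K. y K i j * e i j * th (Inl i) * th (Inr j)\<bar> > sqrt (2 * Bd K * ((c + 1 + r) * real (card K)))"
  have "th x \<in> {-1, 1}" if "x \<in> K" for x using th that by (auto simp: power2_eq_1_iff)
  then have "(K, restrict th K) \<in> S" using K by (auto simp: S_def)
  moreover have "(\<Sum>i\<in>rws K. \<Sum>j\<in>cls K. y K i j * e i j * th (Inl i) * th (Inr j)) =
   (\<Sum>i\<in>rws K. \<Sum>j\<in>cls K. (y K i j * restrict th K (Inl i) * restrict th K (Inr j)) * e i j)"
   by (intro sum.cong refl) (auto simp: rws_def cls_def)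
  ultimately show "\<exists>x\<in>S. Q x e" using g by (intro bexI[of _ "(K, restrict th K)"]) (auto simp: Q_def)
 qed
 also have "... \<le> (\<Sum>x\<in>S. 2 * exp (- ((c + 1 + r) * real (card (fst x)))))"
 proof (rule pr_ex_le[OF finS])
  fix x assume x: "x \<in> S"
  obtain K th where xe: "x = (K, th)" by (cases x)
  have K: "K \<in> KK" "th \<in> PiE K (\<lambda>_. {-1, 1})" using x xe by (auto simp: S_def)
  have KV: "K \<subseteq> VV A" using fam[OF K(1)] by auto
  have th: "(th x)\<^sup>2 = 1" if "x \<in> K" for x using K(2) that by (auto simp: PiE_iff power2_eq_1_iff)
  have "(\<Sum>i\<in>rws K. \<Sum>j\<in>cls K. (y K i j * th (Inl i) * th (Inr j))\<^sup>2) = (\<Sum>i\<in>rws K. \<Sum>j\<in>cls K. (y K i j)\<^sup>2)"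
   by (intro sum.cong refl) (auto simp: power_mult_distrib th rws_def cls_def)
  then have "(\<Sum>i\<in>rws K. \<Sum>j\<in>cls K. (y K i j * th (Inl i) * th (Inr j))\<^sup>2) \<le> Bd K" using Bd[OF K(1)] by simp
  then show "pr n (Q x) \<le> 2 * exp (- ((c + 1 + r) * real (card (fst x))))"
   unfolding Q_def xe prod.case fst_conv using rws_sub[OF KV] cls_sub[OF KV] A c r
   by (intro hoeffding) auto
 qed
 also have "... = (\<Sum>K\<in>KK. \<Sum>th\<in>PiE K (\<lambda>_. {-1, 1::real}). 2 * exp (- ((c + 1 + r) * real (card K))))"
  unfolding S_def using finKK finK by (subst sum.Sigma) (auto intro!: finite_PiE simp: case_prod_beta)
 also have "... \<le> (\<Sum>K\<in>KK. 2 * exp (- (c + r) * real (card K)))"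
 proof (rule sum_mono)
  fix K assume K: "K \<in> KK"
  have "(2::real) ^ card K \<le> exp 1 ^ card K" using exp_ge_add_one_self[of 1] by (intro power_mono) auto
  then have t: "(2::real) ^ card K \<le> exp (real (card K))" by (simp flip: exp_of_nat_mult)
  have "(\<Sum>th\<in>PiE K (\<lambda>_. {-1, 1::real}). 2 * exp (- ((c + 1 + r) * real (card K)))) = 2 ^ card K * (2 * exp (- ((c + 1 + r) * real (card K))))"
   using finK[OF K] by (simp add: card_PiE)
  also have "... \<le> exp (real (card K)) * (2 * exp (- ((c + 1 + r) * real (card K))))" using t by (intro mult_right_mono) auto
  also have "... = 2 * exp (- (c + r) * real (card K))" by (simp add: mult_exp_exp algebra_simps)
  finally show "(\<Sum>th\<in>PiE K (\<lambda>_. {-1, 1::real}). 2 * exp (- ((c + 1 + r) * real (card K)))) \<le> 2 * exp (- (c + r) * real (card K))" .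
 qed
 also have "... = 2 * (\<Sum>K\<in>KK. exp (- (c + r) * real (card K)))" by (simp add: sum_distrib_left)
 also have "... \<le> 2 * (2 * exp (- r * real m))" using fam by (intro mult_left_mono sum_family[OF finKK _ r cnt]) auto
 finally show ?thesis by simp
qed

text \<open>\<open>fargood\<close>, and below \<open>cgood\<close> for \<open>colgood\<close>, as
  events in the signs alone: they do not involve levels, so one exceptional event serves all
  configurations simultaneously.\<close>

definition fgood :: "nat set => (nat => nat => real) => (nat => nat => real) => nat => nat => nat => real => real => bool" where
 "fgood A a e b dm m L G \<longleftrightarrow> (\<forall>K. K \<subseteq> VV A \<longrightarrow> conn (near3 (adj A a)) K \<longrightarrow> m \<le> card K \<longrightarrow>
   (\<forall>z. (\<forall>j\<in>cls K. z j = 0 \<or> (\<exists>d. b \<le> d \<and> d \<le> dm \<and> \<bar>z j\<bar> = 2 ^ d)) \<longrightarrow>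
    (\<Sum>i\<in>{i\<in>A. (\<Sum>j\<in>cls K. (a i j * z j)\<^sup>2) \<le> 8}. max 0 ((\<Sum>j\<in>cls K. a i j * z j * e i j)\<^sup>2 - L * (\<Sum>j\<in>cls K. (a i j * z j)\<^sup>2)))
    \<le> 144 * exp (- L / 8) * (\<Sum>j\<in>cls K. (z j)\<^sup>2) + G * real (card K)))"

definition cgood :: "nat set => (nat => nat => real) => (nat => nat => real) => real => nat => bool" where
 "cgood A a e Z m \<longleftrightarrow> (\<forall>K. K \<subseteq> VV A \<longrightarrow> conn (near3 (adj A a)) K \<longrightarrow> card K < m \<longrightarrow> opb Z a A (cls K) e)"

lemma (in cfg) fargood_iff: "fargood b dm m L G \<longleftrightarrow> fgood A a e b dm m L G" and colgood_iff: "colgood Z m \<longleftrightarrow> cgood A a e Z m"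
 by (simp_all only: fargood_def fgood_def colgood_def cgood_def)

text \<open>A column takes at most \<open>2 * dm + 3\<close> values, 0 and the signed powers of two,
  which adds the entropy \<open>c'\<close> per vertex. The factor 128 is the 16 of
  \<open>chi_tail\<close> times the variance bound 8.\<close>

lemma (in mat) far_family:
 assumes r: "r \<ge> 1" and c: "c \<ge> 0" and L: "L \<ge> 0"
  and cnt: "\<And>M. m \<le> M ==> real (card {K. K \<subseteq> VV A \<and> conn (near3 (adj A a)) K \<and> card K = M}) \<le> exp (c * real M)"
  and dm: "real (2 * dm + 3) \<le> exp c'" "c' \<ge> 0"
 shows "pr n (\<lambda>e. \<not> fgood A a e b dm m L (128 * (c + c' + r))) \<le> 2 * exp (- r * real m)"
proof -
 define KK where "KK = {K. K \<subseteq> VV A \<and> conn (near3 (adj A a)) K \<and> m \<le> card K}"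
 have finKK: "finite KK" by (rule finite_subset[of _ "Pow (VV A)"]) (auto simp: KK_def)
 have KKf: "K \<subseteq> VV A" "m \<le> card K" if "K \<in> KK" for K using that by (auto simp: KK_def)
 have finc: "finite (cls K)" "cls K \<subseteq> A" if "K \<in> KK" for K
  using KKf(1)[OF that] finite_subset[OF cls_sub finA] cls_sub by auto
 define vals where "vals = insert 0 ((\<lambda>d. 2 ^ d) ` {..dm} \<union> (\<lambda>d. - (2 ^ d)) ` {..dm} :: real set)"
 have finv: "finite vals" by (simp add: vals_def)
 have cv: "real (card vals) \<le> exp c'"
 proof -
  have "card ((\<lambda>d. 2 ^ d) ` {..dm} \<union> (\<lambda>d. - (2 ^ d)) ` {..dm} :: real set) \<le> card {..dm} + card {..dm}"
   by (rule order_trans[OF card_Un_le add_mono[OF card_image_le card_image_le]]) auto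
  then have "card vals \<le> 2 * dm + 3" unfolding vals_def by (simp add: card_insert_if)
  then have "real (card vals) \<le> real (2 * dm + 3)" by (simp only: of_nat_le_iff)
  then show ?thesis using dm by linarith
 qed
 define S where "S = Sigma KK (\<lambda>K. PiE (cls K) (\<lambda>_. vals))"
 have finS: "finite S" unfolding S_def using finKK finc finv by (intro finite_SigmaI finite_PiE) auto
 define H where "H = (\<lambda>K::(nat+nat) set. (c + c' + r) * real (card K))"
 define v where "v = (\<lambda>K z i. \<Sum>j\<in>cls K. (a i j * z j)\<^sup>2)"
 define Q where "Q = (\<lambda>(K,z) e. (\<Sum>i\<in>{i\<in>A. v K z i \<le> 8}. max 0 ((\<Sum>j\<in>cls K. a i j * z j * e i j)\<^sup>2 - L * v K z i))
    > 144 * exp (- L / 8) * (\<Sum>i\<in>{i\<in>A. v K z i \<le> 8}. v K z i) + 16 * 8 * H K)"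
 have "pr n (\<lambda>e. \<not> fgood A a e b dm m L (128 * (c + c' + r))) \<le> pr n (\<lambda>e. \<exists>x\<in>S. Q x e)"
 proof (rule pr_mono)
  fix e assume "\<not> fgood A a e b dm m L (128 * (c + c' + r))"
  then obtain K z where K: "K \<subseteq> VV A" "conn (near3 (adj A a)) K" "m \<le> card K"
   and z: "\<forall>j\<in>cls K. z j = 0 \<or> (\<exists>d. b \<le> d \<and> d \<le> dm \<and> \<bar>z j\<bar> = 2 ^ d)"
   and g: "(\<Sum>i\<in>{i\<in>A. v K z i \<le> 8}. max 0 ((\<Sum>j\<in>cls K. a i j * z j * e i j)\<^sup>2 - L * v K z i))
    > 144 * exp (- L / 8) * (\<Sum>j\<in>cls K. (z j)\<^sup>2) + (128 * (c + c' + r)) * real (card K)"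
   unfolding fgood_def v_def by (auto simp: not_le)
  have KK: "K \<in> KK" using K by (simp add: KK_def)
  define z' where "z' = restrict z (cls K)"
  have "z j \<in> vals" if j: "j \<in> cls K" for j
  proof (cases "z j = 0")
   case False
   then obtain d where d: "d \<le> dm" "\<bar>z j\<bar> = 2 ^ d" using z[rule_format, OF j] by auto
   then have "z j = 2 ^ d \<or> z j = - (2 ^ d)" by linarith
   then show ?thesis using d by (auto simp: vals_def)
  qed (simp add: vals_def)
  then have S: "(K, z') \<in> S" using KK by (auto simp: S_def z'_def)
  have vz: "v K z' = v K z" by (auto simp: v_def z'_def fun_eq_iff)
  have Y: "(\<Sum>j\<in>cls K. a i j * z' j * e i j) = (\<Sum>j\<in>cls K. a i j * z j * e i j)" for i by (auto simp: z'_def)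
  have "(\<Sum>i\<in>{i\<in>A. v K z i \<le> 8}. v K z i) \<le> (\<Sum>i\<in>A. v K z i)" by (intro sum_mono2) (auto simp: v_def intro!: sum_nonneg)
  also have "... = (\<Sum>j\<in>cls K. (\<Sum>i\<in>A. (a i j)\<^sup>2) * (z j)\<^sup>2)"
   unfolding v_def by (subst sum.swap) (simp add: power_mult_distrib sum_distrib_right)
  also have "... \<le> (\<Sum>j\<in>cls K. 1 * (z j)\<^sup>2)" using finc(2)[OF KK] col by (intro sum_mono mult_right_mono) auto
  finally have "144 * exp (- L / 8) * (\<Sum>i\<in>{i\<in>A. v K z i \<le> 8}. v K z i) \<le> 144 * exp (- L / 8) * (\<Sum>j\<in>cls K. (z j)\<^sup>2)"
   by (intro mult_left_mono) auto
  then have "Q (K, z') e" using g unfolding Q_def prod.case vz Y H_def by linarith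
  then show "\<exists>x\<in>S. Q x e" using S by blast
 qed
 also have "... \<le> (\<Sum>x\<in>S. exp (- H (fst x)))"
 proof (rule pr_ex_le[OF finS])
  fix x assume x: "x \<in> S"
  obtain K z where xe: "x = (K, z)" by (cases x)
  have K: "K \<in> KK" using x xe by (auto simp: S_def)
  show "pr n (Q x) \<le> exp (- H (fst x))"
   unfolding Q_def xe prod.case fst_conv
   by (rule chi_tail) (use finc(2)[OF K] A L in \<open>auto simp: v_def\<close>)
 qed
 also have "... = (\<Sum>K\<in>KK. \<Sum>z\<in>PiE (cls K) (\<lambda>_. vals). exp (- H K))"
  unfolding S_def using finKK finc finv by (subst sum.Sigma) (auto intro!: finite_PiE simp: case_prod_beta)
 also have "... \<le> (\<Sum>K\<in>KK. exp (- (c + r) * real (card K)))"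
 proof (rule sum_mono)
  fix K assume K: "K \<in> KK"
  have cK: "card (cls K) \<le> card K" using card_VV[OF finite_subset[OF KKf(1)[OF K]]] by simp
  have "real (card (PiE (cls K) (\<lambda>_. vals))) = real (card vals) ^ card (cls K)" using finc[OF K] by (simp add: card_PiE)
  also have "... \<le> exp c' ^ card (cls K)" using cv by (intro power_mono) auto
  also have "... \<le> exp c' ^ card K" using cK dm by (intro power_increasing) auto
  also have "... = exp (c' * real (card K))" by (simp flip: exp_of_nat_mult add: mult.commute)
  finally have "(\<Sum>z\<in>PiE (cls K) (\<lambda>_. vals). exp (- H K)) \<le> exp (c' * real (card K)) * exp (- H K)"
   by (simp add: mult_right_mono)
  then show "(\<Sum>z\<in>PiE (cls K) (\<lambda>_. vals). exp (- H K)) \<le> exp (- (c + r) * real (card K))"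
   by (simp add: H_def mult_exp_exp algebra_simps)
 qed
 also have "... \<le> 2 * exp (- r * real m)"
 proof (rule sum_family[OF finKK _ r])
  fix M assume "m \<le> M"
  then have "{K\<in>KK. card K = M} = {K. K \<subseteq> VV A \<and> conn (near3 (adj A a)) K \<and> card K = M}" by (auto simp: KK_def)
  then show "real (card {K\<in>KK. card K = M}) \<le> exp (c * real M)" using cnt[OF \<open>m \<le> M\<close>] by simp
 qed (use KKf in auto)
 finally show ?thesis .
qed

lemma (in mat) adj_degree:
 assumes D: "\<And>i j. i \<in> A ==> j \<in> A ==> a i j \<noteq> 0 ==> (a i j)\<^sup>2 * D \<ge> 1" "D > 0" and x: "x \<in> VV A"
 shows "real (card {y\<in>VV A. adj A a x y}) \<le> D"
proof -
 have "real (card {y\<in>VV A. adj A a x y}) * (1 / D) = (\<Sum>y\<in>{y\<in>VV A. adj A a x y}. 1 / D)" by simp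
 also have "... \<le> (\<Sum>y\<in>{y\<in>VV A. adj A a x y}. wt A a x y)"
 proof (rule sum_mono)
  fix y assume "y \<in> {y\<in>VV A. adj A a x y}"
  then have "wt A a x y * D \<ge> 1" using D(1) by (auto simp: wt_def split: sum.splits if_splits)
  then show "1 / D \<le> wt A a x y" using D(2) by (simp add: field_simps)
 qed
 also have "... \<le> imass (wt A a) (VV A) x" unfolding imass_def by (intro sum_mono2) (auto simp: wt_nonneg)
 also have "... \<le> 1" by (rule VV_imass[OF _ x]) unfold_locales
 finally show ?thesis using D(2) by (simp add: field_simps)
qed

section \<open>Parameters, and counts of connected and of dense sets\<close>

lemma card_VV_A: "finite A ==> card (VV A) = 2 * card A"
 using card_VV[of "VV A"] by simp

text \<open>The block size bound \<open>N\<close> and its iterated logarithms;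
  \<open>l \<ge> 50\<close> secures the numerical comparisons below.\<close>

locale nums =
 fixes N P h l :: real
 assumes N: "N = exp P" and P: "P = exp h" and h: "h = exp l" and l: "l \<ge> 50"
begin

lemma exp_ge_4: "exp x \<ge> (x / 4) ^ 4" if "x \<ge> 0" for x :: real
proof -
 have "x / 4 \<le> exp (x / 4)" using exp_ge_add_one_self[of "x / 4"] by linarith
 then have "(x / 4) ^ 4 \<le> exp (x / 4) ^ 4" using that by (intro power_mono) auto
 also have "... = exp x" by (simp flip: exp_of_nat_mult)
 finally show ?thesis .
qed

lemma h_ge: "h \<ge> 480 * l"
proof -
 have "480 * l \<le> l ^ 4 / 256"
 proof -
  have "(50::real) ^ 3 \<le> l ^ 3" using l by (intro power_mono) auto
  then have "122880 * l \<le> l ^ 3 * l" using l by (intro mult_right_mono) auto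
  then show ?thesis by (simp add: eval_nat_numeral)
 qed
 also have "... = (l / 4) ^ 4" by (simp add: power_divide)
 also have "... \<le> h" unfolding h using l by (intro exp_ge_4) auto
 finally show ?thesis .
qed

lemma h_big: "h \<ge> 24000" using h_ge l by linarith

lemma P_ge: "P \<ge> 1000 * h"
proof -
 have "1000 * h \<le> h ^ 4 / 256"
 proof -
  have "(24000::real) ^ 3 \<le> h ^ 3" using h_big by (intro power_mono) auto
  then have "256000 * h \<le> h ^ 3 * h" using h_big by (intro mult_right_mono) auto
  then show ?thesis by (simp add: eval_nat_numeral)
 qed
 also have "... = (h / 4) ^ 4" by (simp add: power_divide)
 also have "... \<le> P" unfolding P using h_big by (intro exp_ge_4) auto
 finally show ?thesis .
qed

lemma P_big: "P \<ge> 24000000" using P_ge h_big by linarith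
lemma N_pos: "N > 0" by (simp add: N)
lemma four_P: "4 * P \<le> exp P"
proof -
 have "4 * P \<le> P ^ 4 / 256"
 proof -
  have "(24000000::real) ^ 3 \<le> P ^ 3" using P_big by (intro power_mono) auto
  then have "1024 * P \<le> P ^ 3 * P" using P_big by (intro mult_right_mono) auto
  then show ?thesis by (simp add: eval_nat_numeral)
 qed
 also have "... = (P / 4) ^ 4" by (simp add: power_divide)
 also have "... \<le> exp P" using P_big by (intro exp_ge_4) auto
 finally show ?thesis .
qed

end

text \<open>Absorbs the constants of the union bound over at most \<open>exp (16 P)\<close> column sets.\<close>

definition ZR :: "real => real" where "ZR R = 40 + 4 * R * exp 1000"

lemma opb_mono: "opb Z a I J e ==> Z \<le> Z' ==> opb Z' a I J e"
 unfolding opb_def by (meson mult_right_mono order_trans real_sqrt_ge_zero sqn_nonneg)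

lemma mom_tp:
 assumes A: "A \<subseteq> {1..n}" and m: "mom n A a p R"
 shows "mom n A (\<lambda>i j. a j i) p R"
 unfolding mom_def
proof (intro allI)
 fix s t
 have e: "bform (\<lambda>i j. a j i) A A e s t = bform a A A (tp n e) t s" for e
  unfolding bform_def using A by (subst sum.swap) (auto intro!: sum.cong simp: tp_apply subset_iff)
 have "avg n (\<lambda>e. \<bar>bform (\<lambda>i j. a j i) A A e s t\<bar> powr p) = avg n (\<lambda>e. \<bar>bform a A A e t s\<bar> powr p)"
  unfolding e by (rule avg_tp[of n "\<lambda>e. \<bar>bform a A A e t s\<bar> powr p"])
 also have "... \<le> (R * sqrt (sqn A t) * sqrt (sqn A s)) powr p" using m by (simp add: mom_def)
 finally show "avg n (\<lambda>e. \<bar>bform (\<lambda>i j. a j i) A A e s t\<bar> powr p) \<le> (R * sqrt (sqn A s) * sqrt (sqn A t)) powr p"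
  by (simp add: mult_ac)
qed

text \<open>A block with its moment hypothesis. The order \<open>p\<close> is only comparable to
  \<open>P\<close>, since it is the logarithm of the size of an earlier layer; 17 is the ratio found
  in \<open>nums_ex\<close>.\<close>

locale par = mat n A a + nums N P h l for n A a N P h l +
 fixes p R :: real
 assumes cA: "real (card A) \<le> N" and mom: "mom n A a p R" and R: "R > 0" and p: "P \<le> 17 * p"
begin

lemma par_tp: "par n A (\<lambda>i j. a j i) N P h l p R"
proof -
 interpret T: mat n A "\<lambda>i j. a j i" by (rule mat_tp)
 show ?thesis by unfold_locales (use cA mom_tp[OF A mom] R p in auto)
qed

text \<open>Entropy \<open>c\<close> per vertex; the prefactor \<open>2 * N\<close> bounds the
  number of vertices, the choices of a starting point.\<close>

definition cntf :: "((nat + nat) set => bool) => real => bool" where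
 "cntf Pr c \<longleftrightarrow> (\<forall>M. real (card {K. K \<subseteq> VV A \<and> Pr K \<and> card K = M}) \<le> 2 * N * exp (c * real M))"

text \<open>Below \<open>P / eta\<close> vertices the entropy is at most \<open>k * P\<close> in
  total. There are at most \<open>2 * P\<close> sizes, and the remaining factor
  \<open>4 * P * N\<close> is at most \<open>exp (2 * P)\<close>, so \<open>opb_family\<close>
  applies with \<open>c = k + 2\<close>; \<open>k \<le> 14\<close> fits its constants into
  \<open>ZR\<close>.\<close>

lemma fam_opb:
 assumes eta: "1 \<le> eta" and k: "0 \<le> k" "k \<le> 14" and cnt: "cntf Pr (k * eta)"
 shows "pr n (\<lambda>e. \<exists>K. K \<subseteq> VV A \<and> Pr K \<and> real (card K) < P / eta \<and> \<not> opb (ZR R) a A (cls K) e) \<le> 2 * exp (- 4 * P)"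
proof -
 define F where "F = {K. K \<subseteq> VV A \<and> Pr K \<and> real (card K) < P / eta}"
 define KK where "KK = cls ` F"
 have finF: "finite F" unfolding F_def by (rule finite_subset[of _ "Pow (VV A)"]) auto
 have Pe: "P / eta \<le> P" using eta P_big by (simp add: divide_le_eq mult_le_cancel_left1)
 define m where "m = nat \<lceil>P / eta\<rceil>"
 have "F \<subseteq> (\<Union>M\<in>{..<m}. {K. K \<subseteq> VV A \<and> Pr K \<and> card K = M})"
  by (auto simp: F_def m_def) linarith
 then have "card F \<le> card (\<Union>M\<in>{..<m}. {K. K \<subseteq> VV A \<and> Pr K \<and> card K = M})"
  by (rule card_mono[rotated]) (auto intro!: finite_subset[of _ "Pow (VV A)"])
 also have "... \<le> (\<Sum>M\<in>{..<m}. card {K. K \<subseteq> VV A \<and> Pr K \<and> card K = M})" by (intro card_UN_le) auto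
 finally have "real (card F) \<le> (\<Sum>M\<in>{..<m}. real (card {K. K \<subseteq> VV A \<and> Pr K \<and> card K = M}))"
  by (simp flip: of_nat_sum)
 also have "... \<le> (\<Sum>M\<in>{..<m}. 2 * N * exp (k * P))"
 proof (rule sum_mono)
  fix M assume "M \<in> {..<m}"
  then have M: "real M \<le> P / eta" by (simp add: m_def) linarith
  have "k * eta * real M \<le> k * eta * (P / eta)" using k eta M by (intro mult_left_mono) auto
  then have "k * eta * real M \<le> k * P" using eta by simp
  then have "2 * N * exp (k * eta * real M) \<le> 2 * N * exp (k * P)" using N_pos by simp
  then show "real (card {K. K \<subseteq> VV A \<and> Pr K \<and> card K = M}) \<le> 2 * N * exp (k * P)"
   using cnt unfolding cntf_def by (meson order_trans)
 qed
 also have "... = real m * (2 * N * exp (k * P))" by simp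
 also have "... \<le> (2 * P) * (2 * N * exp (k * P))"
  using Pe P_big N_pos unfolding m_def by (intro mult_right_mono) (linarith, auto)
 also have "... = (4 * P) * exp P * exp (k * P)" by (simp add: N)
 also have "... \<le> exp P * exp P * exp (k * P)" using four_P by (intro mult_right_mono) auto
 finally have cF: "real (card F) \<le> exp ((k + 2) * P)" by (simp add: mult_exp_exp algebra_simps)
 have cKK: "real (card KK) \<le> exp ((k + 2) * P)" using card_image_le[OF finF, of cls] cF unfolding KK_def by linarith
 have Z: "sqrt (736 + 16 * (k + 2)) + 4 * R * exp (17 * ((k + 2) + 34)) \<le> ZR R"
 proof -
  have "sqrt (736 + 16 * (k + 2)) \<le> 40" using k by (intro real_le_lsqrt) auto
  moreover have "4 * R * exp (17 * ((k + 2) + 34)) \<le> 4 * R * exp 1000" using k R by (intro mult_left_mono) auto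
  ultimately show ?thesis by (simp add: ZR_def)
 qed
 have "pr n (\<lambda>e. \<exists>K. K \<subseteq> VV A \<and> Pr K \<and> real (card K) < P / eta \<and> \<not> opb (ZR R) a A (cls K) e) \<le>
   pr n (\<lambda>e. \<exists>K\<in>KK. \<not> opb (sqrt (736 + 16 * (k + 2)) + 4 * R * exp (17 * ((k + 2) + 34))) a A K e)"
 proof (rule pr_mono, elim exE conjE)
  fix e K assume K: "K \<subseteq> VV A" "Pr K" "real (card K) < P / eta" and no: "\<not> opb (ZR R) a A (cls K) e"
  have "cls K \<in> KK" using K by (simp add: KK_def F_def)
  moreover have "\<not> opb (sqrt (736 + 16 * (k + 2)) + 4 * R * exp (17 * ((k + 2) + 34))) a A (cls K) e"
   using opb_mono[OF _ Z, of a A "cls K" e] no by argo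
  ultimately show "\<exists>K\<in>KK. \<not> opb (sqrt (736 + 16 * (k + 2)) + 4 * R * exp (17 * ((k + 2) + 34))) a A K e" by (rule bexI[rotated])
 qed
 also have "... \<le> 2 * exp (- 4 * P)"
 proof (rule opb_family[OF mom R _ p])
  show "finite KK" using finF by (simp add: KK_def)
  show "real (card KK) \<le> exp ((k + 2) * P)" by (rule cKK)
  fix K assume "K \<in> KK"
  then obtain F0 where F0: "F0 \<subseteq> VV A" "real (card F0) < P / eta" "K = cls F0" by (auto simp: KK_def F_def)
  have "card (cls F0) \<le> card F0" using card_VV[OF finite_subset[OF F0(1)]] by simp
  then show "K \<subseteq> A \<and> real (card K) \<le> P" using F0 cls_sub[OF F0(1)] Pe by simp
 qed (use P_big k in auto)
 finally show ?thesis .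
qed

text \<open>From \<open>P / eta\<close> vertices on, the prefactor \<open>2 * N\<close> is absorbed
  into the entropy per vertex.\<close>

lemma cnt_large:
 assumes eta: "1 \<le> eta" and k: "0 \<le> k" and cnt: "cntf Pr (k * eta)" and M: "P / eta \<le> real M"
 shows "real (card {K. K \<subseteq> VV A \<and> Pr K \<and> card K = M}) \<le> exp ((k + 2) * eta * real M)"
proof -
 have PM: "P \<le> eta * real M" using M eta by (simp add: field_simps)
 have "2 \<le> exp P" using P_big exp_ge_add_one_self[of P] by linarith
 then have "2 * N \<le> exp P * exp P" unfolding N by (intro mult_right_mono) auto
 also have "... \<le> exp (2 * eta * real M)" using PM by (simp add: mult_exp_exp)
 finally have "2 * N * exp (k * eta * real M) \<le> exp (2 * eta * real M) * exp (k * eta * real M)" by (intro mult_right_mono) auto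
 then show ?thesis using cnt unfolding cntf_def by (simp add: mult_exp_exp algebra_simps) (meson order_trans)
qed

lemma fam_dev:
 assumes eta: "1 \<le> eta" and k: "0 \<le> k" and cnt: "cntf Pr (k * eta)"
  and Bd: "\<And>K. K \<subseteq> VV A ==> (\<Sum>i\<in>rws K. \<Sum>j\<in>cls K. (y K i j)\<^sup>2) \<le> Bd K"
 shows "pr n (\<lambda>e. \<exists>K th. K \<subseteq> VV A \<and> Pr K \<and> P / eta \<le> real (card K) \<and> (\<forall>x\<in>K. (th x)\<^sup>2 = 1) \<and>
   \<bar>\<Sum>i\<in>rws K. \<Sum>j\<in>cls K. y K i j * e i j * th (Inl i) * th (Inr j)\<bar> > sqrt (2 * Bd K * ((k + 7) * eta * real (card K)))) \<le> 4 * exp (- 4 * P)"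
proof -
 define m where "m = nat \<lceil>P / eta\<rceil>"
 have mM: "m \<le> M \<longleftrightarrow> P / eta \<le> real M" for M unfolding m_def by linarith
 define KK where "KK = {K. K \<subseteq> VV A \<and> Pr K \<and> P / eta \<le> real (card K)}"
 have B0: "Bd K \<ge> 0" if "K \<subseteq> VV A" for K
  using Bd[OF that] by (rule order_trans[rotated]) (auto intro!: sum_nonneg)
 have "pr n (\<lambda>e. \<exists>K th. K \<subseteq> VV A \<and> Pr K \<and> P / eta \<le> real (card K) \<and> (\<forall>x\<in>K. (th x)\<^sup>2 = 1) \<and>
   \<bar>\<Sum>i\<in>rws K. \<Sum>j\<in>cls K. y K i j * e i j * th (Inl i) * th (Inr j)\<bar> > sqrt (2 * Bd K * ((k + 7) * eta * real (card K))))
  \<le> pr n (\<lambda>e. \<exists>K\<in>KK. \<exists>th. (\<forall>x\<in>K. (th x)\<^sup>2 = 1) \<and>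
   \<bar>\<Sum>i\<in>rws K. \<Sum>j\<in>cls K. y K i j * e i j * th (Inl i) * th (Inr j)\<bar> > sqrt (2 * Bd K * (((k + 2) * eta + 1 + 4 * eta) * real (card K))))"
 proof (rule pr_mono, elim exE conjE)
  fix e K th assume K: "K \<subseteq> VV A" "Pr K" "P / eta \<le> real (card K)" and th: "\<forall>x\<in>K. (th x)\<^sup>2 = 1"
   and g: "\<bar>\<Sum>i\<in>rws K. \<Sum>j\<in>cls K. y K i j * e i j * th (Inl i) * th (Inr j)\<bar> > sqrt (2 * Bd K * ((k + 7) * eta * real (card K)))"
  \<comment> \<open>The 7 in \<open>k + 7\<close> consists of 2 from \<open>cnt_large\<close>, 4 for
    the final probability and 1 for the sign vectors.\<close>
  have "sqrt (2 * Bd K * (((k + 2) * eta + 1 + 4 * eta) * real (card K))) \<le> sqrt (2 * Bd K * ((k + 7) * eta * real (card K)))"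
  proof (intro real_sqrt_le_mono mult_left_mono mult_right_mono)
   show "(k + 2) * eta + 1 + 4 * eta \<le> (k + 7) * eta" using eta by (simp add: algebra_simps)
  qed (use B0[OF K(1)] in simp_all)
  then have g2: "\<bar>\<Sum>i\<in>rws K. \<Sum>j\<in>cls K. y K i j * e i j * th (Inl i) * th (Inr j)\<bar> > sqrt (2 * Bd K * (((k + 2) * eta + 1 + 4 * eta) * real (card K)))"
   by (rule le_less_trans) (rule g)
  have "K \<in> KK" using K unfolding KK_def by blast
  with g2 th show "\<exists>K\<in>KK. \<exists>th. (\<forall>x\<in>K. (th x)\<^sup>2 = 1) \<and>
   \<bar>\<Sum>i\<in>rws K. \<Sum>j\<in>cls K. y K i j * e i j * th (Inl i) * th (Inr j)\<bar> > sqrt (2 * Bd K * (((k + 2) * eta + 1 + 4 * eta) * real (card K)))"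
   by blast
 qed
 also have "... \<le> 4 * exp (- (4 * eta) * real m)"
 proof (rule dev_family)
  fix M assume "m \<le> M"
  then have M: "P / eta \<le> real M" by (simp add: mM)
  have "{K\<in>KK. card K = M} = {K. K \<subseteq> VV A \<and> Pr K \<and> card K = M}" using M by (auto simp: KK_def)
  then show "real (card {K\<in>KK. card K = M}) \<le> exp ((k + 2) * eta * real M)" using cnt_large[OF eta k cnt M] by simp
 qed (use eta k Bd mM in \<open>auto simp: KK_def\<close>)
 also have "... \<le> 4 * exp (- 4 * P)"
 proof -
  have "P / eta \<le> real m" using mM[of m] by simp
  then have "P \<le> eta * real m" using eta by (simp add: field_simps)
  then show ?thesis by simp
 qed
 finally show ?thesis .
qed

lemma near3_card:
 assumes D: "\<And>i j. i \<in> A ==> j \<in> A ==> a i j \<noteq> 0 ==> (a i j)\<^sup>2 * (4 * P) \<ge> 1" and x: "x \<in> VV A"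
 shows "real (card {y\<in>VV A. near3 (adj A a) x y}) + 1 \<le> exp (4 * h)"
proof -
 define d where "d = nat \<lfloor>4 * P\<rfloor>"
 have d: "real d \<le> 4 * P" using P_big by (simp add: d_def)
 have deg: "card {y\<in>VV A. adj A a x y} \<le> d" if "x \<in> VV A" for x
  using adj_degree[OF D _ that] P_big unfolding d_def by (simp add: le_nat_floor)
 have "card {y\<in>VV A. near3 (adj A a) x y} \<le> d + d * d + d * d * d"
  by (rule near3_degree[OF finite_VV[OF finA] wt_V deg x])
 then have "real (card {y\<in>VV A. near3 (adj A a) x y}) \<le> real (d + d * d + d * d * d)" by (simp only: of_nat_le_iff)
 also have "... = real d + real d * real d + real d * real d * real d" by simp
 also have "... \<le> 4 * P + (4 * P) * (4 * P) + (4 * P) * (4 * P) * (4 * P)"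
  using d P_big by (intro add_mono mult_mono) auto
 also have "... + 1 \<le> 100 * (P * P * P)"
 proof -
  have 1: "1 \<le> P" using P_big by simp
  have 2: "1 * P \<le> P * P" using 1 by (intro mult_right_mono) auto
  have 3: "1 * (P * P) \<le> P * (P * P)" using 1 by (intro mult_right_mono) auto
  have "1 \<le> P * (P * P)" "P \<le> P * (P * P)" "P * P \<le> P * (P * P)" using 1 2 3 by linarith+
  then show ?thesis by (simp add: mult.assoc)
 qed
 also have "... \<le> P * (P * P * P)" using P_big by (intro mult_right_mono) auto
 also have "... = exp (4 * h)"
  unfolding P by (simp add: mult_exp_exp)
 finally show ?thesis by simp
qed

lemma cnt_conn:
 assumes sym: "\<And>x y. r x y ==> r y x" and deg: "\<And>x. x \<in> VV A ==> real (card {y\<in>VV A. r x y}) + 1 \<le> exp c" and c: "c \<ge> 0"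
 shows "cntf (conn r) (2 * c)"
 unfolding cntf_def
proof
 fix M
 define d where "d = nat \<lfloor>exp c - 1\<rfloor>"
 have deg': "card {y\<in>VV A. r x y} \<le> d" if "x \<in> VV A" for x
  unfolding d_def by (rule le_nat_floor) (use deg[OF that] in simp)
 have d: "real d + 1 \<le> exp c" using c unfolding d_def by (simp add: of_nat_floor)
 have "card {K. K \<subseteq> VV A \<and> conn r K \<and> card K = M} \<le> card (VV A) * (d + 1) ^ (2 * M)"
  by (rule card_conn[OF finite_VV[OF finA] deg' sym])
 then have "real (card {K. K \<subseteq> VV A \<and> conn r K \<and> card K = M}) \<le> real (card (VV A) * (d + 1) ^ (2 * M))" by (simp only: of_nat_le_iff)
 also have "... = 2 * real (card A) * (real d + 1) ^ (2 * M)" by (simp add: card_VV_A add.commute)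
 also have "... \<le> 2 * N * exp c ^ (2 * M)" using d cA by (intro mult_mono power_mono) (use N_pos in auto)
 also have "... = 2 * N * exp (2 * c * real M)" by (simp flip: exp_of_nat_mult add: mult_ac)
 finally show "real (card {K. K \<subseteq> VV A \<and> conn r K \<and> card K = M}) \<le> 2 * N * exp (2 * c * real M)" .
qed

lemma cnt_conn3:
 assumes D: "\<And>i j. i \<in> A ==> j \<in> A ==> a i j \<noteq> 0 ==> (a i j)\<^sup>2 * (4 * P) \<ge> 1"
 shows "cntf (conn (near3 (adj A a))) (8 * h)"
 using cnt_conn[OF near3_adj_sym near3_card[OF D]] h_big by simp

lemma cnt_conn1:
 assumes D: "\<And>i j. i \<in> A ==> j \<in> A ==> a i j \<noteq> 0 ==> (a i j)\<^sup>2 * h ^ 6 \<ge> 1"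
 shows "cntf (conn (adj A a)) (14 * l)"
proof -
 have "real (card {y\<in>VV A. adj A a x y}) + 1 \<le> exp (7 * l)" if x: "x \<in> VV A" for x
 proof -
  have "real (card {y\<in>VV A. adj A a x y}) \<le> h ^ 6" using adj_degree[OF D _ x] h_big by simp
  moreover have "1 \<le> h ^ 6" using h_big by (intro one_le_power) auto
  moreover have "h ^ 6 * 2 \<le> h ^ 6 * h" using h_big by (intro mult_left_mono) auto
  moreover have "h ^ 6 * h = exp (7 * l)" unfolding h by (simp add: mult_exp_exp flip: exp_of_nat_mult)
  ultimately show ?thesis by linarith
 qed
 from cnt_conn[OF adj_sym this] show ?thesis using l by simp
qed

text \<open>A sampling rate \<open>1 / Q\<close> with \<open>Q\<close> about \<open>h\<close> makes
  the connected part of the choice cost a bounded amount per vertex: its entropy is of order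
  \<open>h\<close>, but it has only \<open>4 * M / Q\<close> vertices. What is left is the logarithm
  of \<open>4 / \<rho> = 4 * h\<^sup>2\<close>; in total 43 + 2 * l <= 3 * l. The bound
  \<open>1 / h ^ 6\<close> on the squares of the entries supplies the hypothesis
  \<open>small\<close> of \<open>card_dense\<close>.\<close>

lemma cnt_dense:
 assumes D: "\<And>i j. i \<in> A ==> j \<in> A ==> a i j \<noteq> 0 ==> (a i j)\<^sup>2 * (4 * P) \<ge> 1"
  and U: "\<And>i j. i \<in> A ==> j \<in> A ==> (a i j)\<^sup>2 \<le> 1 / h ^ 6"
 shows "cntf (dense (wt A a) (1 / h\<^sup>2)) (3 * l)"
 unfolding cntf_def
proof
 fix M
 define d where "d = nat \<lfloor>exp (4 * h) - 1\<rfloor>"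
 define Q where "Q = nat \<lceil>h\<rceil>"
 have deg: "card {y\<in>VV A. near3 (adj A a) x y} \<le> d" if "x \<in> VV A" for x
  unfolding d_def by (rule le_nat_floor) (use near3_card[OF D that] in simp)
 have d: "real d + 1 \<le> exp (4 * h)" using h_big unfolding d_def by (simp add: of_nat_floor)
 have Q: "h \<le> real Q" "real Q \<le> 2 * h" using h_big unfolding Q_def by linarith+
 have wU: "wt A a x y \<le> 1 / h ^ 6" for x y using U h_big by (auto simp: wt_def split: sum.splits)
 have small: "4 * (1 / h ^ 6) * real Q ^ 2 \<le> 1 / h\<^sup>2"
 proof -
  have "real Q ^ 2 \<le> (2 * h)\<^sup>2" using Q by (intro power_mono) auto
  then have "4 * (1 / h ^ 6) * real Q ^ 2 \<le> 4 * (1 / h ^ 6) * (2 * h)\<^sup>2" using h_big by (intro mult_left_mono) auto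
  also have "... = 16 / h\<^sup>2 / h\<^sup>2" using h_big by (simp add: field_simps eval_nat_numeral)
  also have "... \<le> 1 / h\<^sup>2"
  proof (rule divide_right_mono)
   have "16 \<le> h * h" using h_big mult_mono[of 4 h 4 h] by simp
   then show "16 / h\<^sup>2 \<le> 1" using h_big by (simp add: power2_eq_square)
  qed simp
  finally show ?thesis .
 qed
 have "real (card {K. K \<subseteq> VV A \<and> dense (wt A a) (1 / h\<^sup>2) K \<and> card K = M}) \<le>
   real (card (VV A)) * real (4 * M + 1) * (2 * (real d + 1)\<^sup>2) powr (4 * real M / real Q) * (4 / (1 / h\<^sup>2)) ^ M * exp (real M)"
  by (rule card_dense[OF finite_VV[OF finA] wt_nonneg wt_sym wU _ VV_imass _ _ _ small deg])
   (use h_big Q in \<open>auto intro: mat_axioms one_le_power\<close>)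
 also have "... \<le> (2 * N) * exp (4 * real M) * exp (36 * real M) * exp ((2 + 2 * l) * real M) * exp (real M)"
 proof (intro mult_mono)
  show "real (card (VV A)) \<le> 2 * N" using cA by (simp add: card_VV_A)
  show "real (4 * M + 1) \<le> exp (4 * real M)" using exp_ge_add_one_self[of "4 * real M"] by simp
  have e2: "2 \<le> exp h" using exp_ge_add_one_self[of h] h_big by linarith
  have "2 * (real d + 1)\<^sup>2 \<le> exp h * (exp (4 * h))\<^sup>2"
   using d e2 by (intro mult_mono power_mono) auto
  also have "... = exp (9 * h)" by (simp add: power2_eq_square mult_exp_exp)
  finally have "(2 * (real d + 1)\<^sup>2) powr (4 * real M / real Q) \<le> exp (9 * h) powr (4 * real M / real Q)"
   by (intro powr_mono2) auto
  also have "... = exp (4 * real M / real Q * (9 * h))" by (simp add: powr_def)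
  also have "... \<le> exp (36 * real M)"
  proof -
   have "4 * real M / real Q * (9 * h) = 36 * real M * (h / real Q)" by simp
   also have "... \<le> 36 * real M * 1" using Q h_big by (intro mult_left_mono) (auto simp: divide_le_eq)
   finally show ?thesis by simp
  qed
  finally show "(2 * (real d + 1)\<^sup>2) powr (4 * real M / real Q) \<le> exp (36 * real M)" .
  have "4 / (1 / h\<^sup>2) = 4 * h\<^sup>2" by simp
  also have "... \<le> exp 2 * h\<^sup>2"
  proof (rule mult_right_mono)
   have "(2::real)\<^sup>2 \<le> (exp 1)\<^sup>2" using exp_ge_add_one_self[of 1] by (intro power_mono) auto
   then show "(4::real) \<le> exp 2" by (simp flip: exp_of_nat_mult)
  qed simp
  also have "... = exp (2 + 2 * l)" unfolding h by (simp add: mult_exp_exp power2_eq_square)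
  finally have "(4 / (1 / h\<^sup>2)) ^ M \<le> exp (2 + 2 * l) ^ M" by (intro power_mono) auto
  then show "(4 / (1 / h\<^sup>2)) ^ M \<le> exp ((2 + 2 * l) * real M)" by (simp flip: exp_of_nat_mult add: mult.commute)
 qed (use N_pos in auto)
 also have "... = 2 * N * exp ((43 + 2 * l) * real M)" by (simp add: mult_exp_exp algebra_simps)
 also have "... \<le> 2 * N * exp (3 * l * real M)" using l N_pos by (auto intro!: mult_right_mono)
 finally show "real (card {K. K \<subseteq> VV A \<and> dense (wt A a) (1 / h\<^sup>2) K \<and> card K = M}) \<le> 2 * N * exp (3 * l * real M)" .
qed

end

lemma ex_pow4:
 assumes "X \<ge> (1::real)"
 shows "\<exists>k::nat. X < 4 ^ k \<and> 4 ^ k \<le> 4 * X"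
proof -
 obtain k :: nat where k: "1 / (4 * X) \<le> (1/4) ^ k" "(1/4) ^ k < 4 * (1 / (4 * X))"
  using ex_level[of "1 / (4 * X)"] assms by auto
 have "X < 4 ^ k" using k(2) assms by (simp add: power_divide field_simps)
 moreover have "4 ^ k \<le> 4 * X" using k(1) assms by (simp add: power_divide field_simps)
 ultimately show ?thesis by blast
qed

lemma exp_nat_le_pow4: "exp (real k) \<le> 4 ^ k"
proof -
 have "exp (real k) = exp 1 ^ k" by (simp flip: exp_of_nat_mult)
 also have "... \<le> 4 ^ k" using exp_le by (intro power_mono) auto
 finally show ?thesis .
qed

context cfg
begin

lemma dev_nbd:
 assumes K: "K \<subseteq> VV A"
  and d: "\<bar>\<Sum>i\<in>rws K. \<Sum>j\<in>cls K. a i j * e i j * th (Inl i) * th (Inr j)\<bar> \<le> sqrt (eta * real (card K) * frob K)"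
  and Z: "Z \<ge> 0" and beta: "beta \<ge> 0"
 shows "nbd Z eta beta K"
proof -
 have "0 \<le> Z * sqrt (real (card (rws K)) * real (card (cls K)))" "beta * real (card K) \<ge> 0" using Z beta by auto
 then show ?thesis using d unfolding nbd_def tform_def bform_def by linarith
qed

end

lemma (in mat) light_frob:
 assumes K: "K \<subseteq> VV A" and rho: "rho \<ge> 0"
 shows "(\<Sum>i\<in>rws K. \<Sum>j\<in>cls K. (if Inl i \<in> core (wt A a) rho K \<and> Inr j \<in> core (wt A a) rho K then 0 else a i j)\<^sup>2) \<le> rho * real (card K)"
proof -
 have finK: "finite K" by (rule finite_subset[OF K finite_VV[OF finA]])
 define C where "C = core (wt A a) rho K"
 define f where "f = (\<lambda>x y. if x \<in> C \<and> y \<in> C then 0 else wt A a x y)"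
 have z: "f (Inl i) (Inl i') = 0" "f (Inr j) (Inr j') = 0" for i i' j j' by (auto simp: f_def wt_def)
 have fs: "f x y = f y x" for x y using wt_sym[of A a] by (auto simp: f_def)
 define T where "T = (\<Sum>i\<in>rws K. \<Sum>j\<in>cls K. f (Inl i) (Inr j))"
 have "(\<Sum>x\<in>K. \<Sum>y\<in>K. f x y) = T + (\<Sum>j\<in>cls K. \<Sum>i\<in>rws K. f (Inr j) (Inl i))"
  by (simp add: sum_VV[OF finK] z T_def)
 also have "(\<Sum>j\<in>cls K. \<Sum>i\<in>rws K. f (Inr j) (Inl i)) = T"
  unfolding T_def by (subst sum.swap, intro sum.cong refl fs)
 finally have "(\<Sum>x\<in>K. \<Sum>y\<in>K. f x y) = 2 * T" by simp
 moreover have "(\<Sum>x\<in>K. \<Sum>y\<in>K. f x y) \<le> 2 * rho * real (card K)"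
  unfolding f_def C_def by (rule light_mass[OF wt_nonneg wt_sym finK rho])
 ultimately have T: "T \<le> rho * real (card K)" by simp
 have "(\<Sum>i\<in>rws K. \<Sum>j\<in>cls K. (if Inl i \<in> C \<and> Inr j \<in> C then 0 else a i j)\<^sup>2) = T"
  unfolding T_def
 proof (rule sum.cong[OF refl], rule sum.cong[OF refl])
  fix i j assume "i \<in> rws K" "j \<in> cls K"
  then have "i \<in> A" "j \<in> A" using rws_sub[OF K] cls_sub[OF K] by auto
  then show "(if Inl i \<in> C \<and> Inr j \<in> C then 0 else a i j)\<^sup>2 = f (Inl i) (Inr j)" by (simp add: f_def wt_def)
 qed
 then show ?thesis using T by (simp add: C_def)
qed

section \<open>Tail bounds for medium and for large entries\<close>

lemma (in par) ZR_nonneg: "ZR R \<ge> 0"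
 using R by (simp add: ZR_def)

lemma (in par) cgood_pr:
 assumes D: "\<And>i j. i \<in> A ==> j \<in> A ==> a i j \<noteq> 0 ==> (a i j)\<^sup>2 * (4 * P) \<ge> 1"
 shows "pr n (\<lambda>e. \<not> cgood A a e (ZR R) (nat \<lceil>P / h\<rceil>)) \<le> 2 * exp (- 4 * P)"
proof -
 have "pr n (\<lambda>e. \<not> cgood A a e (ZR R) (nat \<lceil>P / h\<rceil>)) \<le>
  pr n (\<lambda>e. \<exists>K. K \<subseteq> VV A \<and> conn (near3 (adj A a)) K \<and> real (card K) < P / h \<and> \<not> opb (ZR R) a A (cls K) e)"
 proof (rule pr_mono)
  fix e assume "\<not> cgood A a e (ZR R) (nat \<lceil>P / h\<rceil>)"
  then obtain K where K: "K \<subseteq> VV A" "conn (near3 (adj A a)) K" "card K < nat \<lceil>P / h\<rceil>" "\<not> opb (ZR R) a A (cls K) e"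
   unfolding cgood_def by blast
  have "real (card K) < P / h" using K(3) by linarith
  then show "\<exists>K. K \<subseteq> VV A \<and> conn (near3 (adj A a)) K \<and> real (card K) < P / h \<and> \<not> opb (ZR R) a A (cls K) e"
   using K by blast
 qed
 also have "... \<le> 2 * exp (- 4 * P)"
  by (rule fam_opb[where k = 8]) (use h_big cnt_conn3[OF D] in auto)
 finally show ?thesis .
qed

lemma (in par) fgood_pr:
 assumes D: "\<And>i j. i \<in> A ==> j \<in> A ==> a i j \<noteq> 0 ==> (a i j)\<^sup>2 * (4 * P) \<ge> 1"
  and dm: "real (2 * dm + 3) \<le> exp h"
 shows "pr n (\<lambda>e. \<not> fgood A a e b dm (nat \<lceil>P / h\<rceil>) (24 * l) (1920 * h)) \<le> 2 * exp (- 4 * P)"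
proof -
 \<comment> \<open>The three summands are the entropy of the sets, the entropy of the values of
   \<open>z\<close> and the exponent of the probability; 128 * 15 = 1920.\<close>
 have "pr n (\<lambda>e. \<not> fgood A a e b dm (nat \<lceil>P / h\<rceil>) (24 * l) (128 * (10 * h + h + 4 * h))) \<le> 2 * exp (- (4 * h) * real (nat \<lceil>P / h\<rceil>))"
 proof (rule far_family)
  fix M assume "nat \<lceil>P / h\<rceil> \<le> M"
  then have M: "P / h \<le> real M" by linarith
  show "real (card {K. K \<subseteq> VV A \<and> conn (near3 (adj A a)) K \<and> card K = M}) \<le> exp (10 * h * real M)"
   using cnt_large[of h 8, OF _ _ cnt_conn3[OF D] M] h_big by simp
 qed (use dm h_big l in auto)
 also have "... \<le> 2 * exp (- 4 * P)"
 proof -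
  have "P / h \<le> real (nat \<lceil>P / h\<rceil>)" by linarith
  then have "P \<le> h * real (nat \<lceil>P / h\<rceil>)" using h_big by (simp add: field_simps)
  then show ?thesis by simp
 qed
 finally show ?thesis by simp
qed

lemma pr_or_le: "pr n Q \<le> x ==> pr n Q' \<le> y ==> pr n (\<lambda>e. Q e \<or> Q' e) \<le> x + y"
 using pr_or[of n Q Q'] by linarith

lemma (in nums) sqrt_30_h_nonneg: "sqrt (30 / h) \<ge> 0" using h_big by simp

text \<open>The balance behind \<open>4 ^ b\<close> being about \<open>h\<close>: both
  \<open>2 ^ b * sqrt (30 / h)\<close> and \<open>h * (1/4) ^ b\<close> are bounded. With
  \<open>L = 24 * l\<close> the factor \<open>exp (- L / 8)\<close> is \<open>h\<close> to the power
  -3, which outweighs \<open>dm\<close>, of order \<open>h\<close>. Only multiples of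
  \<open>l\<close> remain.\<close>

lemma (in nums) G2_number:
 assumes b: "h < 4 ^ b" "4 ^ b \<le> 4 * h" and dm: "4 ^ dm \<le> 32 * P" and Z: "Z \<ge> 0"
 shows "2 * Z + (4 * real b * Z + 8 * real b * 2 ^ b * sqrt (30 / h) + 4 * sqrt (2 * real b * (20 * l))) +
   2 * (2 * Z * (1 + real b) + (4 * (sqrt (8 * (24 * l)) + 1) + 576 * exp (- (24 * l) / 8) * (real dm + 1) + 6 * (1920 * h) * (1/4) ^ b))
  \<le> 17 * l * Z + 800 * l" "b > 0" "real (2 * dm + 3) \<le> exp h"
proof -
 have lb: "real b \<le> 2 * l"
 proof -
  have "exp (real b) \<le> 4 * h" using exp_nat_le_pow4[of b] b by linarith
  also have "... \<le> h * h" using h_big by (intro mult_right_mono) auto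
  also have "... = exp (2 * l)" by (simp add: h mult_exp_exp)
  finally show ?thesis by simp
 qed
 have ldm: "real dm \<le> 2 * h"
 proof -
  have "exp (real dm) \<le> 32 * P" using exp_nat_le_pow4[of dm] dm by linarith
  also have "... \<le> P * P" using P_big by (intro mult_right_mono) auto
  also have "... = exp (2 * h)" by (simp add: P mult_exp_exp)
  finally show ?thesis by simp
 qed
 show "b > 0" using b h_big by (cases b) auto
 show "real (2 * dm + 3) \<le> exp h" using ldm P_ge h_big by (simp flip: P)
 have 1: "8 * real b * 2 ^ b * sqrt (30 / h) \<le> 176 * l"
 proof -
  have "2 ^ b * sqrt (30 / h) \<le> 11"
  proof -
   have "2 ^ b * sqrt (30 / h) = sqrt (4 ^ b * (30 / h))"
   proof -
    have "sqrt (4 ^ b) = 2 ^ b" by (rule real_sqrt_unique) (simp_all add: power2_eq_square flip: power_mult_distrib)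
    then show ?thesis unfolding real_sqrt_mult by simp
   qed
   also have "... \<le> sqrt (4 * h * (30 / h))" using b h_big by (intro real_sqrt_le_mono mult_right_mono) auto
   also have "... \<le> 11" using h_big by (intro real_le_lsqrt) auto
   finally show ?thesis .
  qed
  then have "8 * real b * (2 ^ b * sqrt (30 / h)) \<le> 8 * (2 * l) * 11" using lb l h_big by (intro mult_mono) auto
  then show ?thesis by (simp add: mult.assoc)
 qed
 have 2: "4 * sqrt (2 * real b * (20 * l)) \<le> 36 * l"
 proof -
  have "2 * real b * (20 * l) \<le> 2 * (2 * l) * (20 * l)" using lb l by (intro mult_mono) auto
  also have "... \<le> (9 * l)\<^sup>2" by (simp add: power2_eq_square)
  finally have "sqrt (2 * real b * (20 * l)) \<le> 9 * l" using l by (intro real_le_lsqrt) auto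
  then show ?thesis by simp
 qed
 have 3: "4 * (sqrt (8 * (24 * l)) + 1) \<le> 56 * l + 4"
 proof -
  have "8 * (24 * l) \<le> 196 * (1 * l)" using l by simp
  also have "... \<le> 196 * (l * l)" using l by (intro mult_left_mono mult_right_mono) auto
  finally have "sqrt (8 * (24 * l)) \<le> 14 * l" using l by (intro real_le_lsqrt) (auto simp: power2_eq_square)
  then show ?thesis by simp
 qed
 have 4: "576 * exp (- (24 * l) / 8) * (real dm + 1) \<le> 1"
 proof -
  have e: "exp (- (24 * l) / 8) = 1 / (h * h * h)" by (simp add: h mult_exp_exp exp_minus inverse_eq_divide)
  have "576 * (real dm + 1) \<le> 24000 * h * 1" using ldm h_big by simp
  also have "... \<le> h * h * h" using h_big by (intro mult_mono) auto
  finally show ?thesis unfolding e using h_big by (simp add: divide_le_eq)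
 qed
 have 5: "6 * (1920 * h) * (1/4) ^ b \<le> 11520"
  using b h_big by (simp add: power_divide divide_le_eq)
 have 6: "4 * real b * Z \<le> 8 * (l * Z)" using mult_right_mono[OF lb Z] by linarith
 have 7: "2 * Z * (1 + real b) \<le> 2 * Z + 4 * (l * Z)"
 proof -
  have "2 * Z * (1 + real b) = 2 * Z + 2 * (real b * Z)" by (simp add: algebra_simps)
  then show ?thesis using mult_right_mono[OF lb Z] by linarith
 qed
 have 8: "6 * Z \<le> l * Z" using mult_right_mono[of 6 l Z] l Z by simp
 have 9: "17 * l * Z = 17 * (l * Z)" by simp
 show "2 * Z + (4 * real b * Z + 8 * real b * 2 ^ b * sqrt (30 / h) + 4 * sqrt (2 * real b * (20 * l))) +
   2 * (2 * Z * (1 + real b) + (4 * (sqrt (8 * (24 * l)) + 1) + 576 * exp (- (24 * l) / 8) * (real dm + 1) + 6 * (1920 * h) * (1/4) ^ b))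
  \<le> 17 * l * Z + 800 * l"
 proof -
  have "2 * Z + (x6 + x1 + x2) + 2 * (x7 + (x3 + x4 + x5)) \<le> w + 800 * l"
   if "x1 \<le> 176 * l" "x2 \<le> 36 * l" "x3 \<le> 56 * l + 4" "x4 \<le> 1" "x5 \<le> 11520" "x6 \<le> 8 * v" "x7 \<le> 2 * Z + 4 * v"
    "6 * Z \<le> v" "w = 17 * v"
   for x1 x2 x3 x4 x5 x6 x7 v w :: real
   using that l by argo
  from this[OF 1 2 3 4 5 6 7 8 9] show ?thesis .
 qed
qed

text \<open>Entries between \<open>1 / (2 * sqrt P)\<close> and \<open>h\<close> to the power -3.
  Outside seven exceptional events, none of which mentions levels, every configuration satisfies the
  hypotheses of \<open>total_far\<close>.\<close>

theorem (in par) thm_G2: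
 assumes D: "\<And>i j. i \<in> A ==> j \<in> A ==> a i j \<noteq> 0 ==> (a i j)\<^sup>2 * (4 * P) \<ge> 1"
  and U: "\<And>i j. i \<in> A ==> j \<in> A ==> (a i j)\<^sup>2 \<le> 1 / h ^ 6"
 shows "pr n (\<lambda>e. \<not> opb (l * (136 * ZR R + 6400)) a A A e) \<le> 18 * exp (- 4 * P)"
proof -
 interpret T: par n A "\<lambda>i j. a j i" N P h l p R by (rule par_tp)
 obtain b where b: "h < 4 ^ b" "4 ^ b \<le> 4 * h" using ex_pow4[of h] h_big by auto
 \<comment> \<open>With \<open>D\<close>, the bound \<open>8 * P < 4 ^ dm\<close> gives the
   hypothesis \<open>(a i j)\<^sup>2 * 4 ^ dm > 2\<close> of \<open>total_far\<close>.\<close>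
 obtain dm where dm: "8 * P < 4 ^ dm" "4 ^ dm \<le> 4 * (8 * P)" using ex_pow4[of "8 * P"] P_big by auto
 have dm': "4 ^ dm \<le> 32 * P" using dm by simp
 note num = G2_number[OF b dm' ZR_nonneg]
 define m where "m = nat \<lceil>P / h\<rceil>"
 have m: "m > 0" "\<And>k. m \<le> k \<longleftrightarrow> P / h \<le> real k" using P_big h_big unfolding m_def by (auto simp: nat_le_iff ceiling_le_iff)
 \<comment> \<open>Light edges have total square at most \<open>rho * card K\<close>; with the
   entropy 15 * h of \<open>fam_dev\<close> their form deviates by at most
   \<open>sqrt (30 / h)\<close> per vertex. Dense sets cost only the logarithm of
   \<open>1 / rho\<close>, which is 2 * l.\<close>
 define rho where "rho = 1 / h\<^sup>2"
 have rho: "rho > 0" using h_big by (simp add: rho_def)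
 define cr where "cr = core (wt A a) rho"
 define yl where "yl = (\<lambda>K i j. if Inl i \<in> cr K \<and> Inr j \<in> cr K then 0 else a i j)"
 define E3 where "E3 = (\<lambda>e. \<exists>K th. K \<subseteq> VV A \<and> conn (near3 (adj A a)) K \<and> P / h \<le> real (card K) \<and> (\<forall>x\<in>K. (th x)\<^sup>2 = 1) \<and>
   \<bar>\<Sum>i\<in>rws K. \<Sum>j\<in>cls K. yl K i j * e i j * th (Inl i) * th (Inr j)\<bar> > sqrt (2 * (rho * real (card K)) * ((8 + 7) * h * real (card K))))"
 define E4 where "E4 = (\<lambda>e. \<exists>K. K \<subseteq> VV A \<and> dense (wt A a) rho K \<and> real (card K) < P / l \<and> \<not> opb (ZR R) a A (cls K) e)"
 define E5 where "E5 = (\<lambda>e. \<exists>K th. K \<subseteq> VV A \<and> dense (wt A a) rho K \<and> P / l \<le> real (card K) \<and> (\<forall>x\<in>K. (th x)\<^sup>2 = 1) \<and>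
   \<bar>\<Sum>i\<in>rws K. \<Sum>j\<in>cls K. a i j * e i j * th (Inl i) * th (Inr j)\<bar> > sqrt (2 * (\<Sum>i\<in>rws K. \<Sum>j\<in>cls K. (a i j)\<^sup>2) * ((3 + 7) * l * real (card K))))"
 define C1 where "C1 = (\<lambda>e. \<not> cgood A a e (ZR R) m)"
 define C2 where "C2 = (\<lambda>e. \<not> cgood A (\<lambda>i j. a j i) (tp n e) (ZR R) m)"
 define F1 where "F1 = (\<lambda>e. \<not> fgood A a e b dm m (24 * l) (1920 * h))"
 define F2 where "F2 = (\<lambda>e. \<not> fgood A (\<lambda>i j. a j i) (tp n e) b dm m (24 * l) (1920 * h))"
 have pC1: "pr n C1 \<le> 2 * exp (- 4 * P)" unfolding C1_def m_def by (rule cgood_pr[OF D])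
 have pC2: "pr n C2 \<le> 2 * exp (- 4 * P)" unfolding C2_def m_def
  by (subst pr_tp[of n "\<lambda>e. \<not> cgood A (\<lambda>i j. a j i) e (ZR R) (nat \<lceil>P / h\<rceil>)"]) (rule T.cgood_pr, rule D)
 have pF1: "pr n F1 \<le> 2 * exp (- 4 * P)" unfolding F1_def m_def by (rule fgood_pr[OF D num(3)])
 have pF2: "pr n F2 \<le> 2 * exp (- 4 * P)" unfolding F2_def m_def
  by (subst pr_tp[of n "\<lambda>e. \<not> fgood A (\<lambda>i j. a j i) e b dm (nat \<lceil>P / h\<rceil>) (24 * l) (1920 * h)"]) (rule T.fgood_pr, rule D, assumption+, rule num(3))
 have p3: "pr n E3 \<le> 4 * exp (- 4 * P)" unfolding E3_def
 proof (rule fam_dev)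
  fix K assume K: "K \<subseteq> VV A"
  show "(\<Sum>i\<in>rws K. \<Sum>j\<in>cls K. (yl K i j)\<^sup>2) \<le> rho * real (card K)"
   unfolding yl_def cr_def using rho by (intro light_frob[OF K]) auto
 qed (use h_big cnt_conn3[OF D] in auto)
 have cd: "cntf (dense (wt A a) rho) (3 * l)" unfolding rho_def by (rule cnt_dense[OF D U])
 have p4: "pr n E4 \<le> 2 * exp (- 4 * P)" unfolding E4_def
  by (rule fam_opb[where k = 3]) (use l cd in auto)
 have p5: "pr n E5 \<le> 4 * exp (- 4 * P)" unfolding E5_def
  by (rule fam_dev) (use l cd in auto)
 have "pr n (\<lambda>e. \<not> opb (l * (136 * ZR R + 6400)) a A A e) \<le> pr n (\<lambda>e. C1 e \<or> C2 e \<or> F1 e \<or> F2 e \<or> E3 e \<or> E4 e \<or> E5 e)"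
 proof (rule pr_mono, rule ccontr)
  fix e assume no: "\<not> opb (l * (136 * ZR R + 6400)) a A A e" and good: "\<not> (C1 e \<or> C2 e \<or> F1 e \<or> F2 e \<or> E3 e \<or> E4 e \<or> E5 e)"
  have "opb (8 * (17 * l * ZR R + 800 * l)) a A A e"
  proof (rule opb_from_cfg[OF mat_axioms])
   fix lev th kmax assume "cfg n A a lev th kmax"
   then interpret cfg n A a lev th e kmax .
   interpret Tc: cfg n A "\<lambda>i j. a j i" "lev \<circ> sw" "th \<circ> sw" "tp n e" kmax by (rule cfg_tp)
   have thK: "\<forall>x\<in>K. (th x)\<^sup>2 = 1" if "K \<subseteq> VV A" for K using th that by blast
   have dns: "nbd (ZR R) (20 * l) 0 C" if C: "C \<subseteq> VV A" "dense (wt A a) rho C" for C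
   proof (cases "real (card C) < P / l")
    case True
    then have "opb (ZR R) a A (cls C) e" using good C unfolding E4_def by blast
    then show ?thesis by (rule opb_nbd[OF C(1)]) (use l in auto)
   next
    case False
    then have "\<bar>\<Sum>i\<in>rws C. \<Sum>j\<in>cls C. a i j * e i j * th (Inl i) * th (Inr j)\<bar> \<le> sqrt (2 * (\<Sum>i\<in>rws C. \<Sum>j\<in>cls C. (a i j)\<^sup>2) * ((3 + 7) * l * real (card C)))"
     using good C thK[OF C(1)] unfolding E5_def not_less by (meson linorder_not_less)
    then have "\<bar>\<Sum>i\<in>rws C. \<Sum>j\<in>cls C. a i j * e i j * th (Inl i) * th (Inr j)\<bar> \<le> sqrt (20 * l * real (card C) * frob C)"
     by (simp add: frob_def mult_ac)
    then show ?thesis by (rule dev_nbd[OF C(1)]) (use ZR_nonneg in auto)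
   qed
   have cn: "nbd (ZR R) (20 * l) (sqrt (30 / h)) K" if K: "K \<subseteq> VV A" "conn (adj A a) K" for K
   proof (rule core_nbd[OF K _ ZR_nonneg _ sqrt_30_h_nonneg rho _ dns])
    show "colgood (ZR R) m" using good by (simp add: colgood_iff C1_def)
    show "0 \<le> 20 * l" using l by simp
    assume "m \<le> card K"
    then have mK: "P / h \<le> real (card K)" by (simp add: m)
    have cK: "conn (near3 (adj A a)) K" by (rule conn_near3[OF adj_sym K(2)])
    have "\<bar>\<Sum>i\<in>rws K. \<Sum>j\<in>cls K. yl K i j * e i j * th (Inl i) * th (Inr j)\<bar> \<le> sqrt (2 * (rho * real (card K)) * ((8 + 7) * h * real (card K)))"
     using good K(1) cK mK thK[OF K(1)] unfolding E3_def by (meson linorder_not_less)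
    also have "... = sqrt ((30 / h) * (real (card K))\<^sup>2)" using h_big by (simp add: rho_def power2_eq_square field_simps)
    also have "... = sqrt (30 / h) * real (card K)" unfolding real_sqrt_mult by simp
    also have "(\<Sum>i\<in>rws K. \<Sum>j\<in>cls K. yl K i j * e i j * th (Inl i) * th (Inr j)) =
     (\<Sum>i\<in>rws K. \<Sum>j\<in>cls K. if Inl i \<in> core (wt A a) rho K \<and> Inr j \<in> core (wt A a) rho K then 0 else a i j * e i j * th (Inl i) * th (Inr j))"
     unfolding yl_def cr_def by (rule sum.cong[OF refl], rule sum.cong[OF refl]) simp
    finally show "\<bar>\<Sum>i\<in>rws K. \<Sum>j\<in>cls K. if Inl i \<in> core (wt A a) rho K \<and> Inr j \<in> core (wt A a) rho K then 0 else a i j * e i j * th (Inl i) * th (Inr j)\<bar> \<le> sqrt (30 / h) * real (card K)" .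
   qed
   have nb: "nbd (ZR R) (20 * l) (sqrt (30 / h)) X" if X: "X \<subseteq> VV A" for X
   proof (rule nb_ext[OF X _ ZR_nonneg _ sqrt_30_h_nonneg])
    fix x assume x: "x \<in> X"
    show "nbd (ZR R) (20 * l) (sqrt (30 / h)) (ccomp (adj A a) X x)"
     using comp_sub[OF x] X by (intro cn conn_comp[OF adj_sym]) auto
   qed (use l in auto)
   have "\<bar>\<Sum>i\<in>A. \<Sum>j\<in>A. xx i j\<bar> \<le> 2 * ZR R + (4 * real b * ZR R + 8 * real b * 2 ^ b * sqrt (30 / h) + 4 * sqrt (2 * real b * (20 * l))) +
   2 * (2 * ZR R * (1 + real b) + (4 * (sqrt (8 * (24 * l)) + 1) + 576 * exp (- (24 * l) / 8) * (real dm + 1) + 6 * (1920 * h) * (1/4) ^ b))"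
   proof (rule total_far[OF _ _ ZR_nonneg _ _ _ m(1) _ nb _ sqrt_30_h_nonneg num(2)])
    show "colgood (ZR R) m" "cfg.colgood A (\<lambda>i j. a j i) (tp n e) (ZR R) m"
     using good by (simp_all add: colgood_iff Tc.colgood_iff C1_def C2_def)
    show "fargood b dm m (24 * l) (1920 * h)" "cfg.fargood A (\<lambda>i j. a j i) (tp n e) b dm m (24 * l) (1920 * h)"
     using good by (simp_all add: fargood_iff Tc.fargood_iff F1_def F2_def)
    fix i j assume ij: "i \<in> A" "j \<in> A" "a i j \<noteq> 0"
    have "2 \<le> (a i j)\<^sup>2 * (8 * P)" using D[OF ij] by linarith
    also have "... < (a i j)\<^sup>2 * 4 ^ dm" using dm(1) ij by (intro mult_strict_left_mono) auto
    finally show "(a i j)\<^sup>2 * 4 ^ dm > 2" .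
   qed (use l h_big in auto)
   with num(1) have "\<bar>\<Sum>i\<in>A. \<Sum>j\<in>A. xx i j\<bar> \<le> 17 * l * ZR R + 800 * l" by linarith
   then show "\<bar>\<Sum>i\<in>A. \<Sum>j\<in>A. a i j * e i j * (th (Inl i) * (1/2) ^ lev (Inl i)) * (th (Inr j) * (1/2) ^ lev (Inr j))\<bar> \<le> 17 * l * ZR R + 800 * l"
    by (simp add: xx_def sr_def tc_def u_def)
  qed
  moreover have "8 * (17 * l * ZR R + 800 * l) = l * (136 * ZR R + 6400)" by (simp add: algebra_simps)
  ultimately show False using no by simp
 qed
 also have "... \<le> 2 * exp (- 4 * P) + (2 * exp (- 4 * P) + (2 * exp (- 4 * P) + (2 * exp (- 4 * P) + (4 * exp (- 4 * P) + (2 * exp (- 4 * P) + 4 * exp (- 4 * P))))))"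
  by (intro pr_or_le pC1 pC2 pF1 pF2 p3 p4 p5)
 finally show ?thesis by simp
qed

text \<open>The degree is at most \<open>h ^ 6\<close>, so connected sets have entropy
  \<open>14 * l\<close>, and \<open>window\<close> holds with \<open>b \<le> 7 * l\<close>. Hence
  neither a core nor far levels occur, and \<open>total_near\<close> suffices.\<close>

theorem (in par) thm_G3:
 assumes D: "\<And>i j. i \<in> A ==> j \<in> A ==> a i j \<noteq> 0 ==> (a i j)\<^sup>2 * h ^ 6 \<ge> 1"
 shows "pr n (\<lambda>e. \<not> opb (l * (224 * ZR R + 800)) a A A e) \<le> 6 * exp (- 4 * P)"
proof -
 have h1: "1 \<le> h ^ 6" using h_big by (intro one_le_power) auto
 obtain b where b: "8 * h ^ 6 < 4 ^ b" "4 ^ b \<le> 4 * (8 * h ^ 6)" using ex_pow4[of "8 * h ^ 6"] h1 by auto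
 have b0: "b > 0" using b h1 by (cases b) auto
 have lb: "real b \<le> 7 * l"
 proof -
  have "exp (real b) \<le> 32 * h ^ 6" using exp_nat_le_pow4[of b] b by linarith
  also have "... \<le> h * h ^ 6" using h_big by (intro mult_right_mono) auto
  also have "... = exp (7 * l)" by (simp add: h mult_exp_exp flip: exp_of_nat_mult)
  finally show ?thesis by simp
 qed
 define E4 where "E4 = (\<lambda>e. \<exists>K. K \<subseteq> VV A \<and> conn (adj A a) K \<and> real (card K) < P / l \<and> \<not> opb (ZR R) a A (cls K) e)"
 define E5 where "E5 = (\<lambda>e. \<exists>K th. K \<subseteq> VV A \<and> conn (adj A a) K \<and> P / l \<le> real (card K) \<and> (\<forall>x\<in>K. (th x)\<^sup>2 = 1) \<and>
   \<bar>\<Sum>i\<in>rws K. \<Sum>j\<in>cls K. a i j * e i j * th (Inl i) * th (Inr j)\<bar> > sqrt (2 * (\<Sum>i\<in>rws K. \<Sum>j\<in>cls K. (a i j)\<^sup>2) * ((14 + 7) * l * real (card K))))"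
 have p4: "pr n E4 \<le> 2 * exp (- 4 * P)" unfolding E4_def
  by (rule fam_opb[where k = 14]) (use l cnt_conn1[OF D] in auto)
 have p5: "pr n E5 \<le> 4 * exp (- 4 * P)" unfolding E5_def
  by (rule fam_dev) (use l cnt_conn1[OF D] in auto)
 have "pr n (\<lambda>e. \<not> opb (l * (224 * ZR R + 800)) a A A e) \<le> pr n (\<lambda>e. E4 e \<or> E5 e)"
 proof (rule pr_mono, rule ccontr)
  fix e assume no: "\<not> opb (l * (224 * ZR R + 800)) a A A e" and good: "\<not> (E4 e \<or> E5 e)"
  have "opb (8 * (28 * l * ZR R + 100 * l)) a A A e"
  proof (rule opb_from_cfg[OF mat_axioms])
   fix lev th kmax assume "cfg n A a lev th kmax"
   then interpret cfg n A a lev th e kmax .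
   have thK: "\<forall>x\<in>K. (th x)\<^sup>2 = 1" if "K \<subseteq> VV A" for K using th that by blast
   have cn: "nbd (ZR R) (42 * l) 0 C" if C: "C \<subseteq> VV A" "conn (adj A a) C" for C
   proof (cases "real (card C) < P / l")
    case True
    then have "opb (ZR R) a A (cls C) e" using good C unfolding E4_def by blast
    then show ?thesis by (rule opb_nbd[OF C(1)]) (use l in auto)
   next
    case False
    then have "\<bar>\<Sum>i\<in>rws C. \<Sum>j\<in>cls C. a i j * e i j * th (Inl i) * th (Inr j)\<bar> \<le> sqrt (2 * (\<Sum>i\<in>rws C. \<Sum>j\<in>cls C. (a i j)\<^sup>2) * ((14 + 7) * l * real (card C)))"
     using good C thK[OF C(1)] unfolding E5_def not_less by (meson linorder_not_less)
    then have "\<bar>\<Sum>i\<in>rws C. \<Sum>j\<in>cls C. a i j * e i j * th (Inl i) * th (Inr j)\<bar> \<le> sqrt (42 * l * real (card C) * frob C)"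
     by (simp add: frob_def mult_ac)
    then show ?thesis by (rule dev_nbd[OF C(1)]) (use ZR_nonneg in auto)
   qed
   have nb: "nbd (ZR R) (42 * l) 0 X" if X: "X \<subseteq> VV A" for X
   proof (rule nb_ext[OF X _ ZR_nonneg])
    fix x assume x: "x \<in> X"
    show "nbd (ZR R) (42 * l) 0 (ccomp (adj A a) X x)"
     using comp_sub[OF x] X by (intro cn conn_comp[OF adj_sym]) auto
   qed (use l in auto)
   have t: "\<bar>\<Sum>i\<in>A. \<Sum>j\<in>A. xx i j\<bar> \<le> 4 * real b * ZR R + 4 * sqrt (2 * real b * (42 * l))"
   proof (rule total_near[OF nb ZR_nonneg _ b0])
    fix i j assume ij: "i \<in> A" "j \<in> A" "a i j \<noteq> 0"
    have "8 \<le> (a i j)\<^sup>2 * (8 * h ^ 6)" using D[OF ij] by linarith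
    also have "... < (a i j)\<^sup>2 * 4 ^ b" using b(1) ij by (intro mult_strict_left_mono) auto
    finally show "(a i j)\<^sup>2 * 4 ^ b > 8" .
   qed (use l in auto)
   have "2 * real b * (42 * l) \<le> 2 * (7 * l) * (42 * l)" using lb l by (intro mult_mono) auto
   also have "... \<le> (25 * l)\<^sup>2" by (simp add: power2_eq_square)
   finally have "sqrt (2 * real b * (42 * l)) \<le> 25 * l" using l by (intro real_le_lsqrt) auto
   moreover have "4 * real b * ZR R \<le> 28 * l * ZR R" using lb by (intro mult_right_mono ZR_nonneg) auto
   ultimately have "\<bar>\<Sum>i\<in>A. \<Sum>j\<in>A. xx i j\<bar> \<le> 28 * l * ZR R + 100 * l" using t by linarith
   then show "\<bar>\<Sum>i\<in>A. \<Sum>j\<in>A. a i j * e i j * (th (Inl i) * (1/2) ^ lev (Inl i)) * (th (Inr j) * (1/2) ^ lev (Inr j))\<bar> \<le> 28 * l * ZR R + 100 * l"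
    by (simp add: xx_def sr_def tc_def u_def)
  qed
  moreover have "8 * (28 * l * ZR R + 100 * l) = l * (224 * ZR R + 800)" by (simp add: algebra_simps)
  ultimately show False using no by simp
 qed
 also have "... \<le> 2 * exp (- 4 * P) + 4 * exp (- 4 * P)"
  by (intro pr_or_le p4 p5)
 finally show ?thesis by simp
qed

subsection \<open>Matrix powers and traces\<close>

fun Gp :: "'v set => ('v => 'v => real) => nat => 'v => 'v => real" where
 "Gp V G 0 x y = of_bool (x = y)"
| "Gp V G (Suc m) x y = (\<Sum>z\<in>V. G x z * Gp V G m z y)"

lemma Gp_add:
 assumes V: "finite V"
 shows "x \<in> V ==> Gp V G (p + q) x y = (\<Sum>z\<in>V. Gp V G p x z * Gp V G q z y)"
proof (induction p arbitrary: x)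
 case 0
 have "(\<Sum>z\<in>V. of_bool (x = z) * Gp V G q z y) = (\<Sum>z\<in>V. if x = z then Gp V G q z y else 0)"
  by (intro sum.cong) auto
 then show ?case using 0 V by simp
next
 case (Suc p)
 have "Gp V G (Suc p + q) x y = (\<Sum>u\<in>V. G x u * (\<Sum>z\<in>V. Gp V G p u z * Gp V G q z y))"
  using Suc.IH by simp
 also have "... = (\<Sum>z\<in>V. \<Sum>u\<in>V. G x u * (Gp V G p u z * Gp V G q z y))"
  unfolding sum_distrib_left by (rule sum.swap)
 also have "... = (\<Sum>z\<in>V. Gp V G (Suc p) x z * Gp V G q z y)"
  by (simp add: sum_distrib_right mult.assoc)
 finally show ?case .
qed

lemma Gp_1: "finite V ==> y \<in> V ==> Gp V G 1 x y = G x y"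
proof -
 assume V: "finite V" "y \<in> V"
 have "(\<Sum>z\<in>V. G x z * of_bool (z = y)) = (\<Sum>z\<in>V. if z = y then G x z else 0)" by (intro sum.cong) auto
 then show ?thesis using V by simp
qed

locale symk =
 fixes V :: "'v set" and G :: "'v => 'v => real"
 assumes V: "finite V" and sym: "\<And>x y. G x y = G y x"
begin

abbreviation "W \<equiv> Gp V G"
definition "Q v m = (\<Sum>x\<in>V. \<Sum>y\<in>V. v x * W m x y * v y)"
definition "tr m = (\<Sum>x\<in>V. W m x x)"

lemma W_sym: "x \<in> V ==> y \<in> V ==> W m x y = W m y x"
proof (induction m arbitrary: x y)
 case (Suc m)
 have "W (Suc m) x y = (\<Sum>z\<in>V. G x z * W m z y)" by simp
 also have "... = (\<Sum>z\<in>V. W m y z * W 1 z x)"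
 proof (rule sum.cong[OF refl])
  fix z assume z: "z \<in> V"
  show "G x z * W m z y = W m y z * W 1 z x"
   using Suc.IH[OF z Suc.prems(2)] Gp_1[OF V Suc.prems(1), of G z] sym[of x z] by simp
 qed
 also have "... = W (m + 1) y x" by (rule Gp_add[OF V Suc.prems(2), symmetric])
 finally show ?case by simp
qed auto

lemma Q_double: "Q v (m + m) = (\<Sum>z\<in>V. (\<Sum>y\<in>V. W m z y * v y)\<^sup>2)"
proof -
 have "Q v (m + m) = (\<Sum>x\<in>V. \<Sum>y\<in>V. \<Sum>z\<in>V. (W m z x * v x) * (W m z y * v y))"
  unfolding Q_def
 proof (rule sum.cong[OF refl], rule sum.cong[OF refl])
  fix x y assume x: "x \<in> V" and y: "y \<in> V"
  have "v x * W (m + m) x y * v y = (\<Sum>z\<in>V. v x * (W m x z * W m z y) * v y)"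
   unfolding Gp_add[OF V x] by (simp add: sum_distrib_left sum_distrib_right)
  also have "... = (\<Sum>z\<in>V. (W m z x * v x) * (W m z y * v y))"
   by (rule sum.cong[OF refl]) (simp add: W_sym[OF x])
  finally show "v x * W (m + m) x y * v y = (\<Sum>z\<in>V. (W m z x * v x) * (W m z y * v y))" .
 qed
 also have "... = (\<Sum>x\<in>V. \<Sum>z\<in>V. \<Sum>y\<in>V. (W m z x * v x) * (W m z y * v y))"
  by (intro sum.cong refl sum.swap)
 also have "... = (\<Sum>z\<in>V. \<Sum>x\<in>V. \<Sum>y\<in>V. (W m z x * v x) * (W m z y * v y))" by (rule sum.swap)
 also have "... = (\<Sum>z\<in>V. (\<Sum>y\<in>V. W m z y * v y)\<^sup>2)"
  by (simp add: power2_eq_square sum_product)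
 finally show ?thesis .
qed

lemma tr_double: "tr (m + m) = (\<Sum>x\<in>V. \<Sum>z\<in>V. (W m x z)\<^sup>2)"
 unfolding tr_def
proof (rule sum.cong[OF refl])
 fix x assume x: "x \<in> V"
 show "W (m + m) x x = (\<Sum>z\<in>V. (W m x z)\<^sup>2)"
  unfolding Gp_add[OF V x] by (rule sum.cong[OF refl]) (simp add: W_sym[OF _ x] power2_eq_square)
qed

lemma Q_sq: "(\<Sum>x\<in>V. (v x)\<^sup>2) = 1 ==> (Q v m)\<^sup>2 \<le> Q v (m + m)"
proof -
 assume v: "(\<Sum>x\<in>V. (v x)\<^sup>2) = 1"
 have "Q v m = (\<Sum>x\<in>V. v x * (\<Sum>y\<in>V. W m x y * v y))" by (simp add: Q_def sum_distrib_left mult.assoc)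
 then have "(Q v m)\<^sup>2 \<le> (\<Sum>x\<in>V. (v x)\<^sup>2) * (\<Sum>x\<in>V. (\<Sum>y\<in>V. W m x y * v y)\<^sup>2)"
  using Cauchy_Schwarz_ineq_sum[of v "\<lambda>x. \<Sum>y\<in>V. W m x y * v y" V] by simp
 then show ?thesis by (simp add: v Q_double)
qed

lemma Q_tr: "(\<Sum>x\<in>V. (v x)\<^sup>2) = 1 ==> Q v (m + m) \<le> tr (m + m)"
proof -
 assume v: "(\<Sum>x\<in>V. (v x)\<^sup>2) = 1"
 have "(\<Sum>y\<in>V. W m z y * v y)\<^sup>2 \<le> (\<Sum>y\<in>V. (W m z y)\<^sup>2)" for z
  using Cauchy_Schwarz_ineq_sum[of "W m z" v V] by (simp add: v)
 then show ?thesis unfolding Q_double tr_double by (rule sum_mono)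
qed

lemma Q_power:
 assumes v: "(\<Sum>x\<in>V. (v x)\<^sup>2) = 1" and q: "Q v 1 \<ge> 0"
 shows "Q v 1 ^ (2 ^ p) \<le> Q v (2 ^ p)"
proof (induction p)
 case (Suc p)
 have "Q v 1 ^ (2 ^ Suc p) = (Q v 1 ^ (2 ^ p))\<^sup>2" by (simp only: power_Suc2 power_mult)
 also have "... \<le> (Q v (2 ^ p))\<^sup>2" using Suc q by (intro power_mono) auto
 also have "... \<le> Q v (2 ^ p + 2 ^ p)" by (rule Q_sq[OF v])
 finally show ?case by (simp add: mult_2)
qed simp

lemma tr_nonneg: "tr (2 ^ Suc p) \<ge> 0"
 using tr_double[of "2 ^ p"] by (simp add: mult_2 sum_nonneg)

text \<open>Repeated squaring by the Cauchy-Schwarz inequality takes the place of the spectral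
  theorem; this is why all trace exponents are powers of two.\<close>

lemma Q_trace:
 assumes v: "(\<Sum>x\<in>V. (v x)\<^sup>2) = 1" and q: "Q v 1 \<ge> 0"
 shows "Q v 1 ^ (2 ^ Suc p) \<le> tr (2 ^ Suc p)"
 using Q_power[OF v q, of "Suc p"] Q_tr[OF v, of "2 ^ p"] by (simp add: mult_2)

text \<open>A column of the m-th power has squared norm at most \<open>\<beta>\<close> to the power
  2 * m, by induction, and the diagonal entry is one of its coordinates.\<close>

lemma W_bound:
 assumes b: "\<And>v. (\<Sum>x\<in>V. (\<Sum>y\<in>V. G x y * v y)\<^sup>2) \<le> \<beta>\<^sup>2 * (\<Sum>x\<in>V. (v x)\<^sup>2)" and x: "x \<in> V" and beta: "\<beta> \<ge> 0"
 shows "W m x x \<le> \<beta> ^ m"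
proof -
 have s: "(\<Sum>z\<in>V. (W m z x)\<^sup>2) \<le> (\<beta>\<^sup>2) ^ m" for m
 proof (induction m)
  case 0
  have "(\<Sum>z\<in>V. (of_bool (z = x) :: real)\<^sup>2) = (\<Sum>z\<in>V. if z = x then 1 else 0)" by (intro sum.cong) auto
  then show ?case using V x by simp
 next
  case (Suc m)
  have "(\<Sum>z\<in>V. (W (Suc m) z x)\<^sup>2) \<le> \<beta>\<^sup>2 * (\<Sum>z\<in>V. (W m z x)\<^sup>2)" using b[of "\<lambda>z. W m z x"] by simp
  also have "... \<le> \<beta>\<^sup>2 * (\<beta>\<^sup>2) ^ m" by (intro mult_left_mono Suc) auto
  finally show ?case by simp
 qed
 have "(W m x x)\<^sup>2 \<le> (\<Sum>z\<in>V. (W m z x)\<^sup>2)" by (rule member_le_sum[OF x]) (use V in auto)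
 also have "... \<le> (\<beta> ^ m)\<^sup>2" using s[of m] by (simp add: mult.commute flip: power_mult)
 finally show ?thesis by (rule power2_le_imp_le) (use beta in simp)
qed

end

text \<open>The symmetric dilation, with the signed matrix and its transpose as off-diagonal blocks;
  its walks alternate between rows and columns.\<close>

definition gk :: "nat set => (nat => nat => real) => (nat => nat => real) => nat + nat => nat + nat => real" where
 "gk A a e x y = (case (x, y) of
   (Inl i, Inr j) => if i \<in> A \<and> j \<in> A then a i j * e i j else 0
  | (Inr j, Inl i) => if i \<in> A \<and> j \<in> A then a i j * e i j else 0
  | _ => 0)"

lemma gk_simps [simp]:
 "gk A a e (Inl i) (Inr j) = (if i \<in> A \<and> j \<in> A then a i j * e i j else 0)"
 "gk A a e (Inr j) (Inl i) = (if i \<in> A \<and> j \<in> A then a i j * e i j else 0)"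
 "gk A a e (Inl i) (Inl i') = 0" "gk A a e (Inr j) (Inr j') = 0"
 by (simp_all add: gk_def)

lemma symk_gk: "finite A ==> symk (VV A) (gk A a e)"
 by unfold_locales (auto simp: gk_def split: sum.splits)

lemma trace_opb:
 assumes A: "finite A" and Z: "Z \<ge> 0" and no: "\<not> opb Z a A A e"
 shows "Z ^ (2 ^ Suc p) \<le> symk.tr (VV A) (gk A a e) (2 ^ Suc p)"
proof -
 interpret symk "VV A" "gk A a e" by (rule symk_gk[OF A])
 obtain s t where st: "sqn A s \<le> 1" "sqn A t \<le> 1" "bform a A A e s t > Z"
  using opbI[OF A A, of a e Z] no by force
 define v where "v = (\<lambda>x. case x of Inl i => s i | Inr j => t j)"
 define c where "c = sqn A s + sqn A t"
 have sv: "(\<Sum>x\<in>VV A. (v x)\<^sup>2) = c" using A by (simp add: sum_VV v_def c_def sqn_def)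
 have c: "c \<le> 2" "c \<ge> 0" using st by (auto simp: c_def)
 have Qv: "(\<Sum>x\<in>VV A. \<Sum>y\<in>VV A. v x * gk A a e x y * v y) = 2 * bform a A A e s t"
 proof -
  have "(\<Sum>x\<in>VV A. \<Sum>y\<in>VV A. v x * gk A a e x y * v y) =
   (\<Sum>i\<in>A. \<Sum>j\<in>A. s i * (a i j * e i j) * t j) + (\<Sum>j\<in>A. \<Sum>i\<in>A. t j * (a i j * e i j) * s i)"
   using A by (simp add: sum_VV v_def)
  also have "(\<Sum>j\<in>A. \<Sum>i\<in>A. t j * (a i j * e i j) * s i) = (\<Sum>i\<in>A. \<Sum>j\<in>A. t j * (a i j * e i j) * s i)" by (rule sum.swap)
  finally show ?thesis by (simp add: bform_def mult_ac)
 qed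
 have "c \<noteq> 0"
 proof
  assume "c = 0"
  then have "\<forall>x\<in>VV A. v x = 0" using sv A by (simp add: sum_nonneg_eq_0_iff)
  then have "2 * bform a A A e s t = 0" unfolding Qv[symmetric] by simp
  then show False using st Z by simp
 qed
 then have cp: "c > 0" using c by simp
 define w where "w = (\<lambda>x. v x / sqrt c)"
 have w1: "(\<Sum>x\<in>VV A. (w x)\<^sup>2) = 1"
  using cp sv by (simp add: w_def power_divide flip: sum_divide_distrib)
 have Qw: "Q w 1 = 2 * bform a A A e s t / c"
 proof -
  have "Q w 1 = (\<Sum>x\<in>VV A. \<Sum>y\<in>VV A. w x * gk A a e x y * w y)"
   unfolding Q_def by (rule sum.cong[OF refl], rule sum.cong[OF refl]) (simp only: Gp_1[OF V])
  also have "... = (\<Sum>x\<in>VV A. \<Sum>y\<in>VV A. (v x * gk A a e x y * v y) / c)"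
   using cp by (intro sum.cong refl) (simp add: w_def)
  also have "... = 2 * bform a A A e s t / c" unfolding Qv[symmetric] by (simp add: sum_divide_distrib)
  finally show ?thesis .
 qed
 \<comment> \<open>The factor 2 of the dilation compensates the normalisation by
   \<open>c \<le> 2\<close>.\<close>
 have "Z * c \<le> bform a A A e s t * 2" using st Z c by (intro mult_mono) auto
 then have ZQ: "Z \<le> Q w 1" unfolding Qw using cp by (simp add: le_divide_eq mult.commute)
 then have "Z ^ (2 ^ Suc p) \<le> Q w 1 ^ (2 ^ Suc p)" using Z by (intro power_mono) auto
 also have "... \<le> tr (2 ^ Suc p)" using ZQ Z by (intro Q_trace w1) auto
 finally show ?thesis .
qed

text \<open>Testing the operator norm bound against the image vector itself gives the norm bound for
  the dilation (\<open>half\<close>), from which \<open>W_bound\<close> follows.\<close>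

lemma gk_bound:
 assumes A: "finite A" and b: "opb \<beta> a A A e" and x: "x \<in> VV A" and beta: "\<beta> \<ge> 0"
 shows "Gp (VV A) (gk A a e) m x x \<le> \<beta> ^ m"
proof -
 interpret symk "VV A" "gk A a e" by (rule symk_gk[OF A])
 have half: "S \<le> \<beta>\<^sup>2 * T" if "S \<le> \<beta> * sqrt S * sqrt T" "S \<ge> 0" "T \<ge> 0" for S T :: real
 proof (cases "S = 0")
  case False
  then have S: "S > 0" using that by simp
  have "S = sqrt S * sqrt S" using that by simp
  then have "sqrt S * sqrt S \<le> (\<beta> * sqrt T) * sqrt S" using that(1) by (simp add: mult_ac)
  then have "sqrt S \<le> \<beta> * sqrt T" by (rule mult_right_le_imp_le) (use S in simp)
  then have "(sqrt S)\<^sup>2 \<le> (\<beta> * sqrt T)\<^sup>2" using that by (intro power_mono) auto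
  then show ?thesis using that by (simp add: power_mult_distrib)
 qed (use that in auto)
 show ?thesis
 proof (rule W_bound[OF _ x beta])
  fix v :: "nat + nat => real"
  define s where "s = (\<lambda>i. \<Sum>j\<in>A. a i j * e i j * v (Inr j))"
  define t where "t = (\<lambda>j. \<Sum>i\<in>A. a i j * e i j * v (Inl i))"
  have 1: "sqn A s \<le> \<beta>\<^sup>2 * sqn A (\<lambda>j. v (Inr j))"
  proof (rule half)
   have "sqn A s = bform a A A e s (\<lambda>j. v (Inr j))"
    by (simp add: sqn_def bform_def s_def power2_eq_square sum_distrib_left mult_ac)
   also have "... \<le> \<beta> * sqrt (sqn A s) * sqrt (sqn A (\<lambda>j. v (Inr j)))" using b by (simp add: opb_def)
   finally show "sqn A s \<le> \<beta> * sqrt (sqn A s) * sqrt (sqn A (\<lambda>j. v (Inr j)))" .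
  qed auto
  have 2: "sqn A t \<le> \<beta>\<^sup>2 * sqn A (\<lambda>i. v (Inl i))"
  proof (rule half)
   have "sqn A t = (\<Sum>j\<in>A. \<Sum>i\<in>A. a i j * e i j * v (Inl i) * t j)"
    by (simp add: sqn_def t_def power2_eq_square sum_distrib_right)
   also have "... = bform a A A e (\<lambda>i. v (Inl i)) t" unfolding bform_def by (rule sum.swap)
   also have "... \<le> \<beta> * sqrt (sqn A (\<lambda>i. v (Inl i))) * sqrt (sqn A t)" using b by (simp add: opb_def)
   finally show "sqn A t \<le> \<beta> * sqrt (sqn A t) * sqrt (sqn A (\<lambda>i. v (Inl i)))" by (simp add: mult_ac)
  qed auto
  have "(\<Sum>x\<in>VV A. (\<Sum>y\<in>VV A. gk A a e x y * v y)\<^sup>2) = sqn A s + sqn A t"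
   using A by (simp add: sum_VV sqn_def s_def t_def)
  also have "... \<le> \<beta>\<^sup>2 * sqn A (\<lambda>j. v (Inr j)) + \<beta>\<^sup>2 * sqn A (\<lambda>i. v (Inl i))" using 1 2 by linarith
  also have "... = \<beta>\<^sup>2 * (\<Sum>x\<in>VV A. (v x)\<^sup>2)" using A by (simp add: sum_VV sqn_def distrib_left)
  finally show "(\<Sum>x\<in>VV A. (\<Sum>y\<in>VV A. gk A a e x y * v y)\<^sup>2) \<le> \<beta>\<^sup>2 * (\<Sum>x\<in>VV A. (v x)\<^sup>2)" .
 qed
qed

subsection \<open>Sums over walks\<close>

text \<open>Walks are lists with the current vertex at the head.\<close>

fun ext :: "'v set => nat => ('v list => real) => 'v list => real" where
 "ext V 0 f h = f h"
| "ext V (Suc m) f h = (\<Sum>y\<in>V. ext V m f (y # h))"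

lemma ext_mono:
 assumes "\<And>ys. length ys = m ==> set ys \<subseteq> V ==> f (ys @ h) \<le> g (ys @ h)"
 shows "ext V m f h \<le> ext V m g h"
 using assms
proof (induction m arbitrary: h)
 case (Suc m)
 have "ext V m f (y # h) \<le> ext V m g (y # h)" if y: "y \<in> V" for y
 proof (rule Suc.IH)
  fix ys assume "length ys = m" "set ys \<subseteq> V"
  then show "f (ys @ y # h) \<le> g (ys @ y # h)" using Suc.prems[of "ys @ [y]"] y by simp
 qed
 then show ?case by (simp add: sum_mono)
qed auto

lemma ext_cong:
 assumes "\<And>ys. length ys = m ==> set ys \<subseteq> V ==> f (ys @ h) = g (ys @ h)"
 shows "ext V m f h = ext V m g h"
 using ext_mono[of m V f h g] ext_mono[of m V g h f] assms by fastforce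

lemma ext_nonneg: "(\<And>h. f h \<ge> 0) ==> ext V m f h \<ge> 0"
 by (induction m arbitrary: h) (auto intro: sum_nonneg)

lemma ext_cmult: "ext V m (\<lambda>h. c * f h) h = c * ext V m f h"
 by (induction m arbitrary: h) (auto simp: sum_distrib_left)

lemma avg_ext: "avg n (\<lambda>e. ext V m (f e) h) = ext V m (\<lambda>h. avg n (\<lambda>e. f e h)) h"
 by (induction m arbitrary: h) (auto simp: avg_sum)

fun stp :: "('v => 'v => real) => 'v list => real" where
 "stp G (y # x # h) = G x y * stp G (x # h)"
| "stp G _ = 1"

lemma ext_Gp: "ext V m (\<lambda>h. if hd h = z then stp G h else 0) (x # h) = stp G (x # h) * Gp V G m x z"
 by (induction m arbitrary: x h) (auto simp: sum_distrib_left mult_ac)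

fun cnt :: "'v list => 'v => 'v => nat" where
 "cnt (y # x # h) u v = cnt (x # h) u v + of_bool (x = u \<and> y = v \<or> x = v \<and> y = u)"
| "cnt _ u v = 0"

lemma cnt_not_in: "u \<notin> set h \<or> v \<notin> set h ==> cnt h u v = 0"
 by (induction h u v rule: cnt.induct) auto

lemma cnt_map:
 assumes "inj_on \<phi> (set h)" "u \<in> set h" "v \<in> set h"
 shows "cnt (map \<phi> h) (\<phi> u) (\<phi> v) = cnt h u v"
proof -
 have "cnt (map \<phi> h) (\<phi> u) (\<phi> v) = cnt h u v" if "inj_on \<phi> S" "u \<in> S" "v \<in> S" "set h \<subseteq> S" for S
  using that(2-4) by (induction h u v rule: cnt.induct) (auto simp: inj_on_eq_iff[OF that(1)])
 from this[OF assms order_refl] show ?thesis .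
qed

fun bip :: "('v + 'w) list => bool" where
 "bip (y # x # h) \<longleftrightarrow> isl x \<noteq> isl y \<and> bip (x # h)"
| "bip _ \<longleftrightarrow> True"

text \<open>The closed walks whose weight has nonvanishing expectation when the signs are
  independent and all entries are 1.\<close>

definition evw :: "('v + 'w) list => bool" where
 "evw h \<longleftrightarrow> hd h = last h \<and> bip h \<and> (\<forall>u v. even (cnt h u v))"

lemma bip_map: "(\<And>x. x \<in> set h ==> isl (\<phi> x) = isl x) ==> bip (map \<phi> h) = bip h"
 by (induction h rule: bip.induct) auto

lemma evw_map:
 assumes h: "h \<noteq> []" and inj: "inj_on \<phi> (set h)" and sd: "\<And>x. x \<in> set h ==> isl (\<phi> x) = isl x" and e: "evw h"
 shows "evw (map \<phi> h)"
 unfolding evw_def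
proof (intro conjI allI)
 show "hd (map \<phi> h) = last (map \<phi> h)" using e h by (simp add: evw_def hd_map last_map)
 show "bip (map \<phi> h)" using e bip_map[OF sd] by (simp add: evw_def)
 fix u v
 show "even (cnt (map \<phi> h) u v)"
 proof (cases "u \<in> \<phi> ` set h \<and> v \<in> \<phi> ` set h")
  case True
  then show ?thesis using cnt_map[OF inj] e by (auto simp: evw_def)
 next
  case False
  then have "cnt (map \<phi> h) u v = 0" by (intro cnt_not_in) auto
  then show ?thesis by simp
 qed
qed

text \<open>Only steps that discover a new vertex carry weight. For even walks this dominates the
  true weight when entries are at most 1 in modulus (\<open>stp_le_nwt\<close>).\<close>

fun nwt :: "('v => 'v => real) => 'v list => real" where
 "nwt w (y # x # h) = (if y \<in> set (x # h) then 1 else w x y) * nwt w (x # h)"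
| "nwt w _ = 1"

lemma nwt_nonneg: "(\<And>x y. w x y \<ge> 0) ==> nwt w h \<ge> 0"
 by (induction w h rule: nwt.induct) auto

text \<open>The comparison with walks in the complete bipartite graph: a step to a new vertex carries
 total weight at most \<open>k\<close>, and in the complete graph at least \<open>k\<close> vertices are new.\<close>

lemma walk_compare:
 fixes V :: "('v + 'w) set" and V' :: "('x + 'y) set"
 assumes V: "finite V" and V': "finite V'" and w: "\<And>x y. w x y \<ge> 0"
  and side: "\<And>x y. w x y \<noteq> 0 ==> isl x \<noteq> isl y" and mass: "\<And>x. x \<in> V ==> (\<Sum>y\<in>V. w x y) \<le> k"
  and big: "\<And>b. real (card {y\<in>V'. isl y = b}) \<ge> k + r" and k: "k > 0"
 shows "real (length h + m) \<le> r ==> h \<noteq> [] ==> set h \<subseteq> V ==> inj_on \<phi> (set h) ==> \<phi> ` set h \<subseteq> V' ==> (\<And>x. x \<in> set h ==> isl (\<phi> x) = isl x) ==>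
  ext V m (\<lambda>h. if evw h then nwt w h else 0) h \<le> nwt w h * ext V' m (\<lambda>h. of_bool (evw h)) (map \<phi> h)"
proof (induction m arbitrary: h \<phi>)
 case 0
 then show ?case using evw_map[of h \<phi>] nwt_nonneg[of w h] w by auto
next
 case (Suc m)
 note prems = Suc.prems
 let ?F = "\<lambda>y. ext V m (\<lambda>h. if evw h then nwt w h else 0) (y # h)"
 let ?E = "\<lambda>y'. ext V' m (\<lambda>h. of_bool (evw h)) (y' # map \<phi> h)"
 have E0: "?E y' \<ge> 0" for y' by (rule ext_nonneg) simp
 obtain x h0 where h: "h = x # h0" using prems(2) by (cases h) auto
 have xV: "x \<in> V" using prems(3) h by auto
 have W0: "nwt w h \<ge> 0" by (rule nwt_nonneg[OF w])
 define N' where "N' = {y\<in>V'. y \<notin> \<phi> ` set h \<and> isl y \<noteq> isl x}"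
 define S where "S = (\<Sum>y'\<in>N'. ?E y')"
 have S0: "S \<ge> 0" unfolding S_def by (intro sum_nonneg E0)
 have cN: "real (card N') \<ge> k"
 proof -
  have "{y\<in>V'. isl y = (\<not> isl x)} \<subseteq> N' \<union> \<phi> ` set h" by (auto simp: N'_def)
  then have "card {y\<in>V'. isl y = (\<not> isl x)} \<le> card (N' \<union> \<phi> ` set h)"
   by (rule card_mono[rotated]) (use V' in \<open>auto simp: N'_def\<close>)
  also have "... \<le> card N' + card (\<phi> ` set h)" by (rule card_Un_le)
  also have "card (\<phi> ` set h) \<le> length h" by (rule order_trans[OF card_image_le card_length]) simp
  finally have "card {y\<in>V'. isl y = (\<not> isl x)} \<le> card N' + length h" by simp
  then have "real (card {y\<in>V'. isl y = (\<not> isl x)}) \<le> real (card N') + real (length h)" by (simp flip: of_nat_add)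
  then show ?thesis using big[of "\<not> isl x"] prems(1) by simp
 qed
 \<comment> \<open>A step to a visited vertex is matched with the step to its image, and carries no
   weight.\<close>
 have old: "?F y \<le> nwt w h * ?E (\<phi> y)" if y: "y \<in> set h" for y
 proof -
  have "?F y \<le> nwt w (y # h) * ext V' m (\<lambda>h. of_bool (evw h)) (map \<phi> (y # h))"
  proof (rule Suc.IH)
   have "set (y # h) = set h" using y by auto
   then show "set (y # h) \<subseteq> V" "inj_on \<phi> (set (y # h))" "\<phi> ` set (y # h) \<subseteq> V'" "\<And>x. x \<in> set (y # h) ==> isl (\<phi> x) = isl x"
    using prems by auto
  qed (use prems in auto)
  then show ?thesis using y by (simp add: h)
 qed
 have new: "?F y \<le> nwt w h * (w x y * S / k)" if y: "y \<in> V - set h" for y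
 proof (cases "isl y = isl x")
  case True
  have "w x y = 0" using side[of x y] True by auto
  have "?F y \<le> ext V m (\<lambda>h. 0 * 0) (y # h)"
  proof (rule ext_mono)
   fix ys :: "('v + 'w) list" assume "length ys = m" "set ys \<subseteq> V"
   have "\<not> bip (ys @ y # x # h0)"
   proof (induction ys)
    case (Cons a ys)
    then show ?case by (cases ys) auto
   qed (use True in auto)
   then show "(if evw (ys @ y # h) then nwt w (ys @ y # h) else 0) \<le> 0 * 0" by (simp add: evw_def h)
  qed
  also have "... = 0" unfolding ext_cmult by simp
  finally show ?thesis using \<open>w x y = 0\<close> by simp
 next
  case False
  have one: "?F y \<le> w x y * nwt w h * ?E y'" if y': "y' \<in> N'" for y'
  proof -
   define \<psi> where "\<psi> = \<phi>(y := y')"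
   have \<psi>h: "\<psi> x = \<phi> x" if "x \<in> set h" for x using y that by (auto simp: \<psi>_def)
   have mp: "map \<psi> (y # h) = y' # map \<phi> h" using \<psi>h by (simp add: \<psi>_def)
   have "?F y \<le> nwt w (y # h) * ext V' m (\<lambda>h. of_bool (evw h)) (map \<psi> (y # h))"
   proof (rule Suc.IH)
    show "set (y # h) \<subseteq> V" using prems y by auto
    have "inj_on \<psi> (set h)" using prems(4) \<psi>h by (subst inj_on_cong[of _ _ \<phi>]) auto
    then show "inj_on \<psi> (set (y # h))" using y y' \<psi>h by (auto simp: N'_def \<psi>_def)
    show "\<psi> ` set (y # h) \<subseteq> V'" using prems(5) y' \<psi>h by (auto simp: N'_def \<psi>_def)
    show "isl (\<psi> z) = isl z" if "z \<in> set (y # h)" for z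
     using that prems(6) \<psi>h y' False by (auto simp: N'_def \<psi>_def)
   qed (use prems in auto)
   also have "nwt w (y # h) = w x y * nwt w h" using y by (simp add: h)
   finally show ?thesis unfolding mp .
  qed
  have F0: "?F y \<ge> 0" by (rule ext_nonneg) (use nwt_nonneg[OF w] in auto)
  have "k * ?F y \<le> real (card N') * ?F y" using cN F0 by (rule mult_right_mono)
  also have "... = (\<Sum>y'\<in>N'. ?F y)" by simp
  also have "... \<le> (\<Sum>y'\<in>N'. w x y * nwt w h * ?E y')" by (rule sum_mono[OF one])
  also have "... = w x y * nwt w h * S" by (simp add: S_def sum_distrib_left)
  finally show ?thesis using k by (simp add: le_divide_eq mult_ac)
 qed
 have "ext V (Suc m) (\<lambda>h. if evw h then nwt w h else 0) h = (\<Sum>y\<in>set h. ?F y) + (\<Sum>y\<in>V - set h. ?F y)"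
  using prems(3) V by (simp add: sum.subset_diff[of "set h" V] add.commute)
 also have "... \<le> (\<Sum>y\<in>set h. nwt w h * ?E (\<phi> y)) + (\<Sum>y\<in>V - set h. nwt w h * (w x y * S / k))"
  by (intro add_mono sum_mono old new)
 also have "(\<Sum>y\<in>V - set h. nwt w h * (w x y * S / k)) = nwt w h * (S / k) * (\<Sum>y\<in>V - set h. w x y)"
  by (simp add: sum_distrib_left sum_divide_distrib mult_ac)
 also have "... \<le> nwt w h * (S / k) * k"
 proof (rule mult_left_mono)
  have "(\<Sum>y\<in>V - set h. w x y) \<le> (\<Sum>y\<in>V. w x y)" using V w by (intro sum_mono2) auto
  then show "(\<Sum>y\<in>V - set h. w x y) \<le> k" using mass[OF xV] by linarith
 qed (use W0 S0 k in auto)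
 also have "nwt w h * (S / k) * k = nwt w h * S" using k by simp
 also have "(\<Sum>y\<in>set h. nwt w h * ?E (\<phi> y)) = nwt w h * (\<Sum>y'\<in>\<phi> ` set h. ?E y')"
  by (simp add: sum_distrib_left sum.reindex[OF prems(4)])
 also have "nwt w h * (\<Sum>y'\<in>\<phi> ` set h. ?E y') + nwt w h * S = nwt w h * (\<Sum>y'\<in>\<phi> ` set h \<union> N'. ?E y')"
  unfolding S_def distrib_left[symmetric] using V' by (subst sum.union_disjoint) (auto simp: N'_def)
 also have "... \<le> nwt w h * (\<Sum>y'\<in>V'. ?E y')"
  using V' prems(5) W0 E0 by (intro mult_left_mono sum_mono2) (auto simp: N'_def)
 finally show ?case by simp
qed

subsection \<open>Averages over walks\<close>

lemma prod_bump:
 fixes f :: "nat => nat => real"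
 assumes "finite I" "finite J" "i0 \<in> I" "j0 \<in> J"
 shows "(\<Prod>i\<in>I. \<Prod>j\<in>J. f i j ^ (c i j + of_bool (i = i0 \<and> j = j0))) = f i0 j0 * (\<Prod>i\<in>I. \<Prod>j\<in>J. f i j ^ c i j)"
proof -
 have "(\<Prod>i\<in>I. \<Prod>j\<in>J. f i j ^ of_bool (i = i0 \<and> j = j0)) = (\<Prod>i\<in>I. if i = i0 then \<Prod>j\<in>J. if j = j0 then f i0 j0 else 1 else 1)"
 proof (rule prod.cong[OF refl])
  fix i assume "i \<in> I"
  show "(\<Prod>j\<in>J. f i j ^ of_bool (i = i0 \<and> j = j0)) = (if i = i0 then \<Prod>j\<in>J. if j = j0 then f i0 j0 else 1 else 1)"
  proof (cases "i = i0")
   case True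
   then have "(\<Prod>j\<in>J. f i j ^ of_bool (i = i0 \<and> j = j0)) = (\<Prod>j\<in>J. if j = j0 then f i0 j0 else 1)" by (intro prod.cong) auto
   then show ?thesis using True by simp
  qed auto
 qed
 also have "... = f i0 j0" using assms by simp
 finally have "(\<Prod>i\<in>I. \<Prod>j\<in>J. f i j ^ of_bool (i = i0 \<and> j = j0)) = f i0 j0" .
 then show ?thesis by (simp add: power_add prod.distrib)
qed

abbreviation "cn h i j \<equiv> cnt h (Inl i) (Inr j)"

lemma stp_gk:
 assumes A: "A \<subseteq> {1..n}"
 shows "set h \<subseteq> VV A ==> stp (gk A a e) h = (if bip h then \<Prod>i\<in>{1..n}. \<Prod>j\<in>{1..n}. (a i j * e i j) ^ cn h i j else 0)"
proof (induction "gk A a e" h rule: stp.induct)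
 case (1 y x h)
 have IH: "stp (gk A a e) (x # h) = (if bip (x # h) then \<Prod>i\<in>{1..n}. \<Prod>j\<in>{1..n}. (a i j * e i j) ^ cn (x # h) i j else 0)"
  using 1 by simp
 have step: "(\<Prod>i\<in>{1..n}. \<Prod>j\<in>{1..n}. (a i j * e i j) ^ cn (y # x # h) i j) = a i0 j0 * e i0 j0 * (\<Prod>i\<in>{1..n}. \<Prod>j\<in>{1..n}. (a i j * e i j) ^ cn (x # h) i j)"
  if c: "(x, y) = (Inl i0, Inr j0) \<or> (x, y) = (Inr j0, Inl i0)" and i0: "i0 \<in> A" "j0 \<in> A" for i0 j0
 proof -
  have c': "cn (y # x # h) i j = cn (x # h) i j + of_bool (i = i0 \<and> j = j0)" for i j using c by auto
  show ?thesis unfolding c' by (rule prod_bump) (use i0 A in auto)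
 qed
 show ?case
 proof (cases x)
  case xl: (Inl i)
  show ?thesis
  proof (cases y)
   case (Inr j)
   have ij: "i \<in> A" "j \<in> A" using 1 xl Inr by (auto simp: VV_def)
   have st: "stp (gk A a e) (y # x # h) = a i j * e i j * stp (gk A a e) (x # h)" using xl Inr ij by simp
   have bp: "bip (y # x # h) = bip (x # h)" using xl Inr by simp
   have c: "(x, y) = (Inl i, Inr j) \<or> (x, y) = (Inr j, Inl i)" using xl Inr by simp
   show ?thesis unfolding st IH bp step[OF c ij] by (cases "bip (x # h)") (simp_all only: if_True if_False mult_zero_right)
  qed (use xl in simp)
 next
  case xr: (Inr j)
  show ?thesis
  proof (cases y)
   case (Inl i)
   have ij: "i \<in> A" "j \<in> A" using 1 xr Inl by (auto simp: VV_def)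
   have st: "stp (gk A a e) (y # x # h) = a i j * e i j * stp (gk A a e) (x # h)" using xr Inl ij by simp
   have bp: "bip (y # x # h) = bip (x # h)" using xr Inl by simp
   have c: "(x, y) = (Inl i, Inr j) \<or> (x, y) = (Inr j, Inl i)" using xr Inl by simp
   show ?thesis unfolding st IH bp step[OF c ij] by (cases "bip (x # h)") (simp_all only: if_True if_False mult_zero_right)
  qed (use xr in simp)
 qed
qed auto

lemma cnt_sym: "cnt h u v = cnt h v u"
 by (induction h u v rule: cnt.induct) auto

lemma cnt_bip: "bip h ==> isl u = isl v ==> cnt h u v = 0"
 by (induction h u v rule: cnt.induct) auto

lemma all_even:
 assumes b: "bip h" and s: "set h \<subseteq> VV A" and A: "A \<subseteq> {1..n}" and e: "\<forall>i\<in>{1..n}. \<forall>j\<in>{1..n}. even (cn h i j)"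
 shows "even (cnt h u v)"
proof -
 have *: "even (cn h i j)" for i j
 proof (cases "i \<in> A \<and> j \<in> A")
  case False
  then have "cn h i j = 0" using s by (intro cnt_not_in) (auto simp: VV_def)
  then show ?thesis by simp
 qed (use e A in auto)
 show ?thesis
  using *[of "projl u" "projr v"] *[of "projl v" "projr u"] cnt_bip[OF b, of u v] cnt_sym[of h u v]
  by (cases u; cases v) auto
qed

text \<open>A sign with an odd exponent averages to 0, one with an even exponent to 1.\<close>

lemma avg_stp:
 assumes A: "A \<subseteq> {1..n}" and h: "set h \<subseteq> VV A"
 shows "avg n (\<lambda>e. stp (gk A a e) h) = (if bip h \<and> (\<forall>u v. even (cnt h u v)) then \<Prod>i\<in>{1..n}. \<Prod>j\<in>{1..n}. a i j ^ cn h i j else 0)"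
proof (cases "bip h")
 case True
 have "avg n (\<lambda>e. stp (gk A a e) h) = avg n (\<lambda>e. \<Prod>i\<in>{1..n}. \<Prod>j\<in>{1..n}. (a i j * e i j) ^ cn h i j)"
  using True by (simp only: stp_gk[OF A h] if_True)
 also have "... = (\<Prod>i\<in>{1..n}. \<Prod>j\<in>{1..n}. ((a i j * (-1)) ^ cn h i j + (a i j * 1) ^ cn h i j) / 2)"
  by (rule avg_prod[of n "\<lambda>i j x. (a i j * x) ^ cn h i j"])
 also have "... = (\<Prod>i\<in>{1..n}. \<Prod>j\<in>{1..n}. if even (cn h i j) then a i j ^ cn h i j else 0)"
  by (rule prod.cong[OF refl], rule prod.cong[OF refl]) simp
 also have "... = (if \<forall>u v. even (cnt h u v) then \<Prod>i\<in>{1..n}. \<Prod>j\<in>{1..n}. a i j ^ cn h i j else 0)"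
 proof (cases "\<forall>i\<in>{1..n}. \<forall>j\<in>{1..n}. even (cn h i j)")
  case True
  then show ?thesis using all_even[OF \<open>bip h\<close> h A] by simp
 next
  case False
  then show ?thesis by (auto intro!: prod_zero simp del: One_nat_def)
 qed
 finally show ?thesis using True by simp
next
 case False
 then show ?thesis by (simp add: stp_gk[OF A h])
qed

fun nwc :: "'v list => 'v => 'v => nat" where
 "nwc (y # x # h) u v = nwc (x # h) u v + of_bool (y \<notin> set (x # h) \<and> (x = u \<and> y = v \<or> x = v \<and> y = u))"
| "nwc _ u v = 0"

lemma nwc_le_cnt: "nwc h u v \<le> cnt h u v"
proof (induction h u v rule: nwc.induct)
 case (1 y x h u v)
 have "of_bool (y \<notin> set (x # h) \<and> (x = u \<and> y = v \<or> x = v \<and> y = u)) \<le> (of_bool (x = u \<and> y = v \<or> x = v \<and> y = u) :: nat)"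
  by (cases "x = u \<and> y = v \<or> x = v \<and> y = u") simp_all
 then show ?case unfolding nwc.simps cnt.simps by (rule add_mono[OF 1])
qed simp_all

text \<open>Once an edge has been used both of its ends have been visited, so it discovers at most
  one vertex.\<close>

lemma nwc_le_1: "nwc h u v \<le> 1"
proof (induction h u v rule: nwc.induct)
 case (1 y x h u v)
 show ?case
 proof (cases "y \<notin> set (x # h) \<and> (x = u \<and> y = v \<or> x = v \<and> y = u)")
  case True
  then have "cnt (x # h) u v = 0" by (intro cnt_not_in) auto
  then have "nwc (x # h) u v = 0" using nwc_le_cnt[of "x # h" u v] by simp
  then show ?thesis unfolding nwc.simps by simp
 next
  case False
  then have "of_bool (y \<notin> set (x # h) \<and> (x = u \<and> y = v \<or> x = v \<and> y = u)) = (0 :: nat)" by (simp only: of_bool_def if_False)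
  then show ?thesis using 1 unfolding nwc.simps by linarith
 qed
qed simp_all

lemma nwt_prod:
 assumes A: "A \<subseteq> {1..n}"
 shows "set h \<subseteq> VV A ==> bip h ==> nwt (wt A a) h = (\<Prod>i\<in>{1..n}. \<Prod>j\<in>{1..n}. wt A a (Inl i) (Inr j) ^ nwc h (Inl i) (Inr j))"
proof (induction "wt A a" h rule: nwt.induct)
 case (1 y x h)
 have IH: "nwt (wt A a) (x # h) = (\<Prod>i\<in>{1..n}. \<Prod>j\<in>{1..n}. wt A a (Inl i) (Inr j) ^ nwc (x # h) (Inl i) (Inr j))"
  using 1 by simp
 show ?case
 proof (cases "y \<in> set (x # h)")
  case True
  then have "nwc (y # x # h) u v = nwc (x # h) u v" for u v by simp
  moreover have "nwt (wt A a) (y # x # h) = nwt (wt A a) (x # h)" using True by simp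
  ultimately show ?thesis using IH by presburger
 next
  case False
  obtain i0 j0 where c: "(x, y) = (Inl i0, Inr j0) \<or> (x, y) = (Inr j0, Inl i0)"
   using 1(3) by (cases x; cases y) auto
  have i0: "i0 \<in> {1..n}" "j0 \<in> {1..n}" using c 1(2) A by (auto simp: VV_def)
  have c': "nwc (y # x # h) (Inl i) (Inr j) = nwc (x # h) (Inl i) (Inr j) + of_bool (i = i0 \<and> j = j0)" for i j
   using c False by auto
  have "(\<Prod>i\<in>{1..n}. \<Prod>j\<in>{1..n}. wt A a (Inl i) (Inr j) ^ nwc (y # x # h) (Inl i) (Inr j)) = wt A a (Inl i0) (Inr j0) * nwt (wt A a) (x # h)"
   unfolding IH c' by (rule prod_bump) (use i0 in auto)
  also have "wt A a (Inl i0) (Inr j0) = wt A a x y" using c wt_sym[of A a x y] by auto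
  finally have "(\<Prod>i\<in>{1..n}. \<Prod>j\<in>{1..n}. wt A a (Inl i) (Inr j) ^ nwc (y # x # h) (Inl i) (Inr j)) = wt A a x y * nwt (wt A a) (x # h)" .
  moreover have "nwt (wt A a) (y # x # h) = wt A a x y * nwt (wt A a) (x # h)" using False by simp
  ultimately show ?thesis by argo
 qed
qed auto

text \<open>An edge that discovers a vertex has even, hence at least double, multiplicity. One
  square is kept for the discovery, and the other factors are at most 1.\<close>

lemma stp_le_nwt:
 assumes A: "A \<subseteq> {1..n}" and h: "set h \<subseteq> VV A" "bip h" "\<forall>u v. even (cnt h u v)"
  and a: "\<And>i j. i \<in> A ==> j \<in> A ==> (a i j)\<^sup>2 \<le> 1"
 shows "(\<Prod>i\<in>{1..n}. \<Prod>j\<in>{1..n}. a i j ^ cn h i j) \<le> nwt (wt A a) h"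
 unfolding nwt_prod[OF A h(1,2)]
proof -
 have *: "0 \<le> a i j ^ cn h i j \<and> a i j ^ cn h i j \<le> wt A a (Inl i) (Inr j) ^ nwc h (Inl i) (Inr j)" for i j
 proof
 have ev: "even (cn h i j)" using h(3) by blast
 then show nn: "0 \<le> a i j ^ cn h i j" by (simp add: zero_le_even_power)
 show "a i j ^ cn h i j \<le> wt A a (Inl i) (Inr j) ^ nwc h (Inl i) (Inr j)"
 proof (cases "i \<in> A \<and> j \<in> A")
  case True
  obtain c where c: "cn h i j = 2 * c" using ev by (auto elim: evenE)
  have "nwc h (Inl i) (Inr j) \<le> c" using nwc_le_1[of h "Inl i" "Inr j"] nwc_le_cnt[of h "Inl i" "Inr j"] c by linarith
  then have "((a i j)\<^sup>2) ^ c \<le> ((a i j)\<^sup>2) ^ nwc h (Inl i) (Inr j)" using a True by (intro power_decreasing) auto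
  then show ?thesis using True by (simp add: c power_mult wt_def)
 next
  case False
  then have "cn h i j = 0" using h(1) by (intro cnt_not_in) (auto simp: VV_def)
  then show ?thesis using nwc_le_cnt[of h "Inl i" "Inr j"] by simp
 qed
 qed
 show "(\<Prod>i\<in>{1..n}. \<Prod>j\<in>{1..n}. a i j ^ cn h i j) \<le> (\<Prod>i\<in>{1..n}. \<Prod>j\<in>{1..n}. wt A a (Inl i) (Inr j) ^ nwc h (Inl i) (Inr j))"
  by (rule prod_mono, rule conjI, rule prod_nonneg, simp add: *, rule prod_mono, simp add: *)
qed

text \<open>With unit entries, the number of even closed walks in the complete bipartite graph is
  itself an expected diagonal entry of a power, namely for a full sign matrix; so the comparison of
  walks becomes one of moments.\<close>

lemma trace_compare:
 assumes A: "A \<subseteq> {1..n}" and a: "\<And>i j. i \<in> A ==> j \<in> A ==> (a i j)\<^sup>2 \<le> 1"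
  and mass: "\<And>x. x \<in> VV A ==> (\<Sum>y\<in>VV A. wt A a x y) \<le> k" and k: "k > 0" and r: "real r \<ge> k + real (L + 1)"
  and x: "x \<in> VV A" "x' \<in> VV {1..r}" "isl x' = isl x"
 shows "avg n (\<lambda>e. Gp (VV A) (gk A a e) L x x) \<le> avg r (\<lambda>e. Gp (VV {1..r}) (gk {1..r} (\<lambda>_ _. 1) e) L x' x')"
proof -
 have finA: "finite A" using A finite_subset by blast
 have G: "Gp V g L y y = ext V L (\<lambda>h. if hd h = y then stp g h else 0) [y]" for V L y and g :: "nat + nat => nat + nat => real"
  unfolding ext_Gp by simp
 have avi: "avg m (\<lambda>e. if b then f e else 0) = (if b then avg m f else 0)" for m b f by simp
 have "avg n (\<lambda>e. Gp (VV A) (gk A a e) L x x) = ext (VV A) L (\<lambda>h. if hd h = x then avg n (\<lambda>e. stp (gk A a e) h) else 0) [x]"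
  unfolding G avg_ext avi ..
 also have "... \<le> ext (VV A) L (\<lambda>h. if evw h then nwt (wt A a) h else 0) [x]"
 proof (rule ext_mono)
  fix ys assume "set ys \<subseteq> VV A"
  then have s: "set (ys @ [x]) \<subseteq> VV A" using x by auto
  show "(if hd (ys @ [x]) = x then avg n (\<lambda>e. stp (gk A a e) (ys @ [x])) else 0) \<le> (if evw (ys @ [x]) then nwt (wt A a) (ys @ [x]) else 0)"
   unfolding avg_stp[OF A s] using stp_le_nwt[OF A s _ _ a] nwt_nonneg[of "wt A a" "ys @ [x]"] wt_nonneg[of A a]
   by (auto simp: evw_def simp del: One_nat_def)
 qed
 also have "... \<le> nwt (wt A a) [x] * ext (VV {1..r}) L (\<lambda>h. of_bool (evw h)) (map (\<lambda>_. x') [x])"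
 proof (rule walk_compare[OF _ _ wt_nonneg _ mass])
  show "k + real (L + 1) \<le> real (card {y\<in>VV {1..r}. isl y = b})" for b :: bool
  proof -
   have "{y\<in>VV {1..r}. isl y = b} = (if b then Inl ` {1..r} else Inr ` {1..r})" by (auto simp: VV_def)
   then have "card {y\<in>VV {1..r}. isl y = b} = r" by (simp add: card_image)
   then show ?thesis using r by simp
  qed
  show "isl x \<noteq> isl y" if "wt A a x y \<noteq> 0" for x y using that by (auto simp: wt_def split: sum.splits)
 qed (use finA x k in auto)
 also have "... = ext (VV {1..r}) L (\<lambda>h. of_bool (evw h)) [x']" by simp
 also have "... = ext (VV {1..r}) L (\<lambda>h. if hd h = x' then avg r (\<lambda>e. stp (gk {1..r} (\<lambda>_ _. 1) e) h) else 0) [x']"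
 proof (rule ext_cong)
  fix ys assume "set ys \<subseteq> VV {1..r}"
  then have s: "set (ys @ [x']) \<subseteq> VV {1..r}" using x by auto
  show "of_bool (evw (ys @ [x'])) = (if hd (ys @ [x']) = x' then avg r (\<lambda>e. stp (gk {1..r} (\<lambda>_ _. 1) e) (ys @ [x'])) else 0)"
   unfolding avg_stp[OF order_refl s] by (auto simp: evw_def)
 qed
 also have "... = avg r (\<lambda>e. Gp (VV {1..r}) (gk {1..r} (\<lambda>_ _. 1) e) L x' x')"
  unfolding G avg_ext avi ..
 finally show ?thesis .
qed

lemma fact_le_pow: "fact L \<le> (real L) ^ L"
 using fact_le_power[of L, where 'a = real] by simp

text \<open>The L-th power of the norm is at most the sum of L-th powers over pairs of lattice
  vectors, each controlled by \<open>even_moment\<close> with \<open>l = sqrt r\<close>. The net and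
  the exponential contribute 2 * (4 + 3/2) + 8 = 19, and \<open>L \<le> r\<close> turns
  \<open>fact L / sqrt r ^ L\<close> into at most \<open>sqrt L ^ L\<close>.\<close>

lemma sign_moment:
 assumes L: "even L" "L > 0" "L \<le> r" and x: "x \<in> VV {1..r}"
 shows "avg r (\<lambda>e. Gp (VV {1..r}) (gk {1..r} (\<lambda>_ _. 1) e) L x x) \<le>
  2 * exp (19 * real r) * sqrt (real L) ^ L"
proof -
 have r: "real r > 0" using L by simp
 let ?K = "{1..r} :: nat set"
 define m where "m = nat \<lfloor>4 * real r\<rfloor>"
 define D where "D = ilat ?K m"
 have finD: "finite D" by (simp add: D_def)
 define y where "y = (\<lambda>(z :: nat => int) i. real_of_int (z i) / sqrt (real r))"
 define S where "S = (\<lambda>(z, z') e. \<Sum>i\<in>?K. \<Sum>j\<in>?K. (y z i * y z' j) * e i j)"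
 define T where "T = (\<lambda>e. \<Sum>p\<in>D \<times> D. S p e ^ L)"
 have T0: "T e \<ge> 0" for e unfolding T_def using L by (intro sum_nonneg zero_le_even_power) auto
 have op: "opb (root L (T e)) (\<lambda>_ _. 1) ?K ?K e" for e
 proof (rule opbI)
  fix s t assume st: "sqn ?K s \<le> 1" "sqn ?K t \<le> 1"
  obtain z where z: "z \<in> D" "(\<Sum>i\<in>?K. (\<Sum>j\<in>?K. e i j * t j) * s i) \<le> (\<Sum>i\<in>?K. (\<Sum>j\<in>?K. e i j * t j) * y z i)"
   using ilat_max[of ?K "real r" s "\<lambda>i. \<Sum>j\<in>?K. e i j * t j"] st r unfolding D_def m_def y_def sqn_def by auto
  obtain z' where z': "z' \<in> D" "(\<Sum>j\<in>?K. (\<Sum>i\<in>?K. e i j * y z i) * t j) \<le> (\<Sum>j\<in>?K. (\<Sum>i\<in>?K. e i j * y z i) * y z' j)"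
   using ilat_max[of ?K "real r" t "\<lambda>j. \<Sum>i\<in>?K. e i j * y z i"] st r unfolding D_def m_def y_def sqn_def by auto
  have "bform (\<lambda>_ _. 1) ?K ?K e s t = (\<Sum>i\<in>?K. (\<Sum>j\<in>?K. e i j * t j) * s i)"
   unfolding bform_def sum_distrib_right by (intro sum.cong refl) simp
  also have "... \<le> (\<Sum>i\<in>?K. (\<Sum>j\<in>?K. e i j * t j) * y z i)" by (rule z)
  also have "... = (\<Sum>i\<in>?K. \<Sum>j\<in>?K. e i j * y z i * t j)" unfolding sum_distrib_right by (intro sum.cong refl) simp
  also have "... = (\<Sum>j\<in>?K. (\<Sum>i\<in>?K. e i j * y z i) * t j)" unfolding sum_distrib_right by (rule sum.swap)
  also have "... \<le> (\<Sum>j\<in>?K. (\<Sum>i\<in>?K. e i j * y z i) * y z' j)" by (rule z')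
  also have "... = S (z, z') e" unfolding S_def sum_distrib_right prod.case by (subst sum.swap) (intro sum.cong refl, simp)
  also have "... \<le> \<bar>S (z, z') e\<bar>" by simp
  also have "... = root L (\<bar>S (z, z') e\<bar> ^ L)" using L by (simp add: real_root_power_cancel)
  also have "... \<le> root L (T e)"
  proof (rule real_root_le_mono[OF L(2)])
   have "\<bar>S (z, z') e\<bar> ^ L = S (z, z') e ^ L" using L by (simp add: power_even_abs)
   also have "... \<le> T e" unfolding T_def
    by (rule member_le_sum[of "(z, z')" "D \<times> D" "\<lambda>p. S p e ^ L"]) (use z z' finD L in \<open>auto intro: zero_le_even_power\<close>)
   finally show "\<bar>S (z, z') e\<bar> ^ L \<le> T e" .
  qed
  finally show "bform (\<lambda>_ _. 1) ?K ?K e s t \<le> root L (T e)" .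
 qed auto
 have "avg r (\<lambda>e. Gp (VV ?K) (gk ?K (\<lambda>_ _. 1) e) L x x) \<le> avg r T"
 proof (rule avg_mono)
  fix e
  have "Gp (VV ?K) (gk ?K (\<lambda>_ _. 1) e) L x x \<le> root L (T e) ^ L"
   by (rule gk_bound[OF _ op x]) (simp_all add: T0 real_root_ge_zero)
  also have "... = T e" using T0 L by simp
  finally show "Gp (VV ?K) (gk ?K (\<lambda>_ _. 1) e) L x x \<le> T e" .
 qed
 also have "... = (\<Sum>p\<in>D \<times> D. avg r (\<lambda>e. S p e ^ L))" unfolding T_def by (rule avg_sum)
 also have "... \<le> (\<Sum>p\<in>D \<times> D. 2 * fact L * exp ((sqrt (real r))\<^sup>2 * 16 / 2) / sqrt (real r) ^ L)"
 proof (rule sum_mono)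
  fix p assume "p \<in> D \<times> D"
  then obtain z z' where p: "p = (z, z')" "z \<in> D" "z' \<in> D" by auto
  have n4: "(\<Sum>i\<in>?K. (y z i)\<^sup>2) \<le> 4" "(\<Sum>i\<in>?K. (y z' i)\<^sup>2) \<le> 4"
   unfolding y_def using ilat_norm[of _ ?K "real r"] p r by (auto simp: D_def m_def)
  have "(\<Sum>i\<in>?K. \<Sum>j\<in>?K. (y z i * y z' j)\<^sup>2) = (\<Sum>i\<in>?K. (y z i)\<^sup>2) * (\<Sum>j\<in>?K. (y z' j)\<^sup>2)"
   by (simp add: power_mult_distrib sum_product)
  also have "... \<le> 4 * 4" using n4 by (intro mult_mono sum_nonneg) auto
  finally have "(\<Sum>i\<in>?K. \<Sum>j\<in>?K. (y z i * y z' j)\<^sup>2) \<le> 16" by simp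
  from even_moment[OF order_refl order_refl this L(1), of "sqrt (real r)"]
  show "avg r (\<lambda>e. S p e ^ L) \<le> 2 * fact L * exp ((sqrt (real r))\<^sup>2 * 16 / 2) / sqrt (real r) ^ L"
   using r by (simp add: S_def p)
 qed
 also have "... = (real (card D))\<^sup>2 * (2 * fact L * exp (8 * real r) / sqrt (real r) ^ L)"
  by (simp add: card_cartesian_product power2_eq_square)
 also have "... \<le> (exp (4 * real r) * 3 ^ r)\<^sup>2 * (2 * sqrt (real L) ^ L * exp (8 * real r))"
 proof (intro mult_mono power_mono)
  have "real (card D) \<le> exp (real m) * 3 ^ card ?K" unfolding D_def by (rule card_ilat) simp
  also have "... \<le> exp (4 * real r) * 3 ^ r" unfolding m_def by simp
  finally show "real (card D) \<le> exp (4 * real r) * 3 ^ r" .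
  have "(fact L :: real) \<le> real L ^ L" by (rule fact_le_pow)
  also have "... = sqrt (real L) ^ L * sqrt (real L) ^ L" by (simp flip: power_mult_distrib)
  also have "... \<le> sqrt (real L) ^ L * sqrt (real r) ^ L" using L by (intro mult_left_mono power_mono) auto
  finally have "(fact L :: real) / sqrt (real r) ^ L \<le> sqrt (real L) ^ L" using r by (simp add: divide_le_eq)
  then have "2 * exp (8 * real r) * (fact L / sqrt (real r) ^ L) \<le> 2 * exp (8 * real r) * sqrt (real L) ^ L"
   by (intro mult_left_mono) auto
  then show "2 * fact L * exp (8 * real r) / sqrt (real r) ^ L \<le> 2 * sqrt (real L) ^ L * exp (8 * real r)"
   by (simp add: mult_ac)
 qed auto
 also have "... \<le> (exp (4 * real r) * exp (3 / 2 * real r))\<^sup>2 * (2 * sqrt (real L) ^ L * exp (8 * real r))"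
 proof (intro mult_right_mono power_mono mult_left_mono)
  have "(3::real) \<le> exp (3 / 2)"
  proof -
   have "(7 / 4 :: real)\<^sup>2 \<le> (exp (3 / 4))\<^sup>2" using exp_ge_add_one_self[of "3/4"] by (intro power_mono) auto
   then show ?thesis by (simp add: power2_eq_square mult_exp_exp)
  qed
  then have "(3::real) ^ r \<le> exp (3 / 2) ^ r" by (intro power_mono) auto
  then show "(3::real) ^ r \<le> exp (3 / 2 * real r)" by (simp add: mult.commute flip: exp_of_nat_mult)
 qed auto
 also have "... = 2 * exp (19 * real r) * sqrt (real L) ^ L" by (simp add: power2_eq_square mult_exp_exp)
 finally show ?thesis .
qed

text \<open>Scaling by \<open>sqrt L\<close>, with \<open>L\<close> a power of two between
  \<open>2 * P\<close> and \<open>4 * P\<close>, makes the entries at most 1 and the masses at most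
  \<open>L\<close>. The trace is then compared with a sign matrix of size
  \<open>r = 2 * L + 1\<close>, and in Markov's inequality \<open>exp (80 * L)\<close> beats
  \<open>exp (P + 19 * r)\<close>.\<close>

theorem (in mat) thm_G1:
 assumes U: "\<And>i j. i \<in> A ==> j \<in> A ==> (a i j)\<^sup>2 * (4 * P) \<le> 1" and P: "P \<ge> 1" and cA: "real (card A) \<le> exp P"
 shows "pr n (\<lambda>e. \<not> opb (exp 80) a A A e) \<le> 4 * exp (- 4 * P)"
proof -
 have "\<exists>q. 2 * P < 2 ^ q \<and> 2 ^ q \<le> 4 * P"
 proof -
  define q where "q = (LEAST q::nat. 2 * P < 2 ^ q)"
  have ex: "\<exists>q::nat. 2 * P < 2 ^ q" using real_arch_pow[of 2 "2 * P"] by auto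
  have q: "2 * P < 2 ^ q" unfolding q_def by (rule LeastI_ex[OF ex])
  then obtain q' where q': "q = Suc q'" using P by (cases q) auto
  have "\<not> 2 * P < 2 ^ q'" using not_less_Least[of q' "\<lambda>q. 2 * P < 2 ^ q"] q' unfolding q_def by simp
  then show ?thesis using q q' by (intro exI[of _ q]) auto
 qed
 then obtain q0 where q0: "2 * P < 2 ^ q0" "2 ^ q0 \<le> 4 * P" by blast
 then obtain q where q: "q0 = Suc q" using P by (cases q0) auto
 define L :: nat where "L = 2 ^ Suc q"
 have L: "2 * P < real L" "real L \<le> 4 * P" "even L" "L > 0" using q0 q by (auto simp: L_def)
 define b where "b = (\<lambda>i j. sqrt (real L) * a i j)"
 have b1: "(b i j)\<^sup>2 \<le> 1" if "i \<in> A" "j \<in> A" for i j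
 proof -
  have "(b i j)\<^sup>2 = (a i j)\<^sup>2 * real L" by (simp add: b_def power_mult_distrib)
  also have "... \<le> (a i j)\<^sup>2 * (4 * P)" using L by (intro mult_left_mono) auto
  finally show ?thesis using U[OF that] by linarith
 qed
 have wb: "wt A b x y = real L * wt A a x y" for x y by (auto simp: wt_def b_def power_mult_distrib split: sum.splits)
 have mass: "(\<Sum>y\<in>VV A. wt A b x y) \<le> real L" if x: "x \<in> VV A" for x
 proof -
  have "(\<Sum>y\<in>VV A. wt A b x y) = real L * imass (wt A a) (VV A) x" by (simp add: wb imass_def sum_distrib_left)
  also have "... \<le> real L * 1" using VV_imass[OF mat_axioms x] by (intro mult_left_mono) auto
  finally show ?thesis by simp
 qed
 define r where "r = 2 * L + 1"
 let ?B = "2 * exp (19 * real r) * sqrt (real L) ^ L"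
 let ?tr = "\<lambda>e. symk.tr (VV A) (gk A b e) L"
 have sk: "symk (VV A) (gk A b e)" for e by (rule symk_gk[OF finA])
 have one: "avg n (\<lambda>e. Gp (VV A) (gk A b e) L x x) \<le> ?B" if x: "x \<in> VV A" for x
 proof -
  obtain x' where x': "x' \<in> VV {1..r}" "isl x' = isl x"
   by (cases x) (auto simp: VV_def r_def intro: that[of "Inl 1"] that[of "Inr 1"])
  have "avg n (\<lambda>e. Gp (VV A) (gk A b e) L x x) \<le> avg r (\<lambda>e. Gp (VV {1..r}) (gk {1..r} (\<lambda>_ _. 1) e) L x' x')"
   by (rule trace_compare[OF A b1 mass _ _ x x']) (use L in \<open>auto simp: r_def\<close>)
  also have "... \<le> ?B" by (rule sign_moment[OF L(3,4) _ x'(1)]) (simp add: r_def)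
  finally show ?thesis .
 qed
 define Z where "Z = sqrt (real L) * exp 80"
 have Z: "Z > 0" using L by (simp add: Z_def)
 have nob: "\<not> opb Z b A A e" if "\<not> opb (exp 80) a A A e" for e
 proof
  assume o: "opb Z b A A e"
  have "bform a A A e s t \<le> exp 80 * sqrt (sqn A s) * sqrt (sqn A t)" for s t
  proof -
   have "sqrt (real L) * bform a A A e s t = bform b A A e s t" by (simp add: bform_def b_def sum_distrib_left mult_ac)
   also have "... \<le> Z * sqrt (sqn A s) * sqrt (sqn A t)" using o by (simp add: opb_def)
   finally have "sqrt (real L) * bform a A A e s t \<le> sqrt (real L) * (exp 80 * sqrt (sqn A s) * sqrt (sqn A t))" by (simp add: Z_def)
   then show ?thesis using L by (simp add: mult_le_cancel_left_pos)
  qed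
  then show False using that by (simp add: opb_def)
 qed
 have "Z ^ L * pr n (\<lambda>e. \<not> opb (exp 80) a A A e) = avg n (\<lambda>e. Z ^ L * of_bool (\<not> opb (exp 80) a A A e))"
  unfolding pr_def avg_cmult ..
 also have "... \<le> avg n ?tr"
 proof (rule avg_mono)
  fix e
  have "?tr e \<ge> 0" unfolding L_def by (rule symk.tr_nonneg[OF sk])
  moreover have "Z ^ L \<le> ?tr e" if "\<not> opb (exp 80) a A A e"
   unfolding L_def by (rule trace_opb[OF finA _ nob[OF that]]) (use Z in simp)
  ultimately show "Z ^ L * of_bool (\<not> opb (exp 80) a A A e) \<le> ?tr e" by auto
 qed
 also have "... = (\<Sum>x\<in>VV A. avg n (\<lambda>e. Gp (VV A) (gk A b e) L x x))"
  unfolding symk.tr_def[OF sk] by (rule avg_sum)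
 also have "... \<le> real (card (VV A)) * ?B" using sum_bounded_above[of "VV A", OF one] by simp
 also have "... \<le> (2 * exp P) * ?B" using cA by (intro mult_right_mono) (auto simp: card_VV_A finA)
 finally have main: "Z ^ L * pr n (\<lambda>e. \<not> opb (exp 80) a A A e) \<le> 2 * exp P * ?B" .
 have ZL: "Z ^ L = exp (80 * real L) * sqrt (real L) ^ L"
  by (simp add: Z_def power_mult_distrib mult.commute flip: exp_of_nat_mult)
 have sp: "sqrt (real L) ^ L > 0" using L by simp
 have "exp (80 * real L) * pr n (\<lambda>e. \<not> opb (exp 80) a A A e) * sqrt (real L) ^ L \<le> (4 * exp (P + 19 * real r)) * sqrt (real L) ^ L"
  using main unfolding ZL by (simp add: exp_add mult_ac)
 then have "exp (80 * real L) * pr n (\<lambda>e. \<not> opb (exp 80) a A A e) \<le> 4 * exp (P + 19 * real r)" by (rule mult_right_le_imp_le) (rule sp)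
 then have "pr n (\<lambda>e. \<not> opb (exp 80) a A A e) \<le> 4 * exp (P + 19 * real r) / exp (80 * real L)" by (simp add: le_divide_eq mult.commute)
 also have "... = 4 * exp (P + 19 * real r - 80 * real L)" by (simp add: exp_diff)
 also have "... \<le> 4 * exp (- 4 * P)" using L P by (simp add: r_def)
 finally show ?thesis .
qed

section \<open>Splitting the matrix by the size of its entries\<close>

definition emask :: "(nat => nat => bool) => (nat => nat => real) => nat => nat => real" where
 "emask c a i j = (if c i j then a i j else 0)"

lemma mat_mask: "mat n A a ==> mat n A (emask c a)"
proof -
 assume "mat n A a"
 then interpret mat n A a .
 show ?thesis
 proof
  fix i assume i: "i \<in> A"
  have "(\<Sum>j\<in>A. (emask c a i j)\<^sup>2) \<le> (\<Sum>j\<in>A. (a i j)\<^sup>2)" by (rule sum_mono) (auto simp: emask_def)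
  then show "(\<Sum>j\<in>A. (emask c a i j)\<^sup>2) \<le> 1" using row[OF i] by linarith
  have "(\<Sum>j\<in>A. (emask c a j i)\<^sup>2) \<le> (\<Sum>j\<in>A. (a j i)\<^sup>2)" by (rule sum_mono) (auto simp: emask_def)
  then show "(\<Sum>j\<in>A. (emask c a j i)\<^sup>2) \<le> 1" using col[OF i] by linarith
 qed (use A in auto)
qed

lemma mom_mask:
 assumes A: "A \<subseteq> {1..n}" and m: "mom n A a p R" and p: "p \<ge> 1"
 shows "mom n A (emask c a) p R"
 unfolding mom_def
proof (intro allI)
 fix s t
 have e1: "bform (emask c a) A A e s t = (\<Sum>i\<in>A. \<Sum>j\<in>A. (if c i j then a i j * s i * t j else 0) * e i j)" for e
  unfolding bform_def by (intro sum.cong refl) (simp add: emask_def)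
 have e2: "bform a A A e s t = (\<Sum>i\<in>A. \<Sum>j\<in>A. (a i j * s i * t j) * e i j)" for e
  unfolding bform_def by (intro sum.cong refl) simp
 have "avg n (\<lambda>e. \<bar>bform (emask c a) A A e s t\<bar> powr p) \<le> avg n (\<lambda>e. \<bar>bform a A A e s t\<bar> powr p)"
  unfolding e1 e2 by (rule masked_moment[OF A A p])
 also have "... \<le> (R * sqrt (sqn A s) * sqrt (sqn A t)) powr p" using m by (simp add: mom_def)
 finally show "avg n (\<lambda>e. \<bar>bform (emask c a) A A e s t\<bar> powr p) \<le> (R * sqrt (sqn A s) * sqrt (sqn A t)) powr p" .
qed

lemma opb_add3:
 assumes "opb Z1 a1 I J e" "opb Z2 a2 I J e" "opb Z3 a3 I J e" and a: "\<And>i j. a i j = a1 i j + a2 i j + a3 i j"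
 shows "opb (Z1 + Z2 + Z3) a I J e"
 unfolding opb_def
proof (intro allI)
 fix s t
 have "bform a I J e s t = bform a1 I J e s t + bform a2 I J e s t + bform a3 I J e s t"
  unfolding bform_def a by (simp add: sum.distrib[symmetric] algebra_simps)
 moreover have "bform a1 I J e s t \<le> Z1 * sqrt (sqn I s) * sqrt (sqn J t)" "bform a2 I J e s t \<le> Z2 * sqrt (sqn I s) * sqrt (sqn J t)"
  "bform a3 I J e s t \<le> Z3 * sqrt (sqn I s) * sqrt (sqn J t)" using assms(1-3) by (auto simp: opb_def)
 ultimately show "bform a I J e s t \<le> (Z1 + Z2 + Z3) * sqrt (sqn I s) * sqrt (sqn J t)" by (simp add: algebra_simps)
qed

lemma core_number: "exp 80 + l * (136 * ZR R + 6400) + l * (224 * ZR R + 800) \<le> exp 1011 * l * (1 + R)" if "l \<ge> 1" "R \<ge> 0"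
proof -
 have e2: "(2::real) \<le> exp 1" using exp_ge_add_one_self[of 1] by simp
 have "1440 \<le> exp (11::real)"
 proof -
  have "(2::real) ^ 11 \<le> exp 1 ^ 11" using e2 by (intro power_mono) auto
  then show ?thesis by (simp flip: exp_of_nat_mult)
 qed
 then have 1: "1440 * exp (1000::real) \<le> exp 11 * exp 1000" by (intro mult_right_mono) auto
 have "21600 \<le> exp (80::real)"
 proof -
  have "(21::real) ^ 4 \<le> exp 20 ^ 4" using exp_ge_add_one_self[of 20] by (intro power_mono) auto
  then show ?thesis by (simp flip: exp_of_nat_mult)
 qed
 moreover have "2 * exp (80::real) \<le> exp 1 * exp 80" using e2 by (intro mult_right_mono) auto
 moreover have "exp 1 * exp 80 \<le> exp (1011::real)" by (simp add: mult_exp_exp)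
 ultimately have 2: "exp 80 + 21600 \<le> exp (1011::real)" by linarith
 have "exp 80 + l * (136 * ZR R + 6400) + l * (224 * ZR R + 800) = exp 80 + 21600 * l + l * (1440 * exp 1000 * R)"
  by (simp add: ZR_def algebra_simps)
 also have "... \<le> exp 80 * l + 21600 * l + l * (exp 1011 * R)"
 proof -
  have "exp (80::real) * 1 \<le> exp 80 * l" using that by (intro mult_left_mono) auto
  moreover have "l * (1440 * exp 1000 * R) \<le> l * (exp 1011 * R)"
   using 1 that by (intro mult_left_mono mult_right_mono) (auto simp: mult_exp_exp)
  ultimately show ?thesis by linarith
 qed
 also have "... = (exp 80 + 21600) * l + l * (exp 1011 * R)" by (simp add: distrib_right)
 also have "... \<le> exp 1011 * l + l * (exp 1011 * R)" using 2 that by (intro add_right_mono mult_right_mono) auto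
 also have "... = exp 1011 * l * (1 + R)" by (simp add: algebra_simps)
 finally show ?thesis .
qed

theorem core_bound:
 assumes m: "mat n A a" and nm: "nums N P h l" and cA: "real (card A) \<le> N" and mo: "mom n A a p R" and R: "R > 0"
  and p: "P \<le> 17 * p"
 shows "pr n (\<lambda>e. \<not> opb (exp 1011 * l * (1 + R)) a A A e) \<le> 28 * exp (- 4 * P)"
proof -
 interpret nums N P h l by fact
 interpret mat n A a by fact
 have p1: "p \<ge> 1" using p P_big by linarith
 define c1 where "c1 = (\<lambda>i j. (a i j)\<^sup>2 * (4 * P) < 1)"
 define c2 where "c2 = (\<lambda>i j. \<not> c1 i j \<and> (a i j)\<^sup>2 \<le> 1 / h ^ 6)"
 define c3 where "c3 = (\<lambda>i j. \<not> c1 i j \<and> \<not> c2 i j)"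
 have pm: "par n A (emask c a) N P h l p R" for c
  by (intro par.intro par_axioms.intro mat_mask[OF m] nm cA mom_mask[OF A mo p1] R p)
 define Z2 where "Z2 = l * (136 * ZR R + 6400)"
 define Z3 where "Z3 = l * (224 * ZR R + 800)"
 have h6: "h ^ 6 > 0" using h_big by simp
 have p1: "pr n (\<lambda>e. \<not> opb (exp 80) (emask c1 a) A A e) \<le> 4 * exp (- 4 * P)"
  by (rule mat.thm_G1[OF mat_mask[OF m]]) (use P_big cA N in \<open>auto simp: emask_def c1_def\<close>)
 have p2: "pr n (\<lambda>e. \<not> opb Z2 (emask c2 a) A A e) \<le> 18 * exp (- 4 * P)"
  unfolding Z2_def by (rule par.thm_G2[OF pm]) (use h6 in \<open>auto simp: emask_def c1_def c2_def split: if_splits\<close>)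
 have p3: "pr n (\<lambda>e. \<not> opb Z3 (emask c3 a) A A e) \<le> 6 * exp (- 4 * P)"
  unfolding Z3_def
 proof (rule par.thm_G3[OF pm])
  fix i j assume "emask c3 a i j \<noteq> 0"
  then have c: "c3 i j" by (auto simp: emask_def split: if_splits)
  then have "(a i j)\<^sup>2 > 1 / h ^ 6" by (auto simp: c3_def c2_def)
  then show "(emask c3 a i j)\<^sup>2 * h ^ 6 \<ge> 1" using c h6 by (simp add: emask_def divide_less_eq)
 qed
 have "pr n (\<lambda>e. \<not> opb (exp 1011 * l * (1 + R)) a A A e) \<le>
  pr n (\<lambda>e. \<not> opb (exp 80) (emask c1 a) A A e \<or> \<not> opb Z2 (emask c2 a) A A e \<or> \<not> opb Z3 (emask c3 a) A A e)"
 proof (rule pr_mono, rule ccontr)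
  fix e assume no: "\<not> opb (exp 1011 * l * (1 + R)) a A A e"
   and g: "\<not> (\<not> opb (exp 80) (emask c1 a) A A e \<or> \<not> opb Z2 (emask c2 a) A A e \<or> \<not> opb Z3 (emask c3 a) A A e)"
  have "opb (exp 80 + Z2 + Z3) a A A e"
   by (rule opb_add3[of _ "emask c1 a" _ _ _ _ "emask c2 a" _ "emask c3 a"]) (use g in \<open>auto simp: emask_def c3_def c2_def\<close>)
  moreover have "exp 80 + Z2 + Z3 \<le> exp 1011 * l * (1 + R)" unfolding Z2_def Z3_def using l R by (intro core_number) auto
  ultimately show False using no opb_mono by blast
 qed
 also have "... \<le> 4 * exp (- 4 * P) + (18 * exp (- 4 * P) + 6 * exp (- 4 * P))"
  by (intro pr_or_le p1 p2 p3)
 finally show ?thesis by simp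
qed

subsection \<open>Layers\<close>

lemma half_sum: "(\<Sum>q\<le>Q. (1/2::real) ^ q) \<le> 2"
proof -
 have "(\<Sum>q\<le>Q. (1/2::real) ^ q) = 2 - (1/2) ^ Q" by (induction Q) auto
 then show ?thesis by simp
qed

lemma frob_opb:
 assumes fin: "finite I" "finite J"
 shows "opb (sqrt (\<Sum>i\<in>I. \<Sum>j\<in>J. (a i j * e i j)\<^sup>2)) a I J e"
proof (rule opbI[OF fin])
 fix s t assume st: "sqn I s \<le> 1" "sqn J t \<le> 1"
 let ?S = "I \<times> J"
 have "bform a I J e s t = (\<Sum>p\<in>?S. (a (fst p) (snd p) * e (fst p) (snd p)) * (s (fst p) * t (snd p)))"
  unfolding bform_def sum.cartesian_product by (intro sum.cong) (auto simp: mult_ac)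
 then have "(bform a I J e s t)\<^sup>2 \<le> (\<Sum>p\<in>?S. (a (fst p) (snd p) * e (fst p) (snd p))\<^sup>2) * (\<Sum>p\<in>?S. (s (fst p) * t (snd p))\<^sup>2)"
  using Cauchy_Schwarz_ineq_sum[of "\<lambda>p. a (fst p) (snd p) * e (fst p) (snd p)" "\<lambda>p. s (fst p) * t (snd p)" ?S] by simp
 also have "... = (\<Sum>i\<in>I. \<Sum>j\<in>J. (a i j * e i j)\<^sup>2) * (sqn I s * sqn J t)"
  by (simp add: sum.cartesian_product sqn_def sum_product power_mult_distrib case_prod_beta)
 also have "... \<le> (\<Sum>i\<in>I. \<Sum>j\<in>J. (a i j * e i j)\<^sup>2) * (1 * 1)"
  using st by (intro mult_left_mono mult_mono sum_nonneg) auto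
 finally show "bform a I J e s t \<le> sqrt (\<Sum>i\<in>I. \<Sum>j\<in>J. (a i j * e i j)\<^sup>2)" by (intro real_le_rsqrt) simp
qed

text \<open>The Hilbert-Schmidt bound holds for every choice of signs; it serves for the first block
  and on exceptional events.\<close>

lemma (in mat) card_opb:
 assumes T: "T \<subseteq> A" and e: "e \<in> sg n"
 shows "opb (sqrt (real (card T))) a T T e"
proof (rule opb_mono[OF frob_opb])
 show "finite T" "finite T" by (rule finite_subset[OF T finA])+
 have "(\<Sum>i\<in>T. \<Sum>j\<in>T. (a i j * e i j)\<^sup>2) \<le> (\<Sum>i\<in>T. 1)"
 proof (rule sum_mono)
  fix i assume i: "i \<in> T"
  have "(\<Sum>j\<in>T. (a i j * e i j)\<^sup>2) = (\<Sum>j\<in>T. (a i j)\<^sup>2)"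
   using sg_sq[OF e] i T A by (intro sum.cong) (auto simp: power_mult_distrib subset_iff)
  also have "... \<le> (\<Sum>j\<in>A. (a i j)\<^sup>2)" by (rule sum_mono2[OF finA T]) auto
  finally show "(\<Sum>j\<in>T. (a i j * e i j)\<^sup>2) \<le> 1" using row[of i] i T by auto
 qed
 then show "sqrt (\<Sum>i\<in>T. \<Sum>j\<in>T. (a i j * e i j)\<^sup>2) \<le> sqrt (real (card T))" by simp
qed

lemma opb_tp:
 assumes I: "I \<subseteq> {1..n}" and o: "opb Z (\<lambda>i j. a j i) I I (tp n e)"
 shows "opb Z a I I e"
 unfolding opb_def
proof (intro allI)
 fix s t
 have "bform a I I e s t = bform (\<lambda>i j. a j i) I I (tp n e) t s"
  unfolding bform_def using I by (subst sum.swap) (auto intro!: sum.cong simp: tp_apply subset_iff)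
 also have "... \<le> Z * sqrt (sqn I t) * sqrt (sqn I s)" using o by (simp add: opb_def)
 finally show "bform a I I e s t \<le> Z * sqrt (sqn I s) * sqrt (sqn I t)" by (simp add: mult_ac)
qed

text \<open>The squared Hilbert-Schmidt norm of the off-diagonal part of the Gram matrix of the
  signed rows.\<close>

definition gram :: "(nat => nat => real) => nat set => (nat => nat => real) => real" where
 "gram y I e = (\<Sum>i\<in>I. \<Sum>i'\<in>I - {i}. (\<Sum>j\<in>I. (y i j * y i' j) * (e i j * e i' j))\<^sup>2)"

text \<open>Expanding the squared norm of \<open>u\<close> gives the Gram matrix. Its diagonal does
  not depend on the signs and is at most 1; off the diagonal, the inequality of arithmetic and
  geometric means separates the vector from the matrix. A bound linear in \<open>gram\<close> is
  wanted, since only the mean of \<open>gram\<close> is known.\<close>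

lemma gram_opb:
 assumes I: "I \<subseteq> {1..n}" and row: "\<And>i. i \<in> I ==> (\<Sum>j\<in>I. (y i j)\<^sup>2) \<le> 1" and e: "e \<in> sg n"
 shows "opb (2 + gram y I e) y I I e"
proof (rule opbI)
 show fI: "finite I" "finite I" using I finite_subset by auto
 fix s t assume st: "sqn I s \<le> 1" "sqn I t \<le> 1"
 define u where "u = (\<lambda>j. \<Sum>i\<in>I. y i j * e i j * s i)"
 define M where "M = (\<lambda>i i'. \<Sum>j\<in>I. (y i j * y i' j) * (e i j * e i' j))"
 have g0: "gram y I e \<ge> 0" unfolding gram_def by (intro sum_nonneg) auto
 have "bform y I I e s t = (\<Sum>j\<in>I. u j * t j)"
  unfolding bform_def u_def sum_distrib_right by (rule sum.swap)
 then have "(bform y I I e s t)\<^sup>2 \<le> (\<Sum>j\<in>I. (u j)\<^sup>2) * sqn I t"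
  using Cauchy_Schwarz_ineq_sum[of u t I] by (simp add: sqn_def)
 also have "... \<le> (\<Sum>j\<in>I. (u j)\<^sup>2) * 1" using st by (intro mult_left_mono sum_nonneg) auto
 also have "... = (\<Sum>j\<in>I. \<Sum>i\<in>I. \<Sum>i'\<in>I. (y i j * e i j * s i) * (y i' j * e i' j * s i'))"
  by (simp add: u_def power2_eq_square sum_product)
 also have "... = (\<Sum>i\<in>I. \<Sum>j\<in>I. \<Sum>i'\<in>I. (y i j * e i j * s i) * (y i' j * e i' j * s i'))" by (rule sum.swap)
 also have "... = (\<Sum>i\<in>I. \<Sum>i'\<in>I. \<Sum>j\<in>I. (y i j * e i j * s i) * (y i' j * e i' j * s i'))" by (intro sum.cong refl sum.swap)
 also have "... = (\<Sum>i\<in>I. \<Sum>i'\<in>I. s i * s i' * M i i')"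
  unfolding M_def sum_distrib_left by (intro sum.cong refl) simp
 also have "... = (\<Sum>i\<in>I. s i * s i * M i i + (\<Sum>i'\<in>I - {i}. s i * s i' * M i i'))"
  by (rule sum.cong[OF refl]) (rule sum.remove[OF fI(1)])
 also have "... \<le> (\<Sum>i\<in>I. (s i)\<^sup>2 + (\<Sum>i'\<in>I - {i}. ((s i)\<^sup>2 * (s i')\<^sup>2 + (M i i')\<^sup>2) / 2))"
 proof (rule sum_mono)
  fix i assume i: "i \<in> I"
  have "M i i = (\<Sum>j\<in>I. (y i j)\<^sup>2)" unfolding M_def
  proof (rule sum.cong[OF refl])
   fix j assume "j \<in> I"
   then have "(e i j)\<^sup>2 = 1" by (intro sg_sq[OF e]) (use i I in blast)+
   then show "(y i j * y i j) * (e i j * e i j) = (y i j)\<^sup>2" by (simp add: power2_eq_square)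
  qed
  then have "M i i \<le> 1" using row[OF i] by simp
  then have "(s i)\<^sup>2 * M i i \<le> (s i)\<^sup>2 * 1" by (intro mult_left_mono) auto
  then have 1: "s i * s i * M i i \<le> (s i)\<^sup>2" by (simp add: power2_eq_square)
  have "s i * s i' * M i i' \<le> ((s i)\<^sup>2 * (s i')\<^sup>2 + (M i i')\<^sup>2) / 2" for i'
   using sum_squares_bound[of "s i * s i'" "M i i'"] by (simp add: power_mult_distrib)
  then have 2: "(\<Sum>i'\<in>I - {i}. s i * s i' * M i i') \<le> (\<Sum>i'\<in>I - {i}. ((s i)\<^sup>2 * (s i')\<^sup>2 + (M i i')\<^sup>2) / 2)" by (intro sum_mono)
  show "s i * s i * M i i + (\<Sum>i'\<in>I - {i}. s i * s i' * M i i') \<le> (s i)\<^sup>2 + (\<Sum>i'\<in>I - {i}. ((s i)\<^sup>2 * (s i')\<^sup>2 + (M i i')\<^sup>2) / 2)"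
   by (rule add_mono[OF 1 2])
 qed
 also have "... = sqn I s + ((\<Sum>i\<in>I. \<Sum>i'\<in>I - {i}. (s i)\<^sup>2 * (s i')\<^sup>2) + gram y I e) / 2"
  by (simp add: sum.distrib sqn_def gram_def M_def flip: sum_divide_distrib)
 also have "(\<Sum>i\<in>I. \<Sum>i'\<in>I - {i}. (s i)\<^sup>2 * (s i')\<^sup>2) \<le> (\<Sum>i\<in>I. \<Sum>i'\<in>I. (s i)\<^sup>2 * (s i')\<^sup>2)"
  using fI by (intro sum_mono sum_mono2) auto
 also have "... = sqn I s * sqn I s" by (simp add: sqn_def sum_product)
 finally have "(bform y I I e s t)\<^sup>2 \<le> sqn I s + (sqn I s * sqn I s + gram y I e) / 2" by simp
 also have "... \<le> 1 + (1 * 1 + gram y I e) / 2"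
  using st by (intro add_mono divide_right_mono mult_mono) auto
 also have "... \<le> (2 + gram y I e) * (2 + gram y I e)"
 proof -
  have "2 * (2 + gram y I e) \<le> (2 + gram y I e) * (2 + gram y I e)" using g0 by (intro mult_right_mono) auto
  moreover have "1 + (1 * 1 + gram y I e) / 2 \<le> 2 * (2 + gram y I e)" using g0 by simp
  ultimately show ?thesis by (rule order_trans[rotated])
 qed
 finally have "(bform y I I e s t)\<^sup>2 \<le> (2 + gram y I e)\<^sup>2" by (simp add: power2_eq_square)
 then show "bform y I I e s t \<le> 2 + gram y I e" by (rule power2_le_imp_le) (use g0 in simp)
qed

lemma second_moment:
 assumes i: "i \<in> {1..n}" "i' \<in> {1..n}" "i \<noteq> i'" and J: "J \<subseteq> {1..n}"
 shows "avg n (\<lambda>e. (\<Sum>j\<in>J. z j * (e i j * e i' j))\<^sup>2) = (\<Sum>j\<in>J. (z j)\<^sup>2)"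
proof -
 have fJ: "finite J" using J finite_subset by blast
 let ?x = "\<lambda>e j. z j * (e i j * e i' j)"
 have *: "avg n (\<lambda>e. ?x e j * ?x e j') = (if j = j' then (z j)\<^sup>2 else 0)" if j: "j \<in> J" "j' \<in> J" for j j'
 proof (cases "j = j'")
  case True
  have "avg n (\<lambda>e. ?x e j * ?x e j) = avg n (\<lambda>e. (z j)\<^sup>2)"
  proof (rule avg_cong)
   fix e assume e: "e \<in> sg n"
   have "(e i j)\<^sup>2 = 1" "(e i' j)\<^sup>2 = 1" using sg_sq[OF e] i j J by auto
   moreover have "?x e j * ?x e j = (z j)\<^sup>2 * ((e i j)\<^sup>2 * (e i' j)\<^sup>2)" by (simp add: power2_eq_square)
   ultimately show "?x e j * ?x e j = (z j)\<^sup>2" by simp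
  qed
  then show ?thesis using True by simp
 next
  case False
  \<comment> \<open>Flipping the single sign at row \<open>i\<close> and column \<open>j\<close>
    reverses the product, so its mean is 0.\<close>
  define c where "c = (\<lambda>a b. a = i \<and> b = j)"
  have ij: "j \<in> {1..n}" "j' \<in> {1..n}" using j J by auto
  have f: "?x (flip n c e) j * ?x (flip n c e) j' = - 1 * (?x e j * ?x e j')" for e
  proof -
   have "flip n c e i j = - e i j" "flip n c e i' j = e i' j" "flip n c e i j' = e i j'" "flip n c e i' j' = e i' j'"
    using i ij False by (simp_all add: flip_def c_def)
   then show ?thesis by simp
  qed
  have "avg n (\<lambda>e. ?x e j * ?x e j') = avg n (\<lambda>e. ?x (flip n c e) j * ?x (flip n c e) j')"
   by (rule avg_flip[symmetric, of n "\<lambda>e. ?x e j * ?x e j'"])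
  also have "... = - 1 * avg n (\<lambda>e. ?x e j * ?x e j')" unfolding f by (rule avg_cmult)
  finally show ?thesis using False by simp
 qed
 have "avg n (\<lambda>e. (\<Sum>j\<in>J. ?x e j)\<^sup>2) = (\<Sum>j\<in>J. \<Sum>j'\<in>J. avg n (\<lambda>e. ?x e j * ?x e j'))"
  unfolding power2_eq_square sum_product avg_sum ..
 also have "... = (\<Sum>j\<in>J. \<Sum>j'\<in>J. if j = j' then (z j)\<^sup>2 else 0)" by (intro sum.cong refl *)
 also have "... = (\<Sum>j\<in>J. (z j)\<^sup>2)" using fJ by simp
 finally show ?thesis .
qed

lemma avg_gram:
 assumes I: "I \<subseteq> {1..n}"
 shows "avg n (gram y I) = (\<Sum>i\<in>I. \<Sum>i'\<in>I - {i}. \<Sum>j\<in>I. (y i j * y i' j)\<^sup>2)"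
proof -
 have "avg n (gram y I) = (\<Sum>i\<in>I. \<Sum>i'\<in>I - {i}. avg n (\<lambda>e. (\<Sum>j\<in>I. (y i j * y i' j) * (e i j * e i' j))\<^sup>2))"
  unfolding gram_def avg_sum ..
 also have "... = (\<Sum>i\<in>I. \<Sum>i'\<in>I - {i}. \<Sum>j\<in>I. (y i j * y i' j)\<^sup>2)"
 proof (rule sum.cong[OF refl], rule sum.cong[OF refl])
  fix i i' assume "i \<in> I" "i' \<in> I - {i}"
  then show "avg n (\<lambda>e. (\<Sum>j\<in>I. (y i j * y i' j) * (e i j * e i' j))\<^sup>2) = (\<Sum>j\<in>I. (y i j * y i' j)\<^sup>2)"
   using I by (intro second_moment I) auto
 qed
 finally show ?thesis .
qed

text \<open>An increasing chain of index sets whose differences are the layers. \<open>csep\<close>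
  and \<open>rsep\<close> say that a column or row outside the next set has almost no mass on the
  current one, which is what decouples layers at distance two or more.\<close>

locale lay = mat n "{1..n}" a for n a +
 fixes Q :: nat and Ih :: "nat => nat set" and NN :: "nat => nat"
 assumes Ih_mono: "\<And>q. Ih q \<subseteq> Ih (Suc q)" and Ih_sub: "\<And>q. Ih q \<subseteq> {1..n}" and Ih_Q: "Ih Q = {1..n}"
  and Ih_card: "\<And>q. card (Ih q) \<le> 2 * NN q" and NN: "\<And>q. 8 * 2 ^ q \<le> NN q"
  and csep: "\<And>j q. j \<in> {1..n} ==> j \<notin> Ih (Suc q) ==> (\<Sum>i\<in>Ih q. (a i j)\<^sup>2) \<le> 1 / (real (NN q))\<^sup>2"
  and rsep: "\<And>i q. i \<in> {1..n} ==> i \<notin> Ih (Suc q) ==> (\<Sum>j\<in>Ih q. (a i j)\<^sup>2) \<le> 1 / (real (NN q))\<^sup>2"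
begin

definition blk :: "nat => nat" where "blk i = (LEAST q. i \<in> Ih q)"
definition T :: "nat => nat set" where "T q = {i\<in>{1..n}. blk i = q \<or> blk i = Suc q}"
definition up :: "nat => nat => bool" where "up i j \<longleftrightarrow> blk i + 2 \<le> blk j"

lemma lay_tp: "lay n (\<lambda>i j. a j i) Q Ih NN"
 using mat_tp Ih_mono Ih_sub Ih_Q Ih_card NN csep rsep by (intro lay.intro lay_axioms.intro) auto

lemma Ih_le: "q \<le> q' ==> Ih q \<subseteq> Ih q'" by (rule lift_Suc_mono_le[of Ih]) (use Ih_mono in auto)

lemma blk_in: "i \<in> {1..n} ==> i \<in> Ih (blk i)" and blk_Q: "i \<in> {1..n} ==> blk i \<le> Q"
 and blk_le: "i \<in> {1..n} ==> i \<in> Ih q \<longleftrightarrow> blk i \<le> q"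
proof -
 assume i: "i \<in> {1..n}"
 then have "i \<in> Ih Q" using Ih_Q by simp
 then show b: "i \<in> Ih (blk i)" and "blk i \<le> Q" unfolding blk_def by (auto intro: LeastI Least_le)
 show "i \<in> Ih q \<longleftrightarrow> blk i \<le> q" using b Ih_le[of "blk i" q] unfolding blk_def by (auto intro: Least_le)
qed

text \<open>By symmetry let \<open>i'\<close> be in the layer of \<open>i\<close> or an earlier one.
  For \<open>up i j\<close> the column \<open>j\<close> is outside \<open>Ih (Suc (blk i))\<close>,
  so \<open>csep\<close> bounds its mass on all such rows by \<open>?c\<close>. A layer has at most
  \<open>2 * NN q\<close> rows and contributes at most \<open>2 / NN q\<close>; these sum to at most
  1/2, and the symmetry doubles this.\<close>

lemma gram_up: "avg n (gram (emask up a) {1..n}) \<le> 1"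
proof -
 let ?y = "emask up a"
 let ?I = "{1..n}"
 have fin: "finite ?I" by simp
 define r where "r = (\<lambda>i i'. \<Sum>j\<in>?I. (?y i j * ?y i' j)\<^sup>2)"
 have r0: "r i i' \<ge> 0" for i i' unfolding r_def by (intro sum_nonneg) auto
 define S where "S = (\<Sum>i\<in>?I. \<Sum>i'\<in>?I. if blk i' \<le> blk i then r i i' else 0)"
 have rs: "r i i' = r i' i" for i i' by (simp add: r_def mult.commute)
 have "avg n (gram ?y ?I) = (\<Sum>i\<in>?I. \<Sum>i'\<in>?I - {i}. r i i')" unfolding r_def by (rule avg_gram) simp
 also have "... \<le> (\<Sum>i\<in>?I. \<Sum>i'\<in>?I. r i i')" by (intro sum_mono sum_mono2) (use r0 in auto)
 also have "... \<le> (\<Sum>i\<in>?I. \<Sum>i'\<in>?I. (if blk i' \<le> blk i then r i i' else 0) + (if blk i \<le> blk i' then r i' i else 0))"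
  by (intro sum_mono) (use r0 rs in auto)
 also have "... = S + (\<Sum>i\<in>?I. \<Sum>i'\<in>?I. if blk i \<le> blk i' then r i' i else 0)" by (simp add: S_def sum.distrib)
 also have "(\<Sum>i\<in>?I. \<Sum>i'\<in>?I. if blk i \<le> blk i' then r i' i else 0) = S" unfolding S_def by (rule sum.swap)
 finally have 1: "avg n (gram ?y ?I) \<le> 2 * S" by simp
 have "S \<le> (\<Sum>i\<in>?I. 1 / (real (NN (blk i)))\<^sup>2)"
  unfolding S_def
 proof (rule sum_mono)
  fix i assume i: "i \<in> ?I"
  let ?c = "1 / (real (NN (blk i)))\<^sup>2"
  have "(\<Sum>i'\<in>?I. if blk i' \<le> blk i then r i i' else 0) = (\<Sum>i'\<in>{i'\<in>?I. blk i' \<le> blk i}. r i i')"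
   by (rule sum.inter_filter[OF fin, symmetric])
  also have "... = (\<Sum>j\<in>?I. \<Sum>i'\<in>{i'\<in>?I. blk i' \<le> blk i}. (?y i j * ?y i' j)\<^sup>2)" unfolding r_def by (rule sum.swap)
  also have "... \<le> (\<Sum>j\<in>?I. (a i j)\<^sup>2 * ?c)"
  proof (rule sum_mono)
   fix j assume j: "j \<in> ?I"
   show "(\<Sum>i'\<in>{i'\<in>?I. blk i' \<le> blk i}. (?y i j * ?y i' j)\<^sup>2) \<le> (a i j)\<^sup>2 * ?c"
   proof (cases "up i j")
    case False
    then show ?thesis by (simp add: emask_def)
   next
    case True
    have eqI: "{i'\<in>?I. blk i' \<le> blk i} = Ih (blk i)"
     using blk_le Ih_sub[of "blk i"] by blast
    have "j \<notin> Ih (Suc (blk i))" using True blk_le[OF j] by (auto simp: up_def)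
    have "(\<Sum>i'\<in>{i'\<in>?I. blk i' \<le> blk i}. (?y i j * ?y i' j)\<^sup>2) = (a i j)\<^sup>2 * (\<Sum>i'\<in>{i'\<in>?I. blk i' \<le> blk i}. (?y i' j)\<^sup>2)"
     using True by (simp add: emask_def power_mult_distrib sum_distrib_left)
    also have "... \<le> (a i j)\<^sup>2 * (\<Sum>i'\<in>{i'\<in>?I. blk i' \<le> blk i}. (a i' j)\<^sup>2)"
     by (intro mult_left_mono sum_mono) (auto simp: emask_def)
    also have "... \<le> (a i j)\<^sup>2 * ?c" unfolding eqI
     by (intro mult_left_mono csep j \<open>j \<notin> Ih (Suc (blk i))\<close>) simp
    finally show ?thesis .
   qed
  qed
  also have "... = (\<Sum>j\<in>?I. (a i j)\<^sup>2) * ?c" by (rule sum_distrib_right[symmetric])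
  also have "... \<le> 1 * ?c" by (intro mult_right_mono row i) auto
  finally show "(\<Sum>i'\<in>?I. if blk i' \<le> blk i then r i i' else 0) \<le> ?c" by simp
 qed
 also have "... = (\<Sum>q\<le>Q. \<Sum>i\<in>{i\<in>?I. blk i = q}. 1 / (real (NN (blk i)))\<^sup>2)"
  by (rule sum.group[symmetric]) (use blk_Q in auto)
 also have "... = (\<Sum>q\<le>Q. real (card {i\<in>?I. blk i = q}) / (real (NN q))\<^sup>2)" by (intro sum.cong refl) simp
 also have "... \<le> (\<Sum>q\<le>Q. (1/4) * (1/2) ^ q)"
 proof (rule sum_mono)
  fix q
  have N8: "8 * 2 ^ q \<le> real (NN q)" using NN[of q] by (metis of_nat_le_iff of_nat_mult of_nat_numeral of_nat_power)
  have Np: "real (NN q) > 0" using N8 by (smt (verit) zero_less_power)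
  have "{i\<in>?I. blk i = q} \<subseteq> Ih q" using blk_in by auto
  then have "card {i\<in>?I. blk i = q} \<le> card (Ih q)"
   by (rule card_mono[rotated]) (rule finite_subset[OF Ih_sub], simp)
  also have "... \<le> 2 * NN q" by (rule Ih_card)
  finally have "real (card {i\<in>?I. blk i = q}) \<le> 2 * real (NN q)" by (metis of_nat_le_iff of_nat_mult of_nat_numeral)
  then have "real (card {i\<in>?I. blk i = q}) / (real (NN q))\<^sup>2 \<le> 2 * real (NN q) / (real (NN q))\<^sup>2" by (intro divide_right_mono) auto
  also have "... = 2 / real (NN q)" using Np by (simp add: power2_eq_square)
  also have "... \<le> 2 / (8 * 2 ^ q)" using N8 Np by (intro divide_left_mono mult_pos_pos) simp_all
  also have "... = (1/4) * (1/2) ^ q" by (simp add: power_divide)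
  finally show "real (card {i\<in>?I. blk i = q}) / (real (NN q))\<^sup>2 \<le> (1/4) * (1/2) ^ q" .
 qed
 also have "... \<le> 1 / 2"
  unfolding sum_distrib_left[symmetric] using half_sum[of Q] by linarith
 finally show ?thesis using 1 by simp
qed

text \<open>Labels coincide only within a pair of neighbouring layers. \<open>near_opb\<close> uses
  it for equal layers and for both orders of adjacent ones.\<close>

lemma near_one:
 assumes B: "B \<ge> 0" "\<And>q. opb B a (T q) (T q) e" and fg: "\<And>c. \<exists>q. {i\<in>{1..n}. f i = c} \<subseteq> T q \<and> {j\<in>{1..n}. g j = c} \<subseteq> T q"
  and st: "sqn {1..n} s \<le> 1" "sqn {1..n} t \<le> 1"
 shows "\<bar>\<Sum>i\<in>{1..n}. \<Sum>j\<in>{1..n}. if f i = (g j :: nat) then a i j * e i j * s i * t j else 0\<bar> \<le> B"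
proof -
 let ?I = "{1..n}"
 let ?x = "\<lambda>i j. if f i = g j then a i j * e i j * s i * t j else 0"
 have fT: "finite (T q)" for q by (rule finite_subset[of _ ?I]) (auto simp: T_def)
 have e1: "(\<Sum>i\<in>?I. \<Sum>j\<in>?I. ?x i j) = (\<Sum>c\<in>f ` ?I. \<Sum>i\<in>{i\<in>?I. f i = c}. \<Sum>j\<in>{j\<in>?I. g j = c}. ?x i j)"
  by (rule sum_labelled) (auto split: if_splits)
 have "\<bar>\<Sum>c\<in>f ` ?I. \<Sum>i\<in>{i\<in>?I. f i = c}. \<Sum>j\<in>{j\<in>?I. g j = c}. ?x i j\<bar> \<le> B / 2 * ((\<Sum>i\<in>?I. (s i)\<^sup>2) + (\<Sum>j\<in>{j\<in>?I. g j \<in> f ` ?I}. (t j)\<^sup>2))"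
 proof (rule block_bound)
  fix c
  obtain q where q: "{i\<in>?I. f i = c} \<subseteq> T q" "{j\<in>?I. g j = c} \<subseteq> T q" using fg by blast
  have "(\<Sum>i\<in>{i\<in>?I. f i = c}. \<Sum>j\<in>{j\<in>?I. g j = c}. ?x i j) = bform a {i\<in>?I. f i = c} {j\<in>?I. g j = c} e s t"
   unfolding bform_def by (intro sum.cong refl) auto
  then show "\<bar>\<Sum>i\<in>{i\<in>?I. f i = c}. \<Sum>j\<in>{j\<in>?I. g j = c}. ?x i j\<bar> \<le> B * sqrt (\<Sum>i\<in>{i\<in>?I. f i = c}. (s i)\<^sup>2) * sqrt (\<Sum>j\<in>{j\<in>?I. g j = c}. (t j)\<^sup>2)"
   using opb_abs[OF B(2) fT fT q, where s = s and t = t] by (simp add: sqn_def)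
 qed (use B in auto)
 also have "... \<le> B / 2 * (1 + 1)"
 proof (intro mult_left_mono add_mono)
  have "(\<Sum>j\<in>{j\<in>?I. g j \<in> f ` ?I}. (t j)\<^sup>2) \<le> (\<Sum>j\<in>?I. (t j)\<^sup>2)" by (rule sum_mono2) auto
  then show "(\<Sum>j\<in>{j\<in>?I. g j \<in> f ` ?I}. (t j)\<^sup>2) \<le> 1" using st by (simp add: sqn_def)
 qed (use st B in \<open>auto simp: sqn_def\<close>)
 finally show ?thesis unfolding e1 by simp
qed

lemma near_opb:
 assumes B: "B \<ge> 0" "\<And>q. opb B a (T q) (T q) e"
 shows "opb (3 * B) (emask (\<lambda>i j. \<not> up i j \<and> \<not> up j i) a) {1..n} {1..n} e"
proof (rule opbI)
 fix s t assume st: "sqn {1..n} s \<le> 1" "sqn {1..n} t \<le> 1"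
 let ?N = "\<lambda>f g. \<Sum>i\<in>{1..n}. \<Sum>j\<in>{1..n}. if f i = (g j :: nat) then a i j * e i j * s i * t j else 0"
 have "bform (emask (\<lambda>i j. \<not> up i j \<and> \<not> up j i) a) {1..n} {1..n} e s t = (\<Sum>i\<in>{1..n}. \<Sum>j\<in>{1..n}.
   (if blk i = blk j then a i j * e i j * s i * t j else 0) + (if Suc (blk i) = blk j then a i j * e i j * s i * t j else 0)
   + (if blk i = Suc (blk j) then a i j * e i j * s i * t j else 0))"
  unfolding bform_def by (rule sum.cong[OF refl], rule sum.cong[OF refl]) (auto simp: emask_def up_def)
 also have "... = ?N blk blk + ?N (\<lambda>i. Suc (blk i)) blk + ?N blk (\<lambda>j. Suc (blk j))"
  by (simp only: sum.distrib)
 finally have 0: "bform (emask (\<lambda>i j. \<not> up i j \<and> \<not> up j i) a) {1..n} {1..n} e s t = ?N blk blk + ?N (\<lambda>i. Suc (blk i)) blk + ?N blk (\<lambda>j. Suc (blk j))" .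
 have 1: "\<bar>?N blk blk\<bar> \<le> B"
 proof (rule near_one[OF B _ st])
  show "\<exists>q. {i\<in>{1..n}. blk i = c} \<subseteq> T q \<and> {j\<in>{1..n}. blk j = c} \<subseteq> T q" for c
   by (rule exI[of _ c]) (auto simp: T_def)
 qed
 have 2: "\<bar>?N (\<lambda>i. Suc (blk i)) blk\<bar> \<le> B"
 proof (rule near_one[OF B _ st])
  show "\<exists>q. {i\<in>{1..n}. Suc (blk i) = c} \<subseteq> T q \<and> {j\<in>{1..n}. blk j = c} \<subseteq> T q" for c
   by (rule exI[of _ "c - 1"]) (cases c; auto simp: T_def)
 qed
 have 3: "\<bar>?N blk (\<lambda>j. Suc (blk j))\<bar> \<le> B"
 proof (rule near_one[OF B _ st])
  show "\<exists>q. {i\<in>{1..n}. blk i = c} \<subseteq> T q \<and> {j\<in>{1..n}. Suc (blk j) = c} \<subseteq> T q" for c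
   by (rule exI[of _ "c - 1"]) (cases c; auto simp: T_def)
 qed
 show "bform (emask (\<lambda>i j. \<not> up i j \<and> \<not> up j i) a) {1..n} {1..n} e s t \<le> 3 * B" using 0 1 2 3 by linarith
qed auto

lemma lay_opb:
 assumes e: "e \<in> sg n" and B: "B \<ge> 0" "\<And>q. opb B a (T q) (T q) e"
 shows "opb (3 * B + (2 + gram (emask up a) {1..n} e) + (2 + gram (emask up (\<lambda>i j. a j i)) {1..n} (tp n e))) a {1..n} {1..n} e"
proof (rule opb_add3)
 show "opb (3 * B) (emask (\<lambda>i j. \<not> up i j \<and> \<not> up j i) a) {1..n} {1..n} e" by (rule near_opb[OF B])
 interpret m1: mat n "{1..n}" "emask up a" by (rule mat_mask[OF mat_axioms])
 show "opb (2 + gram (emask up a) {1..n} e) (emask up a) {1..n} {1..n} e"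
  by (rule gram_opb[OF order_refl _ e]) (rule m1.row)
 interpret m2: mat n "{1..n}" "emask up (\<lambda>i j. a j i)" by (rule mat_mask[OF mat_tp])
 have "opb (2 + gram (emask up (\<lambda>i j. a j i)) {1..n} (tp n e)) (emask up (\<lambda>i j. a j i)) {1..n} {1..n} (tp n e)"
  by (rule gram_opb[OF order_refl]) (rule m2.row, assumption, rule tp_in[OF e])
 then have "opb (2 + gram (emask up (\<lambda>i j. a j i)) {1..n} (tp n e)) (\<lambda>i j. emask (\<lambda>i j. up j i) a j i) {1..n} {1..n} (tp n e)"
  by (simp only: emask_def[abs_def])
 then show "opb (2 + gram (emask up (\<lambda>i j. a j i)) {1..n} (tp n e)) (emask (\<lambda>i j. up j i) a) {1..n} {1..n} e"
  by (rule opb_tp[OF order_refl])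
qed (auto simp: emask_def up_def)

lemma op_norm_le:
 assumes "Z \<ge> 0" "opb Z a {1..n} {1..n} e"
 shows "op_norm n (\<lambda>i j. a i j * e i j) \<le> Z"
 unfolding op_norm_def
proof (rule cSUP_least)
 show "unit_ball n \<times> unit_ball n \<noteq> {}" by (auto simp: unit_ball_def L2_set_def intro!: exI[of _ "\<lambda>_. 0"])
 fix p assume "p \<in> unit_ball n \<times> unit_ball n"
 then obtain s t where p: "p = (s, t)" "sqrt (sqn {1..n} s) \<le> 1" "sqrt (sqn {1..n} t) \<le> 1"
  by (auto simp: unit_ball_def L2_set_def sqn_def)
 have "bform a {1..n} {1..n} e s t \<le> Z * sqrt (sqn {1..n} s) * sqrt (sqn {1..n} t)" using assms by (simp add: opb_def)
 also have "... \<le> Z * 1 * 1" using p assms by (intro mult_mono) auto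
 finally show "(case p of (s, t) => \<Sum>i\<in>{1..n}. \<Sum>j\<in>{1..n}. a i j * e i j * s i * t j) \<le> Z"
  by (simp add: p bform_def)
qed

theorem lay_avg:
 assumes B: "B \<ge> 0" and bad: "\<And>q. pr n (\<lambda>e. \<not> opb B a (T q) (T q) e) * sqrt (real (card (T q))) \<le> (1/2) ^ q"
 shows "avg n (\<lambda>e. op_norm n (\<lambda>i j. a i j * e i j)) \<le> 3 * B + 12"
proof -
 interpret t: lay n "\<lambda>i j. a j i" Q Ih NN by (rule lay_tp)
 \<comment> \<open>\<open>B\<close> plus the trivial bound for every bad block: a valid norm bound
   for all signs, with mean at most \<open>B + 2\<close>. The total is then 3 * (B + 2) + 3 +
   3.\<close>
 define D where "D = (\<lambda>e. B + (\<Sum>q\<le>Q. sqrt (real (card (T q))) * of_bool (\<not> opb B a (T q) (T q) e)))"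
 have DB: "D e \<ge> B" for e unfolding D_def by (simp add: sum_nonneg)
 have opD: "opb (D e) a (T q) (T q) e" if e: "e \<in> sg n" for q e
 proof (cases "q \<le> Q")
  case True
  show ?thesis
  proof (cases "opb B a (T q) (T q) e")
   case True
   then show ?thesis using DB by (rule opb_mono)
  next
   case False
   have "sqrt (real (card (T q))) * of_bool (\<not> opb B a (T q) (T q) e) \<le> (\<Sum>q\<le>Q. sqrt (real (card (T q))) * of_bool (\<not> opb B a (T q) (T q) e))"
    using \<open>q \<le> Q\<close> by (intro member_le_sum) auto
   then have "sqrt (real (card (T q))) \<le> D e" using False B by (simp add: D_def)
   moreover have "opb (sqrt (real (card (T q)))) a (T q) (T q) e" by (rule card_opb[OF _ e]) (auto simp: T_def)
   ultimately show ?thesis using opb_mono by blast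
  qed
 next
  case False
  then have "T q = {}" using blk_Q by (fastforce simp: T_def)
  then show ?thesis by (simp add: opb_def bform_def sqn_def)
 qed
 let ?g = "gram (emask up a) {1..n}" and ?g' = "gram (emask up (\<lambda>i j. a j i)) {1..n}"
 have g0: "gram y I e \<ge> 0" for y I e unfolding gram_def by (intro sum_nonneg) auto
 have "avg n (\<lambda>e. op_norm n (\<lambda>i j. a i j * e i j)) \<le> avg n (\<lambda>e. 3 * D e + (2 + ?g e) + (2 + ?g' (tp n e)))"
 proof (rule avg_mono, rule op_norm_le)
  fix e assume e: "e \<in> sg n"
  have D0: "D e \<ge> 0" using DB[of e] B by linarith
  show "opb (3 * D e + (2 + ?g e) + (2 + ?g' (tp n e))) a {1..n} {1..n} e" by (rule lay_opb[OF e D0 opD[OF e]])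
  show "0 \<le> 3 * D e + (2 + ?g e) + (2 + ?g' (tp n e))" using D0 g0[of "emask up a" "{1..n}" e] g0[of "emask up (\<lambda>i j. a j i)" "{1..n}" "tp n e"] by linarith
 qed
 also have "... = 3 * avg n D + (2 + avg n ?g) + (2 + avg n (\<lambda>e. ?g' (tp n e)))"
  by (simp only: avg_add avg_cmult avg_const)
 finally have 1: "avg n (\<lambda>e. op_norm n (\<lambda>i j. a i j * e i j)) \<le> 3 * avg n D + (2 + avg n ?g) + (2 + avg n (\<lambda>e. ?g' (tp n e)))" .
 have 2: "avg n (\<lambda>e. ?g' (tp n e)) = avg n ?g'" by (rule avg_tp)
 have 3: "avg n ?g' \<le> 1" by (rule t.gram_up)
 have 4: "avg n ?g \<le> 1" by (rule gram_up)
 have 5: "avg n D \<le> B + 2"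
 proof -
  have "avg n D = B + (\<Sum>q\<le>Q. sqrt (real (card (T q))) * pr n (\<lambda>e. \<not> opb B a (T q) (T q) e))"
   unfolding D_def pr_def avg_add avg_const avg_sum avg_cmult ..
  also have "... \<le> B + (\<Sum>q\<le>Q. (1/2) ^ q)"
   using bad by (intro add_left_mono sum_mono) (simp add: mult.commute)
  also have "(\<Sum>q\<le>Q. (1/2::real) ^ q) \<le> 2" by (rule half_sum)
  finally show ?thesis by simp
 qed
 show ?thesis using 1 2 3 4 5 by linarith
qed

end

section \<open>Construction of the layers\<close>

lemma mom_subset:
 assumes fin: "finite A" and sub: "B \<subseteq> A" and m: "mom n A a p R"
 shows "mom n B a p R"
 unfolding mom_def
proof (intro allI)
 fix s t
 have "avg n (\<lambda>e. \<bar>bform a A A e (\<lambda>i. if i \<in> B then s i else 0) (\<lambda>j. if j \<in> B then t j else 0)\<bar> powr p)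
  \<le> (R * sqrt (sqn A (\<lambda>i. if i \<in> B then s i else 0)) * sqrt (sqn A (\<lambda>j. if j \<in> B then t j else 0))) powr p"
  using m unfolding mom_def by blast
 then show "avg n (\<lambda>e. \<bar>bform a B B e s t\<bar> powr p) \<le> (R * sqrt (sqn B s) * sqrt (sqn B t)) powr p"
  unfolding bform_sub[OF fin sub sub, symmetric] sqn_ext[OF fin sub] .
qed

lemma mat_subset: "mat n A a ==> B \<subseteq> A ==> mat n B a"
proof -
 assume "mat n A a" and sub: "B \<subseteq> A"
 then interpret mat n A a by simp
 show ?thesis
 proof
  show "B \<subseteq> {1..n}" using sub A by blast
  fix i assume i: "i \<in> B"
  have "(\<Sum>j\<in>B. (a i j)\<^sup>2) \<le> (\<Sum>j\<in>A. (a i j)\<^sup>2)" by (rule sum_mono2[OF finA sub]) auto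
  then show "(\<Sum>j\<in>B. (a i j)\<^sup>2) \<le> 1" using row[of i] i sub by auto
  have "(\<Sum>j\<in>B. (a j i)\<^sup>2) \<le> (\<Sum>j\<in>A. (a j i)\<^sup>2)" by (rule sum_mono2[OF finA sub]) auto
  then show "(\<Sum>j\<in>B. (a j i)\<^sup>2) \<le> 1" using col[of i] i sub by auto
 qed
qed

lemma (in mat) heavy_card:
 assumes S: "S \<subseteq> A" and theta: "\<theta> > 0"
 shows "real (card {j\<in>A. (\<Sum>i\<in>S. (a i j)\<^sup>2) > 1 / \<theta>}) \<le> real (card S) * \<theta>"
proof -
 let ?H = "{j\<in>A. (\<Sum>i\<in>S. (a i j)\<^sup>2) > 1 / \<theta>}"
 have "real (card ?H) * (1 / \<theta>) = (\<Sum>j\<in>?H. 1 / \<theta>)" by simp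
 also have "... \<le> (\<Sum>j\<in>?H. \<Sum>i\<in>S. (a i j)\<^sup>2)" by (rule sum_mono) auto
 also have "... \<le> (\<Sum>j\<in>A. \<Sum>i\<in>S. (a i j)\<^sup>2)" by (rule sum_mono2[OF finA]) (auto intro: sum_nonneg)
 also have "... = (\<Sum>i\<in>S. \<Sum>j\<in>A. (a i j)\<^sup>2)" by (rule sum.swap)
 also have "... \<le> (\<Sum>i\<in>S. 1)" by (rule sum_mono) (use row S in auto)
 finally show ?thesis using theta by (simp add: divide_le_eq)
qed

definition lll :: "nat => real" where "lll n = Log (Log (Log (real n)))"

lemma Log_ge_1: "Log x \<ge> 1"
proof -
 have "ln (exp 1) \<le> ln (max x (exp 1))" by (intro ln_mono) auto
 then show ?thesis by (simp add: Log_def)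
qed

lemma Log_ln: "x \<ge> exp 1 ==> Log x = ln x" by (simp add: Log_def max_def)

text \<open>From \<open>N0\<close> on the third iterated logarithm is at least 50, as
  \<open>nums\<close> requires; smaller sizes are left to the trivial bound.\<close>

locale layers = mat n "{1..n}" a for n a +
 fixes N0 :: nat and I :: "nat => nat set" and R :: real
 assumes N0: "real N0 \<ge> exp (exp (exp 50))" and R: "R > 0"
  and I: "\<And>k. N0 \<le> k ==> k \<le> n ==> I k \<subseteq> {1..n} \<and> card (I k) \<le> k \<and> mom n ({1..n} - I k) a (ln (real k)) R"
begin

lemma e50: "exp (50::real) \<ge> 51" "exp (exp (50::real)) \<ge> 52" "exp (exp (exp (50::real))) \<ge> 53"
 using exp_ge_add_one_self[of "50::real"] exp_ge_add_one_self[of "exp 50::real"] exp_ge_add_one_self[of "exp (exp 50)::real"] by linarith+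

lemma N0_8: "N0 \<ge> 8" using N0 e50 by linarith

text \<open>The fourth power leaves room for the completion: at most \<open>2 * N ^ 3\<close> heavy
  columns and as many heavy rows, with \<open>N = NN q\<close>, besides the chosen set of size at
  most \<open>N ^ 4\<close>.\<close>

definition NN :: "nat => nat" where "NN q = N0 ^ (4 ^ q)"

lemma NN_Suc: "NN (Suc q) = NN q ^ 4" by (simp add: NN_def mult.commute flip: power_mult)
lemma NN_0: "NN 0 = N0" by (simp add: NN_def)

lemma NN_ge: "8 * 2 ^ q \<le> NN q \<and> N0 \<le> NN q"
proof (induction q)
 case (Suc q)
 have n8: "8 \<le> NN q" using Suc N0_8 by linarith
 have "NN q * 2 \<le> NN q * NN q ^ 3"
 proof (rule mult_left_mono)
  have "8 ^ 3 \<le> NN q ^ 3" using n8 by (intro power_mono) auto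
  then show "2 \<le> NN q ^ 3" by simp
 qed simp
 then have "2 * NN q \<le> NN (Suc q)" by (simp add: NN_Suc power_Suc[symmetric] numeral_eq_Suc mult.commute)
 then show ?case using Suc by simp
qed (use N0_8 NN_0 in auto)

text \<open>Adding every column and row with squared mass above \<open>1 / (NN q)\<^sup>2\<close> on
  the current set enforces \<open>csep\<close> and \<open>rsep\<close>. Once the size reaches
  \<open>n\<close>, the set is everything.\<close>

fun Ih :: "nat => nat set" where
 "Ih 0 = (if n \<le> NN 0 then {1..n} else I (NN 0))"
| "Ih (Suc q) = (if n \<le> NN (Suc q) then {1..n} else Ih q \<union> I (NN (Suc q)) \<union>
   {j\<in>{1..n}. (\<Sum>i\<in>Ih q. (a i j)\<^sup>2) > 1 / (real (NN q))\<^sup>2} \<union> {i\<in>{1..n}. (\<Sum>j\<in>Ih q. (a i j)\<^sup>2) > 1 / (real (NN q))\<^sup>2})"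

lemma I_NN: "\<not> n \<le> NN q ==> I (NN q) \<subseteq> {1..n} \<and> card (I (NN q)) \<le> NN q \<and> mom n ({1..n} - I (NN q)) a (ln (real (NN q))) R"
 using I[of "NN q"] NN_ge[of q] by auto

lemma Ih_sub: "Ih q \<subseteq> {1..n}"
proof (induction q)
 case (Suc q)
 then show ?case using I_NN[of "Suc q"] by (auto simp del: One_nat_def)
qed (use I_NN[of 0] in auto)

lemma I_Ih: "\<not> n \<le> NN q ==> I (NN q) \<subseteq> Ih q" by (cases q) auto

lemma Ih_full: "n \<le> NN q ==> Ih q = {1..n}" by (cases q) auto

lemma Ih_card: "card (Ih q) \<le> 2 * NN q"
proof (induction q)
 case 0
 then show ?case using I_NN[of 0] by auto
next
 case (Suc q)
 show ?case
 proof (cases "n \<le> NN (Suc q)")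
  case True
  then show ?thesis by (simp add: Ih_full)
 next
  case False
  interpret T: mat n "{1..n}" "\<lambda>i j. a j i" by (rule mat_tp)
  let ?N = "real (NN q)"
  have N8: "?N \<ge> 8" using NN_ge[of q] N0_8 by linarith
  let ?H = "{j\<in>{1..n}. (\<Sum>i\<in>Ih q. (a i j)\<^sup>2) > 1 / ?N\<^sup>2}" and ?H' = "{i\<in>{1..n}. (\<Sum>j\<in>Ih q. (a i j)\<^sup>2) > 1 / ?N\<^sup>2}"
  have cS: "real (card (Ih q)) \<le> 2 * ?N" using Suc by (metis of_nat_le_iff of_nat_mult of_nat_numeral)
  have h: "real (card ?H) \<le> real (card (Ih q)) * ?N\<^sup>2" "real (card ?H') \<le> real (card (Ih q)) * ?N\<^sup>2"
   using heavy_card[OF Ih_sub, of "?N\<^sup>2" q] T.heavy_card[OF Ih_sub, of "?N\<^sup>2" q] N8 by auto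
  have c3: "real (card (Ih q)) * ?N\<^sup>2 \<le> 2 * ?N * ?N\<^sup>2" by (rule mult_right_mono[OF cS]) simp
  have "card (Ih (Suc q)) \<le> card (Ih q) + card (I (NN (Suc q))) + card ?H + card ?H'"
   using False by (simp only: Ih.simps if_False) (intro order_trans[OF card_Un_le add_mono] order_refl)
  also have "card (I (NN (Suc q))) \<le> NN (Suc q)" using I_NN[OF False] by simp
  finally have "card (Ih (Suc q)) \<le> card (Ih q) + NN (Suc q) + card ?H + card ?H'" by simp
  then have "real (card (Ih (Suc q))) \<le> real (card (Ih q)) + real (NN (Suc q)) + real (card ?H) + real (card ?H')"
   by (simp flip: of_nat_add del: Ih.simps)
  also have "... \<le> 2 * ?N + ?N ^ 4 + 2 * ?N * ?N\<^sup>2 + 2 * ?N * ?N\<^sup>2"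
   using cS h c3 by (simp add: NN_Suc del: Ih.simps)
  also have "... = 2 * ?N + 4 * ?N ^ 3 + ?N ^ 4" by (simp add: power2_eq_square power3_eq_cube)
  also have "... \<le> 2 * ?N ^ 4"
  proof -
   have a1: "8 * ?N ^ 3 \<le> ?N * ?N ^ 3" using N8 by (intro mult_right_mono) auto
   have "8\<^sup>2 \<le> ?N\<^sup>2" using N8 by (intro power_mono) auto
   then have "64 * ?N \<le> ?N\<^sup>2 * ?N" by (intro mult_right_mono) auto
   then have a2: "64 * ?N \<le> ?N ^ 3" by (simp add: power2_eq_square power3_eq_cube)
   have "?N * ?N ^ 3 = ?N ^ 4" by (simp add: power_Suc[symmetric] numeral_eq_Suc)
   then show ?thesis using a1 a2 N8 by linarith
  qed
  finally have "real (card (Ih (Suc q))) \<le> real (2 * NN (Suc q))" by (simp add: NN_Suc del: Ih.simps)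
  then show ?thesis by (simp only: of_nat_le_iff)
 qed
qed

text \<open>So many layers exhaust the indices, since \<open>NN n > n\<close>.\<close>

definition Q :: nat where "Q = n"

lemma lay: "lay n a Q Ih NN"
proof (unfold_locales)
 show "Ih q \<subseteq> Ih (Suc q)" for q
 proof (cases "n \<le> NN (Suc q)")
  case True
  then show ?thesis using Ih_sub[of q] Ih_full[OF True] by blast
 qed auto
 show "Ih Q = {1..n}"
 proof (rule Ih_full)
  have "n < 2 ^ n" by (rule less_exp)
  also have "... \<le> NN n" using NN_ge[of n] by linarith
  finally show "n \<le> NN Q" by (simp add: Q_def)
 qed
 show "(\<Sum>i\<in>Ih q. (a i j)\<^sup>2) \<le> 1 / (real (NN q))\<^sup>2" if "j \<in> {1..n}" "j \<notin> Ih (Suc q)" for j q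
  using that by (cases "n \<le> NN (Suc q)") (auto simp: not_less simp del: One_nat_def)
 show "(\<Sum>j\<in>Ih q. (a i j)\<^sup>2) \<le> 1 / (real (NN q))\<^sup>2" if "i \<in> {1..n}" "i \<notin> Ih (Suc q)" for i q
  using that by (cases "n \<le> NN (Suc q)") (auto simp: not_less simp del: One_nat_def)
qed (use Ih_sub Ih_card NN_ge in auto)

text \<open>The block \<open>T (q + 1)\<close> lies in \<open>Ih (q + 2)\<close> and has at most
  \<open>2 * NN q ^ 16\<close> indices, while its moment order is the logarithm of
  \<open>NN q\<close>; the exponent 16 and the factor 2 give 17. Since \<open>NN q < n\<close>,
  passing from \<open>n\<close> to \<open>N\<close> at most doubles the third logarithm.\<close>

lemma nums_ex:
 assumes q: "\<not> n \<le> NN q"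
 defines "N \<equiv> 2 * real (NN (q + 2))"
 shows "nums N (ln N) (ln (ln N)) (ln (ln (ln N)))" "ln N \<le> 17 * ln (real (NN q))" "ln (ln (ln N)) \<le> 2 * lll n"
proof -
 define M where "M = real (NN q)"
 have "real N0 \<le> M" using NN_ge[of q] by (simp add: M_def)
 then have M: "M \<ge> exp (exp (exp 50))" using N0 by linarith
 have Mp: "M > 0" using M by (meson exp_gt_zero less_le_trans)
 have NM: "N = 2 * M ^ 16" by (simp add: N_def M_def NN_Suc flip: power_mult)
 have MN: "M \<le> N"
 proof -
  have "M * 1 \<le> M * M ^ 15" using M e50 by (intro mult_left_mono one_le_power) linarith+
  also have "... = M ^ 16" by (simp add: power_Suc[symmetric] numeral_eq_Suc)
  finally show ?thesis using Mp by (simp add: NM)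
 qed
 have x: "ln M \<ge> exp (exp 50)" using M Mp by (simp add: ln_ge_iff)
 have lN0: "ln N \<ge> exp (exp 50)" using x MN Mp by (meson ln_mono less_le_trans order_trans)
 then have lN: "ln N > 0" by (meson exp_gt_zero less_le_trans)
 have llN0: "ln (ln N) \<ge> exp 50" using lN0 lN by (simp add: ln_ge_iff)
 then have llN: "ln (ln N) > 0" by (meson exp_gt_zero less_le_trans)
 have lllN: "ln (ln (ln N)) \<ge> 50" using llN0 llN by (simp add: ln_ge_iff)
 have N: "N > 0" using MN Mp by linarith
 show "nums N (ln N) (ln (ln N)) (ln (ln (ln N)))" by unfold_locales (use N lN llN lllN in auto)
 have "ln N = ln 2 + 16 * ln M" using Mp by (simp add: NM ln_mult ln_realpow)
 moreover have "ln 2 \<le> ln M" using M e50 by (subst ln_le_cancel_iff) linarith+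
 ultimately show 17: "ln N \<le> 17 * ln (real (NN q))" by (simp add: M_def)
 define x where "x = ln (real n)"
 have nM: "M \<le> real n" using q by (simp add: M_def)
 have xM: "ln M \<le> x" unfolding x_def using nM Mp by simp
 have x0: "x \<ge> exp (exp 50)" using x xM by linarith
 have x17: "x \<ge> 17" using x0 e50 by linarith
 have lx0: "ln x \<ge> exp 50" using x0 x17 by (simp add: ln_ge_iff)
 have lx2: "ln x \<ge> 2" using lx0 e50 by linarith
 have "ln N \<le> 17 * x" using 17 xM by (simp add: M_def)
 also have "... \<le> x * x" using x17 by (intro mult_right_mono) auto
 finally have "ln (ln N) \<le> ln (x * x)" using lN x17 by (intro ln_mono) auto
 also have "... = 2 * ln x" using x17 by (simp add: ln_mult)
 also have "... \<le> ln x * ln x" using lx2 by (intro mult_right_mono) auto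
 finally have "ln (ln (ln N)) \<le> ln (ln x * ln x)" using llN lx2 by (intro ln_mono) auto
 also have "... = 2 * ln (ln x)" using lx2 by (simp add: ln_mult)
 also have "ln (ln x) = lll n"
 proof -
  have e1: "exp (1::real) \<le> 3" by (rule exp_le)
  have "Log (real n) = x" unfolding x_def by (rule Log_ln) (use nM M e50 e1 in linarith)
  moreover have "Log x = ln x" by (rule Log_ln) (use x17 e1 in linarith)
  moreover have "Log (ln x) = ln (ln x)" by (rule Log_ln) (use lx0 e50 e1 in linarith)
  ultimately show ?thesis by (simp add: lll_def)
 qed
 finally show "ln (ln (ln N)) \<le> 2 * lll n" .
qed

theorem layers_avg:
 "avg n (\<lambda>e. op_norm n (\<lambda>i j. a i j * e i j)) \<le> 3 * (sqrt (real (2 * NN 1)) + exp 1011 * (2 * lll n) * (1 + R)) + 12"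
proof -
 interpret lay n a Q Ih NN by (rule lay)
 define B where "B = sqrt (real (2 * NN 1)) + exp 1011 * (2 * lll n) * (1 + R)"
 have l1: "lll n \<ge> 1" unfolding lll_def by (rule Log_ge_1)
 have B2: "exp 1011 * (2 * lll n) * (1 + R) \<ge> 0" using l1 R by (intro mult_nonneg_nonneg) auto
 have B: "B \<ge> 0" "B \<ge> sqrt (real (2 * NN 1))" "B \<ge> exp 1011 * (2 * lll n) * (1 + R)" using B2 by (auto simp: B_def)
 show ?thesis unfolding B_def[symmetric]
 proof (rule lay_avg[OF B(1)])
  fix q
  show "pr n (\<lambda>e. \<not> opb B a (T q) (T q) e) * sqrt (real (card (T q))) \<le> (1/2) ^ q"
  proof (cases q)
   case 0
   \<comment> \<open>The first block has bounded size, so the trivial bound suffices and no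
     exceptional event arises.\<close>
   have Ts: "T 0 \<subseteq> Ih 1" using blk_le by (auto simp: T_def simp del: One_nat_def Ih.simps)
   have "card (T 0) \<le> card (Ih 1)" by (rule card_mono[OF finite_subset[OF Ih_sub] Ts]) simp
   also have "... \<le> 2 * NN 1" by (rule Ih_card)
   finally have c: "sqrt (real (card (T 0))) \<le> B" using B(2) by (meson of_nat_mono order_trans real_sqrt_le_mono)
   have "pr n (\<lambda>e. \<not> opb B a (T q) (T q) e) \<le> pr n (\<lambda>_. False)"
   proof (rule pr_mono)
    fix e assume e: "e \<in> sg n" and no: "\<not> opb B a (T q) (T q) e"
    have "opb (sqrt (real (card (T 0)))) a (T 0) (T 0) e" by (rule card_opb[OF _ e]) (auto simp: T_def)
    then show False using opb_mono[OF _ c] no 0 by blast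
   qed
   then have "pr n (\<lambda>e. \<not> opb B a (T q) (T q) e) = 0" using pr_nonneg[of n "\<lambda>e. \<not> opb B a (T q) (T q) e"] by (simp add: pr_def)
   then show ?thesis by simp
  next
   case (Suc q')
   \<comment> \<open>The block avoids \<open>Ih q'\<close> and hence the set
     \<open>I (NN q')\<close>; this is where its weak moments of order \<open>ln (NN q')\<close>
     come from.\<close>
   have Ts: "T q \<subseteq> {1..n}" "T q \<subseteq> Ih (q' + 2)" "T q \<inter> Ih q' = {}"
    using blk_le by (auto simp: T_def Suc simp del: One_nat_def Ih.simps)
   show ?thesis
   proof (cases "n \<le> NN q'")
    case True
    then have "T q = {}" using Ts Ih_full[OF True] by blast
    then show ?thesis by simp
   next
    case False
    define N where "N = 2 * real (NN (q' + 2))"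
    note nx = nums_ex[OF False, folded N_def]
    interpret nums N "ln N" "ln (ln N)" "ln (ln (ln N))" by (rule nx(1))
    have "card (T q) \<le> card (Ih (q' + 2))" by (rule card_mono[OF finite_subset[OF Ih_sub] Ts(2)]) simp
    also have "... \<le> 2 * NN (q' + 2)" by (rule Ih_card)
    finally have cT: "real (card (T q)) \<le> N" unfolding N_def by (metis of_nat_le_iff of_nat_mult of_nat_numeral)
    have mo: "mom n (T q) a (ln (real (NN q'))) R"
    proof (rule mom_subset)
     show "mom n ({1..n} - I (NN q')) a (ln (real (NN q'))) R" using I_NN[OF False] by blast
     show "T q \<subseteq> {1..n} - I (NN q')" using Ts I_Ih[OF False] by blast
    qed simp
    have "pr n (\<lambda>e. \<not> opb (exp 1011 * ln (ln (ln N)) * (1 + R)) a (T q) (T q) e) \<le> 28 * exp (- 4 * ln N)"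
     by (rule core_bound[OF mat_subset[OF mat_axioms Ts(1)] nx(1) cT mo R nx(2)])
    moreover have "pr n (\<lambda>e. \<not> opb B a (T q) (T q) e) \<le> pr n (\<lambda>e. \<not> opb (exp 1011 * ln (ln (ln N)) * (1 + R)) a (T q) (T q) e)"
    proof (rule pr_mono)
     fix e assume no: "\<not> opb B a (T q) (T q) e"
     have "exp 1011 * ln (ln (ln N)) * (1 + R) \<le> exp 1011 * (2 * lll n) * (1 + R)"
      using nx(3) R by (intro mult_right_mono mult_left_mono) auto
     then have "exp 1011 * ln (ln (ln N)) * (1 + R) \<le> B" using B(3) by linarith
     then show "\<not> opb (exp 1011 * ln (ln (ln N)) * (1 + R)) a (T q) (T q) e" using opb_mono no by blast
    qed
    ultimately have p: "pr n (\<lambda>e. \<not> opb B a (T q) (T q) e) \<le> 28 * exp (- 4 * ln N)" by linarith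
    have eN: "exp (ln N) = N" using N_pos by simp
    have N1: "N \<ge> 1" using four_P P_big eN by linarith
    have "sqrt (real (card (T q))) \<le> N"
    proof (rule real_le_lsqrt)
     have "N * 1 \<le> N * N" using N1 by (intro mult_left_mono) auto
     then show "real (card (T q)) \<le> N\<^sup>2" using cT by (simp add: power2_eq_square)
    qed (use N1 in auto)
    then have "pr n (\<lambda>e. \<not> opb B a (T q) (T q) e) * sqrt (real (card (T q))) \<le> 28 * exp (- 4 * ln N) * exp (ln N)"
     using p pr_nonneg unfolding eN by (intro mult_mono) auto
    also have "... = 28 * exp (- 2 * ln N) * exp (- ln N)" by (simp add: mult_exp_exp)
    also have "... \<le> 1 * exp (- ln N)"
    proof (rule mult_right_mono)
     have "28 \<le> exp (2 * ln N)" using exp_ge_add_one_self[of "2 * ln N"] P_big by linarith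
     then show "28 * exp (- 2 * ln N) \<le> 1" by (simp add: exp_minus field_simps)
    qed simp
    also have "... = 1 / N" using eN by (simp add: exp_minus inverse_eq_divide)
    also have "... \<le> 1 / 2 ^ q"
    proof (rule divide_left_mono)
     have "8 * 2 ^ (q' + 2) \<le> NN (q' + 2)" using NN_ge by blast
     then have "2 ^ q \<le> 2 * NN (q' + 2)" by (simp add: Suc)
     then show "2 ^ q \<le> N" unfolding N_def by (metis of_nat_le_iff of_nat_mult of_nat_numeral of_nat_power)
    qed (use N_pos in auto)
    also have "... = (1/2) ^ q" by (simp add: power_divide)
    finally show ?thesis .
   qed
  qed
 qed
qed

end

subsection \<open>Rademacher families\<close>

lemma card_sg: "real (card (sg n)) = 2 ^ (n * n)"
proof -
 have "card (rsig n) = 2 ^ n" unfolding rsig_def by (subst card_PiE) (auto simp: card_insert_if numeral_2_eq_2)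
 then have "card (sg n) = (2 ^ n) ^ n" unfolding sg_def by (subst card_PiE) auto
 then show ?thesis by (simp add: power_mult)
qed

text \<open>By independence the events \<open>D e\<close>, that the signs equal \<open>e\<close> on
  the square, have equal probability; they are disjoint and exhaust the space up to a null set, so
  the integrand is almost everywhere a simple function.\<close>

lemma rade_avg:
 assumes rf: "rademacher_family M \<epsilon>" and g: "\<And>e e'. (\<And>i j. i \<in> {1..n} ==> j \<in> {1..n} ==> e i j = e' i j) ==> g e = g e'"
  and meas: "(\<lambda>\<omega>. g (\<lambda>i j. \<epsilon> i j \<omega>)) \<in> borel_measurable M"
 shows "(\<integral>\<omega>. g (\<lambda>i j. \<epsilon> i j \<omega>) \<partial>M) = avg n g"
proof (cases "n = 0")
 case True
 interpret prob_space M using rf by (simp add: rademacher_family_def)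
 have s: "sg n = {\<lambda>_. undefined}" using True by (simp add: sg_def)
 have "g (\<lambda>i j. \<epsilon> i j \<omega>) = g (\<lambda>_. undefined)" for \<omega> by (rule g) (use True in auto)
 then show ?thesis by (simp add: avg_def s prob_space)
next
 case False
 interpret prob_space M using rf by (simp add: rademacher_family_def)
 let ?I = "{1..n} \<times> {1..n}"
 let ?X = "\<lambda>p. \<epsilon> (fst p) (snd p)"
 have ind: "indep_vars (\<lambda>_. borel) ?X ({1..} \<times> {1..})"
  using rf by (simp add: rademacher_family_def case_prod_beta')
 have half: "prob {\<omega>\<in>space M. \<epsilon> i j \<omega> = v} = 1/2" if "i \<ge> 1" "j \<ge> 1" "v = -1 \<or> v = 1" for i j v
  using rf that by (auto simp: rademacher_family_def)
 define D where "D = (\<lambda>e. \<Inter>p\<in>?I. ?X p -` {e (fst p) (snd p)} \<inter> space M)"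
 have rv: "?X p \<in> borel_measurable M" if "p \<in> ?I" for p
  using ind that by (auto simp: indep_vars_def2)
 have sets: "D e \<in> events" for e
  unfolding D_def using False rv by (intro sets.finite_INT measurable_sets[OF rv]) auto
 have D: "\<omega> \<in> D e \<longleftrightarrow> \<omega> \<in> space M \<and> (\<forall>i\<in>{1..n}. \<forall>j\<in>{1..n}. \<epsilon> i j \<omega> = e i j)" for e \<omega>
  using False by (auto simp: D_def)
 have pD: "prob (D e) = 1 / real (card (sg n))" if e: "e \<in> sg n" for e
 proof -
  have "prob (D e) = (\<Prod>p\<in>?I. prob (?X p -` {e (fst p) (snd p)} \<inter> space M))"
   unfolding D_def by (rule indep_varsD[OF ind]) (use False in auto)
  also have "... = (\<Prod>p\<in>?I. 1/2)"
  proof (rule prod.cong[OF refl])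
   fix p assume p: "p \<in> ?I"
   have "?X p -` {e (fst p) (snd p)} \<inter> space M = {\<omega>\<in>space M. \<epsilon> (fst p) (snd p) \<omega> = e (fst p) (snd p)}" by auto
   then show "prob (?X p -` {e (fst p) (snd p)} \<inter> space M) = 1/2" using half sg_sign[OF e] p by auto
  qed
  also have "... = 1 / real (card (sg n))" by (simp add: card_cartesian_product card_sg power_one_over)
  finally show ?thesis .
 qed
 have dis: "disjoint_family_on D (sg n)"
  unfolding disjoint_family_on_def
 proof (intro ballI impI)
  fix e e' assume e: "e \<in> sg n" "e' \<in> sg n" "e \<noteq> e'"
  show "D e \<inter> D e' = {}"
  proof (rule ccontr)
   assume "D e \<inter> D e' \<noteq> {}"
   then obtain \<omega> where "\<omega> \<in> D e" "\<omega> \<in> D e'" by blast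
   then have "e i j = e' i j" if "i \<in> {1..n}" "j \<in> {1..n}" for i j using that unfolding D by metis
   then show False using sg_eqI[OF e(1,2)] e(3) by blast
  qed
 qed
 have "prob (\<Union>e\<in>sg n. D e) = (\<Sum>e\<in>sg n. prob (D e))"
  by (rule finite_measure_finite_Union) (use dis sets in auto)
 also have "... = 1" using pD sg_ne[of n] by simp
 finally have "AE \<omega> in M. \<omega> \<in> (\<Union>e\<in>sg n. D e)" by (rule AE_prob_1)
 then have "AE \<omega> in M. g (\<lambda>i j. \<epsilon> i j \<omega>) = (\<Sum>e\<in>sg n. g e * indicator (D e) \<omega>)"
 proof (rule AE_mp, intro AE_I2 impI)
  fix \<omega> assume "\<omega> \<in> (\<Union>e\<in>sg n. D e)"
  then obtain e where e: "e \<in> sg n" "\<omega> \<in> D e" by blast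
  have "(\<Sum>e'\<in>sg n. g e' * indicator (D e') \<omega>) = (\<Sum>e'\<in>sg n. if e' = e then g e else 0)"
  proof (rule sum.cong[OF refl])
   fix e' assume e': "e' \<in> sg n"
   show "g e' * indicator (D e') \<omega> = (if e' = e then g e else 0)"
    using e dis e' by (cases "e' = e") (auto simp: disjoint_family_on_def indicator_def)
  qed
  also have "... = g e" using e by simp
  also have "... = g (\<lambda>i j. \<epsilon> i j \<omega>)" by (rule g) (use e in \<open>simp add: D\<close>)
  finally show "g (\<lambda>i j. \<epsilon> i j \<omega>) = (\<Sum>e\<in>sg n. g e * indicator (D e) \<omega>)" by simp
 qed
 then have "(\<integral>\<omega>. g (\<lambda>i j. \<epsilon> i j \<omega>) \<partial>M) = (\<integral>\<omega>. (\<Sum>e\<in>sg n. g e * indicator (D e) \<omega>) \<partial>M)"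
  by (intro integral_cong_AE meas) (use sets in measurable)
 also have "... = (\<Sum>e\<in>sg n. g e * prob (D e))"
  using sets by (subst Bochner_Integration.integral_sum) (auto simp: integrable_real_mult_indicator emeasure_eq_measure)
 also have "... = avg n g" by (simp add: pD avg_def sum_divide_distrib)
 finally show ?thesis .
qed

lemma unit_ball_sqn: "s \<in> unit_ball n \<longleftrightarrow> sqn {1..n} s \<le> 1"
 by (simp add: unit_ball_def L2_set_def sqn_def)

lemma unit_ball_0: "(\<lambda>_. 0) \<in> unit_ball n" by (simp add: unit_ball_sqn sqn_def)

lemma unit_ball_abs: "s \<in> unit_ball n ==> i \<in> {1..n} ==> \<bar>s i\<bar> \<le> 1"
proof -
 assume s: "s \<in> unit_ball n" and i: "i \<in> {1..n}"
 have "(s i)\<^sup>2 \<le> sqn {1..n} s" unfolding sqn_def by (rule member_le_sum[OF i]) auto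
 then have "(s i)\<^sup>2 \<le> 1" using s by (simp add: unit_ball_sqn)
 then show ?thesis by (simp add: abs_square_le_1)
qed

lemma op_norm_bdd: "bdd_above ((\<lambda>p. case p of (s, t) => \<Sum>i\<in>{1..n}. \<Sum>j\<in>{1..n}. B i j * s i * t j) ` (unit_ball n \<times> unit_ball n))"
proof (rule bdd_aboveI2)
 fix p assume "p \<in> unit_ball n \<times> unit_ball n"
 then obtain s t where p: "p = (s, t)" "s \<in> unit_ball n" "t \<in> unit_ball n" by auto
 have "(\<Sum>i\<in>{1..n}. \<Sum>j\<in>{1..n}. B i j * s i * t j) \<le> (\<Sum>i\<in>{1..n}. \<Sum>j\<in>{1..n}. \<bar>B i j\<bar>)"
 proof (rule sum_mono, rule sum_mono)
  fix i j assume "i \<in> {1..n}" "j \<in> {1..n}"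
  then have "\<bar>s i\<bar> * \<bar>t j\<bar> \<le> 1 * 1" using unit_ball_abs p by (intro mult_mono) auto
  then have "\<bar>B i j\<bar> * (\<bar>s i\<bar> * \<bar>t j\<bar>) \<le> \<bar>B i j\<bar> * 1" by (intro mult_left_mono) auto
  moreover have "B i j * s i * t j \<le> \<bar>B i j\<bar> * (\<bar>s i\<bar> * \<bar>t j\<bar>)" by (metis abs_ge_self abs_mult mult.assoc)
  ultimately show "B i j * s i * t j \<le> \<bar>B i j\<bar>" by linarith
 qed
 then show "(case p of (s, t) => \<Sum>i\<in>{1..n}. \<Sum>j\<in>{1..n}. B i j * s i * t j) \<le> (\<Sum>i\<in>{1..n}. \<Sum>j\<in>{1..n}. \<bar>B i j\<bar>)" by (simp add: p)
qed

lemma op_norm_scale: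
 assumes c: "c \<ge> 0" and B: "\<And>i j. i \<in> {1..n} ==> j \<in> {1..n} ==> B i j = c * B' i j"
 shows "op_norm n B \<le> c * op_norm n B'"
 unfolding op_norm_def[of n B]
proof (rule cSUP_least)
 show "unit_ball n \<times> unit_ball n \<noteq> {}" using unit_ball_0 by auto
 fix p assume p: "p \<in> unit_ball n \<times> unit_ball n"
 have "(case p of (s, t) => \<Sum>i\<in>{1..n}. \<Sum>j\<in>{1..n}. B i j * s i * t j) = c * (case p of (s, t) => \<Sum>i\<in>{1..n}. \<Sum>j\<in>{1..n}. B' i j * s i * t j)"
  by (cases p) (simp add: B sum_distrib_left mult_ac del: atLeastAtMost_iff One_nat_def)
 also have "... \<le> c * op_norm n B'"
  unfolding op_norm_def by (intro mult_left_mono cSUP_upper[OF p] op_norm_bdd c)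
 finally show "(case p of (s, t) => \<Sum>i\<in>{1..n}. \<Sum>j\<in>{1..n}. B i j * s i * t j) \<le> c * op_norm n B'" .
qed

lemma Lp_bform:
 assumes rf: "rademacher_family M \<epsilon>" and J: "J \<subseteq> {1..n}"
 shows "Lp_norm M p (\<lambda>\<omega>. \<Sum>i\<in>J. \<Sum>j\<in>J. a i j * \<epsilon> i j \<omega> * s i * t j) = (avg n (\<lambda>e. \<bar>bform a J J e s t\<bar> powr p)) powr (1 / p)"
proof -
 interpret prob_space M using rf by (simp add: rademacher_family_def)
 have rv: "\<epsilon> i j \<in> borel_measurable M" if "i \<in> J" "j \<in> J" for i j
 proof -
  have "indep_vars (\<lambda>_. borel) (\<lambda>p. \<epsilon> (fst p) (snd p)) ({1..} \<times> {1..})"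
   using rf by (simp add: rademacher_family_def case_prod_beta')
  then have "(\<lambda>p. \<epsilon> (fst p) (snd p)) (i, j) \<in> borel_measurable M"
   unfolding indep_vars_def2 using that J by (auto simp del: One_nat_def simp: subset_iff)
  then show ?thesis by simp
 qed
 have "(\<integral>\<omega>. \<bar>bform a J J (\<lambda>i j. \<epsilon> i j \<omega>) s t\<bar> powr p \<partial>M) = avg n (\<lambda>e. \<bar>bform a J J e s t\<bar> powr p)"
 proof (rule rade_avg[OF rf])
  fix e e' :: "nat => nat => real" assume "\<And>i j. i \<in> {1..n} ==> j \<in> {1..n} ==> e i j = e' i j"
  then have "bform a J J e s t = bform a J J e' s t" unfolding bform_def by (intro sum.cong refl) (metis J subsetD)
  then show "\<bar>bform a J J e s t\<bar> powr p = \<bar>bform a J J e' s t\<bar> powr p" by simp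
 next
  show "(\<lambda>\<omega>. \<bar>bform a J J (\<lambda>i j. \<epsilon> i j \<omega>) s t\<bar> powr p) \<in> borel_measurable M"
   unfolding bform_def by (intro powr_real_measurable borel_measurable_abs borel_measurable_sum borel_measurable_times borel_measurable_const rv)
 qed
 then show ?thesis by (simp add: Lp_norm_def bform_def)
qed

lemma mom_weak:
 assumes rf: "rademacher_family M \<epsilon>" and J: "J \<subseteq> {1..n}" and p: "p \<ge> 1"
 shows "mom n J a p (weak_moment M \<epsilon> n a J p)" "weak_moment M \<epsilon> n a J p \<ge> 0"
proof -
 define F where "F = (\<lambda>s t. (avg n (\<lambda>e. \<bar>bform a J J e s t\<bar> powr p)) powr (1 / p))"
 define W where "W = weak_moment M \<epsilon> n a J p"
 have W: "W = (SUP (s, t) \<in> unit_ball n \<times> unit_ball n. F s t)"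
  unfolding W_def weak_moment_def Lp_bform[OF rf J] F_def ..
 have finJ: "finite J" using J finite_subset by blast
 define K where "K = (\<Sum>i\<in>J. \<Sum>j\<in>J. \<bar>a i j\<bar>)"
 have K0: "K \<ge> 0" unfolding K_def by (intro sum_nonneg) auto
 \<comment> \<open>A real supremum bounds its members only when the set is bounded above; the crude
   bound \<open>K\<close> settles this.\<close>
 have bdd: "bdd_above ((\<lambda>(s, t). F s t) ` (unit_ball n \<times> unit_ball n))"
 proof (rule bdd_aboveI2)
  fix q assume "q \<in> unit_ball n \<times> unit_ball n"
  then obtain s t where q: "q = (s, t)" "s \<in> unit_ball n" "t \<in> unit_ball n" by auto
  have "\<bar>bform a J J e s t\<bar> \<le> K" if e: "e \<in> sg n" for e
   unfolding bform_def K_def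
  proof (rule order_trans[OF sum_abs], rule sum_mono, rule order_trans[OF sum_abs], rule sum_mono)
   fix i j assume ij: "i \<in> J" "j \<in> J"
   then have m: "i \<in> {1..n}" "j \<in> {1..n}" using J by auto
   have "\<bar>s i\<bar> * \<bar>t j\<bar> \<le> 1 * 1" using unit_ball_abs q m by (intro mult_mono) auto
   then have "\<bar>a i j\<bar> * (\<bar>s i\<bar> * \<bar>t j\<bar>) \<le> \<bar>a i j\<bar> * 1" by (intro mult_left_mono) auto
   then show "\<bar>a i j * e i j * s i * t j\<bar> \<le> \<bar>a i j\<bar>" using sg_abs[OF e m] by (simp add: abs_mult mult.assoc)
  qed
  then have "avg n (\<lambda>e. \<bar>bform a J J e s t\<bar> powr p) \<le> avg n (\<lambda>e. K powr p)" using p by (intro avg_mono powr_mono2) auto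
  then have "F s t \<le> (K powr p) powr (1 / p)" unfolding F_def using p by (intro powr_mono2 avg_nonneg) auto
  also have "... = K" using K0 p by (simp add: powr_powr)
  finally show "(case q of (s, t) => F s t) \<le> K" by (simp add: q)
 qed
 have FW: "F s t \<le> W" if "s \<in> unit_ball n" "t \<in> unit_ball n" for s t
  unfolding W using cSUP_upper[OF _ bdd, of "(s, t)"] that by simp
 have F0: "F s t \<ge> 0" for s t by (simp add: F_def)
 show W0: "weak_moment M \<epsilon> n a J p \<ge> 0" using order_trans[OF F0 FW[OF unit_ball_0 unit_ball_0]] by (simp add: W_def)
 have FWp: "avg n (\<lambda>e. \<bar>bform a J J e s t\<bar> powr p) \<le> W powr p" if "s \<in> unit_ball n" "t \<in> unit_ball n" for s t
 proof -
  have "(F s t) powr p \<le> W powr p" using FW[OF that] F0 p by (intro powr_mono2) auto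
  moreover have "(F s t) powr p = avg n (\<lambda>e. \<bar>bform a J J e s t\<bar> powr p)"
   using p by (simp add: F_def powr_powr) (simp add: avg_nonneg)
  ultimately show ?thesis by simp
 qed
 show "mom n J a p (weak_moment M \<epsilon> n a J p)"
  unfolding mom_def W_def[symmetric]
 proof (intro allI)
  fix s t
  show "avg n (\<lambda>e. \<bar>bform a J J e s t\<bar> powr p) \<le> (W * sqrt (sqn J s) * sqrt (sqn J t)) powr p"
  proof (cases "sqn J s = 0 \<or> sqn J t = 0")
   case True
   then have "(\<forall>i\<in>J. s i = 0) \<or> (\<forall>j\<in>J. t j = 0)" using finJ by (auto simp: sqn_def sum_nonneg_eq_0_iff)
   then have "bform a J J e s t = 0" for e by (auto simp: bform_def)
   then show ?thesis by simp
  next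
   case False
   define x y where "x = sqrt (sqn J s)" and "y = sqrt (sqn J t)"
   have xy: "x > 0" "y > 0" "x\<^sup>2 = sqn J s" "y\<^sup>2 = sqn J t"
    using False sqn_nonneg[of J s] sqn_nonneg[of J t] by (auto simp: x_def y_def less_le)
   define s' where "s' = (\<lambda>i. if i \<in> J then s i / x else 0)"
   define t' where "t' = (\<lambda>i. if i \<in> J then t i / y else 0)"
   have nrm: "(\<lambda>i. if i \<in> J then v i / z else 0) \<in> unit_ball n" if "z > 0" "z\<^sup>2 = sqn J v" for v z
   proof -
    have "sqn {1..n} (\<lambda>i. if i \<in> J then v i / z else 0) = sqn J (\<lambda>i. v i / z)" by (rule sqn_ext[OF _ J]) simp
    also have "... = sqn J v / z\<^sup>2" by (simp add: sqn_def power_divide sum_divide_distrib)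
    also have "... = 1" using that by (simp flip: that(2))
    finally show ?thesis by (simp add: unit_ball_sqn)
   qed
   have b: "bform a J J e s t = x * y * bform a J J e s' t'" for e
    unfolding bform_def sum_distrib_left using xy by (intro sum.cong refl) (simp add: s'_def t'_def)
   have "avg n (\<lambda>e. \<bar>bform a J J e s t\<bar> powr p) = (x * y) powr p * avg n (\<lambda>e. \<bar>bform a J J e s' t'\<bar> powr p)"
    unfolding b avg_cmult[symmetric] using xy by (simp add: abs_mult powr_mult)
   also have "... \<le> (x * y) powr p * W powr p"
    by (intro mult_left_mono FWp) (use nrm xy in \<open>auto simp: s'_def t'_def\<close>)
   also have "... = (W * x * y) powr p" using xy W0 by (simp add: powr_mult W_def)
   finally show ?thesis by (simp add: x_def y_def)
  qed
 qed
qed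

lemma powr_convex_nonneg:
 assumes r: "r \<ge> 1" shows "convex_on {0..} (\<lambda>x. x powr r)"
proof (rule convex_onI)
 fix t x y :: real assume t: "0 < t" "t < 1" and xy: "x \<in> {0..}" "y \<in> {0..}"
 have z: "(u * v) powr r \<le> u * v powr r" if "0 < u" "u < 1" "v \<ge> 0" for u v :: real
 proof -
  have "u powr r \<le> u powr 1" using that r by (intro powr_mono') auto
  then show ?thesis using that by (simp add: powr_mult mult_right_mono)
 qed
 consider "x > 0" "y > 0" | "x = 0" | "y = 0" using xy by fastforce
 then show "((1 - t) *\<^sub>R x + t *\<^sub>R y) powr r \<le> (1 - t) * x powr r + t * y powr r"
 proof cases
  case 1
  then show ?thesis using convex_onD[OF powr_convex[OF r], of t x y] t by simp
 qed (use z[of t y] z[of "1 - t" x] t xy r in auto)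
qed simp

text \<open>Jensen's inequality for the exponent \<open>q / p\<close>: a bound for the moment of
  order \<open>q\<close> passes to every smaller order.\<close>

lemma power_mean:
 assumes pq: "0 < p" "p \<le> q" and f: "\<And>e. f e \<ge> 0" and K: "K \<ge> 0" and le: "avg n (\<lambda>e. f e powr q) \<le> K powr q"
 shows "avg n (\<lambda>e. f e powr p) \<le> K powr p"
proof -
 have r: "q / p \<ge> 1" using pq by simp
 define m where "m = real (card (sg n))"
 have m: "m > 0" using card_sg_pos[of n] by (simp add: m_def)
 define G where "G = avg n (\<lambda>e. f e powr p)"
 have G0: "G \<ge> 0" unfolding G_def by (rule avg_nonneg) simp
 have "(\<Sum>e\<in>sg n. (1 / m) *\<^sub>R (f e powr p)) powr (q / p) \<le> (\<Sum>e\<in>sg n. (1 / m) * (f e powr p) powr (q / p))"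
  by (rule convex_on_sum[OF _ _ powr_convex_nonneg[OF r]]) (use m sg_ne in \<open>auto simp: m_def\<close>)
 then have "G powr (q / p) \<le> avg n (\<lambda>e. (f e powr p) powr (q / p))"
  by (simp add: G_def avg_def m_def sum_divide_distrib)
 also have "... = avg n (\<lambda>e. f e powr q)" using pq by (simp add: powr_powr)
 also have "... \<le> K powr q" by (rule le)
 also have "... = (K powr p) powr (q / p)" using pq by (simp add: powr_powr)
 finally have le': "G powr (q / p) \<le> (K powr p) powr (q / p)" .
 have "\<not> K powr p < G" using powr_less_mono2[of "q / p" "K powr p" G] le' r by fastforce
 then show ?thesis by (simp add: G_def)
qed

lemma mom_le:
 assumes m: "mom n A a q R" and p: "0 < p" "p \<le> q" and R: "0 \<le> R" "R \<le> R'"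
 shows "mom n A a p R'"
 unfolding mom_def
proof (intro allI)
 fix s t
 have "avg n (\<lambda>e. \<bar>bform a A A e s t\<bar> powr p) \<le> (R * sqrt (sqn A s) * sqrt (sqn A t)) powr p"
  by (rule power_mean[OF p]) (use m R in \<open>auto simp: mom_def\<close>)
 also have "... \<le> (R' * sqrt (sqn A s) * sqrt (sqn A t)) powr p" using R p by (intro powr_mono2 mult_right_mono) auto
 finally show "avg n (\<lambda>e. \<bar>bform a A A e s t\<bar> powr p) \<le> (R' * sqrt (sqn A s) * sqrt (sqn A t)) powr p" .
qed

lemma mom_divide:
 assumes m: "mom n A a p R" and c: "c > 0"
 shows "mom n A (\<lambda>i j. a i j / c) p (R / c)"
 unfolding mom_def
proof (intro allI)
 fix s t
 have b: "bform (\<lambda>i j. a i j / c) A A e s t = bform a A A e (\<lambda>i. s i / c) t" for e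
  unfolding bform_def by (intro sum.cong refl) simp
 have n: "sqrt (sqn A (\<lambda>i. s i / c)) = sqrt (sqn A s) / c"
  using c by (simp add: sqn_def power_divide real_sqrt_divide flip: sum_divide_distrib)
 have "avg n (\<lambda>e. \<bar>bform a A A e (\<lambda>i. s i / c) t\<bar> powr p) \<le> (R * sqrt (sqn A (\<lambda>i. s i / c)) * sqrt (sqn A t)) powr p"
  using m unfolding mom_def by blast
 then show "avg n (\<lambda>e. \<bar>bform (\<lambda>i j. a i j / c) A A e s t\<bar> powr p) \<le> (R / c * sqrt (sqn A s) * sqrt (sqn A t)) powr p"
  unfolding b n by simp
qed

lemma row_le_max:
 assumes "i \<in> {1..n}"
 shows "(\<Sum>j\<in>{1..n}. (a i j)\<^sup>2) \<le> (max_row_norm n a)\<^sup>2"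
proof -
 have "L2_set (\<lambda>j. a i j) {1..n} \<le> max_row_norm n a" unfolding max_row_norm_def by (rule Max_ge) (use assms in auto)
 then have "(L2_set (\<lambda>j. a i j) {1..n})\<^sup>2 \<le> (max_row_norm n a)\<^sup>2" by (intro power_mono) auto
 then show ?thesis by (simp add: L2_set_def sum_nonneg)
qed

lemma col_le_max: "j \<in> {1..n} ==> (\<Sum>i\<in>{1..n}. (a i j)\<^sup>2) \<le> (max_col_norm n a)\<^sup>2"
 using row_le_max[of j n "\<lambda>i j. a j i"] by (simp add: max_row_norm_def max_col_norm_def)

lemma max_row_nonneg: "n \<ge> 1 ==> max_row_norm n a \<ge> 0"
proof -
 assume n: "n \<ge> 1"
 have "0 \<le> L2_set (\<lambda>j. a 1 j) {1..n}" by simp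
 also have "... \<le> max_row_norm n a" unfolding max_row_norm_def by (rule Max_ge) (use n in auto)
 finally show ?thesis .
qed

lemma max_col_nonneg: "n \<ge> 1 ==> max_col_norm n a \<ge> 0"
 using max_row_nonneg[of n "\<lambda>i j. a j i"] by (simp add: max_row_norm_def max_col_norm_def)

section \<open>Normalisation, and the two inequalities\<close>

definition N0 :: nat where "N0 = nat \<lceil>exp (exp (exp (50 :: real)))\<rceil>"

lemma N0_ge: "real N0 \<ge> exp (exp (exp 50))" unfolding N0_def by linarith

text \<open>The terms come from \<open>layers_avg\<close>: the first block with
  \<open>NN 1 = N0 ^ 4\<close>, the main term with 3 * 2 * 2 = 12 after
  \<open>1 + R \<le> 2 * R\<close>, and the additive 12.\<close>

definition CC :: real where "CC = 3 * sqrt (2 * real N0 ^ 4) + 12 * exp 1011 + 12"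

lemma CC_pos: "CC > 0"
 unfolding CC_def by (intro add_pos_pos add_nonneg_pos) auto

theorem avg_bound:
 assumes n: "n \<ge> 1" and Wn: "W \<ge> 0"
  and I: "\<And>k. N0 \<le> k ==> k \<le> n ==> \<exists>I. I \<subseteq> {1..n} \<and> card I \<le> k \<and> mom n ({1..n} - I) a (ln (real k)) W"
 shows "avg n (\<lambda>e. op_norm n (\<lambda>i j. a i j * e i j)) \<le> CC * lll n * (max_row_norm n a + max_col_norm n a + W)"
proof -
 define c where "c = max_row_norm n a + max_col_norm n a"
 have nn: "max_row_norm n a \<ge> 0" "max_col_norm n a \<ge> 0" by (rule max_row_nonneg[OF n], rule max_col_nonneg[OF n])
 then have c0: "c \<ge> 0" by (simp add: c_def)
 have rc: "(\<Sum>j\<in>{1..n}. (a i j)\<^sup>2) \<le> c\<^sup>2" "(\<Sum>j\<in>{1..n}. (a j i)\<^sup>2) \<le> c\<^sup>2" if i: "i \<in> {1..n}" for i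
 proof -
  have "(max_row_norm n a)\<^sup>2 \<le> c\<^sup>2" "(max_col_norm n a)\<^sup>2 \<le> c\<^sup>2" using nn by (auto simp: c_def intro!: power_mono)
  then show "(\<Sum>j\<in>{1..n}. (a i j)\<^sup>2) \<le> c\<^sup>2" "(\<Sum>j\<in>{1..n}. (a j i)\<^sup>2) \<le> c\<^sup>2"
   using row_le_max[OF i, of a] col_le_max[OF i, of a] by linarith+
 qed
 have l1: "lll n \<ge> 1" unfolding lll_def by (rule Log_ge_1)
 show ?thesis
 proof (cases "c = 0")
  case True
  have "a i j = 0" if ij: "i \<in> {1..n}" "j \<in> {1..n}" for i j
  proof -
   have "(a i j)\<^sup>2 \<le> (\<Sum>j\<in>{1..n}. (a i j)\<^sup>2)" by (rule member_le_sum[OF ij(2)]) auto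
   also have "... \<le> 0" using rc(1)[OF ij(1)] True by simp
   finally show ?thesis by simp
  qed
  then have "op_norm n (\<lambda>i j. a i j * e i j) \<le> 0 * op_norm n (\<lambda>_ _. 0)" for e
   by (intro op_norm_scale) (auto simp del: One_nat_def)
  then have "avg n (\<lambda>e. op_norm n (\<lambda>i j. a i j * e i j)) \<le> avg n (\<lambda>_. 0)" by (intro avg_mono) simp
  also have "... \<le> CC * lll n * (c + W)" using CC_pos l1 c0 Wn by (simp add: mult_nonneg_nonneg)
  finally show ?thesis by (simp add: c_def)
 next
  case False
  then have cp: "c > 0" using c0 by simp
  define b where "b = (\<lambda>i j. a i j / c)"
  \<comment> \<open>The summand 1 makes \<open>R \<ge> 1\<close>, so that additive constants are
    absorbed, and gives \<open>c * R = c + W\<close> after undoing the normalisation by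
    \<open>c\<close>.\<close>
  define R where "R = 1 + W / c"
  have R: "R > 0" using Wn cp by (simp add: R_def add_pos_nonneg)
  have "\<forall>k. \<exists>I. N0 \<le> k \<longrightarrow> k \<le> n \<longrightarrow> I \<subseteq> {1..n} \<and> card I \<le> k \<and> mom n ({1..n} - I) b (ln (real k)) R"
  proof
   fix k
   show "\<exists>I. N0 \<le> k \<longrightarrow> k \<le> n \<longrightarrow> I \<subseteq> {1..n} \<and> card I \<le> k \<and> mom n ({1..n} - I) b (ln (real k)) R"
   proof (cases "N0 \<le> k \<and> k \<le> n")
    case True
    then obtain I where I': "I \<subseteq> {1..n}" "card I \<le> k" "mom n ({1..n} - I) a (ln (real k)) W" using I by blast
    have k1: "real k > 1"
    proof -
     have "real N0 > 1" using N0_ge exp_ge_add_one_self[of "exp (exp 50) :: real"] exp_gt_zero[of "exp 50 :: real"] by linarith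
     then show ?thesis using True by linarith
    qed
    then have "ln (real k) > 0" by simp
    then have "mom n ({1..n} - I) b (ln (real k)) R"
     unfolding b_def by (rule mom_le[OF mom_divide[OF I'(3) cp]]) (use Wn cp in \<open>auto simp: R_def\<close>)
    then show ?thesis using I' by blast
   qed auto
  qed
  then obtain If where If: "\<forall>k. N0 \<le> k \<longrightarrow> k \<le> n \<longrightarrow> If k \<subseteq> {1..n} \<and> card (If k) \<le> k \<and> mom n ({1..n} - If k) b (ln (real k)) R"
   by metis
  interpret L: layers n b N0 If R
  proof
   fix i assume i: "i \<in> {1..n}"
   show "(\<Sum>j\<in>{1..n}. (b i j)\<^sup>2) \<le> 1" "(\<Sum>j\<in>{1..n}. (b j i)\<^sup>2) \<le> 1"
    using rc[OF i] cp by (simp_all add: b_def power_divide divide_le_eq flip: sum_divide_distrib)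
  qed (use N0_ge R If in auto)
  have NN1: "real (2 * L.NN 1) = 2 * real N0 ^ 4" by (simp add: L.NN_def)
  have "avg n (\<lambda>e. op_norm n (\<lambda>i j. a i j * e i j)) \<le> avg n (\<lambda>e. c * op_norm n (\<lambda>i j. b i j * e i j))"
   by (intro avg_mono op_norm_scale) (use cp in \<open>auto simp: b_def\<close>)
  also have "... = c * avg n (\<lambda>e. op_norm n (\<lambda>i j. b i j * e i j))" by (rule avg_cmult)
  also have "... \<le> c * (3 * (sqrt (2 * real N0 ^ 4) + exp 1011 * (2 * lll n) * (1 + R)) + 12)"
   using L.layers_avg cp unfolding NN1 by (intro mult_left_mono) auto
  also have "... \<le> c * (CC * lll n * R)"
  proof (rule mult_left_mono)
   have R1: "R \<ge> 1" using Wn cp by (simp add: R_def)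
   have lR: "1 * 1 \<le> lll n * R" using l1 R1 by (intro mult_mono) auto
   have "exp 1011 * (2 * lll n) * (1 + R) \<le> exp 1011 * (2 * lll n) * (2 * R)" using R1 l1 by (intro mult_left_mono) auto
   moreover have "sqrt (2 * real N0 ^ 4) * 1 \<le> sqrt (2 * real N0 ^ 4) * (lll n * R)" using lR by (intro mult_left_mono) auto
   moreover have "CC * lll n * R = 3 * (sqrt (2 * real N0 ^ 4) * (lll n * R)) + 3 * (exp 1011 * (2 * lll n) * (2 * R)) + 12 * (lll n * R)"
    by (simp add: CC_def algebra_simps)
   moreover have "3 * (y + x) + 12 \<le> t" if "x \<le> x'" "y * 1 \<le> y'" "t = 3 * y' + 3 * x' + 12 * z" "1 * 1 \<le> z" for x x' y y' t z :: real
    using that by argo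
   ultimately show "3 * (sqrt (2 * real N0 ^ 4) + exp 1011 * (2 * lll n) * (1 + R)) + 12 \<le> CC * lll n * R" using lR by blast
  qed (use cp in simp)
  also have "... = CC * lll n * (c * R)" by simp
  also have "c * R = c + W" using cp by (simp add: R_def distrib_left)
  finally show ?thesis by (simp add: c_def)
 qed
qed

text \<open>If the operator norm were not integrable, its Bochner integral would be 0 by convention
  and the bound would hold as \<open>X \<ge> 0\<close>; so measurability of the supremum is not an
  issue.\<close>

lemma integral_op_norm:
 assumes rf: "rademacher_family M \<epsilon>" and X: "avg n (\<lambda>e. op_norm n (\<lambda>i j. a i j * e i j)) \<le> X" "X \<ge> 0"
 shows "(\<integral>\<omega>. op_norm n (\<lambda>i j. a i j * \<epsilon> i j \<omega>) \<partial>M) \<le> X"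
proof (cases "integrable M (\<lambda>\<omega>. op_norm n (\<lambda>i j. a i j * \<epsilon> i j \<omega>))")
 case True
 have "(\<integral>\<omega>. op_norm n (\<lambda>i j. a i j * \<epsilon> i j \<omega>) \<partial>M) = avg n (\<lambda>e. op_norm n (\<lambda>i j. a i j * e i j))"
 proof (rule rade_avg[OF rf])
  fix e e' :: "nat => nat => real" assume "\<And>i j. i \<in> {1..n} ==> j \<in> {1..n} ==> e i j = e' i j"
  then have "(\<Sum>i\<in>{1..n}. \<Sum>j\<in>{1..n}. a i j * e i j * s i * t j) = (\<Sum>i\<in>{1..n}. \<Sum>j\<in>{1..n}. a i j * e' i j * s i * t j)" for s t
   by (intro sum.cong refl) metis
  then show "op_norm n (\<lambda>i j. a i j * e i j) = op_norm n (\<lambda>i j. a i j * e' i j)" unfolding op_norm_def by simp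
 qed (use True in simp)
 then show ?thesis using X by simp
next
 case False
 then show ?thesis using X by (simp add: not_integrable_integral_eq)
qed

lemma Log_real_N0: "N0 \<le> k ==> Log (real k) = ln (real k)"
proof (rule Log_ln)
 assume k: "N0 \<le> k"
 have "exp 1 \<le> exp (exp (exp (50::real)))"
 proof -
  have "1 \<le> exp (50::real)" by simp
  also have "... \<le> exp (exp 50)" using exp_ge_add_one_self[of "exp 50 :: real"] by linarith
  finally show ?thesis by simp
 qed
 then show "exp 1 \<le> real k" using N0_ge k by linarith
qed

theorem theorem1p9:
  shows "\<exists>C>0. \<forall>(M :: 'w measure) \<epsilon>. rademacher_family M \<epsilon> \<longrightarrow>
    (\<forall>n\<ge>1. \<forall>a :: nat \<Rightarrow> nat \<Rightarrow> real.
      (\<integral>\<omega>. op_norm n (\<lambda>i j. a i j * \<epsilon> i j \<omega>) \<partial>M)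
        \<le> C * Log (Log (Log (real n))) *
          (max_row_norm n a + max_col_norm n a + weak_moment M \<epsilon> n a {1..n} (Log (real n)))
      \<and>
      (\<integral>\<omega>. op_norm n (\<lambda>i j. a i j * \<epsilon> i j \<omega>) \<partial>M)
        \<le> C * Log (Log (Log (real n))) *
          (max_row_norm n a + max_col_norm n a +
           (MAX k\<in>{1..n}. MIN I\<in>{I. I \<subseteq> {1..n} \<and> card I \<le> k}.
              weak_moment M \<epsilon> n a ({1..n} - I) (Log (real k)))))"
proof (rule exI[of _ CC], intro conjI allI impI)
 show "CC > 0" by (rule CC_pos)
 fix M :: "'w measure" and \<epsilon> and n :: nat and a :: "nat => nat => real"
 assume rf: "rademacher_family M \<epsilon>" and n: "1 \<le> n"
 have nn: "max_row_norm n a \<ge> 0" "max_col_norm n a \<ge> 0" by (rule max_row_nonneg[OF n], rule max_col_nonneg[OF n])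
 have l1: "lll n \<ge> 1" unfolding lll_def by (rule Log_ge_1)
 \<comment> \<open>Both inequalities are instances: \<open>W\<close> is the third term of the sum on
   the right, witnessed by the empty set in the first and by a minimising set in the second. From
   \<open>N0\<close> on, \<open>Log\<close> and \<open>ln\<close> agree.\<close>
 have fin: "(\<integral>\<omega>. op_norm n (\<lambda>i j. a i j * \<epsilon> i j \<omega>) \<partial>M) \<le> CC * Log (Log (Log (real n))) * (max_row_norm n a + max_col_norm n a + W)"
  if W: "W \<ge> 0" and I: "\<And>k. N0 \<le> k ==> k \<le> n ==> \<exists>I. I \<subseteq> {1..n} \<and> card I \<le> k \<and> mom n ({1..n} - I) a (ln (real k)) W" for W
  unfolding lll_def[symmetric]
 proof (rule integral_op_norm[OF rf avg_bound[OF n W I]])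
  show "0 \<le> CC * lll n * (max_row_norm n a + max_col_norm n a + W)"
   using CC_pos l1 nn W by (intro mult_nonneg_nonneg add_nonneg_nonneg) auto
 qed
 let ?w = "\<lambda>I k. weak_moment M \<epsilon> n a ({1..n} - I) (Log (real k))"
 have w0: "?w I k \<ge> 0" for I k by (rule mom_weak[OF rf]) (auto intro: Log_ge_1)
 show "(\<integral>\<omega>. op_norm n (\<lambda>i j. a i j * \<epsilon> i j \<omega>) \<partial>M) \<le> CC * Log (Log (Log (real n))) *
     (max_row_norm n a + max_col_norm n a + weak_moment M \<epsilon> n a {1..n} (Log (real n)))"
 proof (rule fin)
  show "weak_moment M \<epsilon> n a {1..n} (Log (real n)) \<ge> 0" using w0[of "{}" n] by simp
  fix k assume k: "N0 \<le> k" "k \<le> n"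
  have m: "mom n {1..n} a (Log (real n)) (weak_moment M \<epsilon> n a {1..n} (Log (real n)))"
   by (rule mom_weak[OF rf order_refl Log_ge_1])
  have lk: "ln (real k) \<ge> 1" using Log_real_N0[OF k(1)] Log_ge_1[of "real k"] by simp
  have "k > 0" using lk by (cases k) auto
  then have "ln (real k) \<le> Log (real n)" using Log_real_N0[of n] k by simp
  then have "mom n {1..n} a (ln (real k)) (weak_moment M \<epsilon> n a {1..n} (Log (real n)))"
   by (intro mom_le[OF m]) (use lk w0[of "{}" n] in auto)
  then show "\<exists>I. I \<subseteq> {1..n} \<and> card I \<le> k \<and> mom n ({1..n} - I) a (ln (real k)) (weak_moment M \<epsilon> n a {1..n} (Log (real n)))"
   by (intro exI[of _ "{}"]) simp
 qed
 let ?S = "\<lambda>k. {I. I \<subseteq> {1..n} \<and> card I \<le> k}"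
 let ?m = "\<lambda>k. MIN I\<in>?S k. ?w I k"
 have finS: "finite (?S k)" for k by (rule finite_subset[of _ "Pow {1..n}"]) auto
 have att: "\<exists>I\<in>?S k. ?m k = ?w I k" for k
 proof -
  have "?m k \<in> (\<lambda>I. ?w I k) ` ?S k" by (rule Min_in) (use finS[of k] in auto)
  then show ?thesis by auto
 qed
 have mM: "?m k \<le> (MAX k\<in>{1..n}. ?m k)" if "k \<in> {1..n}" for k
  by (rule Max_ge) (use that in auto)
 show "(\<integral>\<omega>. op_norm n (\<lambda>i j. a i j * \<epsilon> i j \<omega>) \<partial>M) \<le> CC * Log (Log (Log (real n))) *
     (max_row_norm n a + max_col_norm n a + (MAX k\<in>{1..n}. ?m k))"
 proof (rule fin)
  obtain I where "?m 1 = ?w I 1" using att[of 1] by blast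
  then have "?m 1 \<ge> 0" using w0[of I 1] by simp
  then show "(MAX k\<in>{1..n}. ?m k) \<ge> 0" using mM[of 1] n by simp
  fix k assume k: "N0 \<le> k" "k \<le> n"
  obtain I where I: "I \<in> ?S k" "?m k = ?w I k" using att[of k] by blast
  have lk: "ln (real k) \<ge> 1" using Log_real_N0[OF k(1)] Log_ge_1[of "real k"] by simp
  then have "k > 0" by (cases k) auto
  then have kn: "k \<in> {1..n}" using k by simp
  have wm: "?w I k \<le> (MAX k\<in>{1..n}. ?m k)" by (rule order_trans[OF eq_refl[OF I(2)[symmetric]] mM[OF kn]])
  have "mom n ({1..n} - I) a (Log (real k)) (?w I k)" by (rule mom_weak[OF rf _ Log_ge_1]) auto
  then have "mom n ({1..n} - I) a (ln (real k)) (MAX k\<in>{1..n}. ?m k)"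
   unfolding Log_real_N0[OF k(1)] by (rule mom_le) (use lk wm w0[of I k] Log_real_N0[OF k(1)] in auto)
  then show "\<exists>I. I \<subseteq> {1..n} \<and> card I \<le> k \<and> mom n ({1..n} - I) a (ln (real k)) (MAX k\<in>{1..n}. ?m k)"
   using I(1) by blast
 qed
qed

end
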